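(* Let $d\ge2$, $\nu\ge0$, and let $\rho^\nu$ be a weak solution (in the sense defined in the context) to $(GAG_\nu)$ on a time interval $[0,T]$ with initial density $\rho^\nu_0=\rho_0\in L^1\cap L^\infty(\mathbb{R}^d)$. Then for any $R>0$ and all $t\in[0,T]$, $$\|b_R\rho^\nu(t)\|^2+\nu\int_0^t\|b_R\nabla\rho^\nu\|^2\,ds\le\left(\|b_R\rho^\nu_0\|^2+C_0(t)\,t\,(\nu+1)R^{-2}\right)e^{C_0(t)t}.$$ Now assume that for some integer $N\ge2$ we have $\|b_R\rho^\nu_0\|^2\le CR^{-N}$ for all sufficiently large $R$ (with $C$ a constant independent of $R$). Then for all sufficiently large $R$ and all $t\in[0,T]$, $$\|b_R\rho^\nu(t)\|^2+\nu\int_0^t\|b_R\nabla\rho^\nu\|^2\,ds\le C_0(t)\,t\,(\nu+1)^2R^{-N}e^{C_0(t)t}.$$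
   Context: $\|\cdot\|$ without subscript denotes the $L^2(\mathbb{R}^d)$ norm. $C_0(t)$ denotes a positive, continuous, nondecreasing function of $t\in[0,\infty)$, not depending on $R$ or $\nu$; it may differ from one occurrence to another. Let $a\in C^\infty(\mathbb{R}^d)$ be a fixed radially symmetric function supported in $B_2(0)$ with $a\equiv1$ on $B_1(0)$ and $a(x)$ nonincreasing in $|x|$; set $a_R(x)=a(x/R)$ and $b_R=1-a_R$. When $\nu=0$ the term $\nu\int_0^t\|b_R\nabla\rho^\nu\|^2\,ds$ is understood to be $0$. $\Phi$ is the fundamental solution of the Laplacian on $\mathbb{R}^d$ ($\Delta\Phi=\delta$). For $\nu\ge0$ and real constants $\sigma_1\ne0$, $\sigma_2$, $(GAG_\nu)$ is the system on $\mathbb{R}^d$: $\partial_t\rho^\nu+\mathbf v^\nu\cdot\nabla\rho^\nu=\sigma_2(\rho^\nu)^2+\nu\Delta\rho^\nu$, $\ \mathbf v^\nu=\sigma_1\nabla\Phi*\rho^\nu$, $\ \rho^\nu(0)=\rho_0$. Weak solution: for $\nu\ge0$ and $\rho_0\in L^1\cap L^\infty$, $\rho^\nu$ is a weak solution to $(GAG_\nu)$ on $[0,T]$ with initial density $\rho_0$ if $\rho^\nu(0)=\rho_0$ (i.e. $\rho^\nu(t)\to\rho_0$ in $L^2$ as $t\to0^+$), $\rho^\nu\in L^\infty(0,T;L^1\cap L^\infty)\cap C([0,T];L^2)$, $\partial_t\rho^\nu\in L^2(0,T;H^{-1})$, $\rho^\nu\in L^2(0,T;H^1)$ if $\nu>0$,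 and, with $\mathbf v^\nu=\sigma_1\nabla\Phi*\rho^\nu$, for all smooth compactly supported $\varphi$ on $[0,T)\times\mathbb{R}^d$, $$\int_0^T\!\!\int_{\mathbb{R}^d}\left(\rho^\nu\partial_t\varphi+\rho^\nu\mathbf v^\nu\cdot\nabla\varphi+(\sigma_1+\sigma_2)(\rho^\nu)^2\varphi-\nu\nabla\rho^\nu\cdot\nabla\varphi\right)dx\,dt=-\int_{\mathbb{R}^d}\rho_0\,\varphi(0,\cdot)\,dx$$ (the last term in the left integrand is absent when $\nu=0$).
   Formalization: The second bound, false as printed at t=0, has the initial term ‖b_Rρ₀‖² restored inside the bracket before e^{C₀(t)t}; C₀ may also depend on a given function K(t) bounding the L¹ and L^∞ norms of ρ^ν, as uniformity in ν fails without such a bound. *)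

theory Defs
  imports "HOL-Analysis.Analysis"
begin

text \<open>
  The space \<open>\<real>\<^sup>d\<close> is a type \<open>'a\<close> of class \<open>euclidean_space\<close> with \<open>d = DIM('a)\<close>. Elements of
  Lebesgue spaces are represented by Borel functions (every Lebesgue class contains one), and a
  function of time with values in such a space by \<open>\<rho> :: real \<Rightarrow> 'a \<Rightarrow> real\<close>.
\<close>

subsection \<open>Smooth functions and gradients\<close>

primrec Ck :: "nat \<Rightarrow> ('a::real_normed_vector \<Rightarrow> real) \<Rightarrow> bool" where
  "Ck 0 f \<longleftrightarrow> continuous_on UNIV f"
| "Ck (Suc k) f \<longleftrightarrow> (\<forall>x. f differentiable (at x)) \<and>
     (\<forall>v. Ck k (\<lambda>x. frechet_derivative f (at x) v))"

definition test_fun :: "'a::real_normed_vector set \<Rightarrow> ('a \<Rightarrow> real) \<Rightarrow> bool" where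
  "test_fun S \<phi> \<longleftrightarrow> (\<forall>k. Ck k \<phi>) \<and>
     compact (closure {z. \<phi> z \<noteq> 0}) \<and> closure {z. \<phi> z \<noteq> 0} \<subseteq> S"

definition grad :: "('a::euclidean_space \<Rightarrow> real) \<Rightarrow> 'a \<Rightarrow> 'a" where
  "grad f x = (\<Sum>i\<in>Basis. frechet_derivative f (at x) i *\<^sub>R i)"

subsection \<open>Function spaces on the whole space\<close>

definition in_L2 :: "('a::euclidean_space \<Rightarrow> 'b::euclidean_space) \<Rightarrow> bool" where
  "in_L2 f \<longleftrightarrow> f \<in> borel_measurable lborel \<and> integrable lborel (\<lambda>x. (norm (f x))\<^sup>2)"

definition L2_norm :: "('a::euclidean_space \<Rightarrow> 'b::euclidean_space) \<Rightarrow> real" where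
  "L2_norm f = sqrt (\<integral>x. (norm (f x))\<^sup>2 \<partial>lborel)"

text \<open>\<open>f \<in> L\<^sup>1 \<inter> L\<^sup>\<infinity>\<close> with both norms at most \<open>M\<close>.\<close>

definition L1_Linf_le :: "('a::euclidean_space \<Rightarrow> real) \<Rightarrow> real \<Rightarrow> bool" where
  "L1_Linf_le f M \<longleftrightarrow> integrable lborel f \<and> (\<integral>x. \<bar>f x\<bar> \<partial>lborel) \<le> M \<and>
     (AE x in lborel. \<bar>f x\<bar> \<le> M)"

definition weak_gradient :: "('a::euclidean_space \<Rightarrow> real) \<Rightarrow> ('a \<Rightarrow> 'a) \<Rightarrow> bool" where
  "weak_gradient f g \<longleftrightarrow> (\<forall>\<psi>. test_fun UNIV \<psi> \<longrightarrow>
     (\<integral>x. f x *\<^sub>R grad \<psi> x \<partial>lborel) = - (\<integral>x. \<psi> x *\<^sub>R g x \<partial>lborel))"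

definition in_H1 :: "('a::euclidean_space \<Rightarrow> real) \<Rightarrow> bool" where
  "in_H1 f \<longleftrightarrow> in_L2 f \<and> (\<exists>g. in_L2 g \<and> weak_gradient f g)"

text \<open>The weak gradient in \<open>L\<^sup>2\<close>, unique up to null sets for \<open>f \<in> H\<^sup>1\<close>.\<close>

definition wgrad :: "('a::euclidean_space \<Rightarrow> real) \<Rightarrow> 'a \<Rightarrow> 'a" where
  "wgrad f = (SOME g. in_L2 g \<and> weak_gradient f g)"

definition H1_norm :: "('a::euclidean_space \<Rightarrow> real) \<Rightarrow> real" where
  "H1_norm f = sqrt ((L2_norm f)\<^sup>2 + (L2_norm (wgrad f))\<^sup>2)"

text \<open>
  \<open>H\<^sup>-\<^sup>1\<close> is the dual of \<open>H\<^sup>1\<close>. Only the values of a functional on \<open>H\<^sup>1\<close> matter; boundedness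
  forces it to respect equality almost everywhere.
\<close>

definition in_Hm1 :: "(('a::euclidean_space \<Rightarrow> real) \<Rightarrow> real) \<Rightarrow> bool" where
  "in_Hm1 F \<longleftrightarrow>
     (\<forall>f g. in_H1 f \<longrightarrow> in_H1 g \<longrightarrow> F (\<lambda>x. f x + g x) = F f + F g) \<and>
     (\<forall>c f. in_H1 f \<longrightarrow> F (\<lambda>x. c * f x) = c * F f) \<and>
     (\<exists>M. \<forall>f. in_H1 f \<longrightarrow> \<bar>F f\<bar> \<le> M * H1_norm f)"

definition Hm1_norm :: "(('a::euclidean_space \<Rightarrow> real) \<Rightarrow> real) \<Rightarrow> real" where
  "Hm1_norm F = (SUP f\<in>{f. in_H1 f \<and> H1_norm f \<le> 1}. \<bar>F f\<bar>)"

subsection \<open>Function spaces in time\<close>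

text \<open>
  \<open>\<rho> \<in> L\<^sup>\<infinity>(0,T; L\<^sup>1 \<inter> L\<^sup>\<infinity>)\<close> and \<open>\<rho> \<in> L\<^sup>2(0,T; H\<^sup>1)\<close>, for \<open>\<rho>\<close> known to lie in \<open>C([0,T]; L\<^sup>2)\<close>:
  measurability in time is then automatic and only the bounds have to be stated.
\<close>

definition in_C_L2 :: "real \<Rightarrow> (real \<Rightarrow> 'a::euclidean_space \<Rightarrow> real) \<Rightarrow> bool" where
  "in_C_L2 T \<rho> \<longleftrightarrow> (\<forall>t\<in>{0..T}. in_L2 (\<rho> t) \<and>
     ((\<lambda>s. L2_norm (\<lambda>x. \<rho> s x - \<rho> t x)) \<longlongrightarrow> 0) (at t within {0..T}))"

definition in_Linf_L1_Linf :: "real \<Rightarrow> (real \<Rightarrow> 'a::euclidean_space \<Rightarrow> real) \<Rightarrow> bool" where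
  "in_Linf_L1_Linf T \<rho> \<longleftrightarrow> (\<exists>M. AE t in lborel. t \<in> {0..T} \<longrightarrow> L1_Linf_le (\<rho> t) M)"

definition in_L2_H1 :: "real \<Rightarrow> (real \<Rightarrow> 'a::euclidean_space \<Rightarrow> real) \<Rightarrow> bool" where
  "in_L2_H1 T \<rho> \<longleftrightarrow> (AE t in lborel. t \<in> {0..T} \<longrightarrow> in_H1 (\<rho> t)) \<and>
     set_integrable lborel {0..T} (\<lambda>t. (H1_norm (\<rho> t))\<^sup>2)"

text \<open>
  \<open>\<partial>\<^sub>t\<rho> \<in> L\<^sup>2(0,T; H\<^sup>-\<^sup>1)\<close>: the distributional time derivative is a function \<open>w\<close>. As \<open>H\<^sup>-\<^sup>1\<close> is
  separable and reflexive, Bochner measurability of \<open>w\<close> is measurability of all pairings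
  with elements of \<open>H\<^sup>1\<close>.
\<close>

definition dt_in_L2_Hm1 :: "real \<Rightarrow> (real \<Rightarrow> 'a::euclidean_space \<Rightarrow> real) \<Rightarrow> bool" where
  "dt_in_L2_Hm1 T \<rho> \<longleftrightarrow> (\<exists>w.
     (AE t in lborel. t \<in> {0..T} \<longrightarrow> in_Hm1 (w t)) \<and>
     (\<forall>\<psi>. in_H1 \<psi> \<longrightarrow> set_borel_measurable lborel {0..T} (\<lambda>t. w t \<psi>)) \<and>
     set_integrable lborel {0..T} (\<lambda>t. (Hm1_norm (w t))\<^sup>2) \<and>
     (\<forall>\<theta> \<psi>. test_fun {0<..<T} \<theta> \<longrightarrow> in_H1 \<psi> \<longrightarrow>
        (LBINT t:{0..T}. deriv \<theta> t * (\<integral>x. \<rho> t x * \<psi> x \<partial>lborel))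
          = - (LBINT t:{0..T}. \<theta> t * w t \<psi>)))"

subsection \<open>The system\<close>

text \<open>
  The fundamental solution of the Laplacian, with the sign convention \<open>\<Delta>\<Phi> = \<delta>\<close>. Its value at
  the origin is irrelevant.
\<close>

definition \<Phi> :: "'a::euclidean_space \<Rightarrow> real" where
  "\<Phi> x = (if DIM('a) = 2 then ln (norm x) / (2 * pi)
     else - 1 / (real DIM('a) * (real DIM('a) - 2) * unit_ball_vol (real DIM('a))
                   * norm x ^ (DIM('a) - 2)))"

definition velocity :: "real \<Rightarrow> ('a::euclidean_space \<Rightarrow> real) \<Rightarrow> 'a \<Rightarrow> 'a" where
  "velocity \<sigma>\<^sub>1 f x = \<sigma>\<^sub>1 *\<^sub>R (\<integral>y. f y *\<^sub>R grad \<Phi> (x - y) \<partial>lborel)"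

text \<open>
  Smooth compactly supported functions on \<open>[0,T) \<times> \<real>\<^sup>d\<close> are the restrictions of those on
  \<open>(-\<infinity>,T) \<times> \<real>\<^sup>d\<close>; in particular they need not vanish at time \<open>0\<close>.
\<close>

definition weak_solution ::
  "real \<Rightarrow> real \<Rightarrow> real \<Rightarrow> real \<Rightarrow> ('a::euclidean_space \<Rightarrow> real) \<Rightarrow> (real \<Rightarrow> 'a \<Rightarrow> real) \<Rightarrow> bool" where
  "weak_solution \<sigma>\<^sub>1 \<sigma>\<^sub>2 \<nu> T \<rho>\<^sub>0 \<rho> \<longleftrightarrow>
     (\<exists>M. L1_Linf_le \<rho>\<^sub>0 M) \<and>
     ((\<lambda>t. L2_norm (\<lambda>x. \<rho> t x - \<rho>\<^sub>0 x)) \<longlongrightarrow> 0) (at_right 0) \<and>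
     in_Linf_L1_Linf T \<rho> \<and> in_C_L2 T \<rho> \<and> dt_in_L2_Hm1 T \<rho> \<and>
     (\<nu> > 0 \<longrightarrow> in_L2_H1 T \<rho>) \<and>
     (\<forall>\<phi>. test_fun ({..<T} \<times> UNIV) \<phi> \<longrightarrow>
        (LBINT t:{0..T}. (\<integral>x.
             \<rho> t x * deriv (\<lambda>s. \<phi> (s, x)) t
           + \<rho> t x * (velocity \<sigma>\<^sub>1 (\<rho> t) x \<bullet> grad (\<lambda>y. \<phi> (t, y)) x)
           + (\<sigma>\<^sub>1 + \<sigma>\<^sub>2) * (\<rho> t x)\<^sup>2 * \<phi> (t, x)
           - \<nu> * (wgrad (\<rho> t) x \<bullet> grad (\<lambda>y. \<phi> (t, y)) x) \<partial>lborel))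
        = - (\<integral>x. \<rho>\<^sub>0 x * \<phi> (0, x) \<partial>lborel))"

subsection \<open>Cutoffs and time-dependent constants\<close>

definition radial_cutoff :: "('a::euclidean_space \<Rightarrow> real) \<Rightarrow> bool" where
  "radial_cutoff a \<longleftrightarrow> test_fun (ball 0 2) a \<and> (\<forall>x\<in>ball 0 1. a x = 1) \<and>
     (\<forall>x y. norm x = norm y \<longrightarrow> a x = a y) \<and> (\<forall>x y. norm x \<le> norm y \<longrightarrow> a y \<le> a x)"

definition bcut :: "('a::euclidean_space \<Rightarrow> real) \<Rightarrow> real \<Rightarrow> 'a \<Rightarrow> real" where
  "bcut a R x = 1 - a (x /\<^sub>R R)"

definition time_const :: "(real \<Rightarrow> real) \<Rightarrow> bool" where
  "time_const C \<longleftrightarrow> (\<forall>t\<ge>0. C t > 0) \<and> continuous_on {0..} C \<and> mono_on {0..} C"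

text \<open>
  A control \<open>K\<close> of the norm of \<open>\<rho>\<close> in \<open>L\<^sup>1 \<inter> L\<^sup>\<infinity>\<close>. Each single weak solution has one (a constant).
  It is made explicit because the constants in the estimates depend on the solution through it,
  and cannot be chosen uniformly in \<open>\<nu>\<close> for solutions that are not uniformly bounded.
\<close>

definition controlled :: "(real \<Rightarrow> real) \<Rightarrow> real \<Rightarrow> (real \<Rightarrow> 'a::euclidean_space \<Rightarrow> real) \<Rightarrow> bool" where
  "controlled K T \<rho> \<longleftrightarrow> (AE t in lborel. t \<in> {0..T} \<longrightarrow> L1_Linf_le (\<rho> t) (K t))"

text \<open>The quantity \<open>\<parallel>b\<^sub>R \<rho>(t)\<parallel>\<^sup>2 + \<nu> \<integral>\<^sub>0\<^sup>t \<parallel>b\<^sub>R \<nabla>\<rho>\<parallel>\<^sup>2 ds\<close>; the second term is \<open>0\<close> when \<open>\<nu> = 0\<close>.\<close>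

definition outer_energy ::
  "('a::euclidean_space \<Rightarrow> real) \<Rightarrow> real \<Rightarrow> real \<Rightarrow> (real \<Rightarrow> 'a \<Rightarrow> real) \<Rightarrow> real \<Rightarrow> real" where
  "outer_energy a \<nu> R \<rho> t =
     (L2_norm (\<lambda>x. bcut a R x * \<rho> t x))\<^sup>2
     + \<nu> * (LBINT s:{0..t}. (L2_norm (\<lambda>x. bcut a R x *\<^sub>R wgrad (\<rho> s) x))\<^sup>2)"

end

theory Submission
  imports Defs
begin

text \<open>
  Testing the equation with \<open>b^2 \<rho>\<close>, \<open>b = b\<^sub>R\<close>, gives
  \<open>d/dt \<parallel>b \<rho>\<parallel>^2 + \<nu> \<parallel>b \<nabla>\<rho>\<parallel>^2 \<le> A \<parallel>b \<rho>\<parallel>^2 + B (\<nu> + 1) R^-2 \<integral> \<rho>^2\<close>, the last integral being over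
  the annulus \<open>R \<le> |x| \<le> 2 R\<close> that carries \<open>\<nabla>b\<close>, and the first claim is Gronwall's inequality. As
  \<open>b = 1\<close> on this annulus when \<open>R\<close> is replaced by \<open>R / 2\<close>, a decay rate of \<open>\<parallel>b \<rho>\<parallel>^2\<close> improves
  itself by \<open>R^-2\<close> up to the rate of the initial data, whence the second claim.

  To justify the test function, \<open>\<rho>\<close> is mollified. The commutator of mollification and transport
  tends to zero because the velocity is bounded with bounded divergence and no curl, so that its
  difference quotients are bounded in \<open>L^2\<close> on compact sets (a Caccioppoli estimate replaces the
  singular integral estimate of \<open>\<nabla>v\<close>), and because \<open>s \<mapsto> \<rho>(s)\<close> has compact range in \<open>L^2\<close>, which
  makes the continuity of translations uniform in time.
\<close>

text \<open>The constant may depend on \<open>t\<close> but not on \<open>T\<close>. The solution is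
  therefore restricted to the times from 0 to \<open>t\<close>, where \<open>K t\<close> bounds both
  norms at every time because \<open>K\<close> is nondecreasing, and Gronwall's inequality is
  applied there with constant coefficients. As b does not have compact support, it is cut off once
  more at a radius of order n. The commutator error involves the difference quotients of the
  velocity on that larger ball, so the mollification scale is chosen after n and one sequence
  carries both limits. Only part of the commutator vanishes. Subtracting \<rho>^2 times a quantity
  that sees nothing of v but its divergence leaves a product of a translation difference of \<rho>
  and a difference of v. The second factor is of the order of the mollification scale, which
  compensates the size of the gradient of the mollifier; the first tends to zero. The subtracted
  part is bounded by a multiple of \<rho>^2 and enters the growth rate A. In the limit the
  dissipation is merely lower semicontinuous. Fatou's lemma gives the inequality in the required
  direction.\<close>

abbreviation borelf :: "('a::topological_space => 'b::topological_space) => bool" where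
 "borelf f \<equiv> f \<in> borel_measurable borel"

abbreviation intble :: "('a::euclidean_space => 'b::{banach, second_countable_topology}) => bool" where
 "intble f \<equiv> integrable lborel f"

subsection \<open>Smooth functions\<close>

abbreviation dd :: "'a::real_normed_vector => ('a => real) => 'a => real" where
 "dd v f \<equiv> (\<lambda>x. frechet_derivative f (at x) v)"

abbreviation smooth :: "('a::real_normed_vector => real) => bool" where
 "smooth f \<equiv> (\<forall>k. Ck k f)"

lemma Ck_SucD: "Ck (Suc k) f ==> Ck k f"
proof (induction k arbitrary: f)
 case 0
 then show ?case
  by (auto intro!: differentiable_imp_continuous_on simp: differentiable_on_def)
next
 case (Suc k)
 then show ?case by simp
qed

lemma has_derivative_dd:
 "f differentiable (at x) ==> (f has_derivative (\<lambda>h. dd h f x)) (at x)"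
 using frechet_derivative_works by metis

lemma dd_eq: "(f has_derivative f') (at x) ==> dd v f x = f' v"
 using frechet_derivative_at by metis

lemma Ck_const: "Ck k (\<lambda>x. c)"
 by (induction k arbitrary: c) simp_all

lemma dd_add:
 "f differentiable (at x) ==> g differentiable (at x) ==>
  dd v (\<lambda>x. f x + g x) x = dd v f x + dd v g x"
 by (rule dd_eq) (intro has_derivative_add has_derivative_dd)

lemma dd_mult:
 "f differentiable (at x) ==> g differentiable (at x) ==>
  dd v (\<lambda>x. f x * g x) x = f x * dd v g x + dd v f x * g x"
 by (rule dd_eq) (intro has_derivative_mult has_derivative_dd)

lemma Ck_add: "Ck k f ==> Ck k g ==> Ck k (\<lambda>x. f x + g x)"
proof (induction k arbitrary: f g)
 case 0 then show ?case by (auto intro: continuous_on_add)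
next
 case (Suc k) then show ?case by (auto simp: dd_add)
qed

lemma Ck_mult: "Ck k f ==> Ck k g ==> Ck k (\<lambda>x. f x * g x)"
proof (induction k arbitrary: f g)
 case 0 then show ?case by (auto intro: continuous_on_mult)
next
 case (Suc k)
 then have "Ck k f" "Ck k g" using Ck_SucD by blast+
 with Suc show ?case by (auto simp: dd_mult intro!: Ck_add)
qed

lemma dd_affine:
 assumes "f differentiable (at (c + L x))" "bounded_linear L"
 shows "((\<lambda>x. f (c + L x)) has_derivative (\<lambda>h. dd (L h) f (c + L x))) (at x)"
proof -
 have "((\<lambda>x. c + L x) has_derivative L) (at x)"
  using assms(2) by (auto intro!: derivative_eq_intros bounded_linear_imp_has_derivative)
 from has_derivative_compose[OF this has_derivative_dd[OF assms(1)]]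
 show ?thesis .
qed

lemma Ck_affine: "bounded_linear L ==> Ck k f ==> Ck k (\<lambda>x. f (c + L x))"
proof (induction k arbitrary: f)
 case 0
 then show ?case
  by (auto intro!: continuous_on_compose2[of UNIV f UNIV "\<lambda>x. c + L x"] continuous_on_add
    continuous_on_const bounded_linear.continuous_on[of L])
next
 case (Suc k)
 have "(\<lambda>x. f (c + L x)) differentiable (at x)" for x
  using dd_affine[of f c L x] Suc by (auto simp: differentiable_def)
 moreover have "dd v (\<lambda>x. f (c + L x)) = (\<lambda>x. dd (L v) f (c + L x))" for v
  using Suc.prems by (auto intro!: dd_eq[OF dd_affine])
 moreover have "Ck k (\<lambda>x. dd (L v) f (c + L x))" for v
  using Suc.IH[of "dd (L v) f"] Suc.prems by simp
 ultimately show ?case by simp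
qed

lemma smooth_differentiable: "smooth f ==> f differentiable (at x)"
 using Ck.simps(2) by blast

lemma smooth_dd: "smooth f ==> smooth (dd v f)"
 using Ck.simps(2) by blast

lemma smooth_continuous_on: "smooth f ==> continuous_on S f"
 using Ck.simps(1) continuous_on_subset by blast

lemma smooth_borel: "smooth (f :: 'a::euclidean_space => real) ==> f \<in> borel_measurable borel"
 using Ck.simps(1) borel_measurable_continuous_onI by blast

lemma smooth_const: "smooth (\<lambda>x. c)" by (simp add: Ck_const)
lemma smooth_add: "smooth f ==> smooth g ==> smooth (\<lambda>x. f x + g x)" by (simp add: Ck_add)
lemma smooth_mult: "smooth f ==> smooth g ==> smooth (\<lambda>x. f x * g x)" by (simp add: Ck_mult)

lemma smooth_sum: "(!!i. i \<in> I ==> smooth (f i)) ==> smooth (\<lambda>x. \<Sum>i\<in>I. f i x)"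
 by (induction I rule: infinite_finite_induct) (auto intro: smooth_const[rule_format] Ck_add)

lemma dd_linear: "smooth f ==> linear (\<lambda>v. dd v f x)"
 using has_derivative_dd[OF smooth_differentiable] has_derivative_linear by metis

lemma grad_inner:
 assumes "smooth (f :: 'a::euclidean_space => real)"
 shows "grad f x \<bullet> v = dd v f x"
proof -
 have "dd v f x = dd (\<Sum>i\<in>Basis. (v \<bullet> i) *\<^sub>R i) f x" by (simp add: euclidean_representation)
 also have "... = (\<Sum>i\<in>Basis. (v \<bullet> i) * dd i f x)"
  by (simp add: linear_sum[OF dd_linear[OF assms]] linear_scale[OF dd_linear[OF assms]]
    del: euclidean_representation)
 finally show ?thesis
  by (simp add: grad_def inner_sum_left inner_commute[of v] mult.commute)
qed

lemma grad_continuous_on: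
 "smooth (f :: 'a::euclidean_space => real) ==> continuous_on S (grad f)"
 unfolding grad_def by (intro continuous_intros smooth_continuous_on smooth_dd)

lemma grad_borel: "smooth (f :: 'a::euclidean_space => real) ==> grad f \<in> borel_measurable borel"
 using grad_continuous_on borel_measurable_continuous_onI by blast

lemma norm_le_sum_inner: "norm (x::'a::euclidean_space) <= (\<Sum>i\<in>Basis. \<bar>x \<bullet> i\<bar>)"
 by (rule norm_le_l1)

lemma norm_sq_sum: "(norm (x::'a::euclidean_space))^2 = (\<Sum>i\<in>Basis. (x \<bullet> i)^2)"
 unfolding power2_norm_eq_inner by (subst euclidean_inner) (simp add: power2_eq_square)

subsection \<open>Test functions\<close>

lemma tf_smooth: "test_fun S f ==> smooth f" by (simp add: test_fun_def)

lemma tf_support: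
 assumes "test_fun S (f :: 'a::euclidean_space => real)"
 obtains r where "r > 0" "!!x. norm x > r ==> f x = 0"
proof -
 have "bounded (closure {z. f z \<noteq> 0})" using assms compact_imp_bounded by (auto simp: test_fun_def)
 then obtain r where "r > 0" "\<forall>x\<in>closure {z. f z \<noteq> 0}. norm x <= r" using bounded_pos by blast
 then have "f x = 0" if "norm x > r" for x
  using that closure_subset[of "{z. f z \<noteq> 0}"] by force
 with \<open>r > 0\<close> that show ?thesis by blast
qed

lemma tf_intro:
 assumes "smooth (f :: 'a::euclidean_space => real)" "!!x. norm x > r ==> f x = 0"
 shows "test_fun UNIV f"
proof -
 have "{z. f z \<noteq> 0} \<subseteq> cball 0 r" using assms(2) by (force simp: not_less)
 then have "closure {z. f z \<noteq> 0} \<subseteq> cball 0 r" by (simp add: closure_minimal)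
 then have "compact (closure {z. f z \<noteq> 0})"
  by (metis bounded_subset bounded_cball closed_closure compact_eq_bounded_closed)
 with assms show ?thesis by (simp add: test_fun_def)
qed

lemma tf_UNIV: "test_fun S f ==> test_fun UNIV f" by (simp add: test_fun_def)

lemma dd_zero_outside:
 assumes "!!x. norm x > r ==> f x = 0" "norm x > r"
 shows "dd v f x = 0"
proof (rule dd_eq)
 have "open {y::'a. norm y > r}" by (intro open_Collect_less continuous_intros)
 moreover have "((\<lambda>_. 0::real) has_derivative (\<lambda>_. 0)) (at x)" by simp
 ultimately show "(f has_derivative (\<lambda>_. 0)) (at x)"
  using assms by (auto intro: has_derivative_transform_within_open[of "\<lambda>_. 0"])
qed

lemma tf_dd: "test_fun UNIV (f :: 'a::euclidean_space => real) ==> test_fun UNIV (dd v f)"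
proof -
 assume f: "test_fun UNIV f"
 obtain r where "!!x. norm x > r ==> f x = 0" using tf_support[OF f] by metis
 then show ?thesis
  by (intro tf_intro[of _ r] smooth_dd tf_smooth[OF f] dd_zero_outside)
qed

lemma tf_bounded:
 assumes "test_fun S (f :: 'a::euclidean_space => real)"
 obtains B where "B > 0" "!!x. \<bar>f x\<bar> <= B"
proof -
 obtain r where r: "r > 0" "!!x. norm x > r ==> f x = 0" using tf_support[OF assms] by metis
 have "compact (f ` cball 0 r)"
  by (intro compact_continuous_image smooth_continuous_on tf_smooth[OF assms] compact_cball)
 then obtain B where B: "B > 0" "\<forall>y\<in>f ` cball 0 r. norm y <= B"
  using compact_imp_bounded bounded_pos by metis
 have "\<bar>f x\<bar> <= B" for x
  using B r(2)[of x] by (cases "norm x > r") auto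
 with B that show ?thesis by blast
qed

lemma tf_add: "test_fun UNIV (f::'a::euclidean_space => real) ==> test_fun UNIV g ==> test_fun UNIV (\<lambda>x. f x + g x)"
proof -
 assume f: "test_fun UNIV f" and g: "test_fun UNIV g"
 obtain r where r: "!!x. norm x > r ==> f x = 0" using tf_support[OF f] by metis
 obtain s where s: "!!x. norm x > s ==> g x = 0" using tf_support[OF g] by metis
 show ?thesis
  using r s by (intro tf_intro[of _ "max r s"] smooth_add tf_smooth[OF f] tf_smooth[OF g]) auto
qed

lemma tf_mult: "test_fun UNIV (f::'a::euclidean_space => real) ==> smooth g ==> test_fun UNIV (\<lambda>x. g x * f x)"
proof -
 assume f: "test_fun UNIV f" and g: "smooth g"
 obtain r where r: "!!x. norm x > r ==> f x = 0" using tf_support[OF f] by metis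
 show ?thesis
  using r by (intro tf_intro[of _ r] smooth_mult tf_smooth[OF f] g) auto
qed

lemma tf_cmult: "test_fun UNIV (f::'a::euclidean_space => real) ==> test_fun UNIV (\<lambda>x. c * f x)"
 using tf_mult[of f "\<lambda>_. c"] smooth_const by blast

lemma tf_mult': "test_fun UNIV (f::'a::euclidean_space => real) ==> smooth g ==> test_fun UNIV (\<lambda>x. f x * g x)"
 using tf_mult[of f g] by (simp add: mult.commute)

lemma tf_affine:
 assumes "test_fun UNIV (f::'a::euclidean_space => real)" "c \<noteq> 0"
 shows "test_fun UNIV (\<lambda>x. f (b + c *\<^sub>R x))"
proof -
 obtain r where r: "r > 0" "!!x. norm x > r ==> f x = 0" using tf_support[OF assms(1)] by metis
 have sm: "smooth (\<lambda>x. f (b + c *\<^sub>R x))"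
  using Ck_affine[OF bounded_linear_scaleR_right] tf_smooth[OF assms(1)] by blast
 show ?thesis
 proof (rule tf_intro[OF sm, of "(r + norm b) / \<bar>c\<bar>"])
  fix x :: 'a assume "norm x > (r + norm b) / \<bar>c\<bar>"
  then have "\<bar>c\<bar> * norm x > r + norm b" using assms(2) by (simp add: field_simps)
  moreover have "norm (c *\<^sub>R x) <= norm (b + c *\<^sub>R x) + norm b"
   using norm_triangle_ineq4[of "b + c *\<^sub>R x" b] by simp
  ultimately show "f (b + c *\<^sub>R x) = 0" by (intro r) simp
 qed
qed

lemma dd_affine_eq:
 assumes "smooth (f::'a::euclidean_space => real)"
 shows "dd v (\<lambda>x. f (b + c *\<^sub>R x)) x = c * dd v f (b + c *\<^sub>R x)"
proof -
 have "dd v (\<lambda>x. f (b + c *\<^sub>R x)) x = dd (c *\<^sub>R v) f (b + c *\<^sub>R x)"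
  by (rule dd_eq[OF dd_affine[OF smooth_differentiable[OF assms] bounded_linear_scaleR_right]])
 also have "... = c * dd v f (b + c *\<^sub>R x)"
  using linear_scale[OF dd_linear[OF assms]] by simp
 finally show ?thesis .
qed

lemma dd_reflect:
 assumes "smooth (f::'a::euclidean_space => real)"
 shows "dd v (\<lambda>y. f (x - y)) y = - dd v f (x - y)"
 using dd_affine_eq[OF assms, where v = v and b = x and c = "-1" and x = y] by simp

lemma tf_reflect: "test_fun UNIV (f::'a::euclidean_space => real) ==> test_fun UNIV (\<lambda>y. f (x - y))"
 using tf_affine[where f = f and c = "-1" and b = x] by simp

section \<open>Lipschitz and Taylor estimates for test functions\<close>

lemma smooth_lipschitz:
 assumes "test_fun UNIV (f::'a::euclidean_space => real)"
 obtains L where "L > 0" "!!x y. \<bar>f x - f y\<bar> <= L * norm (x - y)"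
proof -
 have "\<exists>B>0. \<forall>x. \<bar>dd i f x\<bar> <= B" for i
  using tf_bounded[OF tf_dd[OF assms, of i]] by metis
 then obtain B where B: "!!i. B i > 0" "!!i x. \<bar>dd i f x\<bar> <= B i" by metis
 define L where "L = (\<Sum>i\<in>(Basis::'a set). B i)"
 have "L > 0" unfolding L_def using B by (intro sum_pos) auto
 have on: "onorm (\<lambda>h. dd h f x) <= L" for x
 proof (rule onorm_bound)
  show "0 <= L" using \<open>L > 0\<close> by simp
  fix h
  have "\<bar>dd h f x\<bar> = \<bar>\<Sum>i\<in>Basis. dd i f x * (i \<bullet> h)\<bar>"
   using grad_inner[OF tf_smooth[OF assms], of x h] by (simp add: grad_def inner_sum_left)
  also have "... <= (\<Sum>i\<in>Basis. \<bar>dd i f x\<bar> * \<bar>i \<bullet> h\<bar>)"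
   by (intro order_trans[OF sum_abs]) (simp add: abs_mult)
  also have "... <= (\<Sum>i\<in>Basis. B i * norm h)"
  proof (intro sum_mono mult_mono)
   fix i :: 'a assume "i \<in> Basis"
   then show "\<bar>i \<bullet> h\<bar> <= norm h" by (metis Basis_le_norm inner_commute)
  qed (use B in \<open>auto simp: less_imp_le\<close>)
  finally show "norm (dd h f x) <= L * norm h" by (simp add: L_def sum_distrib_right)
 qed
 have "norm (f x - f y) <= L * norm (x - y)" for x y
  by (rule differentiable_bound[OF convex_UNIV _ on])
   (auto intro: has_derivative_dd[OF smooth_differentiable[OF tf_smooth[OF assms]]])
 with \<open>L > 0\<close> that show ?thesis by simp
qed

text \<open>The partial derivatives are test functions, hence Lipschitz, so the linearization error
  along a segment is quadratic in its length. The uniformity in \<open>x\<close> is what allows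
  convolutions to be differentiated under the integral.\<close>

lemma tf_taylor:
 assumes "test_fun UNIV (f::'a::euclidean_space => real)"
 obtains C where "C > 0" "!!x h. \<bar>f (x + h) - f x - dd h f x\<bar> <= C * (norm h)^2"
proof -
 have "\<exists>L>0. \<forall>x y. \<bar>dd i f x - dd i f y\<bar> <= L * norm (x - y)" for i
  using smooth_lipschitz[OF tf_dd[OF assms, of i]] by metis
 then obtain L where L: "!!i. L i > 0" "!!i x y. \<bar>dd i f x - dd i f y\<bar> <= L i * norm (x - y)"
  by metis
 define C where "C = (\<Sum>i\<in>(Basis::'a set). L i)"
 have "C > 0" unfolding C_def using L by (intro sum_pos) auto
 have gl: "\<bar>dd h f x - dd h f y\<bar> <= C * norm (x - y) * norm h" for x y h
 proof -
  have "\<bar>dd h f x - dd h f y\<bar> = \<bar>\<Sum>i\<in>Basis. (dd i f x - dd i f y) * (i \<bullet> h)\<bar>"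
   using grad_inner[OF tf_smooth[OF assms], of x h] grad_inner[OF tf_smooth[OF assms], of y h]
   by (simp add: grad_def inner_sum_left left_diff_distrib sum_subtractf)
  also have "... <= (\<Sum>i\<in>Basis. \<bar>dd i f x - dd i f y\<bar> * \<bar>i \<bullet> h\<bar>)"
   by (intro order_trans[OF sum_abs]) (simp add: abs_mult)
  also have "... <= (\<Sum>i\<in>Basis. (L i * norm (x - y)) * norm h)"
  proof (intro sum_mono mult_mono)
   fix i :: 'a assume "i \<in> Basis"
   then show "\<bar>i \<bullet> h\<bar> <= norm h" by (metis Basis_le_norm inner_commute)
  qed (use L in \<open>auto simp: less_imp_le\<close>)
  finally show ?thesis by (simp add: C_def sum_distrib_right)
 qed
 have "\<bar>f (x + h) - f x - dd h f x\<bar> <= C * (norm h)^2" for x h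
 proof -
  have "norm (f (x + h) - f x - dd (x + h - x) f x) <= norm (x + h - x) * (C * norm h)"
  proof (rule differentiable_bound_linearization[where S = "closed_segment x (x + h)"])
   show "x + t *\<^sub>R (x + h - x) \<in> closed_segment x (x + h)" if "t \<in> {0..1}" for t
    using that by (auto simp: closed_segment_def algebra_simps intro!: exI[of _ t])
   show "(f has_derivative (\<lambda>h. dd h f y)) (at y within closed_segment x (x + h))" for y
    by (rule has_derivative_at_withinI)
     (rule has_derivative_dd[OF smooth_differentiable[OF tf_smooth[OF assms]]])
   show "onorm ((\<lambda>u. dd u f y) - (\<lambda>u. dd u f x)) <= C * norm h"
    if "y \<in> closed_segment x (x + h)" for y
    unfolding fun_diff_def
   proof (rule onorm_bound)
    show "0 <= C * norm h" using \<open>C > 0\<close> by simp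
    fix u
    have "norm (y - x) <= norm h" using segment_bound1[OF that] by simp
    with gl[of u y x] show "norm (dd u f y - dd u f x) <= C * norm h * norm u"
     using \<open>C > 0\<close> by (auto intro!: order_trans[OF gl] mult_right_mono mult_left_mono)
   qed
   show "x \<in> closed_segment x (x + h)" by simp
  qed
  then show ?thesis by (simp add: power2_eq_square algebra_simps)
 qed
 with \<open>C > 0\<close> that show ?thesis by blast
qed

section \<open>Symmetry of second derivatives\<close>

lemma line_derivative:
 assumes "smooth (f :: 'a::euclidean_space => real)"
 shows "((\<lambda>t. f (p + t *\<^sub>R v)) has_real_derivative dd v f (p + t *\<^sub>R v)) (at t)"
proof -
 have "((\<lambda>t. f (p + t *\<^sub>R v)) has_derivative (\<lambda>h. dd (h *\<^sub>R v) f (p + t *\<^sub>R v))) (at t)"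
  by (rule dd_affine[OF smooth_differentiable[OF assms] bounded_linear_scaleR_left])
 moreover have "(\<lambda>h. dd (h *\<^sub>R v) f (p + t *\<^sub>R v)) = (*) (dd v f (p + t *\<^sub>R v))"
  using linear_scale[OF dd_linear[OF assms]] by (auto simp: mult.commute)
 ultimately show ?thesis by (simp add: has_field_derivative_def)
qed

text \<open>The mean value theorem is used twice: along \<open>v\<close> for the increment of
  \<open>f\<close> in direction \<open>u\<close>, then along \<open>u\<close> for
  \<open>dd v f\<close>.\<close>

lemma second_difference_mvt:
 assumes f: "smooth (f :: 'a::euclidean_space => real)" and s: "0 < (s::real)"
 shows "\<exists>p q. 0 < p \<and> p < s \<and> 0 < q \<and> q < s \<and>
  f (x + s *\<^sub>R u + s *\<^sub>R v) - f (x + s *\<^sub>R u) - f (x + s *\<^sub>R v) + f x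
   = s * s * dd u (dd v f) (x + p *\<^sub>R u + q *\<^sub>R v)"
proof -
 define \<phi> where "\<phi> t = f (x + s *\<^sub>R u + t *\<^sub>R v) - f (x + t *\<^sub>R v)" for t
 define \<phi>' where "\<phi>' t = dd v f (x + s *\<^sub>R u + t *\<^sub>R v) - dd v f (x + t *\<^sub>R v)" for t
 have "\<forall>t. 0 <= t \<and> t <= s --> DERIV \<phi> t :> \<phi>' t"
  unfolding \<phi>_def \<phi>'_def by (intro allI impI DERIV_diff line_derivative f)
 from MVT2[OF s, of \<phi> \<phi>'] this obtain q where q: "0 < q" "q < s" "\<phi> s - \<phi> 0 = s * \<phi>' q" by auto
 have "\<forall>t. 0 <= t \<and> t <= s -->
   DERIV (\<lambda>t. dd v f (x + q *\<^sub>R v + t *\<^sub>R u)) t :> dd u (dd v f) (x + q *\<^sub>R v + t *\<^sub>R u)"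
  by (intro allI impI line_derivative smooth_dd f)
 from MVT2[OF s, of "\<lambda>t. dd v f (x + q *\<^sub>R v + t *\<^sub>R u)" "\<lambda>t. dd u (dd v f) (x + q *\<^sub>R v + t *\<^sub>R u)"] this
 obtain p where p: "0 < p" "p < s"
  "dd v f (x + q *\<^sub>R v + s *\<^sub>R u) - dd v f (x + q *\<^sub>R v)
   = s * dd u (dd v f) (x + q *\<^sub>R v + p *\<^sub>R u)"
  by auto
 have "f (x + s *\<^sub>R u + s *\<^sub>R v) - f (x + s *\<^sub>R u) - f (x + s *\<^sub>R v) + f x = s * \<phi>' q"
  using q(3) by (simp add: \<phi>_def algebra_simps)
 also have "... = s * s * dd u (dd v f) (x + p *\<^sub>R u + q *\<^sub>R v)"
  using p(3) by (simp add: \<phi>'_def add.assoc add.commute[of "q *\<^sub>R v"])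
 finally show ?thesis using p q by blast
qed

text \<open>The second difference is symmetric in \<open>u\<close> and \<open>v\<close>. Hence the
  two mixed derivatives agree at pairs of points that both tend to \<open>x\<close>, and continuity
  gives equality at \<open>x\<close>. The Caccioppoli estimate needs this exchange.\<close>

lemma mixed_derivatives_commute:
 assumes f: "smooth (f :: 'a::euclidean_space => real)"
 shows "dd u (dd v f) x = dd v (dd u f) x"
proof -
 define s where "s n = 1 / real (Suc n)" for n
 have s: "s n > 0" for n by (simp add: s_def)
 have s0: "s \<longlonglongrightarrow> 0" unfolding s_def using LIMSEQ_inverse_real_of_nat by (simp add: inverse_eq_divide)
 have "\<forall>n. \<exists>p q. 0 < p \<and> p < s n \<and> 0 < q \<and> q < s n \<and>
  f (x + s n *\<^sub>R u + s n *\<^sub>R v) - f (x + s n *\<^sub>R u) - f (x + s n *\<^sub>R v) + f x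
   = s n * s n * dd u (dd v f) (x + p *\<^sub>R u + q *\<^sub>R v)"
  using second_difference_mvt[OF f s] by blast
 then obtain p q where pq: "!!n. 0 < p n \<and> p n < s n \<and> 0 < q n \<and> q n < s n \<and>
  f (x + s n *\<^sub>R u + s n *\<^sub>R v) - f (x + s n *\<^sub>R u) - f (x + s n *\<^sub>R v) + f x
   = s n * s n * dd u (dd v f) (x + p n *\<^sub>R u + q n *\<^sub>R v)"
  by metis
 have "\<forall>n. \<exists>p q. 0 < p \<and> p < s n \<and> 0 < q \<and> q < s n \<and>
  f (x + s n *\<^sub>R v + s n *\<^sub>R u) - f (x + s n *\<^sub>R v) - f (x + s n *\<^sub>R u) + f x
   = s n * s n * dd v (dd u f) (x + p *\<^sub>R v + q *\<^sub>R u)"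
  using second_difference_mvt[OF f s] by blast
 then obtain p' q' where pq': "!!n. 0 < p' n \<and> p' n < s n \<and> 0 < q' n \<and> q' n < s n \<and>
  f (x + s n *\<^sub>R v + s n *\<^sub>R u) - f (x + s n *\<^sub>R v) - f (x + s n *\<^sub>R u) + f x
   = s n * s n * dd v (dd u f) (x + p' n *\<^sub>R v + q' n *\<^sub>R u)"
  by metis
 have lim0: "g \<longlonglongrightarrow> 0" if "!!n. 0 < g n \<and> g n < s n" for g :: "nat => real"
  by (rule real_tendsto_sandwich[OF _ _ tendsto_const s0]) (use that in \<open>auto simp: less_imp_le\<close>)
 have cont: "isCont (dd u (dd v f)) y" for u v y
  using smooth_continuous_on[OF smooth_dd[OF smooth_dd[OF f]], of UNIV]
  by (simp add: continuous_on_eq_continuous_at)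
 have pl: "p \<longlonglongrightarrow> 0" "q \<longlonglongrightarrow> 0" "p' \<longlonglongrightarrow> 0" "q' \<longlonglongrightarrow> 0" by (auto intro!: lim0 simp: pq pq')
 have eq: "dd u (dd v f) (x + p n *\<^sub>R u + q n *\<^sub>R v) = dd v (dd u f) (x + p' n *\<^sub>R v + q' n *\<^sub>R u)" for n
 proof -
  have "s n * s n * dd u (dd v f) (x + p n *\<^sub>R u + q n *\<^sub>R v)
    = s n * s n * dd v (dd u f) (x + p' n *\<^sub>R v + q' n *\<^sub>R u)"
   using pq[of n] pq'[of n] by (simp add: algebra_simps)
  then show ?thesis using s[of n] by simp
 qed
 have "(\<lambda>n. x + p n *\<^sub>R u + q n *\<^sub>R v) \<longlonglongrightarrow> x + 0 *\<^sub>R u + 0 *\<^sub>R v" by (intro tendsto_intros pl)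
 then have 1: "(\<lambda>n. dd u (dd v f) (x + p n *\<^sub>R u + q n *\<^sub>R v)) \<longlonglongrightarrow> dd u (dd v f) x"
  using isCont_tendsto_compose[OF cont] by simp
 have "(\<lambda>n. x + p' n *\<^sub>R v + q' n *\<^sub>R u) \<longlonglongrightarrow> x + 0 *\<^sub>R v + 0 *\<^sub>R u" by (intro tendsto_intros pl)
 then have 2: "(\<lambda>n. dd v (dd u f) (x + p' n *\<^sub>R v + q' n *\<^sub>R u)) \<longlonglongrightarrow> dd v (dd u f) x"
  using isCont_tendsto_compose[OF cont] by simp
 show ?thesis using LIMSEQ_unique[OF 1] 2 eq by simp
qed

subsection \<open>Translation and reflection\<close>

lemma lborel_distr_reflect: "distr lborel borel (\<lambda>x. c - x) = (lborel :: 'a::euclidean_space measure)"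
 by (subst (2) lborel_affine[of "-1" c]) (auto simp: density_1)

lemma nn_integral_shift:
 "f \<in> borel_measurable borel ==> (\<integral>\<^sup>+x. f (c + x) \<partial>lborel) = (\<integral>\<^sup>+x. f x \<partial>(lborel :: 'a::euclidean_space measure))"
 by (subst (2) lborel_distr_plus[of c, symmetric]) (simp add: nn_integral_distr)

lemma nn_integral_reflect:
 "f \<in> borel_measurable borel ==> (\<integral>\<^sup>+x. f (c - x) \<partial>lborel) = (\<integral>\<^sup>+x. f x \<partial>(lborel :: 'a::euclidean_space measure))"
 by (subst (2) lborel_distr_reflect[of c, symmetric]) (simp add: nn_integral_distr)

lemma integral_shift:
 fixes f :: "'a::euclidean_space => 'b::{banach,second_countable_topology}"
 shows "f \<in> borel_measurable borel ==> (LBINT x. f (c + x)) = (LBINT x. f x)"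
 by (subst (2) lborel_distr_plus[of c, symmetric]) (simp add: integral_distr)

lemma integral_reflect:
 fixes f :: "'a::euclidean_space => 'b::{banach,second_countable_topology}"
 shows "f \<in> borel_measurable borel ==> (LBINT x. f (c - x)) = (LBINT x. f x)"
 by (subst (2) lborel_distr_reflect[of c, symmetric]) (simp add: integral_distr)

lemma integrable_shift:
 fixes f :: "'a::euclidean_space => 'b::{banach,second_countable_topology}"
 shows "f \<in> borel_measurable borel ==> intble (\<lambda>x. f (c + x)) \<longleftrightarrow> intble f"
 by (subst (2) lborel_distr_plus[of c, symmetric]) (simp add: integrable_distr_eq)

lemma integrable_reflect:
 fixes f :: "'a::euclidean_space => 'b::{banach,second_countable_topology}"
 shows "f \<in> borel_measurable borel ==> intble (\<lambda>x. f (c - x)) \<longleftrightarrow> intble f"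
 by (subst (2) lborel_distr_reflect[of c, symmetric]) (simp add: integrable_distr_eq)

lemma AE_reflect:
 fixes P :: "'a::euclidean_space => bool"
 assumes "AE x in lborel. P x" shows "AE x in lborel. P (c - x)"
proof -
 from assms obtain N where N: "N \<in> null_sets lborel" "{x. \<not> P x} \<subseteq> N" by (auto elim!: AE_E simp: null_sets_def)
 have "emeasure lborel ((\<lambda>x. c - x) -` N \<inter> space lborel) = emeasure (distr lborel borel (\<lambda>x. c - x)) N"
  using N by (subst emeasure_distr) (auto simp: null_sets_def)
 also have "... = 0" using N by (simp add: lborel_distr_reflect null_sets_def)
 finally have "(\<lambda>x. c - x) -` N \<in> null_sets lborel"
  using N by (auto simp: null_sets_def intro!: measurable_sets_borel[of _ borel])
 then show ?thesis by (rule AE_I'[of "(\<lambda>x. c - x) -` N"]) (use N in auto)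
qed

subsection \<open>Integration by parts\<close>

lemma integrable_bounded_support:
 fixes g :: "'a::euclidean_space => real"
 assumes "borelf g" "!!x. \<bar>g x\<bar> <= B" "!!x. norm x > r ==> g x = 0"
 shows "intble g"
proof (rule Bochner_Integration.integrable_bound[of _ "\<lambda>x. B * indicator (cball 0 r) x"])
 show "intble (\<lambda>x. B * indicator (cball 0 r) x)"
  by (intro integrable_mult_right integrable_real_indicator)
   (auto simp: emeasure_lborel_cball_finite[simplified])
 show "AE x in lborel. norm (g x) <= norm (B * indicator (cball 0 r) x)"
  using assms(2,3) by (intro AE_I2) (auto simp: indicator_def abs_mult not_le intro: order_trans[OF _ abs_ge_self])
qed (use assms in simp)

lemma tf_integrable: "test_fun S (f :: 'a::euclidean_space => real) ==> intble f"
 by (metis tf_bounded tf_support tf_smooth smooth_borel integrable_bounded_support)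

lemma integral_derivative_zero:
 fixes f :: "'a::euclidean_space => real"
 assumes lip: "!!x y. \<bar>f x - f y\<bar> <= L * norm (x - y)"
  and supp: "!!x. norm x > r ==> f x = 0"
  and deriv: "AE x in lborel. ((\<lambda>t. f (x + t *\<^sub>R e)) has_real_derivative f' x) (at 0)"
  and f': "borelf f'"
 shows "intble f'" "integral\<^sup>L lborel f' = 0"
proof -
 have "L-lipschitz_on UNIV f"
 proof (rule lipschitz_onI)
  show "0 <= L" using order_trans[OF abs_ge_zero lip[of "SOME b. b \<in> Basis" 0]] 
   by (metis diff_zero mult.right_neutral norm_some_Basis)
 qed (use lip in \<open>auto simp: dist_norm\<close>)
 then have "continuous_on UNIV f" by (rule lipschitz_on_continuous_on)
 then have fb[measurable]: "borelf f" by (rule borel_measurable_continuous_onI)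
 have L0: "0 <= L" using \<open>L-lipschitz_on UNIV f\<close> lipschitz_on_nonneg by blast
 define h where "h n = 1 / real (Suc n)" for n
 have h: "h n > 0" "h n <= 1" for n by (auto simp: h_def)
 have h0: "h \<longlonglongrightarrow> 0" unfolding h_def using LIMSEQ_inverse_real_of_nat by (simp add: inverse_eq_divide)
 define s where "s n x = (f (x + h n *\<^sub>R e) - f x) / h n" for n x
 have [measurable]: "s n \<in> borel_measurable borel" for n unfolding s_def by simp
 have int_f: "intble f"
 proof -
  have "\<bar>f x\<bar> <= L * (2 * \<bar>r\<bar> + 2)" for x
  proof (cases "norm x > \<bar>r\<bar> + 1")
   case False
   obtain b :: 'a where b: "b \<in> Basis" using nonempty_Basis by blast
   \<comment> \<open>A point outside the support at controlled distance: the Lipschitz condition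
     then bounds \<open>f\<close> on the ball of radius \<open>\<bar>r\<bar> + 1\<close>.\<close>
   have "f ((\<bar>r\<bar> + 1) *\<^sub>R b) = 0" using b by (intro supp) auto
   then have "\<bar>f x\<bar> <= L * norm (x - (\<bar>r\<bar> + 1) *\<^sub>R b)" using lip[of x "(\<bar>r\<bar> + 1) *\<^sub>R b"] by simp
   also have "... <= L * (2 * \<bar>r\<bar> + 2)"
    using False b norm_triangle_ineq4[of x "(\<bar>r\<bar> + 1) *\<^sub>R b"] by (intro mult_left_mono L0) auto
   finally show ?thesis .
  qed (use supp L0 in auto)
  then show ?thesis using supp by (intro integrable_bounded_support[of f _ r]) auto
 qed
 have int_s: "integral\<^sup>L lborel (s n) = 0" for n
 proof -
  have 1: "intble (\<lambda>x. f (x + h n *\<^sub>R e))"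
   using integrable_shift[of f "h n *\<^sub>R e"] int_f by (simp add: add.commute)
  have "integral\<^sup>L lborel (s n) = ((LBINT x. f (x + h n *\<^sub>R e)) - (LBINT x. f x)) / h n"
   unfolding s_def using 1 int_f by simp
  also have "(LBINT x. f (x + h n *\<^sub>R e)) = (LBINT x. f x)"
   using integral_shift[of f "h n *\<^sub>R e"] by (simp add: add.commute)
  finally show ?thesis by simp
 qed
 let ?w = "\<lambda>x. L * norm e * indicator (cball 0 (r + norm e)) x"
 have w: "intble ?w"
  by (intro integrable_mult_right integrable_real_indicator) (auto simp: emeasure_lborel_cball_finite[simplified])
 have bound: "norm (s n x) <= ?w x" for n x
 proof (cases "norm x > r + norm e")
  case True
  then have "norm x > r" using norm_ge_zero[of e] by linarith
  moreover have "norm (x + h n *\<^sub>R e) > r"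
  proof -
   have "h n * norm e <= norm e" using h[of n] by (simp add: mult_left_le_one_le)
   then show ?thesis using True h(1)[of n] norm_diff_ineq[of x "h n *\<^sub>R e"] by simp
  qed
  ultimately show ?thesis using True supp by (simp add: s_def)
 next
  case False
  have "\<bar>f (x + h n *\<^sub>R e) - f x\<bar> <= L * (h n * norm e)"
   using lip[of "x + h n *\<^sub>R e" x] h(1)[of n] by simp
  then show ?thesis using False h(1)[of n] by (simp add: s_def field_simps)
 qed
 have lim: "AE x in lborel. (\<lambda>n. s n x) \<longlonglongrightarrow> f' x"
  using deriv
 proof eventually_elim
  fix x assume "((\<lambda>t. f (x + t *\<^sub>R e)) has_real_derivative f' x) (at 0)"
  then have "((\<lambda>t. (f (x + t *\<^sub>R e) - f x) / t) \<longlongrightarrow> f' x) (at 0)"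
   by (simp add: has_field_derivative_iff)
  moreover have "filterlim h (at 0) sequentially"
   using h0 h(1) by (auto simp: filterlim_at less_imp_neq[symmetric])
  ultimately show "(\<lambda>n. s n x) \<longlonglongrightarrow> f' x"
   unfolding s_def by (rule filterlim_compose)
 qed
 have f'm: "f' \<in> borel_measurable lborel" using f' by simp
 show "intble f'"
  by (rule integrable_dominated_convergence[OF f'm _ w lim]) (use bound in auto)
 have "(\<lambda>n. integral\<^sup>L lborel (s n)) \<longlonglongrightarrow> integral\<^sup>L lborel f'"
  by (rule integral_dominated_convergence[OF f'm _ w lim]) (use bound in auto)
 then show "integral\<^sup>L lborel f' = 0" using int_s LIMSEQ_unique[OF _ tendsto_const] by simp
qed

lemma tf_integral_dd: "test_fun UNIV (f :: 'a::euclidean_space => real) ==> integral\<^sup>L lborel (dd v f) = 0"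
proof -
 assume f: "test_fun UNIV f"
 obtain L where "!!x y. \<bar>f x - f y\<bar> <= L * norm (x - y)" using smooth_lipschitz[OF f] by metis
 moreover obtain r where "!!x. norm x > r ==> f x = 0" using tf_support[OF f] by metis
 ultimately show ?thesis
  using line_derivative[OF tf_smooth[OF f], where v = v and t = 0]
  by (intro integral_derivative_zero(2)[of f L r v]) (auto intro: smooth_borel[OF smooth_dd] simp: tf_smooth[OF f])
qed

lemma integration_by_parts:
 fixes f g :: "'a::euclidean_space => real"
 assumes f: "smooth f" and g: "test_fun UNIV g"
 shows "(LBINT x. dd v f x * g x) = - (LBINT x. f x * dd v g x)"
proof -
 have 1: "intble (\<lambda>x. f x * dd v g x)" "intble (\<lambda>x. dd v f x * g x)"
  using tf_integrable[OF tf_mult[OF tf_dd[OF g] f]] tf_integrable[OF tf_mult[OF g smooth_dd[OF f]]] by auto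
 have "0 = (LBINT x. f x * dd v g x + dd v f x * g x)"
  using tf_integral_dd[OF tf_mult[OF g f], of v]
  by (simp add: dd_mult smooth_differentiable f tf_smooth[OF g])
 also have "... = (LBINT x. f x * dd v g x) + (LBINT x. dd v f x * g x)"
  using 1 by simp
 finally show ?thesis by simp
qed

subsection \<open>Convolution with test functions\<close>

definition locint :: "('a::euclidean_space => real) => bool" where
 "locint f \<longleftrightarrow> f \<in> borel_measurable borel \<and> (\<forall>r. intble (\<lambda>x. indicator (cball 0 r) x * f x))"

definition conv :: "('a::euclidean_space => real) => ('a => real) => 'a => real" where
 "conv f \<eta> x = (LBINT y. f y * \<eta> (x - y))"

lemma locint_mult:
 assumes f: "locint f" and g: "borelf g" "!!x. \<bar>g x\<bar> <= B" "!!x. norm x > r ==> g x = 0"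
 shows "intble (\<lambda>x. f x * g x)"
proof (rule Bochner_Integration.integrable_bound[of _ "\<lambda>x. B * (indicator (cball 0 r) x * f x)"])
 show "intble (\<lambda>x. B * (indicator (cball 0 r) x * f x))"
  using f by (intro integrable_mult_right) (auto simp: locint_def)
 have B0: "0 <= B" using order_trans[OF abs_ge_zero g(2)] .
 show "AE x in lborel. norm (f x * g x) <= norm (B * (indicator (cball 0 r) x * f x))"
  using g(2,3) B0
  by (intro AE_I2) (auto simp: indicator_def abs_mult not_le mult.commute[of "\<bar>f _\<bar>"] intro!: mult_right_mono)
 show "(\<lambda>x. f x * g x) \<in> borel_measurable lborel" using f g by (auto simp: locint_def)
qed

lemma locint_tf: "locint f ==> test_fun S g ==> intble (\<lambda>x. f x * g x)"
 by (metis tf_bounded tf_support tf_smooth smooth_borel locint_mult)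

lemma conv_integrable: "locint f ==> test_fun UNIV \<eta> ==> intble (\<lambda>y. f y * \<eta> (x - y))"
 by (rule locint_tf[OF _ tf_reflect])

lemma locint_integrable:
 fixes f :: "'a::euclidean_space => real"
 shows "intble f ==> locint f"
 by (auto simp: locint_def intro!: integrable_mult_indicator[where 'b = real, simplified])

lemma locint_bounded:
 fixes f :: "'a::euclidean_space => real"
 assumes [measurable]: "borelf f" and "!!x. \<bar>f x\<bar> <= B"
 shows "locint f"
proof -
 have "intble (\<lambda>x. indicator (cball 0 r) x * f x)" for r
  by (rule integrable_bounded_support[where B = B and r = r])
   (use assms in \<open>auto simp: abs_mult indicator_def intro: order_trans[OF abs_ge_zero]\<close>)
 then show ?thesis by (simp add: locint_def)
qed

text \<open>The derivative falls on \<open>\<eta>\<close>, since \<open>f\<close> is merely locally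
  integrable. The quadratic Taylor remainder of \<open>\<eta>\<close>, integrated against
  \<open>\<bar>f\<bar>\<close> over a fixed ball, is of smaller order than the increment.\<close>

lemma conv_has_derivative:
 assumes f: "locint f" and \<eta>: "test_fun UNIV \<eta>"
 shows "(conv f \<eta> has_derivative (\<lambda>h. conv f (dd h \<eta>) x)) (at x)"
proof -
 note ci = conv_integrable[OF f tf_dd[OF \<eta>]] conv_integrable[OF f \<eta>]
 obtain C where C: "C > 0" "!!x h. \<bar>\<eta> (x + h) - \<eta> x - dd h \<eta> x\<bar> <= C * (norm h)^2"
  using tf_taylor[OF \<eta>] by metis
 obtain r where r: "r > 0" "!!x. norm x > r ==> \<eta> x = 0" using tf_support[OF \<eta>] by metis
 \<comment> \<open>For increments shorter than 1, all the shifted kernels involved vanish outside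
   the ball of this radius about the origin.\<close>
 define R where "R = norm x + r + 1"
 define I where "I = (LBINT y. \<bar>indicator (cball 0 R) y * f y\<bar>)"
 have fR: "intble (\<lambda>y. indicator (cball 0 R) y * f y)" using f by (simp add: locint_def)
 have lin: "linear (\<lambda>h. conv f (dd h \<eta>) x)"
 proof (rule linearI)
  show "conv f (dd (u + v) \<eta>) x = conv f (dd u \<eta>) x + conv f (dd v \<eta>) x" for u v
   unfolding conv_def using ci(1)
   by (simp add: linear_add[OF dd_linear[OF tf_smooth[OF \<eta>]]] distrib_left)
  show "conv f (dd (c *\<^sub>R v) \<eta>) x = c *\<^sub>R conv f (dd v \<eta>) x" for c v
   unfolding conv_def by (simp add: linear_scale[OF dd_linear[OF tf_smooth[OF \<eta>]]] mult.left_commute)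
 qed
 show ?thesis
 proof (rule has_derivativeI_sandwich[where e = 1 and H = "\<lambda>y. C * I * norm (y - x)"])
  show "bounded_linear (\<lambda>h. conv f (dd h \<eta>) x)" using lin by (simp add: linear_conv_bounded_linear)
  show "((\<lambda>y. C * I * norm (y - x)) \<longlongrightarrow> 0) (at x)"
   by (rule tendsto_eq_intros refl | simp)+
  fix z assume z: "z \<noteq> x" "dist z x < 1"
  define h where "h = z - x"
  have h: "norm h < 1" "z = x + h" using z by (auto simp: h_def dist_norm)
  have eq: "conv f \<eta> z - conv f \<eta> x - conv f (dd h \<eta>) x
    = (LBINT y. f y * (\<eta> (x - y + h) - \<eta> (x - y) - dd h \<eta> (x - y)))"
   unfolding conv_def using ci(1)[of x h] ci(2)[of x] ci(2)[of z]
   by (simp add: h right_diff_distrib add_diff_eq diff_add_eq)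
  have "norm (LBINT y. f y * (\<eta> (x - y + h) - \<eta> (x - y) - dd h \<eta> (x - y)))
    <= (LBINT y. C * (norm h)^2 * \<bar>indicator (cball 0 R) y * f y\<bar>)"
  proof (rule Bochner_Integration.integral_norm_bound_integral)
   show "intble (\<lambda>y. f y * (\<eta> (x - y + h) - \<eta> (x - y) - dd h \<eta> (x - y)))"
    using ci(1)[of x h] ci(2)[of x] ci(2)[of z]
    by (simp add: h right_diff_distrib add_diff_eq diff_add_eq)
   show "intble (\<lambda>y. C * (norm h)^2 * \<bar>indicator (cball 0 R) y * f y\<bar>)"
    using fR by (intro integrable_mult_right integrable_abs)
   fix y
   show "norm (f y * (\<eta> (x - y + h) - \<eta> (x - y) - dd h \<eta> (x - y)))
     <= C * (norm h)^2 * \<bar>indicator (cball 0 R) y * f y\<bar>"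
   proof (cases "norm y > R")
    case True
    have "norm (x - y) > r + 1" using True norm_triangle_ineq2[of y x] by (simp add: R_def norm_minus_commute)
    moreover from this have "norm (x - y + h) > r" using h norm_diff_ineq[of "x - y" h] by linarith
    ultimately show ?thesis using r dd_zero_outside[of r \<eta>] True by simp
   next
    case False
    then show ?thesis using mult_right_mono[OF C(2)[of "x - y" h], of "\<bar>f y\<bar>"]
     by (simp add: abs_mult mult.commute)
   qed
  qed
  also have "... = C * I * (norm h)^2" by (simp add: I_def)
  finally show "norm (conv f \<eta> z - conv f \<eta> x - conv f (dd (z - x) \<eta>) x) / norm (z - x)
    <= C * I * norm (z - x)"
   using z eq by (simp add: h_def[symmetric] divide_le_eq power2_eq_square mult.assoc)
 qed auto
qed

lemma dd_conv: "locint f ==> test_fun UNIV \<eta> ==> dd v (conv f \<eta>) = conv f (dd v \<eta>)"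
 by (rule ext, rule dd_eq, rule conv_has_derivative)

lemma smooth_conv:
 assumes "locint f" "test_fun UNIV \<eta>"
 shows "smooth (conv f \<eta>)"
proof
 fix k show "Ck k (conv f \<eta>)" using assms(2)
 proof (induction k arbitrary: \<eta>)
  case 0
  then have "conv f \<eta> differentiable_on UNIV"
   using conv_has_derivative[OF assms(1)] by (auto simp: differentiable_on_def differentiable_def)
  then show ?case by (simp add: differentiable_imp_continuous_on)
 next
  case (Suc k)
  then show ?case
   using conv_has_derivative[OF assms(1) Suc.prems] dd_conv[OF assms(1) Suc.prems] tf_dd[OF Suc.prems]
   by (auto simp: differentiable_def)
 qed
qed

subsection \<open>Continuity of translations in the mean square\<close>

lemma in_L2_real: "in_L2 (f :: 'a::euclidean_space => real) \<longleftrightarrow>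
  f \<in> borel_measurable borel \<and> intble (\<lambda>x. (f x)^2)"
 by (simp add: in_L2_def)

lemma L2_norm_sq: "(L2_norm f)^2 = (LBINT x. (norm (f x))^2)"
 by (simp add: L2_norm_def)

lemma cball_borel[measurable]: "cball (x::'a::euclidean_space) r \<in> sets borel"
 by (intro borel_closed closed_cball)

lemma sq_add_le: "((a::real) + b)^2 <= 2 * a^2 + 2 * b^2"
 using sum_squares_bound[of a b] by (simp add: power2_sum)

lemma integrable_sq_add:
 fixes f g :: "'a::euclidean_space => real"
 assumes "in_L2 f" "in_L2 g"
 shows "in_L2 (\<lambda>x. f x + g x)"
proof -
 have [measurable]: "borelf f" "borelf g"
  using assms by (auto simp: in_L2_real)
 have "intble (\<lambda>x. (f x + g x)^2)"
  by (rule Bochner_Integration.integrable_bound[of _ "\<lambda>x. 2 * (f x)^2 + 2 * (g x)^2"])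
   (use assms in \<open>auto simp: in_L2_real intro!: AE_I2 order_trans[OF sq_add_le]\<close>)
 then show ?thesis by (simp add: in_L2_real)
qed

lemma in_L2_cmult: "in_L2 (f :: 'a::euclidean_space => real) ==> in_L2 (\<lambda>x. c * f x)"
 by (auto simp: in_L2_real power_mult_distrib)

lemma in_L2_diff:
 fixes f g :: "'a::euclidean_space => real"
 shows "in_L2 f ==> in_L2 g ==> in_L2 (\<lambda>x. f x - g x)"
 using integrable_sq_add[of f "\<lambda>x. (-1) * g x"] in_L2_cmult[of g "-1"] by simp

lemma in_L2_mult_integrable:
 fixes f g :: "'a::euclidean_space => real"
 assumes "in_L2 f" "in_L2 g"
 shows "intble (\<lambda>x. f x * g x)"
proof (rule Bochner_Integration.integrable_bound[of _ "\<lambda>x. (f x)^2 + (g x)^2"])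
 show "AE x in lborel. norm (f x * g x) <= norm ((f x)^2 + (g x)^2)"
 proof (intro AE_I2)
  fix x
  have "2 * (\<bar>f x\<bar> * \<bar>g x\<bar>) <= (f x)^2 + (g x)^2"
   using sum_squares_bound[of "\<bar>f x\<bar>" "\<bar>g x\<bar>"] by simp
  moreover have "0 <= \<bar>f x\<bar> * \<bar>g x\<bar>" by simp
  ultimately show "norm (f x * g x) <= norm ((f x)^2 + (g x)^2)"
   unfolding real_norm_def abs_mult by linarith
 qed
qed (use assms in \<open>auto simp: in_L2_real\<close>)

lemma Cauchy_Schwarz_integral:
 fixes f g :: "'a::euclidean_space => real"
 assumes "in_L2 f" "in_L2 g"
 shows "\<bar>LBINT x. f x * g x\<bar> <= L2_norm f * L2_norm g"
proof -
 let ?F = "LBINT x. (f x)^2" and ?G = "LBINT x. (g x)^2" and ?P = "LBINT x. f x * g x"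
 have int: "intble (\<lambda>x. (f x)^2)" "intble (\<lambda>x. (g x)^2)"
  "intble (\<lambda>x. f x * g x)"
  using assms in_L2_mult_integrable[OF assms] by (auto simp: in_L2_real)
 have q: "0 <= ?F + 2 * t * ?P + t^2 * ?G" for t
 proof -
  have "0 <= (LBINT x. (f x + t * g x)^2)" by simp
  also have "... = (LBINT x. (f x)^2 + 2 * t * (f x * g x) + t^2 * (g x)^2)"
   by (intro Bochner_Integration.integral_cong) (auto simp: power2_eq_square algebra_simps)
  also have "... = ?F + 2 * t * ?P + t^2 * ?G"
   using int by simp
  finally show ?thesis .
 qed
 \<comment> \<open>If \<open>?G = 0\<close>, the quadratic \<open>q\<close> is affine in
   \<open>t\<close> and can be nonnegative only with slope zero; otherwise it is evaluated at its
   minimum.\<close>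
 have "?P^2 <= ?F * ?G"
 proof (cases "?G = 0")
  case True
  have "?P = 0"
  proof (rule ccontr)
   assume "?P \<noteq> 0"
   then show False using q[of "- (?F + 1) / (2 * ?P)"] True by (simp add: field_simps)
  qed
  then show ?thesis using True by simp
 next
  case False
  then have "?G > 0" by (simp add: less_le)
  then show ?thesis using q[of "- ?P / ?G"] by (simp add: field_simps power2_eq_square)
 qed
 then have "\<bar>?P\<bar> <= sqrt (?F * ?G)" using real_le_rsqrt by (metis power2_abs)
 then show ?thesis by (simp add: L2_norm_def real_sqrt_mult)
qed

lemma locint_L2:
 fixes f :: "'a::euclidean_space => real"
 assumes "in_L2 f" shows "locint f"
proof -
 have "intble (\<lambda>x. indicator (cball 0 r) x * f x)" for r
 proof (rule in_L2_mult_integrable[OF _ assms])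
  have "intble (\<lambda>x::'a. indicator (cball 0 r) x :: real)"
   by (intro integrable_real_indicator) (auto simp: emeasure_lborel_cball_finite[simplified])
  moreover have "(\<lambda>x::'a. (indicator (cball 0 r) x :: real)^2) = indicator (cball 0 r)"
   by (auto simp: indicator_def)
  ultimately show "in_L2 (\<lambda>x::'a. indicator (cball 0 r) x :: real)" by (simp add: in_L2_real)
 qed
 with assms show ?thesis by (simp add: locint_def in_L2_real)
qed

lemma in_L2_shift: "in_L2 (f :: 'a::euclidean_space => real) ==> in_L2 (\<lambda>x. f (x - h))"
 using integrable_shift[of "\<lambda>x. (f x)^2" "-h"] by (auto simp: in_L2_real)

lemma integral_sq_shift:
 "in_L2 (f :: 'a::euclidean_space => real) ==> (LBINT x. (f (x - h))^2) = (LBINT x. (f x)^2)"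
 using integral_shift[of "\<lambda>x. (f x)^2" "-h"] by (auto simp: in_L2_real)

definition trunc :: "real => real => real" where
 "trunc m y = max (- m) (min m y)"

lemma continuous_trunc: "continuous_on UNIV (trunc m)"
 unfolding trunc_def by (intro continuous_intros)

lemma trunc_measurable[measurable]:
 assumes [measurable]: "f \<in> borel_measurable M"
 shows "(\<lambda>x. trunc m (f x)) \<in> borel_measurable M"
 unfolding trunc_def by measurable

lemma in_L2_support:
 fixes g :: "'a::euclidean_space => real"
 assumes "borelf g" "!!x. \<bar>g x\<bar> <= B" "!!x. norm x > r ==> g x = 0"
 shows "in_L2 g"
proof -
 have "intble (\<lambda>x. (g x)^2)"
 proof (rule integrable_bounded_support[where B = "B^2" and r = r])
  show "\<bar>(g x)^2\<bar> <= B^2" for x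
   using assms(2)[of x] abs_le_square_iff[of "g x" B] by simp
 qed (use assms in auto)
 with assms show ?thesis by (simp add: in_L2_real)
qed

lemma L2_approx_bounded:
 fixes f :: "'a::euclidean_space => real"
 assumes f: "in_L2 f" and e: "e > 0"
 obtains m :: nat where "m > 0"
  "(LBINT x. (f x - indicator (cball 0 (real m)) x * trunc (real m) (f x))^2) < e"
proof -
 let ?H = "\<lambda>n x. indicator (cball 0 (real n)) x * trunc (real n) (f x)"
 have [measurable]: "borelf f" using f by (simp add: in_L2_real)
 have "(\<lambda>n. \<integral>x. (f x - ?H n x)^2 \<partial>lborel) \<longlonglongrightarrow> (\<integral>x. 0 \<partial>(lborel::'a measure))"
 proof (rule integral_dominated_convergence[where w = "\<lambda>x. (f x)^2"])
  show "intble (\<lambda>x. (f x)^2)" using f by (simp add: in_L2_real)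
  show "AE x in lborel. (\<lambda>n. (f x - ?H n x)^2) \<longlonglongrightarrow> 0"
  proof (intro AE_I2 tendsto_eventually)
   fix x
   obtain N :: nat where N: "max (norm x) \<bar>f x\<bar> <= real N" using real_arch_simple by blast
   show "\<forall>\<^sub>F n in sequentially. (f x - ?H n x)^2 = 0"
    using eventually_ge_at_top[of N]
   proof eventually_elim
    fix n assume "N <= n"
    then have "norm x <= real n" "\<bar>f x\<bar> <= real n" using N by auto
    then show "(f x - ?H n x)^2 = 0" by (auto simp: trunc_def)
   qed
  qed
  show "AE x in lborel. norm ((f x - ?H n x)^2) <= (f x)^2" for n
   by (intro AE_I2) (auto simp: indicator_def trunc_def abs_le_square_iff[symmetric])
 qed auto
 then have "\<forall>\<^sub>F n in sequentially. (LBINT x. (f x - ?H n x)^2) < e"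
  using e by (simp add: order_tendsto_iff)
 then have "\<forall>\<^sub>F n in sequentially. n > 0 \<and> (LBINT x. (f x - ?H n x)^2) < e"
  using eventually_gt_at_top[of 0] by eventually_elim auto
 then obtain n where "n > 0 \<and> (LBINT x. (f x - ?H n x)^2) < e"
  using eventually_happens trivial_limit_sequentially by blast
 then show ?thesis using that by auto
qed

text \<open>A measurable function is almost everywhere a limit of continuous ones, with no control
  of their size. Truncating the target in height and in space, and the approximants likewise,
  supplies the dominating function.\<close>

lemma L2_approx_continuous:
 fixes f :: "'a::euclidean_space => real"
 assumes f: "in_L2 f" and e: "e > 0"
 obtains g r B where "continuous_on UNIV g" "r > 0" "!!x. norm x > r ==> g x = 0" "!!x. \<bar>g x\<bar> <= B"
  "(LBINT x. (f x - g x)^2) < e"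
proof -
 obtain m :: nat where m: "m > 0"
  "(LBINT x. (f x - indicator (cball 0 (real m)) x * trunc (real m) (f x))^2) < e / 4"
  using L2_approx_bounded[OF f, of "e / 4"] e by auto
 define H where "H x = indicator (cball 0 (real m)) x * trunc (real m) (f x)" for x
 have [measurable]: "borelf f" using f by (simp add: in_L2_real)
 have Hm[measurable]: "borelf H" unfolding H_def by measurable
 have Hb: "\<bar>H x\<bar> <= real m" "norm x > real m ==> H x = 0" for x
  by (auto simp: H_def indicator_def trunc_def)
 have H2: "in_L2 H" using Hb by (intro in_L2_support[where B = "real m" and r = "real m"]) auto
 have "H \<in> borel_measurable lebesgue" using Hm by (simp add: measurable_completion)
 then have "H measurable_on UNIV" by (simp add: lebesgue_measurable_imp_measurable_on)
 then obtain N g where g: "negligible N" "!!n. continuous_on UNIV (g n)"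
  "!!x. x \<notin> N ==> (\<lambda>n. g n x) \<longlonglongrightarrow> H x"
  unfolding measurable_on_def by auto
 define c where "c x = max 0 (min 1 (real m + 1 - norm x))" for x :: 'a
 have c: "continuous_on UNIV c" "0 <= c x" "c x <= 1" "norm x > real m + 1 ==> c x = 0" 
  "norm x <= real m ==> c x = 1" for x
  by (auto simp: c_def intro!: continuous_intros)
 define G where "G n x = c x * trunc (real m) (g n x)" for n x
 have Gc: "continuous_on UNIV (G n)" for n
  unfolding G_def
  by (intro continuous_intros c(1) continuous_on_compose2[OF continuous_trunc g(2)]) auto
 then have [measurable]: "G n \<in> borel_measurable borel" for n by (rule borel_measurable_continuous_onI)
 have Gb: "\<bar>G n x\<bar> <= real m" for n x
 proof -
  have "\<bar>trunc (real m) (g n x)\<bar> <= real m" by (auto simp: trunc_def)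
  then show ?thesis unfolding G_def abs_mult using c(2,3)[of x] mult_mono[of "\<bar>c x\<bar>" 1] by fastforce
 qed
 have Gs: "norm x > real m + 1 ==> G n x = 0" for n x by (simp add: G_def c)
 have G2: "in_L2 (G n)" for n using Gb Gs by (intro in_L2_support[where B = "real m" and r = "real m + 1"]) auto
 have "(\<lambda>n. \<integral>x. (H x - G n x)^2 \<partial>lborel) \<longlonglongrightarrow> (\<integral>x. 0 \<partial>(lborel::'a measure))"
 proof (rule integral_dominated_convergence[where w = "\<lambda>x. (2 * real m)^2 * indicator (cball 0 (real m + 1)) x"])
  show "intble (\<lambda>x::'a. (2 * real m)^2 * indicator (cball 0 (real m + 1)) x)"
   by (intro integrable_mult_right integrable_real_indicator) (auto simp: emeasure_lborel_cball_finite[simplified])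
  have "AE x in lborel. x \<notin> N" using g(1)
   by (metis AE_not_in AE_completion_iff negligible_iff_null_sets)
  then show "AE x in lborel. (\<lambda>n. (H x - G n x)^2) \<longlonglongrightarrow> 0"
  proof eventually_elim
   fix x assume "x \<notin> N"
   then have "(\<lambda>n. trunc (real m) (g n x)) \<longlonglongrightarrow> trunc (real m) (H x)"
    unfolding trunc_def by (intro tendsto_intros g)
   then have "(\<lambda>n. (H x - G n x)^2) \<longlonglongrightarrow> (H x - c x * trunc (real m) (H x))^2"
    unfolding G_def by (intro tendsto_intros)
   moreover have "c x * trunc (real m) (H x) = H x"
    using Hb[of x] c(5)[of x] by (cases "norm x > real m") (auto simp: trunc_def)
   ultimately show "(\<lambda>n. (H x - G n x)^2) \<longlonglongrightarrow> 0" by simp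
  qed
  show "AE x in lborel. norm ((H x - G n x)^2) <= (2 * real m)^2 * indicator (cball 0 (real m + 1)) x" for n
  proof (intro AE_I2)
   fix x
   show "norm ((H x - G n x)^2) <= (2 * real m)^2 * indicator (cball 0 (real m + 1)) x"
   proof (cases "norm x > real m + 1")
    case False
    have "\<bar>H x - G n x\<bar> <= \<bar>2 * real m\<bar>" using Hb(1)[of x] Gb[of n x] by linarith
    then have "(H x - G n x)^2 <= (2 * real m)^2" by (simp only: abs_le_square_iff)
    with False show ?thesis by simp
   qed (use Hb Gs in auto)
  qed
 qed auto
 then have "\<forall>\<^sub>F n in sequentially. (LBINT x. (H x - G n x)^2) < e / 4"
  using e by (intro order_tendstoD(2)) auto
 then obtain n where n: "(LBINT x. (H x - G n x)^2) < e / 4"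
  using eventually_happens trivial_limit_sequentially by blast
 have i1: "intble (\<lambda>x. (f x - H x)^2)" and i2: "intble (\<lambda>x. (H x - G n x)^2)"
  using in_L2_diff[OF f H2] in_L2_diff[OF H2 G2] by (auto simp: in_L2_real)
 have "(LBINT x. (f x - G n x)^2) <= (LBINT x. 2 * (f x - H x)^2 + 2 * (H x - G n x)^2)"
 proof (rule integral_mono)
  show "intble (\<lambda>x. (f x - G n x)^2)" using in_L2_diff[OF f G2] by (simp add: in_L2_real)
  show "(f x - G n x)^2 <= 2 * (f x - H x)^2 + 2 * (H x - G n x)^2" for x
   using sum_squares_bound[of "f x - H x" "H x - G n x"]
   by (simp add: power2_eq_square algebra_simps)
 qed (use i1 i2 in auto)
 also have "... = 2 * (LBINT x. (f x - H x)^2) + 2 * (LBINT x. (H x - G n x)^2)"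
  using i1 i2 by simp
 also have "... < e" using m(2) n unfolding H_def by linarith
 finally have *: "(LBINT x. (f x - G n x)^2) < e" .
 show ?thesis by (rule that[of "G n" "real m + 1", OF Gc _ Gs Gb *]) simp_all
qed

text \<open>Approximation by a uniformly continuous function of compact support. The square of a sum
  of three differences costs a factor 3, so each of the three integrals is made at most
  \<open>e / 9\<close>; \<open>k\<close> below is the pointwise oscillation that achieves this on
  the ball of radius \<open>r + 1\<close>.\<close>

lemma translation_L2:
 fixes f :: "'a::euclidean_space => real"
 assumes f: "in_L2 f" and e: "e > 0"
 obtains \<delta> where "\<delta> > 0" "!!h. norm h <= \<delta> ==> (LBINT x. (f (x - h) - f x)^2) <= e"
proof -
 obtain g r B where g: "continuous_on UNIV g" "r > 0" "!!x. norm x > r ==> g x = 0" "!!x. \<bar>g x\<bar> <= B"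
  "(LBINT x. (f x - g x)^2) < e / 9"
  using L2_approx_continuous[OF f, of "e / 9"] e by auto
 have [measurable]: "borelf g" using g(1) by (rule borel_measurable_continuous_onI)
 have g2: "in_L2 g" using g by (intro in_L2_support[where B = B and r = r]) auto
 define V where "V = measure lborel (cball (0::'a) (r + 1))"
 have "V \<ge> 0" by (simp add: V_def)
 define k where "k = sqrt (e / (9 * (V + 1)))"
 have k: "k > 0" "k^2 = e / (9 * (V + 1))" using e \<open>V \<ge> 0\<close> by (auto simp: k_def)
 have "uniformly_continuous_on (cball 0 (r + 2)) g"
  by (intro compact_uniformly_continuous continuous_on_subset[OF g(1)]) auto
 then obtain d where d: "d > 0" "!!x y. norm x <= r + 2 ==> norm y <= r + 2 ==> dist y x < d ==> dist (g y) (g x) < k"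
  unfolding uniformly_continuous_on_def using k(1) by (force simp: Ball_def)
 define \<delta> where "\<delta> = min 1 (d / 2)"
 show ?thesis
 proof (rule that[of \<delta>])
  show "\<delta> > 0" using d by (simp add: \<delta>_def)
  fix h :: 'a assume h: "norm h <= \<delta>"
  have gk: "(g (x - h) - g x)^2 <= k^2 * indicator (cball 0 (r + 1)) x" for x
  proof (cases "norm x <= r + 1")
   case True
   have "norm (x - h) <= r + 2" using True h norm_triangle_ineq4[of x h] by (simp add: \<delta>_def)
   then have "\<bar>g (x - h) - g x\<bar> < k" using d(2)[of x "x - h"] True h d(1)
    by (auto simp: dist_norm \<delta>_def)
   then have "(g (x - h) - g x)^2 <= k^2" using abs_le_square_iff[of "g (x - h) - g x" k] by simp
   then show ?thesis using True by simp
  next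
   case False
   then have "norm (x - h) > r" using h norm_triangle_ineq2[of x h] by (simp add: \<delta>_def)
   then show ?thesis using False g(3) by simp
  qed
  have gh2: "in_L2 (\<lambda>x. g (x - h) - g x)" by (intro in_L2_diff in_L2_shift g2)
  have i3: "intble (\<lambda>x::'a. k^2 * indicator (cball 0 (r + 1)) x)"
   by (intro integrable_mult_right integrable_real_indicator) (auto simp: emeasure_lborel_cball_finite[simplified])
  have "(LBINT x. (g (x - h) - g x)^2) <= (\<integral>x. k^2 * indicator (cball 0 (r + 1)) x \<partial>(lborel :: 'a measure))"
   by (rule integral_mono) (use gh2 i3 gk in \<open>auto simp: in_L2_real\<close>)
  also have "... = k^2 * V" by (simp add: V_def)
  also have "... <= e / 9" unfolding k(2) using e \<open>V \<ge> 0\<close> by (simp add: field_simps)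
  finally have gs: "(LBINT x. (g (x - h) - g x)^2) <= e / 9" .
  have fg: "in_L2 (\<lambda>x. f x - g x)" by (intro in_L2_diff f g2)
  note fgs = in_L2_shift[OF fg, of h]
  have ints: "intble (\<lambda>x. (f (x - h) - g (x - h))^2)" "intble (\<lambda>x. (g (x - h) - g x)^2)"
   "intble (\<lambda>x. (f x - g x)^2)" "intble (\<lambda>x. (f (x - h) - f x)^2)"
   using fg fgs gh2 in_L2_diff[OF in_L2_shift[OF f] f] by (auto simp: in_L2_real)
  have "(LBINT x. (f (x - h) - f x)^2)
    <= (LBINT x. 3 * (f (x - h) - g (x - h))^2 + 3 * (g (x - h) - g x)^2 + 3 * (f x - g x)^2)"
  proof (rule integral_mono)
   have sq: "(a + b + c)^2 <= 3 * a^2 + 3 * b^2 + 3 * c^2" for a b c :: real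
    using sum_squares_bound[of a b] sum_squares_bound[of b c] sum_squares_bound[of a c]
    by (simp add: power2_eq_square algebra_simps)
   show "(f (x - h) - f x)^2 <= 3 * (f (x - h) - g (x - h))^2 + 3 * (g (x - h) - g x)^2 + 3 * (f x - g x)^2" for x
    using sq[of "f (x - h) - g (x - h)" "g (x - h) - g x" "g x - f x"] by (simp add: power2_commute)
  qed (use ints in auto)
  also have "... = 3 * (LBINT x. (f (x - h) - g (x - h))^2) + 3 * (LBINT x. (g (x - h) - g x)^2)
    + 3 * (LBINT x. (f x - g x)^2)"
   using ints by simp
  also have "(LBINT x. (f (x - h) - g (x - h))^2) = (LBINT x. (f x - g x)^2)"
   by (rule integral_sq_shift[OF fg])
  finally show "(LBINT x. (f (x - h) - f x)^2) <= e" using g(5) gs by linarith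
 qed
qed

subsection \<open>Mollification\<close>

lemma integral_le_nn_integral:
 fixes g :: "'a => real"
 assumes "g \<in> borel_measurable M" "!!x. 0 <= g x" "0 <= c" "(\<integral>\<^sup>+x. ennreal (g x) \<partial>M) <= ennreal c"
 shows "integrable M g" "integral\<^sup>L M g <= c"
proof -
 show i: "integrable M g"
  using assms by (intro integrableI_nonneg) (auto intro: le_less_trans ennreal_less_top)
 have "ennreal (integral\<^sup>L M g) = (\<integral>\<^sup>+x. ennreal (g x) \<partial>M)"
  using i assms(2) by (simp add: nn_integral_eq_integral)
 then show "integral\<^sup>L M g <= c" using assms(3,4) by (metis ennreal_le_iff)
qed

text \<open>Jensen's inequality for the probability density \<open>\<eta>\<close>: the variance is
  nonnegative.\<close>

lemma square_integral_le:
 fixes g \<eta> :: "'a::euclidean_space => real"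
 assumes "intble \<eta>" "!!x. 0 <= \<eta> x" "(LBINT x. \<eta> x) = 1"
  "intble (\<lambda>x. g x * \<eta> x)" "intble (\<lambda>x. (g x)^2 * \<eta> x)"
 shows "(LBINT x. g x * \<eta> x)^2 <= (LBINT x. (g x)^2 * \<eta> x)"
proof -
 define c where "c = (LBINT x. g x * \<eta> x)"
 have "0 <= (LBINT x. (g x - c)^2 * \<eta> x)" using assms(2) by simp
 also have "... = (LBINT x. (g x)^2 * \<eta> x - 2 * c * (g x * \<eta> x) + c^2 * \<eta> x)"
  by (intro Bochner_Integration.integral_cong) (auto simp: power2_eq_square algebra_simps)
 also have "... = (LBINT x. (g x)^2 * \<eta> x) - 2 * c * c + c^2"
  using assms by (simp add: c_def)
 finally show ?thesis by (simp add: c_def[symmetric] power2_eq_square)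
qed

lemma tf_grad_bounded:
 assumes "test_fun UNIV (f :: 'a::euclidean_space => real)"
 obtains B where "B > 0" "!!x. norm (grad f x) <= B"
proof -
 have "\<exists>B>0. \<forall>x. \<bar>dd i f x\<bar> <= B" for i
  using tf_bounded[OF tf_dd[OF assms, of i]] by metis
 then obtain B where B: "!!i. B i > 0" "!!i x. \<bar>dd i f x\<bar> <= B i" by metis
 have "norm (grad f x) <= (\<Sum>i\<in>Basis. B i)" for x
  by (rule order_trans[OF norm_le_sum_inner])
   (auto intro!: sum_mono simp: grad_inner[OF tf_smooth[OF assms]] B)
 moreover have "(\<Sum>i\<in>(Basis::'a set). B i) > 0" using B by (intro sum_pos) auto
 ultimately show ?thesis using that by blast
qed

lemma grad_zero_outside:
 "(!!x. norm x > r ==> f x = 0) ==> norm x > r ==> grad f x = 0"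
 unfolding grad_def by (intro sum.neutral ballI) (simp add: dd_zero_outside[of r f])

section \<open>Mollifiers built from the radial cutoff\<close>

locale cutoff =
 fixes a :: "'a::euclidean_space => real"
 assumes cutoff: "radial_cutoff a"
begin

lemma a_tf: "test_fun UNIV a"
 using cutoff tf_UNIV unfolding radial_cutoff_def by blast

lemma a_smooth: "smooth a" by (rule tf_smooth[OF a_tf])

lemma a_zero: "norm x \<ge> 2 ==> a x = 0"
proof -
 assume "norm x \<ge> 2"
 moreover have "{z. a z \<noteq> 0} \<subseteq> ball 0 2"
  using cutoff closure_subset[of "{z. a z \<noteq> 0}"] unfolding radial_cutoff_def test_fun_def by blast
 ultimately show ?thesis by force
qed

lemma a_one: "norm x < 1 ==> a x = 1"
 using cutoff unfolding radial_cutoff_def by (simp only: mem_ball_0)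

lemma a_mono: "norm x <= norm y ==> a y <= a x"
 using cutoff unfolding radial_cutoff_def by blast

lemma a_nonneg: "0 <= a x"
proof -
 obtain b :: 'a where b: "b \<in> Basis" using nonempty_Basis by blast
 have "a ((norm x + 2) *\<^sub>R b) = 0" using b by (intro a_zero) auto
 then show ?thesis using a_mono[of x "(norm x + 2) *\<^sub>R b"] b by simp
qed

lemma a_le_1: "a x <= 1"
 using a_mono[of 0 x] a_one[of 0] by simp

lemma a_scale_tf: "\<epsilon> > 0 ==> test_fun UNIV (\<lambda>x. a (x /\<^sub>R \<epsilon>))"
 using tf_affine[OF a_tf, of "inverse \<epsilon>" 0] by simp

lemma dd_a_scale: "dd v (\<lambda>x. a (x /\<^sub>R \<epsilon>)) x = dd v a (x /\<^sub>R \<epsilon>) / \<epsilon>"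
 using dd_affine_eq[OF a_smooth, where v = v and b = 0 and c = "inverse \<epsilon>" and x = x]
 by (simp add: divide_inverse mult.commute)

lemma grad_a_scale: "grad (\<lambda>x. a (x /\<^sub>R \<epsilon>)) x = grad a (x /\<^sub>R \<epsilon>) /\<^sub>R \<epsilon>"
 unfolding grad_def dd_a_scale by (simp add: scaleR_sum_right divide_inverse mult.commute)

text \<open>The cutoff itself, rescaled and normalized, serves as the mollifier. Its support has
  radius 2 rather than 1, which is the origin of the many bounds with
  \<open>2 * \<epsilon>\<close>.\<close>

definition mol :: "real => 'a => real" where
 "mol \<epsilon> x = a (x /\<^sub>R \<epsilon>) / (LBINT y. a (y /\<^sub>R \<epsilon>))"

text \<open>The scaled profile is 1 on a ball of radius \<open>\<epsilon>\<close>. This lower bound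
  controls the normalization and thereby the size of the gradient of the mollifier.\<close>

lemma mol_mass: "\<epsilon> > 0 ==> unit_ball_vol (DIM('a)) * \<epsilon> ^ DIM('a) <= (LBINT y. a (y /\<^sub>R \<epsilon>))"
proof -
 assume e: "\<epsilon> > 0"
 have "(\<integral>y. indicator (ball 0 \<epsilon>) y \<partial>(lborel :: 'a measure)) <= (LBINT y. a (y /\<^sub>R \<epsilon>))"
 proof (rule integral_mono)
  show "intble (\<lambda>y::'a. indicator (ball 0 \<epsilon>) y :: real)"
   by (intro integrable_real_indicator) (auto simp: emeasure_lborel_ball_finite[simplified])
  show "indicator (ball 0 \<epsilon>) x <= a (x /\<^sub>R \<epsilon>)" for x
   using a_nonneg[of "x /\<^sub>R \<epsilon>"] a_one[of "x /\<^sub>R \<epsilon>"] e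
   by (auto simp: indicator_def inverse_eq_divide divide_simps)
 qed (rule tf_integrable[OF a_scale_tf[OF e]])
 moreover have "(\<integral>y. indicator (ball 0 \<epsilon>) y \<partial>(lborel::'a measure)) = unit_ball_vol (DIM('a)) * \<epsilon> ^ DIM('a)"
  using e content_ball[of \<epsilon> "0::'a"] by simp
 ultimately show ?thesis by simp
qed

lemma mol_mass_pos: "\<epsilon> > 0 ==> 0 < (LBINT y. a (y /\<^sub>R \<epsilon>))"
 by (rule less_le_trans[OF _ mol_mass]) simp_all

lemma mol_tf: "\<epsilon> > 0 ==> test_fun UNIV (mol \<epsilon>)"
 using tf_cmult[OF a_scale_tf, of \<epsilon> "1 / (LBINT y. a (y /\<^sub>R \<epsilon>))"]
 by (simp add: mol_def[abs_def])

lemma mol_nonneg: "\<epsilon> > 0 ==> 0 <= mol \<epsilon> x"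
 using mol_mass_pos[of \<epsilon>] a_nonneg by (auto simp: mol_def intro!: divide_nonneg_pos)

lemma mol_integral: "\<epsilon> > 0 ==> (LBINT x. mol \<epsilon> x) = 1"
 using mol_mass_pos[of \<epsilon>] by (simp add: mol_def)

lemma mol_zero: "\<epsilon> > 0 ==> norm x \<ge> 2 * \<epsilon> ==> mol \<epsilon> x = 0"
 by (simp add: mol_def a_zero inverse_eq_divide field_simps)

lemma mol_integrable: "\<epsilon> > 0 ==> intble (mol \<epsilon>)"
 by (rule tf_integrable[OF mol_tf])

lemma mol_smooth: "\<epsilon> > 0 ==> smooth (mol \<epsilon>)"
 by (rule tf_smooth[OF mol_tf])

lemma mol_borel: "\<epsilon> > 0 ==> mol \<epsilon> \<in> borel_measurable borel"
 by (rule smooth_borel[OF mol_smooth])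

lemma mol_grad:
 assumes "\<epsilon> > 0"
 shows "grad (mol \<epsilon>) x = grad a (x /\<^sub>R \<epsilon>) /\<^sub>R (\<epsilon> * (LBINT y. a (y /\<^sub>R \<epsilon>)))"
proof -
 define Z where "Z = (LBINT y. a (y /\<^sub>R \<epsilon>))"
 have "dd v (mol \<epsilon>) x = dd v a (x /\<^sub>R \<epsilon>) / (\<epsilon> * Z)" for v
 proof -
  have "mol \<epsilon> = (\<lambda>x. (1 / Z) * a (x /\<^sub>R \<epsilon>))" by (auto simp: mol_def Z_def)
  moreover have "dd v (\<lambda>x. (1 / Z) * a (x /\<^sub>R \<epsilon>)) x = (1 / Z) * dd v (\<lambda>x. a (x /\<^sub>R \<epsilon>)) x"
   using dd_mult[of "\<lambda>_. 1 / Z" x "\<lambda>x. a (x /\<^sub>R \<epsilon>)" v] smooth_differentiable[OF tf_smooth[OF a_scale_tf[OF assms]]]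
   by simp
  ultimately show ?thesis by (simp add: dd_a_scale)
 qed
 then show ?thesis
  by (simp add: grad_def scaleR_sum_right Z_def divide_inverse mult.commute)
qed

lemma mol_grad_integral:
 obtains C where "C > 0" "!!\<epsilon>. \<epsilon> > 0 ==> (LBINT x. norm (grad (mol \<epsilon>) x)) <= C / \<epsilon>"
proof -
 obtain B where B: "B > 0" "!!x. norm (grad a x) <= B" using tf_grad_bounded[OF a_tf] by metis
 \<comment> \<open>The power of 2 is the ratio of the volumes of the balls of radius
   \<open>2 * \<epsilon>\<close>, carrying the gradient, and \<open>\<epsilon>\<close>, bounding the
   mass from below.\<close>
 define C where "C = B * 2 ^ DIM('a)"
 have "(LBINT x. norm (grad (mol \<epsilon>) x)) <= C / \<epsilon>" if e: "\<epsilon> > 0" for \<epsilon>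
 proof -
  define Z where "Z = (LBINT y. a (y /\<^sub>R \<epsilon>))"
  have Z: "unit_ball_vol (DIM('a)) * \<epsilon> ^ DIM('a) <= Z" "Z > 0"
   using mol_mass[OF e] mol_mass_pos[OF e] by (auto simp: Z_def)
  have bd: "norm (grad (mol \<epsilon>) x) <= B / (\<epsilon> * Z) * indicator (cball 0 (2 * \<epsilon>)) x" for x
  proof (cases "norm x > 2 * \<epsilon>")
   case True
   then have "grad (mol \<epsilon>) x = 0"
    by (intro grad_zero_outside[of "2 * \<epsilon>"] mol_zero e) auto
   then show ?thesis using True by simp
  next
   case False
   have "norm (grad (mol \<epsilon>) x) = norm (grad a (x /\<^sub>R \<epsilon>)) / (\<epsilon> * Z)"
    using Z e by (simp add: mol_grad Z_def[symmetric] divide_inverse mult.commute)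
   also have "... <= B / (\<epsilon> * Z)" using B Z e by (intro divide_right_mono) auto
   finally show ?thesis using False by simp
  qed
  have i: "intble (\<lambda>x::'a. B / (\<epsilon> * Z) * indicator (cball 0 (2 * \<epsilon>)) x)"
   by (intro integrable_mult_right integrable_real_indicator) (auto simp: emeasure_lborel_cball_finite[simplified])
  have "(LBINT x. norm (grad (mol \<epsilon>) x)) <= (\<integral>x. B / (\<epsilon> * Z) * indicator (cball 0 (2 * \<epsilon>)) x \<partial>(lborel :: 'a measure))"
  proof (rule integral_mono[OF _ i bd])
   show "intble (\<lambda>x. norm (grad (mol \<epsilon>) x))"
    by (rule Bochner_Integration.integrable_bound[OF i])
     (use order_trans[OF bd abs_ge_self] grad_borel[OF mol_smooth[OF e]] in \<open>auto intro!: AE_I2\<close>)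
  qed
  also have "... = B / (\<epsilon> * Z) * (unit_ball_vol (DIM('a)) * (2 * \<epsilon>) ^ DIM('a))"
   using e content_cball[of "2 * \<epsilon>" "0::'a"] by simp
  also have "... = C / \<epsilon> * (unit_ball_vol (DIM('a)) * \<epsilon> ^ DIM('a)) / Z"
   by (simp add: C_def power_mult_distrib)
  also have "... <= C / \<epsilon> * Z / Z"
   using Z B e by (intro divide_right_mono mult_left_mono) (auto simp: C_def)
  finally show ?thesis using Z by simp
 qed
 moreover have "C > 0" using B by (simp add: C_def)
 ultimately show ?thesis using that by blast
qed

lemma conv_mol_eq:
 assumes "borelf f" "\<epsilon> > 0"
 shows "conv f (mol \<epsilon>) x = (LBINT h. f (x - h) * mol \<epsilon> h)"
proof -
 have [measurable]: "borelf f" "mol \<epsilon> \<in> borel_measurable borel"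
  using assms mol_borel by auto
 have "(LBINT y. (\<lambda>y. f y * mol \<epsilon> (x - y)) (x - y)) = (LBINT y. f y * mol \<epsilon> (x - y))"
  by (rule integral_reflect) measurable
 then show ?thesis by (simp add: conv_def)
qed

lemma mol_shift_integrable: "\<epsilon> > 0 ==> intble (\<lambda>y. mol \<epsilon> (x - y))"
 using integrable_reflect[of "mol \<epsilon>" x] mol_borel mol_integrable by auto

lemma mol_shift_integral: "\<epsilon> > 0 ==> (LBINT y. mol \<epsilon> (x - y)) = 1"
 using integral_reflect[of "mol \<epsilon>" x] mol_borel mol_integral by auto

lemma conv_mol_bounded:
 assumes f: "locint f" "AE x in lborel. \<bar>f x\<bar> <= M" and e: "\<epsilon> > 0"
 shows "\<bar>conv f (mol \<epsilon>) x\<bar> <= M"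
proof -
 have "\<bar>conv f (mol \<epsilon>) x\<bar> <= (LBINT y. \<bar>f y * mol \<epsilon> (x - y)\<bar>)"
  unfolding conv_def by (rule integral_abs_bound)
 also have "... <= (LBINT y. M * mol \<epsilon> (x - y))"
 proof (rule integral_mono_AE)
  show "AE y in lborel. \<bar>f y * mol \<epsilon> (x - y)\<bar> <= M * mol \<epsilon> (x - y)"
   using f(2) by eventually_elim (auto simp: abs_mult mol_nonneg[OF e] intro: mult_right_mono)
 qed (use conv_integrable[OF f(1) mol_tf[OF e], of x] mol_shift_integrable[OF e, of x] in auto)
 also have "... = M" using mol_shift_integral[OF e] by simp
 finally show ?thesis .
qed

text \<open>By Jensen, the squared error at \<open>x\<close> is at most an average of squared
  translation differences over shifts of length at most \<open>2 * \<epsilon>\<close>; integrating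
  in \<open>x\<close> first gives \<open>S\<close>.\<close>

lemma conv_mol_L2:
 assumes f: "in_L2 f" and e: "\<epsilon> > 0"
  and S: "!!h. norm h <= 2 * \<epsilon> ==> (LBINT x. (f (x - h) - f x)^2) <= S"
 shows "in_L2 (conv f (mol \<epsilon>))" "(LBINT x. (conv f (mol \<epsilon>) x - f x)^2) <= S"
proof -
 have [measurable]: "borelf f" "mol \<epsilon> \<in> borel_measurable borel"
  using f e mol_borel by (auto simp: in_L2_real)
 have [measurable]: "conv f (mol \<epsilon>) \<in> borel_measurable borel"
  by (intro smooth_borel smooth_conv locint_L2 f mol_tf e)
 have S0: "0 <= S" by (rule order_trans[OF _ S[of 0]]) (use e in auto)
 have jensen: "(conv f (mol \<epsilon>) x - f x)^2 <= (LBINT h. (f (x - h) - f x)^2 * mol \<epsilon> h)"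
  and ji: "intble (\<lambda>h. (f (x - h) - f x)^2 * mol \<epsilon> h)" for x
 proof -
  have fr: "in_L2 (\<lambda>h. f (x - h))"
   using f integrable_reflect[of "\<lambda>x. (f x)^2" x] by (auto simp: in_L2_real)
  have li: "intble (\<lambda>h. f (x - h) * mol \<epsilon> h)"
   by (rule locint_tf[OF locint_L2[OF fr] mol_tf[OF e]])
  have li2: "intble (\<lambda>h. (f (x - h))^2 * mol \<epsilon> h)"
   using fr by (intro locint_tf[OF locint_integrable mol_tf[OF e]]) (simp add: in_L2_real)
  have eq: "(f (x - h) - f x) * mol \<epsilon> h = f (x - h) * mol \<epsilon> h - f x * mol \<epsilon> h"
   "(f (x - h) - f x)^2 * mol \<epsilon> h = (f (x - h))^2 * mol \<epsilon> h - 2 * f x * (f (x - h) * mol \<epsilon> h) + (f x)^2 * mol \<epsilon> h" for h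
   by (auto simp: power2_eq_square algebra_simps)
  show ji: "intble (\<lambda>h. (f (x - h) - f x)^2 * mol \<epsilon> h)"
   unfolding eq using li li2 mol_integrable[OF e] by simp
  have i1: "intble (\<lambda>h. (f (x - h) - f x) * mol \<epsilon> h)"
   unfolding eq using li mol_integrable[OF e] by simp
  have "conv f (mol \<epsilon>) x - f x = (LBINT h. (f (x - h) - f x) * mol \<epsilon> h)"
   unfolding eq using li mol_integrable[OF e] conv_mol_eq[OF _ e, of f x] by (simp add: mol_integral[OF e])
  then show "(conv f (mol \<epsilon>) x - f x)^2 <= (LBINT h. (f (x - h) - f x)^2 * mol \<epsilon> h)"
   using square_integral_le[OF mol_integrable[OF e] mol_nonneg[OF e] mol_integral[OF e] i1 ji] by simp
 qed
 have "(\<integral>\<^sup>+x. ennreal ((conv f (mol \<epsilon>) x - f x)^2) \<partial>lborel)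
   <= (\<integral>\<^sup>+x. (\<integral>\<^sup>+h. ennreal ((f (x - h) - f x)^2 * mol \<epsilon> h) \<partial>lborel) \<partial>lborel)"
  using jensen ji mol_nonneg[OF e]
  by (intro nn_integral_mono) (simp add: nn_integral_eq_integral)
 also have "... = (\<integral>\<^sup>+h. (\<integral>\<^sup>+x. ennreal ((f (x - h) - f x)^2 * mol \<epsilon> h) \<partial>lborel) \<partial>lborel)"
  by (rule lborel_pair.Fubini') measurable
 also have "... <= (\<integral>\<^sup>+h. ennreal (S * mol \<epsilon> h) \<partial>lborel)"
 proof (rule nn_integral_mono)
  fix h
  show "(\<integral>\<^sup>+x. ennreal ((f (x - h) - f x)^2 * mol \<epsilon> h) \<partial>lborel) <= ennreal (S * mol \<epsilon> h)"
  proof (cases "norm h <= 2 * \<epsilon>")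
   case True
   have "intble (\<lambda>x. (f (x - h) - f x)^2)"
    using in_L2_diff[OF in_L2_shift[OF f] f] by (simp add: in_L2_real)
   then have "(\<integral>\<^sup>+x. ennreal ((f (x - h) - f x)^2 * mol \<epsilon> h) \<partial>lborel)
     = ennreal ((LBINT x. (f (x - h) - f x)^2) * mol \<epsilon> h)"
    using mol_nonneg[OF e] by (subst nn_integral_eq_integral) auto
   then show ?thesis using S[OF True] mol_nonneg[OF e] by (auto intro!: ennreal_leI mult_right_mono)
  qed (simp add: mol_zero e)
 qed
 also have "... = ennreal S"
  using mol_integrable[OF e] mol_nonneg[OF e] S0 mol_integral[OF e]
  by (subst nn_integral_eq_integral) auto
 finally have le: "(\<integral>\<^sup>+x. ennreal ((conv f (mol \<epsilon>) x - f x)^2) \<partial>lborel) <= ennreal S" .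
 show "(LBINT x. (conv f (mol \<epsilon>) x - f x)^2) <= S"
  by (rule integral_le_nn_integral(2)[OF _ _ S0 le]) auto
 have "intble (\<lambda>x. (conv f (mol \<epsilon>) x - f x)^2)"
  by (rule integral_le_nn_integral(1)[OF _ _ S0 le]) auto
 then have "in_L2 (\<lambda>x. (conv f (mol \<epsilon>) x - f x) + f x)"
  by (intro integrable_sq_add f) (simp add: in_L2_real)
 then show "in_L2 (conv f (mol \<epsilon>))" by simp
qed

end

subsection \<open>The kernel\<close>

text \<open>The gradient of the fundamental solution up to a constant factor, by one formula for all
  dimensions from 2 on. It takes the value 0 at the origin.\<close>

definition ker :: "'a::euclidean_space => 'a" where
 "ker x = x /\<^sub>R norm x ^ DIM('a)"

text \<open>A Lipschitz truncation: its divergence is \<open>DIM('a) / \<delta> ^ DIM('a)\<close> in the ball of radius \<open>\<delta>\<close>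
 and vanishes outside.\<close>

definition kert :: "real => 'a::euclidean_space => 'a" where
 "kert \<delta> x = x /\<^sub>R (max (norm x) \<delta>) ^ DIM('a)"

text \<open>An admissible constant for the integral of \<open>norm (ker x)\<close> over a ball,
  divided by the radius. The exact value has the dimension in place of the power of 2; the loss
  comes from summing over dyadic balls.\<close>

definition ker_const :: "'a::euclidean_space itself => real" where
 "ker_const _ = unit_ball_vol (DIM('a)) * 2 ^ DIM('a)"

lemma ker_const_pos: "ker_const TYPE('a::euclidean_space) > 0"
 by (simp add: ker_const_def)

lemma ker_borel[measurable]: "borelf (ker :: 'a::euclidean_space => 'a)"
 unfolding ker_def[abs_def] by measurable

lemma kert_borel[measurable]: "borelf (kert \<delta> :: 'a::euclidean_space => 'a)"
 unfolding kert_def[abs_def] by measurable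

lemma power_DIM: "(x::real) ^ DIM('a::euclidean_space) = x * x ^ (DIM('a) - 1)"
 by (metis DIM_positive Suc_diff_1 power_Suc)

lemma norm_ker: "norm (ker (x::'a::euclidean_space)) = (if x = 0 then 0 else (1 / norm x) ^ (DIM('a) - 1))"
 by (simp add: ker_def power_DIM[where 'a = 'a] power_one_over divide_simps)

lemma norm_ker_le: "r > 0 ==> norm x \<ge> r ==> norm (ker (x::'a::euclidean_space)) <= (1 / r) ^ (DIM('a) - 1)"
 unfolding norm_ker by (auto intro!: power_mono divide_left_mono)

lemma norm_kert_le: "\<delta> > 0 ==> norm (kert \<delta> (x::'a::euclidean_space)) <= (1 / \<delta>) ^ (DIM('a) - 1)"
proof -
 assume d: "\<delta> > 0"
 define m where "m = max (norm x) \<delta>"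
 have m: "m > 0" "norm x <= m" "\<delta> <= m" using d by (auto simp: m_def)
 have "norm (kert \<delta> x) = norm x / m ^ DIM('a)"
  using m by (simp add: kert_def m_def[symmetric] divide_inverse mult.commute)
 also have "... <= m / m ^ DIM('a)" using m by (intro divide_right_mono) auto
 also have "... = (1 / m) ^ (DIM('a) - 1)"
  using m by (simp add: power_DIM[where 'a = 'a] power_one_over)
 also have "... <= (1 / \<delta>) ^ (DIM('a) - 1)" using m d by (intro power_mono divide_left_mono) auto
 finally show ?thesis .
qed

lemma kert_eq: "norm x \<ge> \<delta> ==> kert \<delta> x = ker x"
 by (simp add: kert_def ker_def max_def)

lemma norm_kert_le_ker: "norm (kert \<delta> (x::'a::euclidean_space)) <= norm (ker x)"
proof (cases "x = 0")
 case False
 then have "inverse (max (norm x) \<delta> ^ DIM('a)) <= inverse (norm x ^ DIM('a))"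
  by (intro le_imp_inverse_le power_mono) auto
 moreover have "0 <= max (norm x) \<delta>" by (rule max.coboundedI1) (rule norm_ge_zero)
 then have "0 <= inverse (max (norm x) \<delta> ^ DIM('a))" by simp
 ultimately show ?thesis
  unfolding kert_def ker_def norm_scaleR by (intro mult_right_mono) auto
qed (simp add: kert_def ker_def)

text \<open>Dyadic decomposition. Where the norm is between \<open>r / 2 ^ Suc n\<close> and
  \<open>r / 2 ^ n\<close>, the kernel is at most \<open>c n\<close>, and \<open>c n\<close> times
  the volume of the n-th ball is a geometric sequence. Using whole balls instead of shells only
  enlarges the sum.\<close>

lemma ker_near_bound:
 assumes r: "r > 0"
 shows "(\<integral>\<^sup>+x. ennreal (indicator (cball 0 r) x * norm (ker (x::'a::euclidean_space))) \<partial>lborel)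
  <= ennreal (ker_const TYPE('a) * r)"
proof -
 let ?d = "DIM('a)"
 define c where "c n = (2 ^ Suc n / r) ^ (?d - 1)" for n :: nat
 have c0: "c n \<ge> 0" for n using r by (simp add: c_def)
 define B where "B n = cball (0::'a) (r / 2 ^ n)" for n :: nat
 have [measurable]: "B n \<in> sets borel" for n by (simp add: B_def)
 have pt: "ennreal (indicator (cball 0 r) x * norm (ker x)) <= (\<Sum>n. ennreal (c n * indicator (B n) x))" for x :: 'a
 proof (cases "x = 0 \<or> norm x > r")
  case True
  then show ?thesis by (auto simp: ker_def)
 next
  case False
  then have x: "norm x > 0" "norm x <= r" by auto
  obtain n0 where "r / norm x < 2 ^ n0" using real_arch_pow[of 2 "r / norm x"] by auto
  \<comment> \<open>By minimality, the predecessor of \<open>n1\<close> is the index of the dyadic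
    shell that contains \<open>x\<close>.\<close>
  define n1 where "n1 = (LEAST n. r / norm x < 2 ^ n)"
  have n1: "r / norm x < 2 ^ n1" unfolding n1_def by (rule LeastI) fact
  have "n1 \<noteq> 0" using n1 x by (intro notI) (simp add: divide_less_eq)
  then obtain n where n: "n1 = Suc n" by (cases n1) auto
  have "\<not> r / norm x < 2 ^ n" using not_less_Least[of n "\<lambda>n. r / norm x < 2 ^ n"] n by (simp add: n1_def)
  then have xn: "norm x <= r / 2 ^ n" using x by (simp add: field_simps)
  have "norm (ker x) <= c n"
  proof -
   have "1 / norm x <= 2 ^ Suc n / r" using n1 x r by (simp add: n field_simps)
   then show ?thesis using x by (auto simp: norm_ker c_def intro!: power_mono)
  qed
  then have "ennreal (indicator (cball 0 r) x * norm (ker x)) <= ennreal (c n * indicator (B n) x)"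
   using xn x by (simp add: B_def ennreal_leI)
  also have "... <= (\<Sum>n. ennreal (c n * indicator (B n) x))"
  proof -
   have "(\<Sum>m\<in>{n}. ennreal (c m * indicator (B m) x)) <= (\<Sum>n. ennreal (c n * indicator (B n) x))"
    by (rule sum_le_suminf) auto
   then show ?thesis by simp
  qed
  finally show ?thesis .
 qed
 have each: "(\<integral>\<^sup>+x. ennreal (c n * indicator (B n) x) \<partial>lborel)
   = ennreal (unit_ball_vol ?d * 2 ^ (?d - 1) * r * (1 / 2) ^ n)" for n
 proof -
  have "(\<integral>\<^sup>+x. ennreal (c n * indicator (B n) x) \<partial>lborel) = ennreal (c n) * emeasure lborel (B n)"
   using c0 by (simp add: ennreal_mult'' ennreal_indicator nn_integral_cmult)
  also have "emeasure lborel (B n) = ennreal (unit_ball_vol ?d * (r / 2 ^ n) ^ ?d)"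
   unfolding B_def using r by (intro emeasure_cball) auto
  also have "ennreal (c n) * ennreal (unit_ball_vol ?d * (r / 2 ^ n) ^ ?d)
    = ennreal (c n * (unit_ball_vol ?d * (r / 2 ^ n) ^ ?d))"
   using c0 r by (simp add: ennreal_mult')
  also have "c n * (unit_ball_vol ?d * (r / 2 ^ n) ^ ?d) = unit_ball_vol ?d * 2 ^ (?d - 1) * r * (1 / 2) ^ n"
  proof -
   have "c n * (r / 2 ^ n) ^ (?d - 1) = (2 ^ Suc n / r * (r / 2 ^ n)) ^ (?d - 1)"
    by (simp only: c_def power_mult_distrib)
   also have "2 ^ Suc n / r * (r / 2 ^ n) = 2" using r by simp
   finally have "c n * (r / 2 ^ n) ^ ?d = r / 2 ^ n * 2 ^ (?d - 1)"
    by (subst power_DIM) (simp add: mult.left_commute)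
   then have "unit_ball_vol ?d * (c n * (r / 2 ^ n) ^ ?d) = unit_ball_vol ?d * (r / 2 ^ n * 2 ^ (?d - 1))"
    by (simp only:)
   then show ?thesis unfolding mult.left_commute[of "c n"] by (simp add: power_one_over mult_ac)
  qed
  finally show ?thesis .
 qed
 have "(\<integral>\<^sup>+x. ennreal (indicator (cball 0 r) x * norm (ker (x::'a))) \<partial>lborel)
   <= (\<integral>\<^sup>+x. (\<Sum>n. ennreal (c n * indicator (B n) x)) \<partial>lborel)"
  by (intro nn_integral_mono pt)
 also have "... = (\<Sum>n. \<integral>\<^sup>+x. ennreal (c n * indicator (B n) x) \<partial>lborel)"
  by (intro nn_integral_suminf) measurable
 also have "... = (\<Sum>n. ennreal (unit_ball_vol ?d * 2 ^ (?d - 1) * r * (1 / 2) ^ n))"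
  by (simp add: each)
 also have "... = ennreal (unit_ball_vol ?d * 2 ^ (?d - 1) * r * 2)"
 proof (rule suminf_ennreal_eq)
  show "(\<lambda>n. unit_ball_vol ?d * 2 ^ (?d - 1) * r * (1 / 2) ^ n) sums (unit_ball_vol ?d * 2 ^ (?d - 1) * r * 2)"
   using sums_mult[OF geometric_sums[of "1/2 :: real"], of "unit_ball_vol ?d * 2 ^ (?d - 1) * r"] by simp
 qed (use r in simp)
 also have "unit_ball_vol ?d * 2 ^ (?d - 1) * r * 2 = ker_const TYPE('a) * r"
  by (simp add: ker_const_def power_DIM[where 'a = 'a] mult_ac)
 finally show ?thesis .
qed

lemma ker_near:
 assumes r: "r > 0"
 shows "intble (\<lambda>x. indicator (cball 0 r) x * norm (ker (x::'a::euclidean_space)))"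
  "(LBINT x. indicator (cball 0 r) x * norm (ker (x::'a))) <= ker_const TYPE('a) * r"
 using integral_le_nn_integral[OF _ _ _ ker_near_bound[OF r, where 'a = 'a]] r ker_const_pos[where 'a = 'a]
 by auto

lemma ker_near_reflect:
 assumes r: "r > 0"
 shows "intble (\<lambda>y. indicator (cball 0 r) (x - y) * norm (ker (x - y::'a::euclidean_space)))"
  "(LBINT y. indicator (cball 0 r) (x - y) * norm (ker (x - y::'a))) <= ker_const TYPE('a) * r"
proof -
 have [measurable]: "(\<lambda>y::'a. indicator (cball 0 r) y * norm (ker y)) \<in> borel_measurable borel" by measurable
 show "intble (\<lambda>y. indicator (cball 0 r) (x - y) * norm (ker (x - y::'a::euclidean_space)))"
  using integrable_reflect[of "\<lambda>y::'a. indicator (cball 0 r) y * norm (ker y) :: real" x] ker_near(1)[OF r] by simp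
 show "(LBINT y. indicator (cball 0 r) (x - y) * norm (ker (x - y::'a))) <= ker_const TYPE('a) * r"
  using integral_reflect[of "\<lambda>y::'a. indicator (cball 0 r) y * norm (ker y) :: real" x] ker_near(2)[OF r] by simp
qed

lemma AE_bound_nonneg:
 assumes "AE x in (lborel :: 'a::euclidean_space measure). \<bar>f x\<bar> <= (P::real)"
 shows "0 <= P"
proof (rule ccontr)
 assume "\<not> 0 <= P"
 then have "AE x in (lborel :: 'a measure). False" using assms by (auto elim!: eventually_mono)
 then have "emeasure (lborel :: 'a measure) (space lborel) = 0"
  using ae_filter_eq_bot_iff[of "lborel :: 'a measure"] by (simp add: trivial_limit_def)
 then show False by (simp add: emeasure_lborel_UNIV)
qed

subsection \<open>The velocity field\<close>

definition vel :: "('a::euclidean_space => real) => 'a => 'a" where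
 "vel f x = (LBINT y. f y *\<^sub>R ker (x - y))"

definition velt :: "real => ('a::euclidean_space => real) => 'a => 'a" where
 "velt \<delta> f x = (LBINT y. f y *\<^sub>R kert \<delta> (x - y))"

text \<open>Three zones: close to \<open>x\<close> the supremum of \<open>f\<close> is paired with
  the integrable singularity, beyond it the decay of the kernel with the mass of \<open>f\<close>.
  The middle zone is kept separate because there the mass is later estimated by the norm in L^2,
  which makes the velocity stable in the mean square.\<close>

lemma vel_bounds:
 fixes f :: "'a::euclidean_space => real"
 assumes f: "intble f" "AE x in lborel. \<bar>f x\<bar> <= P" and dr: "0 < \<delta>" "\<delta> <= r"
 shows "intble (\<lambda>y. f y *\<^sub>R ker (x - y))"
  and "norm (vel f x) <= P * ker_const TYPE('a) * \<delta>
   + (1 / \<delta>) ^ (DIM('a) - 1) * (LBINT y. indicator (cball x r) y * \<bar>f y\<bar>)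
   + (1 / r) ^ (DIM('a) - 1) * (LBINT y. \<bar>f y\<bar>)"
proof -
 have [measurable]: "borelf f" using f by auto
 have P: "0 <= P" by (rule AE_bound_nonneg[OF f(2)])
 let ?k1 = "\<lambda>y. P * (indicator (cball 0 \<delta>) (x - y) * norm (ker (x - y)))"
 let ?k2 = "\<lambda>y. (1 / \<delta>) ^ (DIM('a) - 1) * (indicator (cball x r) y * \<bar>f y\<bar>)"
 let ?k3 = "\<lambda>y. (1 / r) ^ (DIM('a) - 1) * \<bar>f y\<bar>"
 have i1: "intble ?k1" using ker_near_reflect(1)[OF dr(1), of x] by simp
 have "intble (\<lambda>y. indicator (cball x r) y *\<^sub>R \<bar>f y\<bar>)"
  using f by (intro integrable_mult_indicator) auto
 then have i2: "intble ?k2" by simp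
 have i3: "intble ?k3" using f by simp
 have bd: "AE y in lborel. norm (f y *\<^sub>R ker (x - y)) <= ?k1 y + ?k2 y + ?k3 y"
  using f(2)
 proof eventually_elim
  fix y assume fy: "\<bar>f y\<bar> <= P"
  have pos: "0 <= ?k1 y" "0 <= ?k2 y" "0 <= ?k3 y" using P dr by auto
  consider "norm (x - y) <= \<delta>" | "\<delta> < norm (x - y)" "norm (x - y) <= r" | "r < norm (x - y)" by linarith
  then show "norm (f y *\<^sub>R ker (x - y)) <= ?k1 y + ?k2 y + ?k3 y"
  proof cases
   case 1
   then have "norm (f y *\<^sub>R ker (x - y)) <= ?k1 y"
    using fy by (auto simp: mult_right_mono)
   then show ?thesis using pos by linarith
  next
   case 2
   have "norm (f y *\<^sub>R ker (x - y)) <= \<bar>f y\<bar> * (1 / \<delta>) ^ (DIM('a) - 1)"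
    using 2 dr norm_ker_le[of \<delta> "x - y"] by (auto intro!: mult_left_mono)
   also have "... = ?k2 y" using 2 by (simp add: dist_norm)
   finally show ?thesis using pos by linarith
  next
   case 3
   have "norm (f y *\<^sub>R ker (x - y)) <= \<bar>f y\<bar> * (1 / r) ^ (DIM('a) - 1)"
    using 3 dr norm_ker_le[of r "x - y"] by (auto intro!: mult_left_mono)
   also have "... = ?k3 y" by simp
   finally show ?thesis using pos by linarith
  qed
 qed
 have isum: "intble (\<lambda>y. ?k1 y + ?k2 y + ?k3 y)"
  by (intro Bochner_Integration.integrable_add i1 i2 i3)
 show int: "intble (\<lambda>y. f y *\<^sub>R ker (x - y))"
  by (rule Bochner_Integration.integrable_bound[OF isum])
   (measurable, use bd in eventually_elim, fastforce intro: order_trans[OF _ abs_ge_self])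
 have "norm (vel f x) <= (LBINT y. norm (f y *\<^sub>R ker (x - y)))"
  unfolding vel_def by (rule integral_norm_bound)
 also have "... <= (LBINT y. ?k1 y + ?k2 y + ?k3 y)"
  by (rule integral_mono_AE[OF integrable_norm[OF int] isum bd])
 also have "... = (LBINT y. ?k1 y) + (LBINT y. ?k2 y) + (LBINT y. ?k3 y)"
  by (subst Bochner_Integration.integral_add[OF Bochner_Integration.integrable_add[OF i1 i2] i3],
    subst Bochner_Integration.integral_add[OF i1 i2]) (rule refl)
 also have "(LBINT y. ?k1 y) <= P * ker_const TYPE('a) * \<delta>"
  using mult_left_mono[OF ker_near_reflect(2)[OF dr(1), of x] P] by (simp add: mult.assoc)
 finally show "norm (vel f x) <= P * ker_const TYPE('a) * \<delta>
   + (1 / \<delta>) ^ (DIM('a) - 1) * (LBINT y. indicator (cball x r) y * \<bar>f y\<bar>)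
   + (1 / r) ^ (DIM('a) - 1) * (LBINT y. \<bar>f y\<bar>)"
  by simp
qed

lemma vel_bounded:
 fixes f :: "'a::euclidean_space => real"
 assumes f: "intble f" "AE x in lborel. \<bar>f x\<bar> <= M" "(LBINT y. \<bar>f y\<bar>) <= M"
 shows "norm (vel f x) <= M * (ker_const TYPE('a) + 2)"
proof -
 have "(LBINT y. indicator (cball x 1) y * \<bar>f y\<bar>) <= (LBINT y. \<bar>f y\<bar>)"
 proof (rule integral_mono)
  have "intble (\<lambda>y. indicator (cball x 1) y *\<^sub>R \<bar>f y\<bar>)"
   using f by (intro integrable_mult_indicator) auto
  then show "intble (\<lambda>y. indicator (cball x 1) y * \<bar>f y\<bar>)" by simp
 qed (use f in \<open>auto simp: indicator_def\<close>)
 with vel_bounds(2)[OF f(1,2), of 1 1 x] f(3) show ?thesis by (simp add: algebra_simps)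
qed

lemma vel_borel:
 fixes f :: "'a::euclidean_space => real"
 assumes [measurable]: "borelf f"
 shows "vel f \<in> borel_measurable borel" "velt \<delta> f \<in> borel_measurable borel"
proof -
 have "(\<lambda>x. \<integral>y. f y *\<^sub>R ker (x - y) \<partial>lborel) \<in> borel_measurable lborel"
  by (rule lborel.borel_measurable_lebesgue_integral) measurable
 then show "vel f \<in> borel_measurable borel" by (simp add: vel_def[abs_def])
 have "(\<lambda>x. \<integral>y. f y *\<^sub>R kert \<delta> (x - y) \<partial>lborel) \<in> borel_measurable lborel"
  by (rule lborel.borel_measurable_lebesgue_integral) measurable
 then show "velt \<delta> f \<in> borel_measurable borel" by (simp add: velt_def[abs_def])
qed

lemma velt_integrable:
 fixes f :: "'a::euclidean_space => real"
 assumes f: "intble f" and d: "\<delta> > 0"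
 shows "intble (\<lambda>y. f y *\<^sub>R kert \<delta> (x - y))"
proof (rule Bochner_Integration.integrable_bound[of _ "\<lambda>y. f y * (1 / \<delta>) ^ (DIM('a) - 1)"])
 have [measurable]: "borelf f" using f by auto
 show "(\<lambda>y. f y *\<^sub>R kert \<delta> (x - y)) \<in> borel_measurable lborel" by measurable
 show "AE y in lborel. norm (f y *\<^sub>R kert \<delta> (x - y)) <= norm (f y * (1 / \<delta>) ^ (DIM('a) - 1))"
  using norm_kert_le[OF d] d by (intro AE_I2) (auto simp: abs_mult intro!: mult_left_mono)
qed (use f in simp)

text \<open>The two kernels agree outside the ball of radius \<open>\<delta>\<close>, and inside it
  both are dominated by the singular one. The approximation is thus uniform in \<open>x\<close>,
  with a rate.\<close>

lemma vel_velt: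
 fixes f :: "'a::euclidean_space => real"
 assumes f: "intble f" "AE x in lborel. \<bar>f x\<bar> <= P" and d: "0 < \<delta>"
 shows "norm (vel f x - velt \<delta> f x) <= 2 * P * ker_const TYPE('a) * \<delta>"
proof -
 have P: "0 <= P" by (rule AE_bound_nonneg[OF f(2)])
 have i: "intble (\<lambda>y. f y *\<^sub>R ker (x - y))" "intble (\<lambda>y. f y *\<^sub>R kert \<delta> (x - y))"
  using vel_bounds(1)[OF f d order_refl] velt_integrable[OF f(1) d] by auto
 let ?k1 = "\<lambda>y. 2 * P * (indicator (cball 0 \<delta>) (x - y) * norm (ker (x - y)))"
 have i1: "intble ?k1" using ker_near_reflect(1)[OF d, of x] by simp
 have "norm (vel f x - velt \<delta> f x) = norm (LBINT y. f y *\<^sub>R ker (x - y) - f y *\<^sub>R kert \<delta> (x - y))"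
  using i by (simp add: vel_def velt_def)
 also have "... <= (LBINT y. norm (f y *\<^sub>R ker (x - y) - f y *\<^sub>R kert \<delta> (x - y)))"
  by (rule integral_norm_bound)
 also have "... <= (LBINT y. ?k1 y)"
 proof (rule integral_mono_AE[OF _ i1])
  show "intble (\<lambda>y. norm (f y *\<^sub>R ker (x - y) - f y *\<^sub>R kert \<delta> (x - y)))" using i by simp
  show "AE y in lborel. norm (f y *\<^sub>R ker (x - y) - f y *\<^sub>R kert \<delta> (x - y)) <= ?k1 y"
   using f(2)
  proof eventually_elim
   fix y assume fy: "\<bar>f y\<bar> <= P"
   show "norm (f y *\<^sub>R ker (x - y) - f y *\<^sub>R kert \<delta> (x - y)) <= ?k1 y"
   proof (cases "norm (x - y) <= \<delta>")
    case True
    have "norm (f y *\<^sub>R ker (x - y) - f y *\<^sub>R kert \<delta> (x - y)) = \<bar>f y\<bar> * norm (ker (x - y) - kert \<delta> (x - y))"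
     by (metis norm_scaleR scaleR_right_diff_distrib)
    also have "... <= P * (2 * norm (ker (x - y)))"
     using fy P norm_triangle_ineq4[of "ker (x - y)" "kert \<delta> (x - y)"] norm_kert_le_ker[of \<delta> "x - y"]
     by (intro mult_mono) auto
    finally show ?thesis using True by simp
   next
    case False
    then show ?thesis by (simp add: kert_eq)
   qed
  qed
 qed
 also have "... <= 2 * P * (ker_const TYPE('a) * \<delta>)"
  using mult_left_mono[OF ker_near_reflect(2)[OF d, of x], of "2 * P"] P by simp
 finally show ?thesis by (simp add: mult.assoc)
qed

text \<open>With m and n the truncated norms of \<open>x\<close> and \<open>y\<close>, the
  difference is m^-d (x - y) + (m^-d - n^-d) y. The first term contributes 1 to the constant, the
  difference of powers contributes d. The assumption that m is at least n is removed afterwards by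
  symmetry.\<close>

lemma kert_lipschitz_aux:
 fixes x y :: "'a::euclidean_space"
 assumes d: "\<delta> > 0" and xy: "max (norm y) \<delta> <= max (norm x) \<delta>"
 shows "norm (kert \<delta> x - kert \<delta> y) <= (1 + DIM('a)) / \<delta> ^ DIM('a) * norm (x - y)"
proof -
 let ?d = "DIM('a)"
 define m where "m = max (norm x) \<delta>"
 define n where "n = max (norm y) \<delta>"
 have m: "m > 0" "n > 0" "\<delta> <= n" "n <= m" "norm y <= n" using d xy by (auto simp: m_def n_def)
 have mn: "m - n <= norm (x - y)"
  using norm_triangle_ineq2[of x y] norm_ge_zero[of "x - y"] unfolding m_def n_def by linarith
 have "m ^ ?d - n ^ ?d <= ?d * (m - n) * m ^ (?d - 1)"
 proof -
  have "m ^ ?d - n ^ ?d = (m - n) * (\<Sum>i<?d. n ^ (?d - Suc i) * m ^ i)"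
   by (rule power_diff_sumr2)
  also have "... <= (m - n) * (\<Sum>i<?d. m ^ (?d - 1))"
  proof (intro mult_left_mono sum_mono)
   fix i assume i: "i \<in> {..<?d}"
   have "n ^ (?d - Suc i) * m ^ i <= m ^ (?d - Suc i) * m ^ i"
    using m by (intro mult_right_mono power_mono) auto
   also have "... = m ^ (?d - 1)" using i by (simp flip: power_add)
   finally show "n ^ (?d - Suc i) * m ^ i <= m ^ (?d - 1)" .
  qed (use m in auto)
  finally show ?thesis by (simp add: mult_ac)
 qed
 then have diff: "\<bar>1 / m ^ ?d - 1 / n ^ ?d\<bar> <= ?d * (m - n) * m ^ (?d - 1) / (m ^ ?d * n ^ ?d)"
 proof -
  have "n ^ ?d <= m ^ ?d" using m by (intro power_mono) auto
  then have "\<bar>1 / m ^ ?d - 1 / n ^ ?d\<bar> = (m ^ ?d - n ^ ?d) / (m ^ ?d * n ^ ?d)"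
   using m by (simp add: field_simps)
  also have "... <= ?d * (m - n) * m ^ (?d - 1) / (m ^ ?d * n ^ ?d)"
   using m \<open>m ^ ?d - n ^ ?d <= _\<close> by (intro divide_right_mono) auto
  finally show ?thesis .
 qed
 have "kert \<delta> x - kert \<delta> y = (1 / m ^ ?d) *\<^sub>R (x - y) + (1 / m ^ ?d - 1 / n ^ ?d) *\<^sub>R y"
  by (simp add: kert_def m_def[symmetric] n_def[symmetric] inverse_eq_divide algebra_simps)
 then have "norm (kert \<delta> x - kert \<delta> y) <= norm ((1 / m ^ ?d) *\<^sub>R (x - y)) + norm ((1 / m ^ ?d - 1 / n ^ ?d) *\<^sub>R y)"
  by (metis norm_triangle_ineq)
 also have "norm ((1 / m ^ ?d) *\<^sub>R (x - y)) <= 1 / \<delta> ^ ?d * norm (x - y)"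
  using m d by (auto intro!: mult_right_mono divide_left_mono power_mono)
 also have "norm ((1 / m ^ ?d - 1 / n ^ ?d) *\<^sub>R y) <= (?d * (m - n) * m ^ (?d - 1) / (m ^ ?d * n ^ ?d)) * n"
  using m diff unfolding norm_scaleR by (intro mult_mono) auto
 also have "(?d * (m - n) * m ^ (?d - 1) / (m ^ ?d * n ^ ?d)) * n = ?d * (m - n) * (n / m) / n ^ ?d"
  using m by (simp add: power_DIM[where 'a = 'a and x = m])
 also have "... <= ?d * norm (x - y) * 1 / \<delta> ^ ?d"
  using m d mn by (intro frac_le mult_mono power_mono) (auto simp: divide_le_eq_1)
 finally show ?thesis by (simp add: add_divide_distrib algebra_simps)
qed

lemma kert_lipschitz:
 fixes x y :: "'a::euclidean_space"
 assumes d: "\<delta> > 0"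
 shows "norm (kert \<delta> x - kert \<delta> y) <= (1 + DIM('a)) / \<delta> ^ DIM('a) * norm (x - y)"
proof (cases "max (norm y) \<delta> <= max (norm x) \<delta>")
 case False
 then show ?thesis
  using kert_lipschitz_aux[OF d, of x y] unfolding norm_minus_commute[of x y] norm_minus_commute[of "kert \<delta> x"]
  by linarith
qed (rule kert_lipschitz_aux[OF d])

text \<open>A uniform limit of the Lipschitz fields \<open>velt \<delta> f\<close>.\<close>

lemma vel_continuous:
 fixes f :: "'a::euclidean_space => real"
 assumes f: "intble f" "AE x in lborel. \<bar>f x\<bar> <= P"
 shows "continuous_on UNIV (vel f)"
proof -
 have ct: "continuous_on UNIV (velt \<delta> f)" if d: "\<delta> > 0" for \<delta>
 proof -
  define C where "C = (1 + DIM('a)) / \<delta> ^ DIM('a) * (LBINT y. \<bar>f y\<bar>)"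
  have "C-lipschitz_on UNIV (velt \<delta> f)"
  proof (rule lipschitz_onI)
   fix x z :: 'a
   note i = velt_integrable[OF f(1) d, of x] velt_integrable[OF f(1) d, of z]
   have "norm (velt \<delta> f x - velt \<delta> f z) = norm (LBINT y. f y *\<^sub>R kert \<delta> (x - y) - f y *\<^sub>R kert \<delta> (z - y))"
    using i by (simp add: velt_def)
   also have "... <= (LBINT y. \<bar>f y\<bar> * ((1 + DIM('a)) / \<delta> ^ DIM('a) * norm (x - z)))"
   proof (rule Bochner_Integration.integral_norm_bound_integral)
    fix y
    have "norm (f y *\<^sub>R kert \<delta> (x - y) - f y *\<^sub>R kert \<delta> (z - y))
      = \<bar>f y\<bar> * norm (kert \<delta> (x - y) - kert \<delta> (z - y))"
     by (metis norm_scaleR scaleR_right_diff_distrib)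
    also have "... <= \<bar>f y\<bar> * ((1 + DIM('a)) / \<delta> ^ DIM('a) * norm (x - z))"
     using kert_lipschitz[OF d, of "x - y" "z - y"] by (intro mult_left_mono) auto
    finally show "norm (f y *\<^sub>R kert \<delta> (x - y) - f y *\<^sub>R kert \<delta> (z - y))
      <= \<bar>f y\<bar> * ((1 + DIM('a)) / \<delta> ^ DIM('a) * norm (x - z))" .
   qed (use i f in auto)
   also have "... = C * norm (x - z)" by (simp add: C_def)
   finally show "dist (velt \<delta> f x) (velt \<delta> f z) <= C * dist x z" by (simp add: dist_norm)
  qed (use d in \<open>simp add: C_def\<close>)
  then show ?thesis by (rule lipschitz_on_continuous_on)
 qed
 define \<delta> where "\<delta> n = 1 / real (Suc n)" for n
 have d0: "\<delta> n > 0" for n by (simp add: \<delta>_def)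
 have dl: "\<delta> \<longlonglongrightarrow> 0" unfolding \<delta>_def using LIMSEQ_inverse_real_of_nat by (simp add: inverse_eq_divide)
 have "(\<lambda>n. 2 * P * ker_const TYPE('a) * \<delta> n) \<longlonglongrightarrow> 2 * P * ker_const TYPE('a) * 0"
  by (intro tendsto_intros dl)
 then have lim: "(\<lambda>n. 2 * P * ker_const TYPE('a) * \<delta> n) \<longlonglongrightarrow> 0" by simp
 have "uniform_limit UNIV (\<lambda>n. velt (\<delta> n) f) (vel f) sequentially"
 proof (rule uniform_limitI)
  fix e :: real assume "e > 0"
  then have "\<forall>\<^sub>F n in sequentially. 2 * P * ker_const TYPE('a) * \<delta> n < e"
   using lim by (rule order_tendstoD(2)[rotated])
  then show "\<forall>\<^sub>F n in sequentially. \<forall>x\<in>UNIV. dist (velt (\<delta> n) f x) (vel f x) < e"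
  proof eventually_elim
   case (elim n)
   have "dist (velt (\<delta> n) f x) (vel f x) < e" for x
    using le_less_trans[OF vel_velt[OF f d0, of x n] elim] by (simp add: dist_norm norm_minus_commute)
   then show ?case by blast
  qed
 qed
 then show ?thesis
  by (rule uniform_limit_theorem[rotated]) (auto intro: always_eventually ct d0)
qed

text \<open>The derivative in direction \<open>j\<close> of the component \<open>i\<close> of
  \<open>kert \<delta>\<close>, off the sphere of radius \<open>\<delta>\<close>. Its symmetry in
  \<open>i\<close> and \<open>j\<close> makes the velocity curl-free, and its trace yields the
  divergence.\<close>

definition kder :: "real => 'a::euclidean_space => 'a => 'a => real" where
 "kder \<delta> i j z = (if norm z < \<delta> then (i \<bullet> j) / \<delta> ^ DIM('a)
  else (i \<bullet> j) / norm z ^ DIM('a) - DIM('a) * (z \<bullet> i) * (z \<bullet> j) / norm z ^ (DIM('a) + 2))"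

lemma kder_sym: "kder \<delta> i j z = kder \<delta> j i z"
 by (simp add: kder_def inner_commute mult_ac)

lemma kder_borel[measurable]: "kder \<delta> (i::'a::euclidean_space) j \<in> borel_measurable borel"
 unfolding kder_def[abs_def] by measurable

text \<open>Outside the ball the two terms cancel, the kernel being divergence-free there. Inside,
  the constant divergence integrates to d times \<open>unit_ball_vol\<close>, whatever
  \<open>\<delta>\<close> is.\<close>

lemma kder_trace: "norm z \<noteq> 0 \<or> \<delta> > 0 ==> (\<Sum>i\<in>Basis. kder \<delta> i i (z::'a::euclidean_space))
  = (if norm z < \<delta> then DIM('a) / \<delta> ^ DIM('a) else 0)"
proof -
 assume z: "norm z \<noteq> 0 \<or> \<delta> > 0"
 show ?thesis
 proof (cases "norm z < \<delta>")
  case False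
  then have n: "norm z > 0" using z by auto
  have "(\<Sum>i\<in>Basis. kder \<delta> i i z)
    = (\<Sum>i\<in>(Basis::'a set). 1 / norm z ^ DIM('a)) - DIM('a) * (\<Sum>i\<in>Basis. (z \<bullet> i) * (z \<bullet> i)) / norm z ^ (DIM('a) + 2)"
   using False by (simp add: kder_def sum_subtractf sum_distrib_left sum_divide_distrib mult.assoc)
  also have "(\<Sum>i\<in>Basis. (z \<bullet> i) * (z \<bullet> i)) = (norm z)^2"
   unfolding norm_sq_sum by (simp add: power2_eq_square)
  also have "(\<Sum>i\<in>(Basis::'a set). 1 / norm z ^ DIM('a)) - DIM('a) * (norm z)^2 / norm z ^ (DIM('a) + 2) = 0"
   using n by (simp add: power_add power2_eq_square)
  finally show ?thesis using False by simp
 qed (simp add: kder_def)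
qed

lemma kder_bounded:
 fixes i j :: "'a::euclidean_space"
 assumes "i \<in> Basis" "j \<in> Basis" "\<delta> > 0"
 shows "\<bar>kder \<delta> i j z\<bar> <= (1 + DIM('a)) / \<delta> ^ DIM('a)"
proof -
 have ij: "\<bar>i \<bullet> j\<bar> <= 1" using assms by (simp add: inner_Basis)
 show ?thesis
 proof (cases "norm z < \<delta>")
  case True
  then show ?thesis using ij assms by (auto simp: kder_def abs_div divide_right_mono)
 next
  case False
  then have n: "norm z \<ge> \<delta>" "norm z > 0" using assms by auto
  have zz: "\<bar>z \<bullet> i\<bar> * \<bar>z \<bullet> j\<bar> <= norm z * norm z"
   using assms by (intro mult_mono Basis_le_norm) auto
  have "\<bar>kder \<delta> i j z\<bar> <= \<bar>(i \<bullet> j) / norm z ^ DIM('a)\<bar> + \<bar>DIM('a) * (z \<bullet> i) * (z \<bullet> j) / norm z ^ (DIM('a) + 2)\<bar>"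
   unfolding kder_def by (simp only: False if_False) (rule abs_triangle_ineq4)
  also have "\<bar>(i \<bullet> j) / norm z ^ DIM('a)\<bar> <= 1 / norm z ^ DIM('a)"
   using ij n by (simp add: abs_div divide_right_mono)
  also have "\<bar>DIM('a) * (z \<bullet> i) * (z \<bullet> j) / norm z ^ (DIM('a) + 2)\<bar>
    <= DIM('a) * (norm z * norm z) / norm z ^ (DIM('a) + 2)"
  proof -
   have "\<bar>DIM('a) * (z \<bullet> i) * (z \<bullet> j) / norm z ^ (DIM('a) + 2)\<bar>
     = DIM('a) * (\<bar>z \<bullet> i\<bar> * \<bar>z \<bullet> j\<bar>) / norm z ^ (DIM('a) + 2)"
    by (simp add: abs_mult mult.assoc)
   also have "... <= DIM('a) * (norm z * norm z) / norm z ^ (DIM('a) + 2)"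
    by (intro divide_right_mono mult_left_mono zz) auto
   finally show ?thesis .
  qed
  also have "... = DIM('a) / norm z ^ DIM('a)" using n by (simp add: power_add)
  also have "1 / norm z ^ DIM('a) + DIM('a) / norm z ^ DIM('a) = (1 + DIM('a)) / norm z ^ DIM('a)"
   by (simp add: add_divide_distrib)
  also have "... <= (1 + DIM('a)) / \<delta> ^ DIM('a)"
   using n assms by (intro divide_left_mono power_mono) auto
  finally show ?thesis by simp
 qed
qed

lemma norm_line_derivative:
 fixes z j :: "'a::euclidean_space"
 assumes "z \<noteq> 0"
 shows "((\<lambda>t. norm (z + t *\<^sub>R j)) has_real_derivative (z \<bullet> j) / norm z) (at 0)"
proof -
 have 1: "((\<lambda>t. z + t *\<^sub>R j) has_derivative (\<lambda>h. h *\<^sub>R j)) (at 0)"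
  by (auto intro!: derivative_eq_intros)
 have 2: "(norm has_derivative (\<lambda>x. x \<bullet> sgn z)) (at (z + 0 *\<^sub>R j))"
  using has_derivative_norm[OF assms] by simp
 have "((\<lambda>t. norm (z + t *\<^sub>R j)) has_derivative (\<lambda>h. (h *\<^sub>R j) \<bullet> sgn z)) (at 0)"
  by (rule has_derivative_compose[OF 1 2])
 moreover have "(\<lambda>h. (h *\<^sub>R j) \<bullet> sgn z) = (*) ((z \<bullet> j) / norm z)"
  by (auto simp: sgn_div_norm inner_commute divide_inverse mult_ac)
 ultimately show ?thesis by (simp add: has_field_derivative_def)
qed

lemma ker_line_derivative:
 fixes z j i :: "'a::euclidean_space"
 assumes "z \<noteq> 0"
 shows "((\<lambda>t. (z + t *\<^sub>R j) \<bullet> i / norm (z + t *\<^sub>R j) ^ DIM('a)) has_real_derivative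
  (i \<bullet> j) / norm z ^ DIM('a) - DIM('a) * (z \<bullet> i) * (z \<bullet> j) / norm z ^ (DIM('a) + 2)) (at 0)"
proof -
 have n: "norm z > 0" using assms by simp
 have 1: "((\<lambda>t. (z + t *\<^sub>R j) \<bullet> i) has_real_derivative (j \<bullet> i)) (at 0)"
  by (auto intro!: derivative_eq_intros simp: inner_add_left)
 have 2: "((\<lambda>t. norm (z + t *\<^sub>R j) ^ DIM('a)) has_real_derivative
   (real DIM('a) * ((z \<bullet> j) / norm z * norm z ^ (DIM('a) - 1)))) (at 0)"
  using DERIV_power[OF norm_line_derivative[OF assms, of j], of "DIM('a)"] by simp
 have "((\<lambda>t. (z + t *\<^sub>R j) \<bullet> i / norm (z + t *\<^sub>R j) ^ DIM('a)) has_real_derivative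
  ((j \<bullet> i) * norm z ^ DIM('a) - (z \<bullet> i) * (real DIM('a) * ((z \<bullet> j) / norm z * norm z ^ (DIM('a) - 1))))
   / (norm z ^ DIM('a) * norm z ^ DIM('a))) (at 0)"
  using DERIV_divide[OF 1 2] n by simp
 moreover have "((j \<bullet> i) * norm z ^ DIM('a) - (z \<bullet> i) * (real DIM('a) * ((z \<bullet> j) / norm z * norm z ^ (DIM('a) - 1))))
   / (norm z ^ DIM('a) * norm z ^ DIM('a))
  = (i \<bullet> j) / norm z ^ DIM('a) - DIM('a) * (z \<bullet> i) * (z \<bullet> j) / norm z ^ (DIM('a) + 2)"
  using n by (simp add: power_add power_DIM[where 'a = 'a and x = "norm z"] inner_commute[of j i]
    power2_eq_square field_simps)
 ultimately show ?thesis by simp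
qed

lemma kert_line_derivative:
 fixes z :: "'a::euclidean_space"
 assumes d: "\<delta> > 0" and z: "norm z \<noteq> \<delta>"
 shows "((\<lambda>t. kert \<delta> (z + t *\<^sub>R j) \<bullet> i) has_real_derivative kder \<delta> i j z) (at 0)"
proof (cases "norm z < \<delta>")
 case True
 have op: "open {t::real. norm (z + t *\<^sub>R j) < \<delta>}" by (intro open_Collect_less continuous_intros)
 have "((\<lambda>t. (z \<bullet> i) / \<delta> ^ DIM('a) + t * ((i \<bullet> j) / \<delta> ^ DIM('a))) has_real_derivative (i \<bullet> j) / \<delta> ^ DIM('a)) (at 0)"
  using d by (auto intro!: derivative_eq_intros)
 then have dv: "((\<lambda>t. (z + t *\<^sub>R j) \<bullet> i / \<delta> ^ DIM('a)) has_real_derivative (i \<bullet> j) / \<delta> ^ DIM('a)) (at 0)"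
  by (simp add: inner_add_left inner_commute[of j] add_divide_distrib)
 have "((\<lambda>t. kert \<delta> (z + t *\<^sub>R j) \<bullet> i) has_real_derivative (i \<bullet> j) / \<delta> ^ DIM('a)) (at 0)"
 proof (rule has_field_derivative_transform_within_open[OF dv op])
  show "(z + t *\<^sub>R j) \<bullet> i / \<delta> ^ DIM('a) = kert \<delta> (z + t *\<^sub>R j) \<bullet> i" if "t \<in> {t. norm (z + t *\<^sub>R j) < \<delta>}" for t
   using that by (simp add: kert_def max_def divide_inverse mult.commute)
 qed (use True in simp)
 with True show ?thesis by (simp add: kder_def)
next
 case False
 then have z: "norm z > \<delta>" "z \<noteq> 0" using z d by auto
 have op: "open {t::real. norm (z + t *\<^sub>R j) > \<delta>}" by (intro open_Collect_less continuous_intros)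
 have "((\<lambda>t. kert \<delta> (z + t *\<^sub>R j) \<bullet> i) has_real_derivative
  (i \<bullet> j) / norm z ^ DIM('a) - DIM('a) * (z \<bullet> i) * (z \<bullet> j) / norm z ^ (DIM('a) + 2)) (at 0)"
 proof (rule has_field_derivative_transform_within_open[OF ker_line_derivative[OF z(2)] op])
  show "(z + t *\<^sub>R j) \<bullet> i / norm (z + t *\<^sub>R j) ^ DIM('a) = kert \<delta> (z + t *\<^sub>R j) \<bullet> i" if "t \<in> {t. norm (z + t *\<^sub>R j) > \<delta>}" for t
   using that by (simp add: kert_def max_def divide_inverse mult.commute)
 qed (use z in simp)
 with z show ?thesis by (simp add: kder_def)
qed

lemma ball_borel[measurable]: "ball (x::'a::euclidean_space) r \<in> sets borel"
 by (intro borel_open open_ball)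

lemma AE_not_sphere: "AE x in lborel. norm (x - y::'a::euclidean_space) \<noteq> r"
proof -
 have "sphere y r \<in> null_sets lborel"
  using negligible_sphere[of y r] by (auto simp: null_sets_completion_iff negligible_iff_null_sets)
 then show ?thesis by (rule AE_I'[of "sphere y r"]) (auto simp: dist_norm norm_minus_commute)
qed

text \<open>The product of the truncated kernel and a test function is Lipschitz with compact
  support and is differentiable off a sphere, so its derivative integrates to zero.\<close>

lemma kert_ibp:
 fixes g :: "'a::euclidean_space => real"
 assumes d: "\<delta> > 0" and g: "test_fun UNIV g" and i: "i \<in> Basis" and j: "j \<in> Basis"
 shows "(LBINT x. (kert \<delta> (x - y) \<bullet> i) * dd j g x) = - (LBINT x. kder \<delta> i j (x - y) * g x)"
proof -
 define F where "F x = (kert \<delta> (x - y) \<bullet> i) * g x" for x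
 define K where "K = (1 + DIM('a)) / \<delta> ^ DIM('a)"
 define A where "A = (1 / \<delta>) ^ (DIM('a) - 1)"
 obtain L where L: "L > 0" "!!x y. \<bar>g x - g y\<bar> <= L * norm (x - y)" using smooth_lipschitz[OF g] by metis
 obtain B where B: "B > 0" "!!x. \<bar>g x\<bar> <= B" using tf_bounded[OF g] by metis
 obtain r where r: "!!x. norm x > r ==> g x = 0" using tf_support[OF g] by metis
 have kb: "\<bar>kert \<delta> z \<bullet> i\<bar> <= A" for z
  using norm_kert_le[OF d, of z] Basis_le_norm[OF i, of "kert \<delta> z"] by (simp add: A_def)
 have kl: "\<bar>kert \<delta> z \<bullet> i - kert \<delta> z' \<bullet> i\<bar> <= K * norm (z - z')" for z z'
  using kert_lipschitz[OF d, of z z'] Basis_le_norm[OF i, of "kert \<delta> z - kert \<delta> z'"]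
  by (simp add: K_def inner_diff_left)
 have lip: "\<bar>F x - F x'\<bar> <= (K * B + A * L) * norm (x - x')" for x x'
 proof -
  have "F x - F x' = (kert \<delta> (x - y) \<bullet> i - kert \<delta> (x' - y) \<bullet> i) * g x + (kert \<delta> (x' - y) \<bullet> i) * (g x - g x')"
   by (simp add: F_def algebra_simps)
  also have "\<bar>\<dots>\<bar> <= \<bar>kert \<delta> (x - y) \<bullet> i - kert \<delta> (x' - y) \<bullet> i\<bar> * \<bar>g x\<bar> + \<bar>kert \<delta> (x' - y) \<bullet> i\<bar> * \<bar>g x - g x'\<bar>"
   by (rule order_trans[OF abs_triangle_ineq]) (simp add: abs_mult)
  also have "... <= (K * norm (x - x')) * B + A * (L * norm (x - x'))"
   using kl[of "x - y" "x' - y"] kb d B L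
   by (intro add_mono mult_mono) (auto simp: K_def A_def)
  finally show ?thesis by (simp add: algebra_simps)
 qed
 have [measurable]: "borelf g" "dd j g \<in> borel_measurable borel"
  using smooth_borel tf_smooth[OF g] smooth_dd by blast+
 have der: "AE x in lborel. ((\<lambda>t. F (x + t *\<^sub>R j)) has_real_derivative
   kder \<delta> i j (x - y) * g x + (kert \<delta> (x - y) \<bullet> i) * dd j g x) (at 0)"
  using AE_not_sphere[of y \<delta>]
 proof eventually_elim
  fix x assume "norm (x - y) \<noteq> \<delta>"
  from kert_line_derivative[OF d this, of j i] line_derivative[OF tf_smooth[OF g], of x j 0]
  have "((\<lambda>t. (kert \<delta> (x - y + t *\<^sub>R j) \<bullet> i) * g (x + t *\<^sub>R j)) has_real_derivative
   kder \<delta> i j (x - y) * g x + dd j g x * (kert \<delta> (x - y) \<bullet> i)) (at 0)"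
   using DERIV_mult[of "\<lambda>t. kert \<delta> (x - y + t *\<^sub>R j) \<bullet> i" _ 0 UNIV "\<lambda>t. g (x + t *\<^sub>R j)"] by simp
  then show "((\<lambda>t. F (x + t *\<^sub>R j)) has_real_derivative
   kder \<delta> i j (x - y) * g x + (kert \<delta> (x - y) \<bullet> i) * dd j g x) (at 0)"
   by (simp add: F_def mult.commute add_diff_eq diff_add_eq)
 qed
 have z: "(LBINT x. kder \<delta> i j (x - y) * g x + (kert \<delta> (x - y) \<bullet> i) * dd j g x) = 0"
  by (rule integral_derivative_zero(2)[OF lip _ der]) (use r in \<open>auto simp: F_def\<close>)
 have i1: "intble (\<lambda>x. kder \<delta> i j (x - y) * g x)"
 proof (rule integrable_bounded_support[where B = "K * B" and r = r])
  show "\<bar>kder \<delta> i j (x - y) * g x\<bar> <= K * B" for x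
   unfolding abs_mult using kder_bounded[OF i j d, of "x - y"] B d by (intro mult_mono) (auto simp: K_def)
 qed (use r in auto)
 obtain B' where B': "B' > 0" "!!x. \<bar>dd j g x\<bar> <= B'" using tf_bounded[OF tf_dd[OF g]] by metis
 have i2: "intble (\<lambda>x. (kert \<delta> (x - y) \<bullet> i) * dd j g x)"
 proof (rule integrable_bounded_support[where B = "A * B'" and r = r])
  show "\<bar>(kert \<delta> (x - y) \<bullet> i) * dd j g x\<bar> <= A * B'" for x
   unfolding abs_mult using kb[of "x - y"] B' d by (intro mult_mono) (auto simp: A_def)
 qed (use r dd_zero_outside[of r g] in auto)
 from z show ?thesis using i1 i2 by simp
qed

lemma integrable_conv_kernel:
 fixes f G :: "'a::euclidean_space => real" and K :: "'a => real"
 assumes f: "intble f" and G: "intble G"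
  and [measurable]: "borelf K" and K: "!!z. \<bar>K z\<bar> <= B"
 shows "integrable (lborel \<Otimes>\<^sub>M lborel) (\<lambda>(x, y). f y * K (x - y) * G x)"
proof (rule lborel_pair.Fubini_integrable)
 have [measurable]: "borelf f" "borelf G" using f G by auto
 show "(\<lambda>(x, y). f y * K (x - y) * G x) \<in> borel_measurable (lborel \<Otimes>\<^sub>M lborel)" by measurable
 have B0: "0 <= B" using K[of 0] by linarith
 have i1: "intble (\<lambda>y. f y * K (x - y))" for x
  by (rule Bochner_Integration.integrable_bound[of _ "\<lambda>y. B * f y"])
   (use f K B0 in \<open>auto simp: abs_mult mult.commute[of "\<bar>f _\<bar>"] intro!: AE_I2 mult_right_mono\<close>)
 show "AE x in lborel. intble (\<lambda>y. case (x, y) of (x, y) => f y * K (x - y) * G x)"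
  using i1 by simp
 have "intble (\<lambda>x. (LBINT y. \<bar>f y * K (x - y)\<bar>) * \<bar>G x\<bar>)"
 proof (rule Bochner_Integration.integrable_bound[of _ "\<lambda>x. (B * (LBINT y. \<bar>f y\<bar>)) * G x"])
  have "(\<lambda>x. \<integral>y. \<bar>f y * K (x - y)\<bar> \<partial>lborel) \<in> borel_measurable lborel"
   by (rule lborel.borel_measurable_lebesgue_integral) measurable
  then show "(\<lambda>x. (LBINT y. \<bar>f y * K (x - y)\<bar>) * \<bar>G x\<bar>) \<in> borel_measurable lborel" by measurable
  show "AE x in lborel. norm ((LBINT y. \<bar>f y * K (x - y)\<bar>) * \<bar>G x\<bar>) <= norm ((B * (LBINT y. \<bar>f y\<bar>)) * G x)"
  proof (intro AE_I2)
   fix x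
   have "(LBINT y. \<bar>f y * K (x - y)\<bar>) <= (LBINT y. B * \<bar>f y\<bar>)"
   proof (rule integral_mono)
    show "intble (\<lambda>y. \<bar>f y * K (x - y)\<bar>)" by (intro integrable_abs i1)
    show "\<bar>f y * K (x - y)\<bar> <= B * \<bar>f y\<bar>" for y
     using mult_right_mono[OF K[of "x - y"], of "\<bar>f y\<bar>"] by (simp add: abs_mult mult.commute)
   qed (use f in auto)
   then have "(LBINT y. \<bar>f y * K (x - y)\<bar>) <= B * (LBINT y. \<bar>f y\<bar>)" by simp
   then show "norm ((LBINT y. \<bar>f y * K (x - y)\<bar>) * \<bar>G x\<bar>) <= norm ((B * (LBINT y. \<bar>f y\<bar>)) * G x)"
    using B0 by (auto simp: abs_mult intro!: mult_right_mono)
  qed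
 qed (use G in simp)
 then show "intble (\<lambda>x. \<integral>y. norm (case (x, y) of (x, y) => f y * K (x - y) * G x) \<partial>lborel)"
  by (simp add: abs_mult)
qed

lemma conv_kernel_swap:
 fixes f G :: "'a::euclidean_space => real" and K :: "'a => real"
 assumes f: "intble f" and G: "intble G"
  and K: "borelf K" "!!z. \<bar>K z\<bar> <= B"
 shows "(LBINT x. (LBINT y. f y * K (x - y)) * G x) = (LBINT y. f y * (LBINT x. K (x - y) * G x))"
proof -
 have "(LBINT x. (LBINT y. f y * K (x - y)) * G x) = (LBINT x. (LBINT y. f y * K (x - y) * G x))"
  by simp
 also have "... = (LBINT y. (LBINT x. f y * K (x - y) * G x))"
  by (rule lborel_pair.Fubini_integral[symmetric]) (rule integrable_conv_kernel[OF f G K])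
 also have "... = (LBINT y. f y * (LBINT x. K (x - y) * G x))"
  by (simp add: mult.assoc)
 finally show ?thesis .
qed

lemma velt_inner:
 fixes f :: "'a::euclidean_space => real"
 assumes f: "intble f" and d: "\<delta> > 0"
 shows "velt \<delta> f x \<bullet> i = (LBINT y. f y * (kert \<delta> (x - y) \<bullet> i))"
 unfolding velt_def using velt_integrable[OF f d, of x] by (simp flip: integral_inner_left)

lemma velt_ibp:
 fixes f :: "'a::euclidean_space => real"
 assumes f: "intble f" and d: "\<delta> > 0" and g: "test_fun UNIV g" and i: "i \<in> Basis" and j: "j \<in> Basis"
 shows "(LBINT x. (velt \<delta> f x \<bullet> i) * dd j g x) = - (LBINT x. (LBINT y. f y * kder \<delta> i j (x - y)) * g x)"
proof -
 have kb: "\<bar>kert \<delta> z \<bullet> i\<bar> <= (1 / \<delta>) ^ (DIM('a) - 1)" for z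
  using norm_kert_le[OF d, of z] Basis_le_norm[OF i, of "kert \<delta> z"] by simp
 have "(LBINT x. (velt \<delta> f x \<bullet> i) * dd j g x) = (LBINT y. f y * (LBINT x. (kert \<delta> (x - y) \<bullet> i) * dd j g x))"
  unfolding velt_inner[OF f d] by (rule conv_kernel_swap[OF f tf_integrable[OF tf_dd[OF g]] _ kb]) measurable
 also have "... = (LBINT y. - (f y * (LBINT x. kder \<delta> i j (x - y) * g x)))"
  by (simp add: kert_ibp[OF d g i j])
 also have "... = - (LBINT y. f y * (LBINT x. kder \<delta> i j (x - y) * g x))"
  by (rule Bochner_Integration.integral_minus)
 also have "(LBINT y. f y * (LBINT x. kder \<delta> i j (x - y) * g x))
   = (LBINT x. (LBINT y. f y * kder \<delta> i j (x - y)) * g x)"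
  by (rule conv_kernel_swap[OF f tf_integrable[OF g] kder_borel kder_bounded[OF i j d], symmetric])
 finally show ?thesis .
qed

lemma kder_conv_integrable:
 fixes f :: "'a::euclidean_space => real"
 assumes f: "intble f" and d: "\<delta> > 0" and i: "i \<in> Basis" and j: "j \<in> Basis"
 shows "intble (\<lambda>y. f y * kder \<delta> i j (x - y))"
proof (rule Bochner_Integration.integrable_bound[of _ "\<lambda>y. (1 + DIM('a)) / \<delta> ^ DIM('a) * f y"])
 have [measurable]: "borelf f" using f by auto
 show "(\<lambda>y. f y * kder \<delta> i j (x - y)) \<in> borel_measurable lborel" by measurable
 show "AE y in lborel. norm (f y * kder \<delta> i j (x - y)) <= norm ((1 + DIM('a)) / \<delta> ^ DIM('a) * f y)"
 proof (intro AE_I2)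
  fix y
  have "norm (f y * kder \<delta> i j (x - y)) = \<bar>kder \<delta> i j (x - y)\<bar> * \<bar>f y\<bar>" by (simp add: abs_mult)
  also have "... <= (1 + DIM('a)) / \<delta> ^ DIM('a) * \<bar>f y\<bar>"
   by (intro mult_right_mono kder_bounded i j d) simp
  finally show "norm (f y * kder \<delta> i j (x - y)) <= norm ((1 + DIM('a)) / \<delta> ^ DIM('a) * f y)"
   using d by (simp add: abs_mult)
 qed
qed (use f in simp)

text \<open>The divergence of \<open>velt \<delta> f\<close> at \<open>x\<close> is d / \<delta>^d
  times the integral of \<open>f\<close> over the ball of radius \<open>\<delta>\<close> about
  \<open>x\<close>. This is a multiple of a mean value, bounded independently of
  \<open>\<delta>\<close>, so the bound survives the limit.\<close>

lemma velt_div_bound: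
 fixes f :: "'a::euclidean_space => real"
 assumes f: "intble f" "AE x in lborel. \<bar>f x\<bar> <= P" and d: "\<delta> > 0" and g: "test_fun UNIV g"
 shows "\<bar>LBINT x. velt \<delta> f x \<bullet> grad g x\<bar> <= DIM('a) * unit_ball_vol (DIM('a)) * P * (LBINT x. \<bar>g x\<bar>)"
proof -
 have [measurable]: "borelf f" using f by auto
 have P: "0 <= P" by (rule AE_bound_nonneg[OF f(2)])
 let ?h = "\<lambda>i x. \<integral>y. f y * kder \<delta> i i (x - y) \<partial>lborel"
 let ?D = "DIM('a) * unit_ball_vol (DIM('a)) * P"
 have kb: "\<bar>kert \<delta> z \<bullet> i\<bar> <= (1 / \<delta>) ^ (DIM('a) - 1)" if "i \<in> Basis" for z :: 'a and i
  using norm_kert_le[OF d, of z] Basis_le_norm[OF that, of "kert \<delta> z"] by simp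
 have int1: "intble (\<lambda>x. (velt \<delta> f x \<bullet> i) * dd i g x)" if "i \<in> Basis" for i
  unfolding velt_inner[OF f(1) d]
 proof -
  have "integrable (lborel \<Otimes>\<^sub>M lborel) (\<lambda>(x, y). f y * (kert \<delta> (x - y) \<bullet> i) * dd i g x)"
   by (rule integrable_conv_kernel[OF f(1) tf_integrable[OF tf_dd[OF g]] _ kb[OF that]]) measurable
  from lborel_pair.integrable_fst'[OF this]
  show "intble (\<lambda>x. (LBINT y. f y * (kert \<delta> (x - y) \<bullet> i)) * dd i g x)" by simp
 qed
 have int2: "intble (\<lambda>x. ?h i x * g x)" if "i \<in> Basis" for i
  using lborel_pair.integrable_fst'[OF integrable_conv_kernel[OF f(1) tf_integrable[OF g] kder_borel kder_bounded[OF that that d]]]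
  by simp
 have "(LBINT x. velt \<delta> f x \<bullet> grad g x) = (LBINT x. (\<Sum>i\<in>Basis. (velt \<delta> f x \<bullet> i) * dd i g x))"
  by (intro Bochner_Integration.integral_cong refl) (simp add: grad_def inner_sum_right mult.commute)
 also have "... = (\<Sum>i\<in>Basis. \<integral>x. (velt \<delta> f x \<bullet> i) * dd i g x \<partial>lborel)"
  by (rule Bochner_Integration.integral_sum) (rule int1)
 also have "... = (\<Sum>i\<in>Basis. - (LBINT x. ?h i x * g x))"
  by (intro sum.cong refl velt_ibp f d g)
 also have "... = - (LBINT x. (\<Sum>i\<in>Basis. ?h i x * g x))"
  by (subst Bochner_Integration.integral_sum[OF int2]) (simp_all add: sum_negf)
 finally have eq: "(LBINT x. velt \<delta> f x \<bullet> grad g x) = - (LBINT x. (\<Sum>i\<in>Basis. ?h i x * g x))" .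
 have hb: "\<bar>\<Sum>i\<in>Basis. ?h i x\<bar> <= ?D" for x
 proof -
  have "(\<Sum>i\<in>Basis. ?h i x) = (LBINT y. (\<Sum>i\<in>Basis. f y * kder \<delta> i i (x - y)))"
   by (rule Bochner_Integration.integral_sum[symmetric]) (rule kder_conv_integrable[OF f(1) d])
  also have "... = (LBINT y. f y * (DIM('a) / \<delta> ^ DIM('a) * indicator (ball x \<delta>) y))"
   using d by (intro Bochner_Integration.integral_cong refl)
    (simp add: sum_distrib_left[symmetric] kder_trace indicator_def dist_norm)
  finally have eq: "(\<Sum>i\<in>Basis. ?h i x) = (LBINT y. f y * (DIM('a) / \<delta> ^ DIM('a) * indicator (ball x \<delta>) y))" .
  have i3: "intble (\<lambda>y. P * (DIM('a) / \<delta> ^ DIM('a) * indicator (ball x \<delta>) y))"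
   by (intro integrable_mult_right integrable_real_indicator) (auto simp: emeasure_lborel_ball_finite[simplified])
  have bd: "AE y in lborel. norm (f y * (DIM('a) / \<delta> ^ DIM('a) * indicator (ball x \<delta>) y)) <= P * (DIM('a) / \<delta> ^ DIM('a) * indicator (ball x \<delta>) y)"
   using f(2) by eventually_elim (use d in \<open>auto simp: abs_mult intro!: divide_right_mono mult_right_mono\<close>)
  have i4: "intble (\<lambda>y. f y * (DIM('a) / \<delta> ^ DIM('a) * indicator (ball x \<delta>) y))"
  proof (rule Bochner_Integration.integrable_bound[OF i3])
   show "AE y in lborel. norm (f y * (DIM('a) / \<delta> ^ DIM('a) * indicator (ball x \<delta>) y)) <= norm (P * (DIM('a) / \<delta> ^ DIM('a) * indicator (ball x \<delta>) y))"
    using bd by eventually_elim (simp add: abs_mult P d less_imp_le)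
  qed measurable
  have "\<bar>\<Sum>i\<in>Basis. ?h i x\<bar> <= (LBINT y. norm (f y * (DIM('a) / \<delta> ^ DIM('a) * indicator (ball x \<delta>) y)))"
   unfolding eq by (subst real_norm_def[symmetric], rule integral_norm_bound)
  also have "... <= (LBINT y. P * (DIM('a) / \<delta> ^ DIM('a) * indicator (ball x \<delta>) y))"
   by (rule integral_mono_AE[OF integrable_norm[OF i4] i3 bd])
  also have "... = ?D" using d content_ball[of \<delta> x] by simp
  finally show ?thesis .
 qed
 have "\<bar>LBINT x. (\<Sum>i\<in>Basis. ?h i x * g x)\<bar> <= (LBINT x. ?D * \<bar>g x\<bar>)"
 proof (rule integral_abs_bound_integral)
  show "intble (\<lambda>x. \<Sum>i\<in>Basis. ?h i x * g x)" by (intro Bochner_Integration.integrable_sum int2)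
  show "intble (\<lambda>x. ?D * \<bar>g x\<bar>)" using tf_integrable[OF g] by simp
  show "\<bar>\<Sum>i\<in>Basis. ?h i x * g x\<bar> <= ?D * \<bar>g x\<bar>" for x
   using mult_right_mono[OF hb[of x], of "\<bar>g x\<bar>"] by (simp add: sum_distrib_right[symmetric] abs_mult)
 qed
 then show ?thesis using eq by simp
qed

lemma vel_limit:
 fixes f :: "'a::euclidean_space => real"
 assumes f: "intble f" "AE x in lborel. \<bar>f x\<bar> <= P" and G: "intble G"
 shows "(\<lambda>n. \<integral>x. velt (1 / real (Suc n)) f x \<bullet> G x \<partial>lborel) \<longlonglongrightarrow> (LBINT x. vel f x \<bullet> G x)"
proof (rule integral_dominated_convergence)
 have [measurable]: "borelf f" "borelf G" using f G by auto
 note [measurable] = vel_borel[of f]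
 have P: "0 <= P" by (rule AE_bound_nonneg[OF f(2)])
 let ?C = "2 * P * ker_const TYPE('a)"
 let ?V = "P * ker_const TYPE('a) + (LBINT y. \<bar>f y\<bar>) + (LBINT y. \<bar>f y\<bar>)"
 have near: "norm (vel f x - velt (1 / real (Suc n)) f x) <= ?C * (1 / real (Suc n))" for n x
  by (rule vel_velt[OF f]) simp
 have C0: "0 <= ?C" using P ker_const_pos[where 'a = 'a] by simp
 show "AE x in lborel. (\<lambda>n. velt (1 / real (Suc n)) f x \<bullet> G x) \<longlonglongrightarrow> vel f x \<bullet> G x"
 proof (intro AE_I2 tendsto_intros)
  fix x
  have "(\<lambda>n. ?C * (1 / real (Suc n))) \<longlonglongrightarrow> ?C * 0"
   by (intro tendsto_mult tendsto_const) (use LIMSEQ_inverse_real_of_nat in \<open>simp add: inverse_eq_divide\<close>)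
  then have "(\<lambda>n. norm (vel f x - velt (1 / real (Suc n)) f x)) \<longlonglongrightarrow> 0"
   by (intro Lim_null_comparison[of "\<lambda>n. norm (vel f x - velt (1 / real (Suc n)) f x)" "\<lambda>n. ?C * (1 / real (Suc n))"]
     always_eventually allI) (simp_all only: real_norm_def abs_norm_cancel near mult_zero_right)
  then have "(\<lambda>n. vel f x - (vel f x - velt (1 / real (Suc n)) f x)) \<longlonglongrightarrow> vel f x - 0"
   by (rule tendsto_diff[OF tendsto_const tendsto_norm_zero_cancel])
  then show "(\<lambda>n. velt (1 / real (Suc n)) f x) \<longlonglongrightarrow> vel f x" by simp
 qed
 have vb: "norm (vel f x) <= ?V" for x
 proof -
  have "(LBINT y. indicator (cball x 1) y * \<bar>f y\<bar>) <= (LBINT y. \<bar>f y\<bar>)"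
  proof (rule integral_mono)
   have "intble (\<lambda>y. indicator (cball x 1) y *\<^sub>R \<bar>f y\<bar>)"
    using f by (intro integrable_mult_indicator) auto
   then show "intble (\<lambda>y. indicator (cball x 1) y * \<bar>f y\<bar>)" by simp
  qed (use f in \<open>auto simp: indicator_def\<close>)
  with vel_bounds(2)[OF f(1,2), of 1 1 x] show ?thesis by simp
 qed
 show "AE x in lborel. norm (velt (1 / real (Suc n)) f x \<bullet> G x) <= (?V + ?C) * norm (G x)" for n
 proof (intro AE_I2)
  fix x
  have "norm (velt (1 / real (Suc n)) f x) <= norm (vel f x) + norm (vel f x - velt (1 / real (Suc n)) f x)"
   by (metis norm_minus_commute norm_triangle_sub)
  also have "... <= ?V + ?C"
  proof (intro add_mono vb order_trans[OF near])
   show "?C * (1 / real (Suc n)) <= ?C" using mult_left_mono[OF _ C0, of "1 / real (Suc n)" 1] by simp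
  qed
  finally have "norm (velt (1 / real (Suc n)) f x) <= ?V + ?C" .
  then have "norm (velt (1 / real (Suc n)) f x) * norm (G x) <= (?V + ?C) * norm (G x)"
   by (rule mult_right_mono) simp
  then show "norm (velt (1 / real (Suc n)) f x \<bullet> G x) <= (?V + ?C) * norm (G x)"
   using Cauchy_Schwarz_ineq2[of "velt (1 / real (Suc n)) f x" "G x"] unfolding real_norm_def by linarith
 qed
 show "intble (\<lambda>x. (?V + ?C) * norm (G x))" using G by simp
 show "(\<lambda>x. vel f x \<bullet> G x) \<in> borel_measurable lborel" by measurable
 show "(\<lambda>x. velt (1 / real (Suc n)) f x \<bullet> G x) \<in> borel_measurable lborel" for n by measurable
qed

lemma vel_div_bound:
 fixes f :: "'a::euclidean_space => real"
 assumes f: "intble f" "AE x in lborel. \<bar>f x\<bar> <= P" and g: "test_fun UNIV g"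
 shows "\<bar>LBINT x. vel f x \<bullet> grad g x\<bar> <= DIM('a) * unit_ball_vol (DIM('a)) * P * (LBINT x. \<bar>g x\<bar>)"
proof (rule LIMSEQ_le_const2)
 have "intble (grad g)"
  unfolding grad_def by (intro Bochner_Integration.integrable_sum integrable_scaleR_left tf_integrable[OF tf_dd[OF g]])
 then show "(\<lambda>n. \<bar>LBINT x. velt (1 / real (Suc n)) f x \<bullet> grad g x\<bar>) \<longlonglongrightarrow> \<bar>LBINT x. vel f x \<bullet> grad g x\<bar>"
  by (intro tendsto_rabs vel_limit[OF f])
 show "\<exists>N. \<forall>n\<ge>N. \<bar>LBINT x. velt (1 / real (Suc n)) f x \<bullet> grad g x\<bar> <= DIM('a) * unit_ball_vol (DIM('a)) * P * (LBINT x. \<bar>g x\<bar>)"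
  by (intro exI[of _ 0] allI impI velt_div_bound[OF f _ g]) simp
qed

text \<open>The symmetry of \<open>kder\<close> gives the identity for the truncated velocities, and
  both sides pass to the limit.\<close>

lemma vel_curl:
 fixes f :: "'a::euclidean_space => real"
 assumes f: "intble f" "AE x in lborel. \<bar>f x\<bar> <= P" and g: "test_fun UNIV g"
  and i: "i \<in> Basis" and j: "j \<in> Basis"
 shows "(LBINT x. (vel f x \<bullet> i) * dd j g x) = (LBINT x. (vel f x \<bullet> j) * dd i g x)"
proof -
 have lim: "(\<lambda>n. \<integral>x. (velt (1 / real (Suc n)) f x \<bullet> i) * dd j g x \<partial>lborel) \<longlonglongrightarrow> (LBINT x. (vel f x \<bullet> i) * dd j g x)" for i j
  using vel_limit[OF f, of "\<lambda>x. dd j g x *\<^sub>R i"] tf_integrable[OF tf_dd[OF g, of j]]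
  by (simp add: mult.commute integrable_scaleR_left)
 have "(LBINT x. (velt (1 / real (Suc n)) f x \<bullet> i) * dd j g x) = (LBINT x. (velt (1 / real (Suc n)) f x \<bullet> j) * dd i g x)" for n
  using velt_ibp[OF f(1) _ g i j, of "1 / real (Suc n)"] velt_ibp[OF f(1) _ g j i, of "1 / real (Suc n)"]
  by (simp add: kder_sym[of _ i j])
 then show ?thesis using lim[of i j] lim[of j i] LIMSEQ_unique by simp
qed

subsection \<open>The fundamental solution\<close>

text \<open>The normalizations of the two cases lead to the same factor, 1 / (d *
  \<open>unit_ball_vol\<close> d), since 2 * pi is twice the area of the unit disc.\<close>

lemma grad_fundamental_solution:
 assumes dim: "DIM('a::euclidean_space) \<ge> 2"
 obtains c where "!!x. x \<noteq> 0 ==> grad \<Phi> x = c *\<^sub>R ker (x::'a)"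
proof -
 have hn: "(norm has_derivative (\<lambda>h. h \<bullet> sgn x)) (at x)" if "x \<noteq> 0" for x :: 'a
  using has_derivative_norm[OF that] .
 have gradI: "grad \<Phi> x = c *\<^sub>R ker x"
  if "(\<Phi> has_derivative (\<lambda>h. c * (h \<bullet> ker x))) (at x)" for x :: 'a and c
 proof -
  have "grad \<Phi> x = (\<Sum>i\<in>Basis. (c *\<^sub>R ker x \<bullet> i) *\<^sub>R i)"
   unfolding grad_def by (intro sum.cong refl) (simp add: dd_eq[OF that] inner_commute)
  then show ?thesis by (simp only: euclidean_representation)
 qed
 show ?thesis
 proof (cases "DIM('a) = 2")
  case True
  have "(\<Phi> has_derivative (\<lambda>h. 1 / (2 * pi) * (h \<bullet> ker x))) (at x)" if x: "x \<noteq> 0" for x :: 'a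
  proof -
   have "((\<lambda>y. ln (norm y)) has_derivative (\<lambda>h. (h \<bullet> sgn x) * (1 / norm x))) (at x)"
   proof (rule has_derivative_compose[OF hn[OF x]])
    have "(ln has_derivative (*) (1 / norm x)) (at (norm x))"
     using DERIV_ln_divide[of "norm x"] x by (simp add: has_field_derivative_def)
    then show "(ln has_derivative (\<lambda>h. h * (1 / norm x))) (at (norm x))"
     by (rule has_derivative_eq_rhs) auto
   qed
   then have "((\<lambda>y. ln (norm y) * (1 / (2 * pi))) has_derivative (\<lambda>h. (h \<bullet> sgn x) * (1 / norm x) * (1 / (2 * pi)))) (at x)"
    by (rule has_derivative_mult_left)
   moreover have "(\<lambda>h. (h \<bullet> sgn x) * (1 / norm x) * (1 / (2 * pi))) = (\<lambda>h. 1 / (2 * pi) * (h \<bullet> ker x))"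
    by (rule ext) (simp only: ker_def True sgn_div_norm power2_eq_square divide_inverse inner_scaleR_right
      inverse_mult_distrib mult_1_left mult_ac)
   moreover have "(\<lambda>y. ln (norm y) * (1 / (2 * pi))) = (\<Phi> :: 'a => real)"
    by (rule ext) (simp add: \<Phi>_def True)
   ultimately show ?thesis by simp
  qed
  then show ?thesis using that gradI by blast
 next
  case False
  \<comment> \<open>The exponent \<open>DIM('a) - 2\<close> becomes \<open>Suc k\<close>, and
    subtraction of natural numbers disappears from the differentiation.\<close>
  then obtain k where k: "DIM('a) = Suc (Suc (Suc k))"
  proof -
   have "DIM('a) = Suc (Suc (Suc (DIM('a) - 3)))" using dim False by linarith
   then show ?thesis using that by blast
  qed
  define A where "A = - 1 / (real DIM('a) * (real DIM('a) - 2) * unit_ball_vol (real DIM('a)))"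
  define c where "c = - A * real (Suc k)"
  have P: "\<Phi> = (\<lambda>y::'a. A * inverse (norm y ^ Suc k))"
   using False by (auto simp: \<Phi>_def A_def k divide_inverse)
  have "(\<Phi> has_derivative (\<lambda>h. c * (h \<bullet> ker x))) (at x)" if x: "x \<noteq> 0" for x :: 'a
  proof -
   have n: "norm x > 0" using x by simp
   have "((\<lambda>r. A * inverse (r ^ Suc k)) has_real_derivative
     A * (- (inverse (norm x ^ Suc k) * (real (Suc k) * norm x ^ k) * inverse (norm x ^ Suc k)))) (at (norm x))"
    by (rule DERIV_cmult, rule DERIV_inverse') (use n DERIV_pow[of "Suc k" "norm x"] in auto)
   from has_derivative_compose[OF hn[OF x] this[unfolded has_field_derivative_def]]
   have "(\<Phi> has_derivative (\<lambda>h. A * (- (inverse (norm x ^ Suc k) * (real (Suc k) * norm x ^ k) * inverse (norm x ^ Suc k))) * (h \<bullet> sgn x))) (at x)"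
    by (simp add: P)
   moreover have "(\<lambda>h. A * (- (inverse (norm x ^ Suc k) * (real (Suc k) * norm x ^ k) * inverse (norm x ^ Suc k))) * (h \<bullet> sgn x))
     = (\<lambda>h. c * (h \<bullet> ker x))"
   proof
    fix h
    have "inverse (norm x ^ Suc k) * norm x ^ k * inverse (norm x ^ Suc k) * inverse (norm x) = inverse (norm x ^ Suc (Suc (Suc k)))"
     using n by (simp add: field_simps)
    from this[symmetric] show "A * (- (inverse (norm x ^ Suc k) * (real (Suc k) * norm x ^ k) * inverse (norm x ^ Suc k))) * (h \<bullet> sgn x) = c * (h \<bullet> ker x)"
     by (simp only: ker_def sgn_div_norm k inner_scaleR_right c_def mult_ac mult_minus_left mult_minus_right)
   qed
   ultimately show ?thesis by simp
  qed
  then show ?thesis using that gradI by blast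
 qed
qed

lemma velocity_eq_vel:
 assumes dim: "DIM('a::euclidean_space) \<ge> 2"
 obtains c where "!!\<sigma> (f :: 'a => real) x. f \<in> borel_measurable borel ==> velocity \<sigma> f x = (\<sigma> * c) *\<^sub>R vel f x"
proof -
 obtain c where c: "!!x. x \<noteq> 0 ==> grad \<Phi> x = c *\<^sub>R ker (x::'a)" using grad_fundamental_solution[OF dim] by blast
 have "velocity \<sigma> f x = (\<sigma> * c) *\<^sub>R vel f x" if [measurable]: "borelf f" for \<sigma> and f :: "'a => real" and x
 proof -
  have "AE y in lborel. y \<noteq> x" by (rule AE_lborel_singleton)
  then have ae: "AE y in lborel. f y *\<^sub>R grad \<Phi> (x - y) = c *\<^sub>R (f y *\<^sub>R ker (x - y))"
   by eventually_elim (simp add: c)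
  have "(LBINT y. f y *\<^sub>R grad \<Phi> (x - y)) = (LBINT y. c *\<^sub>R (f y *\<^sub>R ker (x - y)))"
  proof (rule integral_cong_AE[OF _ _ ae])
   \<comment> \<open>The gradient of \<open>\<Phi>\<close> at the origin is an unspecified vector.
     It affects a single point, and splitting that point off shows the integrand to be
     measurable.\<close>
   have "(\<lambda>y. if y = x then f y *\<^sub>R grad \<Phi> 0 else c *\<^sub>R (f y *\<^sub>R ker (x - y))) \<in> borel_measurable lborel"
    by measurable
   moreover have "(\<lambda>y. if y = x then f y *\<^sub>R grad \<Phi> 0 else c *\<^sub>R (f y *\<^sub>R ker (x - y))) = (\<lambda>y. f y *\<^sub>R grad \<Phi> (x - y))"
    by (auto simp: c)
   ultimately show "(\<lambda>y. f y *\<^sub>R grad \<Phi> (x - y)) \<in> borel_measurable lborel" by simp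
  qed measurable
  also have "... = c *\<^sub>R vel f x" unfolding vel_def by (rule integral_scaleR_right)
  finally show ?thesis by (simp add: velocity_def)
 qed
 then show ?thesis using that by blast
qed

subsection \<open>Regularity of the velocity field\<close>

lemma dd_sum:
 assumes "!!i. i \<in> I ==> smooth (f i)"
 shows "dd v (\<lambda>x. \<Sum>i\<in>I. f i x) x = (\<Sum>i\<in>I. dd v (f i) x)"
 by (rule dd_eq, rule has_derivative_sum, rule has_derivative_dd, rule smooth_differentiable, rule assms)

lemma tf_integral_sum:
 assumes "!!i. i \<in> I ==> test_fun UNIV (f i :: 'a::euclidean_space => real)"
 shows "(LBINT x. (\<Sum>i\<in>I. f i x)) = (\<Sum>i\<in>I. \<integral>x. f i x \<partial>lborel)"
 by (rule Bochner_Integration.integral_sum) (rule tf_integrable, rule assms)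

lemma tf_zero: "test_fun UNIV (\<lambda>x::'a::euclidean_space. 0 :: real)"
 by (rule tf_intro[of _ 0]) (auto intro: Ck_const)

lemma tf_sum:
 assumes "!!i. i \<in> I ==> test_fun UNIV (f i :: 'a::euclidean_space => real)"
 shows "test_fun UNIV (\<lambda>x. \<Sum>i\<in>I. f i x)"
 using assms by (induction I rule: infinite_finite_induct) (auto intro: tf_zero tf_add)

text \<open>For a symmetric gradient, two integrations by parts turn the sum of the squared derivatives into
 the square of the divergence.\<close>

lemma caccioppoli:
 fixes U :: "'a::euclidean_space => 'a => real"
 assumes \<zeta>: "test_fun UNIV \<zeta>"
  and U: "!!i. i \<in> Basis ==> smooth (U i)" "!!i x. i \<in> Basis ==> \<bar>U i x\<bar> <= L"
  and sym: "!!i j x. i \<in> Basis ==> j \<in> Basis ==> dd j (U i) x = dd i (U j) x"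
  and dvg: "!!x. \<bar>\<Sum>i\<in>Basis. dd i (U i) x\<bar> <= D"
 shows "(LBINT x. \<zeta> x * \<zeta> x * (\<Sum>i\<in>Basis. \<Sum>j\<in>Basis. (dd j (U i) x)^2))
  <= 2 * (LBINT x. 2 * L^2 * real DIM('a) * (\<Sum>j\<in>Basis. (dd j \<zeta> x)^2) + D^2 * (\<zeta> x * \<zeta> x)
    + L * D * (\<Sum>j\<in>Basis. \<bar>dd j (\<lambda>x. \<zeta> x * \<zeta> x) x\<bar>))"
proof -
 define X where "X x = \<zeta> x * \<zeta> x" for x
 have X: "test_fun UNIV X" unfolding X_def[abs_def] by (rule tf_mult[OF \<zeta> tf_smooth[OF \<zeta>]])
 have \<zeta>s: "smooth \<zeta>" and Xs: "smooth X" using tf_smooth \<zeta> X by blast+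
 define dv where "dv x = (\<Sum>i\<in>Basis. dd i (U i) x)" for x
 have dvs: "smooth dv" unfolding dv_def[abs_def] by (intro smooth_sum smooth_dd U(1))
 define S where "S x = (\<Sum>i\<in>Basis. \<Sum>j\<in>Basis. (dd j (U i) x)^2)" for x
 note sm = smooth_dd smooth_mult smooth_add smooth_sum U(1) \<zeta>s Xs dvs
 note sd = smooth_differentiable
 have t0: "test_fun UNIV (\<lambda>x. X x * (dd j (U i) x * dd j (U i) x))" if "i \<in> Basis" "j \<in> Basis" for i j
  by (intro tf_mult'[OF X] sm that)
 have t1: "test_fun UNIV (\<lambda>x. U i x * (dd j X x * dd i (U j) x))" if "i \<in> Basis" "j \<in> Basis" for i j
  by (intro tf_mult[OF tf_mult'[OF tf_dd[OF X]]] sm that)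
 have t2: "test_fun UNIV (\<lambda>x. U i x * (X x * dd i (dd j (U j)) x))" if "i \<in> Basis" "j \<in> Basis" for i j
  by (intro tf_mult[OF tf_mult'[OF X]] sm that)
 have t3: "test_fun UNIV (\<lambda>x. dv x * (U i x * dd i X x + dd i (U i) x * X x))" if "i \<in> Basis" for i
  by (intro tf_mult[OF tf_add[OF tf_mult[OF tf_dd[OF X]] tf_mult[OF X]]] sm that)
 \<comment> \<open>One of the two equal factors is replaced by its transpose
   \<open>dd i (U j)\<close>. When \<open>dd j\<close> is moved onto it and the derivatives are
   exchanged, \<open>dd i (dd j (U j))\<close> appears, which becomes a derivative of the divergence
   on summing over \<open>j\<close>.\<close>
 have A: "(LBINT x. X x * (dd j (U i) x * dd j (U i) x))
   = - (LBINT x. U i x * (dd j X x * dd i (U j) x)) - (LBINT x. U i x * (X x * dd i (dd j (U j)) x))"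
  if ij: "i \<in> Basis" "j \<in> Basis" for i j
 proof -
  have "(LBINT x. X x * (dd j (U i) x * dd j (U i) x)) = (LBINT x. dd j (U i) x * (X x * dd i (U j) x))"
   by (intro Bochner_Integration.integral_cong refl) (simp add: sym[OF ij] mult_ac)
  also have "... = - (LBINT x. U i x * dd j (\<lambda>x. X x * dd i (U j) x) x)"
   by (intro integration_by_parts tf_mult'[OF X] sm ij)
  also have "(\<lambda>x. U i x * dd j (\<lambda>x. X x * dd i (U j) x) x)
    = (\<lambda>x. U i x * (dd j X x * dd i (U j) x) + U i x * (X x * dd i (dd j (U j)) x))"
  proof
   fix x
   have "dd j (\<lambda>x. X x * dd i (U j) x) x = X x * dd j (dd i (U j)) x + dd j X x * dd i (U j) x"
    by (intro dd_mult sd sm ij)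
   moreover have "dd j (dd i (U j)) x = dd i (dd j (U j)) x"
    by (rule mixed_derivatives_commute[OF U(1)[OF ij(2)]])
   ultimately show "U i x * dd j (\<lambda>x. X x * dd i (U j) x) x
    = U i x * (dd j X x * dd i (U j) x) + U i x * (X x * dd i (dd j (U j)) x)"
    by (simp add: distrib_left)
  qed
  also have "(LBINT x. U i x * (dd j X x * dd i (U j) x) + U i x * (X x * dd i (dd j (U j)) x))
   = (LBINT x. U i x * (dd j X x * dd i (U j) x)) + (LBINT x. U i x * (X x * dd i (dd j (U j)) x))"
   by (rule Bochner_Integration.integral_add) (rule tf_integrable, rule t1 t2, rule ij, rule ij)+
  finally show ?thesis by simp
 qed
 \<comment> \<open>After the sum over \<open>j\<close> the remaining derivative \<open>dd i\<close>
   is moved off the divergence, so that only the bounded function \<open>dv\<close> itself is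
   left.\<close>
 have B: "(\<Sum>j\<in>Basis. \<integral>x. U i x * (X x * dd i (dd j (U j)) x) \<partial>lborel)
   = - (LBINT x. dv x * (U i x * dd i X x + dd i (U i) x * X x))" if i: "i \<in> Basis" for i
 proof -
  have "(\<Sum>j\<in>Basis. \<integral>x. U i x * (X x * dd i (dd j (U j)) x) \<partial>lborel)
    = (LBINT x. (\<Sum>j\<in>Basis. U i x * (X x * dd i (dd j (U j)) x)))"
   by (rule tf_integral_sum[symmetric]) (rule t2[OF i])
  also have "... = (LBINT x. dd i dv x * (U i x * X x))"
  proof (intro Bochner_Integration.integral_cong refl)
   fix x
   have "dd i dv x = (\<Sum>j\<in>Basis. dd i (dd j (U j)) x)"
    unfolding dv_def[abs_def] by (rule dd_sum) (intro sm)
   then show "(\<Sum>j\<in>Basis. U i x * (X x * dd i (dd j (U j)) x)) = dd i dv x * (U i x * X x)"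
    by (simp add: sum_distrib_left sum_distrib_right mult_ac)
  qed
  also have "... = - (LBINT x. dv x * dd i (\<lambda>x. U i x * X x) x)"
   by (intro integration_by_parts tf_mult[OF X] sm i)
  also have "(\<lambda>x. dv x * dd i (\<lambda>x. U i x * X x) x) = (\<lambda>x. dv x * (U i x * dd i X x + dd i (U i) x * X x))"
   by (intro ext arg_cong[of _ _ "\<lambda>y. _ * y"] dd_mult sd sm i)
  finally show ?thesis .
 qed
 have "(LBINT x. X x * S x) = (\<Sum>i\<in>Basis. \<Sum>j\<in>Basis. \<integral>x. X x * (dd j (U i) x * dd j (U i) x) \<partial>lborel)"
 proof -
  have "(LBINT x. X x * S x) = (LBINT x. (\<Sum>i\<in>Basis. \<Sum>j\<in>Basis. X x * (dd j (U i) x * dd j (U i) x)))"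
   by (simp add: S_def sum_distrib_left power2_eq_square)
  also have "... = (\<Sum>i\<in>Basis. \<integral>x. (\<Sum>j\<in>Basis. X x * (dd j (U i) x * dd j (U i) x)) \<partial>lborel)"
   by (rule tf_integral_sum) (intro tf_sum t0)
  also have "... = (\<Sum>i\<in>Basis. \<Sum>j\<in>Basis. \<integral>x. X x * (dd j (U i) x * dd j (U i) x) \<partial>lborel)"
   by (intro sum.cong refl tf_integral_sum t0)
  finally show ?thesis .
 qed
 also have "... = (\<Sum>i\<in>Basis. (\<Sum>j\<in>Basis. - (LBINT x. U i x * (dd j X x * dd i (U j) x)))
   + (LBINT x. dv x * (U i x * dd i X x + dd i (U i) x * X x)))"
 proof (intro sum.cong refl)
  fix i :: 'a assume i: "i \<in> Basis"
  have "(\<Sum>j\<in>Basis. \<integral>x. X x * (dd j (U i) x * dd j (U i) x) \<partial>lborel)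
   = (\<Sum>j\<in>Basis. - (LBINT x. U i x * (dd j X x * dd i (U j) x)) - (LBINT x. U i x * (X x * dd i (dd j (U j)) x)))"
   by (intro sum.cong refl A i)
  then show "(\<Sum>j\<in>Basis. \<integral>x. X x * (dd j (U i) x * dd j (U i) x) \<partial>lborel)
   = (\<Sum>j\<in>Basis. - (LBINT x. U i x * (dd j X x * dd i (U j) x)))
   + (LBINT x. dv x * (U i x * dd i X x + dd i (U i) x * X x))"
   using B[OF i] by (simp add: sum_subtractf)
 qed
 also have "... = (LBINT x. (\<Sum>i\<in>Basis. (\<Sum>j\<in>Basis. - (U i x * (dd j X x * dd i (U j) x)))
   + dv x * (U i x * dd i X x + dd i (U i) x * X x)))"
 proof -
  have tm: "test_fun UNIV (\<lambda>x. - (U i x * (dd j X x * dd i (U j) x)))" if "i \<in> Basis" "j \<in> Basis" for i j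
   using tf_cmult[OF t1[OF that], of "-1"] by simp
  have "(LBINT x. (\<Sum>i\<in>Basis. (\<Sum>j\<in>Basis. - (U i x * (dd j X x * dd i (U j) x)))
    + dv x * (U i x * dd i X x + dd i (U i) x * X x)))
   = (\<Sum>i\<in>Basis. \<integral>x. (\<Sum>j\<in>Basis. - (U i x * (dd j X x * dd i (U j) x)))
    + dv x * (U i x * dd i X x + dd i (U i) x * X x) \<partial>lborel)"
   by (rule tf_integral_sum) (intro tf_add tf_sum tm t3)
  also have "... = (\<Sum>i\<in>Basis. (LBINT x. (\<Sum>j\<in>Basis. - (U i x * (dd j X x * dd i (U j) x))))
    + (LBINT x. dv x * (U i x * dd i X x + dd i (U i) x * X x)))"
   by (intro sum.cong refl Bochner_Integration.integral_add tf_integrable[of UNIV] tf_sum tm t3)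
  also have "... = (\<Sum>i\<in>Basis. (\<Sum>j\<in>Basis. - (LBINT x. U i x * (dd j X x * dd i (U j) x)))
   + (LBINT x. dv x * (U i x * dd i X x + dd i (U i) x * X x)))"
  proof (intro sum.cong refl arg_cong2[of _ _ _ _ "(+)"])
   fix i :: 'a assume i: "i \<in> Basis"
   show "(LBINT x. (\<Sum>j\<in>Basis. - (U i x * (dd j X x * dd i (U j) x))))
    = (\<Sum>j\<in>Basis. - (LBINT x. U i x * (dd j X x * dd i (U j) x)))"
    by (subst tf_integral_sum[OF tm[OF i]]) simp_all
  qed
  finally show ?thesis by simp
 qed
 \<comment> \<open>Young's inequality leaves half of the gradient integral on the right. It is
   absorbed at the end, which accounts for the factor 2 in the statement.\<close>
 also have "... <= (LBINT x. 1 / 2 * (X x * S x) + (2 * L^2 * real DIM('a) * (\<Sum>j\<in>Basis. (dd j \<zeta> x)^2) + D^2 * X x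
    + L * D * (\<Sum>j\<in>Basis. \<bar>dd j X x\<bar>)))"
 proof (rule integral_mono)
  show "intble (\<lambda>x. \<Sum>i\<in>Basis. (\<Sum>j\<in>Basis. - (U i x * (dd j X x * dd i (U j) x)))
   + dv x * (U i x * dd i X x + dd i (U i) x * X x))"
   by (intro tf_integrable[of UNIV] tf_sum tf_add t3) (use tf_cmult[OF t1, of _ _ "-1"] in simp_all)
  have iS: "intble (\<lambda>x. X x * S x)"
   unfolding S_def power2_eq_square by (intro tf_integrable[of UNIV] tf_mult'[OF X] sm)
  have i1: "intble (\<lambda>x. \<Sum>j\<in>Basis. (dd j \<zeta> x)^2)"
   unfolding power2_eq_square by (intro tf_integrable[of UNIV] tf_sum tf_mult'[OF tf_dd[OF \<zeta>]] sm)
  have i2: "intble (\<lambda>x. \<Sum>j\<in>Basis. \<bar>dd j X x\<bar>)"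
   by (intro Bochner_Integration.integrable_sum integrable_abs tf_integrable[OF tf_dd[OF X]])
  show "intble (\<lambda>x. 1 / 2 * (X x * S x) + (2 * L^2 * real DIM('a) * (\<Sum>j\<in>Basis. (dd j \<zeta> x)^2) + D^2 * X x
    + L * D * (\<Sum>j\<in>Basis. \<bar>dd j X x\<bar>)))"
   by (intro Bochner_Integration.integrable_add integrable_mult_right iS i1 i2 tf_integrable[OF X])
  fix x
  obtain b :: 'a where b: "b \<in> Basis" using nonempty_Basis by blast
  have L0: "0 <= L" using U(2)[OF b, of x] by linarith
  have D0: "0 <= D" using dvg[of x] by linarith
  have X0: "0 <= X x" by (simp add: X_def)
  have dX: "dd j X x = 2 * \<zeta> x * dd j \<zeta> x" for j
   unfolding X_def[abs_def] by (subst dd_mult) (simp_all add: sd \<zeta>s)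
  have 1: "- (U i x * (dd j X x * dd i (U j) x)) <= 1 / 2 * (X x * (dd i (U j) x)^2) + 2 * L^2 * (dd j \<zeta> x)^2"
   if i: "i \<in> Basis" for i j
  proof -
   have "- (U i x * (dd j X x * dd i (U j) x)) = 2 * (- (U i x * dd j \<zeta> x)) * (\<zeta> x * dd i (U j) x)"
    by (simp add: dX)
   also have "... <= 2 * (U i x * dd j \<zeta> x)^2 + 1 / 2 * (\<zeta> x * dd i (U j) x)^2"
    using sum_squares_bound[of "- 2 * (U i x * dd j \<zeta> x)" "\<zeta> x * dd i (U j) x"]
    by (simp add: power_mult_distrib field_simps)
   also have "(U i x * dd j \<zeta> x)^2 <= L^2 * (dd j \<zeta> x)^2"
    unfolding power_mult_distrib using U(2)[OF i, of x] L0
    by (intro mult_right_mono) (auto simp: abs_le_square_iff[symmetric])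
   finally show ?thesis by (simp add: X_def power_mult_distrib power2_eq_square[of "\<zeta> x"] algebra_simps)
  qed
  have "(\<Sum>i\<in>Basis. (\<Sum>j\<in>Basis. - (U i x * (dd j X x * dd i (U j) x))))
    <= (\<Sum>i\<in>Basis. (\<Sum>j\<in>Basis. 1 / 2 * (X x * (dd i (U j) x)^2) + 2 * L^2 * (dd j \<zeta> x)^2))"
   by (intro sum_mono 1)
  also have "... = 1 / 2 * (X x * (\<Sum>i\<in>Basis. \<Sum>j\<in>Basis. (dd i (U j) x)^2)) + 2 * L^2 * real DIM('a) * (\<Sum>j\<in>Basis. (dd j \<zeta> x)^2)"
   by (simp add: sum.distrib sum_distrib_left mult_ac)
  also have "(\<Sum>i\<in>Basis. \<Sum>j\<in>Basis. (dd i (U j) x)^2) = S x"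
   unfolding S_def by (rule sum.swap)
  finally have e1: "(\<Sum>i\<in>Basis. (\<Sum>j\<in>Basis. - (U i x * (dd j X x * dd i (U j) x))))
   <= 1 / 2 * (X x * S x) + 2 * L^2 * real DIM('a) * (\<Sum>j\<in>Basis. (dd j \<zeta> x)^2)" .
  have dvD: "\<bar>dv x\<bar> <= D" unfolding dv_def by (rule dvg)
  have e2: "(\<Sum>i\<in>Basis. dv x * (U i x * dd i X x)) <= L * D * (\<Sum>j\<in>Basis. \<bar>dd j X x\<bar>)"
   unfolding sum_distrib_left
  proof (intro sum_mono)
   fix i :: 'a assume i: "i \<in> Basis"
   have "dv x * (U i x * dd i X x) <= \<bar>dv x\<bar> * (\<bar>U i x\<bar> * \<bar>dd i X x\<bar>)" by (simp flip: abs_mult)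
   also have "... <= D * (L * \<bar>dd i X x\<bar>)"
    by (intro mult_mono dvD U(2)[OF i] order_refl) (use L0 D0 in auto)
   finally show "dv x * (U i x * dd i X x) <= L * D * \<bar>dd i X x\<bar>" by (simp add: mult_ac)
  qed
  have "(\<Sum>i\<in>Basis. dv x * (dd i (U i) x * X x)) = (dv x)^2 * X x"
   by (simp add: dv_def sum_distrib_left sum_distrib_right power2_eq_square mult_ac)
  also have "... <= D^2 * X x"
   using dvD D0 X0 by (intro mult_right_mono) (auto simp: abs_le_square_iff[symmetric])
  finally have e3: "(\<Sum>i\<in>Basis. dv x * (dd i (U i) x * X x)) <= D^2 * X x" .
  have "(\<Sum>i\<in>Basis. (\<Sum>j\<in>Basis. - (U i x * (dd j X x * dd i (U j) x)))
   + dv x * (U i x * dd i X x + dd i (U i) x * X x))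
   = (\<Sum>i\<in>Basis. (\<Sum>j\<in>Basis. - (U i x * (dd j X x * dd i (U j) x))))
   + (\<Sum>i\<in>Basis. dv x * (U i x * dd i X x)) + (\<Sum>i\<in>Basis. dv x * (dd i (U i) x * X x))"
   by (simp add: sum.distrib distrib_left)
  with e1 e2 e3 show "(\<Sum>i\<in>Basis. (\<Sum>j\<in>Basis. - (U i x * (dd j X x * dd i (U j) x)))
   + dv x * (U i x * dd i X x + dd i (U i) x * X x)) <= 1 / 2 * (X x * S x) + (2 * L^2 * real DIM('a) * (\<Sum>j\<in>Basis. (dd j \<zeta> x)^2) + D^2 * X x
    + L * D * (\<Sum>j\<in>Basis. \<bar>dd j X x\<bar>))"
   by linarith
 qed
 also have "... = 1 / 2 * (LBINT x. X x * S x) + (LBINT x. 2 * L^2 * real DIM('a) * (\<Sum>j\<in>Basis. (dd j \<zeta> x)^2) + D^2 * X x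
    + L * D * (\<Sum>j\<in>Basis. \<bar>dd j X x\<bar>))"
 proof -
  have iS: "intble (\<lambda>x. X x * S x)"
   unfolding S_def power2_eq_square by (intro tf_integrable[of UNIV] tf_mult'[OF X] sm)
  have i1: "intble (\<lambda>x. \<Sum>j\<in>Basis. (dd j \<zeta> x)^2)"
   unfolding power2_eq_square by (intro tf_integrable[of UNIV] tf_sum tf_mult'[OF tf_dd[OF \<zeta>]] sm)
  have i2: "intble (\<lambda>x. \<Sum>j\<in>Basis. \<bar>dd j X x\<bar>)"
   by (intro Bochner_Integration.integrable_sum integrable_abs tf_integrable[OF tf_dd[OF X]])
  have i3: "intble (\<lambda>x. 2 * L^2 * real DIM('a) * (\<Sum>j\<in>Basis. (dd j \<zeta> x)^2) + D^2 * X x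
    + L * D * (\<Sum>j\<in>Basis. \<bar>dd j X x\<bar>))"
   by (intro Bochner_Integration.integrable_add integrable_mult_right i1 i2 tf_integrable[OF X])
  show ?thesis using iS i3 by (subst Bochner_Integration.integral_add) simp_all
 qed
 finally show ?thesis unfolding S_def X_def by linarith
qed

text \<open>The fundamental theorem of calculus along the segment, then Jensen on the unit
  interval.\<close>

lemma difference_bound:
 fixes u :: "'a::euclidean_space => real"
 assumes u: "smooth u"
 shows "(u (x + h) - u x)^2 <= (norm h)^2 * (LBINT t. (norm (grad u (x + t *\<^sub>R h)))^2 * indicator {0..1} t)"
  and "intble (\<lambda>t. (norm (grad u (x + t *\<^sub>R h)))^2 * indicator {0..1::real} t)"
proof -
 define q where "q t = dd h u (x + t *\<^sub>R h)" for t
 have cont: "continuous_on UNIV (\<lambda>t. grad u (x + t *\<^sub>R h))"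
  by (rule continuous_on_compose2[OF grad_continuous_on[OF u, of UNIV]]) (auto intro!: continuous_intros)
 have cq: "continuous_on UNIV q"
  unfolding q_def
  by (rule continuous_on_compose2[OF smooth_continuous_on[OF smooth_dd[OF u], of UNIV]]) (auto intro!: continuous_intros)
 have icc: "intble (\<lambda>t. f t * indicator {0..1} t)" if "continuous_on UNIV f" for f :: "real => real"
  using borel_integrable_compact[of "{0..1}" f] that continuous_on_subset
  by (auto simp: mult.commute indicator_def if_distrib cong: if_cong)
 show i1: "intble (\<lambda>t. (norm (grad u (x + t *\<^sub>R h)))^2 * indicator {0..1::real} t)"
  by (rule icc) (intro continuous_intros cont)
 have "(LBINT t. q t * indicator {0..1} t) = u (x + 1 *\<^sub>R h) - u (x + 0 *\<^sub>R h)"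
  unfolding q_def
 proof (rule integral_FTC_Icc_real)
  show "isCont (\<lambda>t. dd h u (x + t *\<^sub>R h)) t" for t
   using cq by (simp add: q_def[abs_def] continuous_on_eq_continuous_at)
 qed (auto intro: line_derivative[OF u])
 then have "(u (x + h) - u x)^2 = (LBINT t. q t * indicator {0..1} t)^2" by simp
 also have "... <= (LBINT t. (q t)^2 * indicator {0..1} t)"
  by (rule square_integral_le) (auto intro!: icc cq continuous_intros)
 also have "... <= (LBINT t. (norm h)^2 * ((norm (grad u (x + t *\<^sub>R h)))^2 * indicator {0..1} t))"
 proof (rule integral_mono)
  show "intble (\<lambda>t. (q t)^2 * indicator {0..1} t)" by (rule icc) (intro continuous_intros cq)
  show "intble (\<lambda>t. (norm h)^2 * ((norm (grad u (x + t *\<^sub>R h)))^2 * indicator {0..1} t))" using i1 by simp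
  show "(q t)^2 * indicator {0..1} t <= (norm h)^2 * ((norm (grad u (x + t *\<^sub>R h)))^2 * indicator {0..1} t)" for t :: real
  proof -
   have "\<bar>q t\<bar> <= norm h * norm (grad u (x + t *\<^sub>R h))"
    unfolding q_def grad_inner[OF u, symmetric] using Cauchy_Schwarz_ineq2 by (metis mult.commute)
   then have "(q t)^2 <= (norm h * norm (grad u (x + t *\<^sub>R h)))^2"
    by (metis abs_ge_zero power2_abs power_mono)
   then show ?thesis by (auto simp: indicator_def power_mult_distrib)
  qed
 qed
 finally show "(u (x + h) - u x)^2 <= (norm h)^2 * (LBINT t. (norm (grad u (x + t *\<^sub>R h)))^2 * indicator {0..1} t)"
  by simp
qed

text \<open>Fubini and translation invariance applied to the segment bound. For shifts of length at
  most 1 the segments stay in the ball of radius \<open>r + 1\<close>.\<close>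

lemma difference_quotient_L2:
 fixes u :: "'a::euclidean_space => real"
 assumes u: "smooth u" and h: "norm h <= 1"
  and I: "(\<integral>\<^sup>+x. ennreal (indicator (cball 0 (r + 1)) x * (norm (grad u x))^2) \<partial>lborel) <= ennreal I" "0 <= I"
 shows "(\<integral>\<^sup>+x. ennreal (indicator (cball 0 r) x * (u (x + h) - u x)^2) \<partial>lborel) <= ennreal ((norm h)^2 * I)"
proof -
 have [measurable]: "borelf u" "grad u \<in> borel_measurable borel"
  using smooth_borel grad_borel u by blast+
 have "(\<integral>\<^sup>+x. ennreal (indicator (cball 0 r) x * (u (x + h) - u x)^2) \<partial>lborel)
  <= (\<integral>\<^sup>+x. ennreal ((norm h)^2) * (\<integral>\<^sup>+t. ennreal (indicator (cball 0 r) x * ((norm (grad u (x + t *\<^sub>R h)))^2 * indicator {0..1} t)) \<partial>lborel) \<partial>lborel)"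
 proof (intro nn_integral_mono)
  fix x
  let ?J = "LBINT t. (norm (grad u (x + t *\<^sub>R h)))^2 * indicator {0..1} t"
  have "indicator (cball 0 r) x * (u (x + h) - u x)^2 <= (norm h)^2 * (indicator (cball 0 r) x * ?J)"
   using difference_bound(1)[OF u, of x h] by (auto simp: indicator_def)
  then have "ennreal (indicator (cball 0 r) x * (u (x + h) - u x)^2) <= ennreal ((norm h)^2) * ennreal (indicator (cball 0 r) x * ?J)"
   by (subst ennreal_mult[symmetric]) (auto intro: ennreal_leI)
  also have "ennreal (indicator (cball 0 r) x * ?J) = (\<integral>\<^sup>+t. ennreal (indicator (cball 0 r) x * ((norm (grad u (x + t *\<^sub>R h)))^2 * indicator {0..1} t)) \<partial>lborel)"
   using difference_bound(2)[OF u, of x h]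
   by (subst nn_integral_eq_integral) auto
  finally show "ennreal (indicator (cball 0 r) x * (u (x + h) - u x)^2) <= ennreal ((norm h)^2) *
   (\<integral>\<^sup>+t. ennreal (indicator (cball 0 r) x * ((norm (grad u (x + t *\<^sub>R h)))^2 * indicator {0..1} t)) \<partial>lborel)" .
 qed
 also have "... = ennreal ((norm h)^2) * (\<integral>\<^sup>+x. (\<integral>\<^sup>+t. ennreal (indicator (cball 0 r) x * ((norm (grad u (x + t *\<^sub>R h)))^2 * indicator {0..1} t)) \<partial>lborel) \<partial>lborel)"
  by (rule nn_integral_cmult) measurable
 also have "(\<integral>\<^sup>+x. (\<integral>\<^sup>+t. ennreal (indicator (cball 0 r) x * ((norm (grad u (x + t *\<^sub>R h)))^2 * indicator {0..1} t)) \<partial>lborel) \<partial>lborel)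
  = (\<integral>\<^sup>+t. (\<integral>\<^sup>+x. ennreal (indicator (cball 0 r) x * ((norm (grad u (x + t *\<^sub>R h)))^2 * indicator {0..1} t)) \<partial>lborel) \<partial>lborel)"
  by (rule lborel_pair.Fubini') measurable
 also have "... <= (\<integral>\<^sup>+t. ennreal I * indicator {0..1::real} t \<partial>lborel)"
 proof (intro nn_integral_mono)
  fix t :: real
  show "(\<integral>\<^sup>+x. ennreal (indicator (cball 0 r) x * ((norm (grad u (x + t *\<^sub>R h)))^2 * indicator {0..1} t)) \<partial>lborel) <= ennreal I * indicator {0..1} t"
  proof (cases "t \<in> {0..1}")
   case True
   have th: "norm (t *\<^sub>R h) <= 1" using True h by (auto intro: mult_le_one)
   have "(\<integral>\<^sup>+x. ennreal (indicator (cball 0 r) x * ((norm (grad u (x + t *\<^sub>R h)))^2 * indicator {0..1} t)) \<partial>lborel)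
    <= (\<integral>\<^sup>+x. ennreal (indicator (cball 0 (r + 1)) (t *\<^sub>R h + x) * (norm (grad u (t *\<^sub>R h + x)))^2) \<partial>lborel)"
   proof (intro nn_integral_mono ennreal_leI)
    fix x
    have "x \<in> cball 0 r ==> t *\<^sub>R h + x \<in> cball 0 (r + 1)"
     using th norm_triangle_ineq[of "t *\<^sub>R h" x] by auto
    then show "indicator (cball 0 r) x * ((norm (grad u (x + t *\<^sub>R h)))^2 * indicator {0..1} t)
     <= indicator (cball 0 (r + 1)) (t *\<^sub>R h + x) * (norm (grad u (t *\<^sub>R h + x)))^2"
     using True by (auto simp: indicator_def add.commute)
   qed
   also have "... = (\<integral>\<^sup>+x. ennreal (indicator (cball 0 (r + 1)) x * (norm (grad u x))^2) \<partial>lborel)"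
    by (rule nn_integral_shift) measurable
   finally show ?thesis using True I by simp
  qed simp
 qed
 also have "... = ennreal I" by (subst nn_integral_cmult_indicator) simp_all
 finally show ?thesis
  unfolding ennreal_mult[OF zero_le_power2 I(2)] by (metis mult_left_mono zero_le)
qed

text \<open>The last clause says that \<open>v\<close> is curl-free; it makes the bound on the divergence control the
 difference quotients of \<open>v\<close>.\<close>

definition regular_field :: "real => real => ('a::euclidean_space => 'a) => bool" where
 "regular_field L D v \<longleftrightarrow> continuous_on UNIV v \<and> (\<forall>x. norm (v x) <= L) \<and>
  (\<forall>g. test_fun UNIV g --> \<bar>LBINT x. v x \<bullet> grad g x\<bar> <= D * (LBINT x. \<bar>g x\<bar>)) \<and>
  (\<forall>g. \<forall>i\<in>Basis. \<forall>j\<in>Basis. test_fun UNIV g -->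
    (LBINT x. (v x \<bullet> i) * dd j g x) = (LBINT x. (v x \<bullet> j) * dd i g x))"

context cutoff
begin

lemma conv_mol_tendsto:
 fixes f :: "'a => real"
 assumes f: "continuous_on UNIV f" "!!x. \<bar>f x\<bar> <= B"
 shows "(\<lambda>n. conv f (mol (1 / real (Suc n))) x) \<longlonglongrightarrow> f x"
proof (rule LIMSEQ_I)
 have [measurable]: "borelf f" using f(1) by (rule borel_measurable_continuous_onI)
 have lf: "locint f" by (rule locint_bounded[OF _ f(2)]) simp
 fix e :: real assume e: "e > 0"
 have "isCont f x" using f(1) by (simp add: continuous_on_eq_continuous_at)
 then obtain d where d: "d > 0" "!!y. dist y x < d ==> dist (f y) (f x) < e / 2"
  unfolding continuous_at_eps_delta using e half_gt_zero by blast
 obtain N :: nat where N: "2 / d < real N" using reals_Archimedean2 by blast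
 show "\<exists>no. \<forall>n\<ge>no. norm (conv f (mol (1 / real (Suc n))) x - f x) < e"
 proof (intro exI allI impI)
  fix n assume n: "N <= n"
  define \<epsilon> where "\<epsilon> = 1 / real (Suc n)"
  have ep: "\<epsilon> > 0" by (simp add: \<epsilon>_def)
  have "2 / d < real (Suc n)" using N n by linarith
  then have ed: "2 * \<epsilon> < d" using d by (simp add: \<epsilon>_def field_simps)
  have i: "intble (\<lambda>y. f y * mol \<epsilon> (x - y))" "intble (\<lambda>y. mol \<epsilon> (x - y))"
   by (rule conv_integrable[OF lf mol_tf[OF ep]], rule mol_shift_integrable[OF ep])
  have "conv f (mol \<epsilon>) x - f x = (LBINT y. f y * mol \<epsilon> (x - y) - f x * mol \<epsilon> (x - y))"
   using i by (simp add: conv_def mol_shift_integral[OF ep])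
  also have "norm \<dots> <= (LBINT y. e / 2 * mol \<epsilon> (x - y))"
  proof (rule Bochner_Integration.integral_norm_bound_integral)
   fix y
   show "norm (f y * mol \<epsilon> (x - y) - f x * mol \<epsilon> (x - y)) <= e / 2 * mol \<epsilon> (x - y)"
   proof (cases "norm (x - y) \<ge> 2 * \<epsilon>")
    case False
    then have "dist y x < d" using ed by (simp add: dist_norm norm_minus_commute)
    then have "\<bar>f y - f x\<bar> <= e / 2" using d(2)[of y] by (simp add: dist_norm)
    from mult_right_mono[OF this mol_nonneg[OF ep, of "x - y"]] show ?thesis
     using mol_nonneg[OF ep, of "x - y"] by (simp add: abs_mult flip: left_diff_distrib)
   qed (simp add: mol_zero[OF ep])
  qed (use i in auto)
  also have "... = e / 2" by (simp add: mol_shift_integral[OF ep])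
  finally show "norm (conv f (mol (1 / real (Suc n))) x - f x) < e" using e by (simp add: \<epsilon>_def)
 qed
qed

text \<open>The weak conditions on \<open>v\<close>, tested with the translated mollifier, become
  pointwise conditions on the mollified components. The constants do not see
  \<open>\<epsilon>\<close>, as the mollifier has mass one.\<close>

lemma regular_field_conv:
 assumes v: "regular_field L D v" and ep: "\<epsilon> > 0"
 defines "U \<equiv> \<lambda>i. conv (\<lambda>y. v y \<bullet> i) (mol \<epsilon>)"
 shows "i \<in> Basis ==> locint (\<lambda>y. v y \<bullet> i)"
  and "i \<in> Basis ==> smooth (U i)" and "i \<in> Basis ==> \<bar>U i x\<bar> <= L"
  and "i \<in> Basis ==> j \<in> Basis ==> dd j (U i) x = dd i (U j) x"
  and "\<bar>\<Sum>i\<in>Basis. dd i (U i) x\<bar> <= D"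
proof -
 have vc: "continuous_on UNIV v" and vb: "!!x. norm (v x) <= L" using v by (auto simp: regular_field_def)
 have [measurable]: "borelf v" using vc by (rule borel_measurable_continuous_onI)
 have vi: "\<bar>v y \<bullet> i\<bar> <= L" if "i \<in> Basis" for y i using vb[of y] Basis_le_norm[OF that, of "v y"] by linarith
 show li: "i \<in> Basis ==> locint (\<lambda>y. v y \<bullet> i)" for i by (rule locint_bounded[OF _ vi]) auto
 show "i \<in> Basis ==> smooth (U i)" unfolding U_def by (intro smooth_conv li mol_tf ep)
 show "i \<in> Basis ==> \<bar>U i x\<bar> <= L" unfolding U_def by (intro conv_mol_bounded li ep AE_I2 vi)
 have g: "test_fun UNIV (\<lambda>y. mol \<epsilon> (x - y))" for x by (rule tf_reflect[OF mol_tf[OF ep]])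
 have dU: "dd j (U i) x = - (LBINT y. (v y \<bullet> i) * dd j (\<lambda>y. mol \<epsilon> (x - y)) y)" if "i \<in> Basis" for i j x
 proof -
  have "dd j (U i) x = (LBINT y. (v y \<bullet> i) * dd j (mol \<epsilon>) (x - y))"
   unfolding U_def using dd_conv[OF li[OF that] mol_tf[OF ep], of j] by (simp add: conv_def fun_eq_iff)
  then show ?thesis by (simp add: dd_reflect[OF mol_smooth[OF ep]])
 qed
 show "i \<in> Basis ==> j \<in> Basis ==> dd j (U i) x = dd i (U j) x"
  unfolding dU using v g[of x] by (simp add: regular_field_def)
 have "(\<Sum>i\<in>Basis. dd i (U i) x) = - (\<Sum>i\<in>Basis. \<integral>y. (v y \<bullet> i) * dd i (\<lambda>y. mol \<epsilon> (x - y)) y \<partial>lborel)"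
  by (simp add: dU sum_negf)
 also have "... = - (LBINT y. (\<Sum>i\<in>Basis. (v y \<bullet> i) * dd i (\<lambda>y. mol \<epsilon> (x - y)) y))"
  by (subst Bochner_Integration.integral_sum) (auto intro!: locint_tf[OF li tf_dd[OF g]])
 also have "... = - (LBINT y. v y \<bullet> grad (\<lambda>y. mol \<epsilon> (x - y)) y)"
  by (simp add: grad_def inner_sum_right mult.commute)
 also have "\<bar>\<dots>\<bar> <= D * (LBINT y. \<bar>mol \<epsilon> (x - y)\<bar>)"
  using v g[of x] unfolding regular_field_def by simp
 also have "... = D" using mol_nonneg[OF ep] by (simp add: mol_shift_integral[OF ep])
 finally show "\<bar>\<Sum>i\<in>Basis. dd i (U i) x\<bar> <= D" .
qed

text \<open>The Caccioppoli estimate is applied to mollified fields and the scale is sent to zero.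
  The constant depends on \<open>r\<close>, \<open>L\<close> and \<open>D\<close> and is chosen
  before the field; this uniformity is needed since the velocity changes with time.\<close>

lemma regular_field_difference:
 assumes r: "r > 0"
 obtains C where "C \<ge> 0" "!!(v :: 'a => 'a) h. regular_field L D v ==> norm h <= 1 ==>
  (LBINT x. indicator (cball 0 r) x * (norm (v (x + h) - v x))^2) <= C * (norm h)^2"
proof -
 \<comment> \<open>This cutoff is 1 on the ball of radius \<open>r + 1\<close>, the ball that the
   segments of length at most 1 starting in \<open>cball 0 r\<close> can reach.\<close>
 define \<zeta> where "\<zeta> x = a (x /\<^sub>R (r + 2))" for x
 have \<zeta>: "test_fun UNIV \<zeta>" unfolding \<zeta>_def[abs_def] using r by (intro a_scale_tf) auto
 define I where "I = 2 * (LBINT x. 2 * L^2 * real DIM('a) * (\<Sum>j\<in>Basis. (dd j \<zeta> x)^2) + D^2 * (\<zeta> x * \<zeta> x)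
    + L * D * (\<Sum>j\<in>Basis. \<bar>dd j (\<lambda>x. \<zeta> x * \<zeta> x) x\<bar>))"
 \<comment> \<open>\<open>L\<close> and \<open>D\<close> are arbitrary reals at this point, so
   \<open>I\<close> may be negative when no field is regular.\<close>
 define C where "C = real DIM('a) * max 0 I"
 have main: "(LBINT x. indicator (cball 0 r) x * (norm (v (x + h) - v x))^2) <= C * (norm h)^2"
  if v: "regular_field L D v" and h: "norm h <= 1" for v :: "'a => 'a" and h
 proof -
  have vc: "continuous_on UNIV v" and vb: "!!x. norm (v x) <= L" using v by (auto simp: regular_field_def)
  have [measurable]: "borelf v" using vc by (rule borel_measurable_continuous_onI)
  have vi: "\<bar>v y \<bullet> i\<bar> <= L" if "i \<in> Basis" for y i using vb[of y] Basis_le_norm[OF that, of "v y"] by linarith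
  have L0: "0 <= L" using vb[of 0] norm_ge_zero order_trans by blast
  have iB: "intble (\<lambda>x::'a. (2 * L)^2 * indicator (cball 0 r) x)"
   by (intro integrable_mult_right integrable_real_indicator) (auto simp: emeasure_lborel_cball_finite[simplified])
  have comp: "(LBINT x. indicator (cball 0 r) x * ((v (x + h) - v x) \<bullet> i)^2) <= (norm h)^2 * max 0 I"
   and compi: "intble (\<lambda>x. indicator (cball 0 r) x * ((v (x + h) - v x) \<bullet> i)^2)"
   if i: "i \<in> Basis" for i
  proof -
   let ?\<epsilon> = "\<lambda>n. 1 / real (Suc n)"
   let ?U = "\<lambda>n i. conv (\<lambda>y. v y \<bullet> i) (mol (?\<epsilon> n))"
   have ep: "?\<epsilon> n > 0" for n by simp
   note rc = regular_field_conv[OF v ep]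
   have [measurable]: "?U n i \<in> borel_measurable borel" for n by (rule smooth_borel[OF rc(2)[OF i]])
   have Ub: "\<bar>?U n i z\<bar> <= L" for n z by (rule rc(3)[OF i])
   have lim: "(\<lambda>n. indicator (cball 0 r) x * (?U n i (x + h) - ?U n i x)^2)
     \<longlonglongrightarrow> indicator (cball 0 r) x * ((v (x + h) - v x) \<bullet> i)^2" for x
    unfolding inner_diff_left
    by (intro tendsto_intros conv_mol_tendsto[OF _ vi[OF i]] continuous_intros vc)
   have dom: "norm (indicator (cball 0 r) x * (?U n i (x + h) - ?U n i x)^2) <= (2 * L)^2 * indicator (cball 0 r) x" for n x
   proof -
    have "\<bar>?U n i (x + h) - ?U n i x\<bar> <= \<bar>2 * L\<bar>"
     using Ub[of n x] Ub[of n "x + h"] L0 by linarith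
    then have "(?U n i (x + h) - ?U n i x)^2 <= (2 * L)^2" by (simp only: abs_le_square_iff)
    then show ?thesis by (auto simp: indicator_def)
   qed
   have ms: "(\<lambda>x. indicator (cball 0 r) x * (?U n i (x + h) - ?U n i x)^2) \<in> borel_measurable lborel" for n
    by measurable
   have mv: "(\<lambda>x. indicator (cball 0 r) x * ((v (x + h) - v x) \<bullet> i)^2) \<in> borel_measurable lborel"
    by measurable
   note dct = mv ms iB AE_I2[OF lim] AE_I2[OF dom]
   show compi: "intble (\<lambda>x. indicator (cball 0 r) x * ((v (x + h) - v x) \<bullet> i)^2)"
    by (rule integrable_dominated_convergence[OF dct])
   have conv: "(\<lambda>n. \<integral>x. indicator (cball 0 r) x * (?U n i (x + h) - ?U n i x)^2 \<partial>lborel)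
     \<longlonglongrightarrow> (LBINT x. indicator (cball 0 r) x * ((v (x + h) - v x) \<bullet> i)^2)"
    by (rule integral_dominated_convergence[OF dct])
   have each: "(LBINT x. indicator (cball 0 r) x * (?U n i (x + h) - ?U n i x)^2) <= (norm h)^2 * max 0 I" for n
   proof -
    let ?S = "\<lambda>x. \<Sum>i\<in>Basis. \<Sum>j\<in>Basis. (dd j (?U n i) x)^2"
    have cac: "(LBINT x. \<zeta> x * \<zeta> x * ?S x) <= I"
     unfolding I_def by (rule caccioppoli[OF \<zeta> rc(2,3,4,5)])
    have iS: "intble (\<lambda>x. \<zeta> x * \<zeta> x * ?S x)"
     unfolding power2_eq_square
     by (intro tf_integrable[of UNIV] tf_mult'[OF tf_mult[OF \<zeta> tf_smooth[OF \<zeta>]]] smooth_sum smooth_mult smooth_dd rc(2))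
    have S0: "0 <= \<zeta> x * \<zeta> x * ?S x" for x
     by (intro mult_nonneg_nonneg sum_nonneg) (auto simp: \<zeta>_def a_nonneg)
    have "(\<integral>\<^sup>+x. ennreal (indicator (cball 0 (r + 1)) x * (norm (grad (?U n i) x))^2) \<partial>lborel)
      <= (\<integral>\<^sup>+x. ennreal (\<zeta> x * \<zeta> x * ?S x) \<partial>lborel)"
    proof (intro nn_integral_mono ennreal_leI)
     fix x
     show "indicator (cball 0 (r + 1)) x * (norm (grad (?U n i) x))^2 <= \<zeta> x * \<zeta> x * ?S x"
     proof (cases "x \<in> cball 0 (r + 1)")
      case True
      then have "norm (x /\<^sub>R (r + 2)) < 1" using r by (simp add: field_simps)
      then have "\<zeta> x = 1" by (simp add: \<zeta>_def a_one)
      moreover have "(norm (grad (?U n i) x))^2 = (\<Sum>j\<in>Basis. (dd j (?U n i) x)^2)"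
       unfolding norm_sq_sum grad_inner[OF rc(2)[OF i]] ..
      moreover have "... <= ?S x"
       using sum_nonneg member_le_sum[OF i, of "\<lambda>i. \<Sum>j\<in>Basis. (dd j (?U n i) x)^2"]
       by (simp add: sum_nonneg)
      ultimately show ?thesis using True by simp
     qed (use S0 in simp)
    qed
    also have "... <= ennreal (max 0 I)"
     using cac iS S0 by (subst nn_integral_eq_integral) (auto intro: ennreal_leI)
    finally have "(\<integral>\<^sup>+x. ennreal (indicator (cball 0 (r + 1)) x * (norm (grad (?U n i) x))^2) \<partial>lborel) <= ennreal (max 0 I)" .
    from difference_quotient_L2[OF rc(2)[OF i] h this]
    have "(\<integral>\<^sup>+x. ennreal (indicator (cball 0 r) x * (?U n i (x + h) - ?U n i x)^2) \<partial>lborel) <= ennreal ((norm h)^2 * max 0 I)" by simp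
    then show ?thesis by (intro integral_le_nn_integral(2)[OF ms]) simp_all
   qed
   show "(LBINT x. indicator (cball 0 r) x * ((v (x + h) - v x) \<bullet> i)^2) <= (norm h)^2 * max 0 I"
    by (rule LIMSEQ_le_const2[OF conv]) (use each in auto)
  qed
  have "(LBINT x. indicator (cball 0 r) x * (norm (v (x + h) - v x))^2)
    = (LBINT x. (\<Sum>i\<in>Basis. indicator (cball 0 r) x * ((v (x + h) - v x) \<bullet> i)^2))"
   by (simp add: norm_sq_sum sum_distrib_left)
  also have "... = (\<Sum>i\<in>Basis. \<integral>x. indicator (cball 0 r) x * ((v (x + h) - v x) \<bullet> i)^2 \<partial>lborel)"
   by (rule Bochner_Integration.integral_sum) (rule compi)
  also have "... <= (\<Sum>i\<in>(Basis::'a set). (norm h)^2 * max 0 I)" by (intro sum_mono comp)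
  finally show ?thesis by (simp add: C_def mult_ac)
 qed
 show ?thesis by (rule that[of C]) (use main in \<open>auto simp: C_def\<close>)
qed

end

subsection \<open>The mollified energy at a fixed time\<close>

lemma L1_Linf_nonneg: "L1_Linf_le f M ==> 0 <= M"
 unfolding L1_Linf_le_def using AE_bound_nonneg by blast

lemma L1_Linf_L2:
 assumes "L1_Linf_le (f :: 'a::euclidean_space => real) M"
 shows "in_L2 f" "(LBINT x. (f x)^2) <= M^2"
proof -
 have f: "intble f" "(LBINT x. \<bar>f x\<bar>) <= M" "AE x in lborel. \<bar>f x\<bar> <= M"
  using assms by (auto simp: L1_Linf_le_def)
 have [measurable]: "borelf f" using f by auto
 have M: "0 <= M" by (rule L1_Linf_nonneg[OF assms])
 have i: "intble (\<lambda>x. M * \<bar>f x\<bar>)" using f by simp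
 have bd: "AE x in lborel. (f x)^2 <= M * \<bar>f x\<bar>"
  using f(3)
 proof eventually_elim
  case (elim x)
  from mult_right_mono[OF this abs_ge_zero[of "f x"]] show ?case by (simp add: power2_eq_square)
 qed
 have i2: "intble (\<lambda>x. (f x)^2)"
 proof (rule Bochner_Integration.integrable_bound[OF i])
  show "AE x in lborel. norm ((f x)^2) <= norm (M * \<bar>f x\<bar>)"
   using bd by eventually_elim (simp add: abs_mult M)
 qed measurable
 then show "in_L2 f" by (simp add: in_L2_real)
 have "(LBINT x. (f x)^2) <= (LBINT x. M * \<bar>f x\<bar>)" by (rule integral_mono_AE[OF i2 i bd])
 also have "... <= M * M" using f(2) M by (simp add: mult_left_mono)
 finally show "(LBINT x. (f x)^2) <= M^2" by (simp add: power2_eq_square)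
qed

lemma integrable_bounded_mult:
 fixes F p :: "'a::euclidean_space => real"
 assumes F: "intble F" and p: "borelf p" "!!x. \<bar>p x\<bar> <= P"
 shows "intble (\<lambda>x. p x * F x)"
proof (rule Bochner_Integration.integrable_bound[of _ "\<lambda>x. P * F x"])
 have P: "0 <= P" using p(2)[of undefined] by linarith
 show "AE x in lborel. norm (p x * F x) <= norm (P * F x)"
  using p P by (intro AE_I2) (auto simp: abs_mult intro!: mult_right_mono)
 show "(\<lambda>x. p x * F x) \<in> borel_measurable lborel" using F p by measurable
qed (use F in simp)

text \<open>Young's inequality in the form g^2 <= (1 + \<mu>) f^2 + (2 / \<mu>) (g - f)^2. The first
  coefficient stays close to 1, so replacing the density by its mollification costs only a multiple
  of \<open>\<mu> + S / \<mu>\<close>, which is small once \<open>S\<close> is of order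
  \<mu>^2.\<close>

lemma weighted_square_le:
 fixes f g p :: "'a::euclidean_space => real"
 assumes f: "in_L2 f" "(LBINT x. (f x)^2) <= Q" and g: "in_L2 g" "(LBINT x. (g x - f x)^2) <= S"
  and p: "borelf p" "!!x. 0 <= p x" "!!x. p x <= P" and l: "0 < \<mu>" "\<mu> <= 1"
 shows "(LBINT x. p x * (g x)^2) <= (LBINT x. p x * (f x)^2) + P * (Q + 2) * (\<mu> + S / \<mu>)"
proof -
 have P: "0 <= P" using p(2)[of undefined] p(3)[of undefined] by linarith
 have S: "0 <= S" by (rule order_trans[OF _ g(2)]) simp
 have Q: "0 <= Q" by (rule order_trans[OF _ f(2)]) simp
 have pa: "\<bar>p x\<bar> <= P" for x using p by simp
 have iff2: "intble (\<lambda>x. (f x)^2)" and ig: "intble (\<lambda>x. (g x)^2)"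
  and id: "intble (\<lambda>x. (g x - f x)^2)"
  using f g in_L2_diff[OF g(1) f(1)] by (auto simp: in_L2_real)
 note ip = integrable_bounded_mult[OF _ p(1) pa]
 have pw: "(g x)^2 <= (1 + \<mu>) * (f x)^2 + 2 / \<mu> * (g x - f x)^2" for x
 proof -
  have "2 * (f x) * (g x - f x) <= \<mu> * (f x)^2 + 1 / \<mu> * (g x - f x)^2"
  proof -
   have "0 <= (sqrt \<mu> * f x - (g x - f x) / sqrt \<mu>)^2" by simp
   also have "... = \<mu> * (f x)^2 - 2 * (f x) * (g x - f x) + 1 / \<mu> * (g x - f x)^2"
    using l by (simp add: power2_diff power_mult_distrib power_divide)
   finally show ?thesis by simp
  qed
  moreover have "(g x - f x)^2 + 1 / \<mu> * (g x - f x)^2 <= 2 / \<mu> * (g x - f x)^2"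
   using l mult_right_mono[of 1 "1 / \<mu>" "(g x - f x)^2"] by simp
  moreover have "(g x)^2 = (f x)^2 + 2 * (f x) * (g x - f x) + (g x - f x)^2"
   by (simp add: power2_eq_square algebra_simps)
  ultimately show ?thesis by (simp add: distrib_right)
 qed
 have "(LBINT x. p x * (g x)^2) <= (LBINT x. (1 + \<mu>) * (p x * (f x)^2) + 2 / \<mu> * (p x * (g x - f x)^2))"
 proof (rule integral_mono)
  show "p x * (g x)^2 <= (1 + \<mu>) * (p x * (f x)^2) + 2 / \<mu> * (p x * (g x - f x)^2)" for x
   using mult_left_mono[OF pw p(2), of x x] by (simp add: algebra_simps)
 qed (use ip iff2 ig id in auto)
 also have "... = (LBINT x. p x * (f x)^2) + \<mu> * (LBINT x. p x * (f x)^2) + 2 / \<mu> * (LBINT x. p x * (g x - f x)^2)"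
  using ip[OF iff2] ip[OF id] by (simp add: distrib_right)
 finally have e1: "(LBINT x. p x * (g x)^2) <= \<dots>" .
 have e2: "(LBINT x. p x * (f x)^2) <= P * Q"
 proof -
  have "(LBINT x. p x * (f x)^2) <= (LBINT x. P * (f x)^2)"
   using ip[OF iff2] iff2 p by (intro integral_mono) (auto intro!: mult_right_mono)
  also have "... <= P * Q" using f(2) P by (simp add: mult_left_mono)
  finally show ?thesis .
 qed
 have e3: "(LBINT x. p x * (g x - f x)^2) <= P * S"
 proof -
  have "(LBINT x. p x * (g x - f x)^2) <= (LBINT x. P * (g x - f x)^2)"
   using ip[OF id] id p by (intro integral_mono) (auto intro!: mult_right_mono)
  also have "... <= P * S" using g(2) P by (simp add: mult_left_mono)
  finally show ?thesis .
 qed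
 have le: "(LBINT x. p x * (g x)^2) <= (LBINT x. p x * (f x)^2) + \<mu> * (P * Q) + 2 / \<mu> * (P * S)"
  using l by (intro order_trans[OF e1] add_mono mult_left_mono e2 e3) auto
 have "\<mu> * (P * Q) + 2 / \<mu> * (P * S) <= P * (Q + 2) * (\<mu> + S / \<mu>)"
  using P Q S l by (simp add: algebra_simps)
 with le show ?thesis by linarith
qed

text \<open>Integration by parts against \<beta>^2 u produces two copies of the weighted
  dissipation. One is kept; the other, together with the cross term and the right-hand side, forms
  the perfect square of \<beta> dd i u + 2 u dd i \<beta>.\<close>

lemma viscous_energy:
 fixes u \<beta> :: "'a::euclidean_space => real"
 assumes u: "smooth u" and \<beta>: "test_fun UNIV \<beta>"
 shows "2 * (LBINT x. (\<beta> x)^2 * u x * (\<Sum>i\<in>Basis. dd i (dd i u) x)) + (LBINT x. (\<beta> x)^2 * (norm (grad u x))^2)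
  <= 4 * (LBINT x. (norm (grad \<beta> x))^2 * (u x)^2)"
proof -
 have \<beta>s: "smooth \<beta>" by (rule tf_smooth[OF \<beta>])
 note sm = smooth_dd smooth_mult smooth_add smooth_sum u \<beta>s
 note sd = smooth_differentiable
 define w where "w x = \<beta> x * (\<beta> x * u x)" for x
 have w: "test_fun UNIV w" unfolding w_def[abs_def] by (intro tf_mult'[OF \<beta>] sm)
 have dw: "dd i w x = \<beta> x * (\<beta> x * dd i u x) + 2 * (\<beta> x * dd i \<beta> x * u x)" for i x
 proof -
  have "dd i (\<lambda>x. \<beta> x * u x) x = \<beta> x * dd i u x + dd i \<beta> x * u x" by (intro dd_mult sd sm)
  moreover have "dd i w x = \<beta> x * dd i (\<lambda>x. \<beta> x * u x) x + dd i \<beta> x * (\<beta> x * u x)"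
   unfolding w_def[abs_def] by (intro dd_mult sd sm)
  ultimately show ?thesis by (simp add: algebra_simps)
 qed
 have t1: "test_fun UNIV (\<lambda>x. dd i (dd i u) x * w x)" and t2: "test_fun UNIV (\<lambda>x. dd i u x * dd i w x)" for i
  by (intro tf_mult[OF w] sm, intro tf_mult[OF tf_dd[OF w]] sm)
 have t3: "test_fun UNIV (\<lambda>x. \<beta> x * (\<beta> x * (\<Sum>i\<in>Basis. dd i u x * dd i u x)))" by (intro tf_mult'[OF \<beta>] sm)
 have t4: "test_fun UNIV (\<lambda>x. (\<Sum>i\<in>Basis. dd i \<beta> x * dd i \<beta> x) * (u x * u x))"
  by (intro tf_mult'[OF tf_sum] tf_mult[OF tf_dd[OF \<beta>]] sm)
 have gu: "(norm (grad u x))^2 = (\<Sum>i\<in>Basis. dd i u x * dd i u x)" for x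
  unfolding norm_sq_sum grad_inner[OF u] by (simp add: power2_eq_square)
 have gb: "(norm (grad \<beta> x))^2 = (\<Sum>i\<in>Basis. dd i \<beta> x * dd i \<beta> x)" for x
  unfolding norm_sq_sum grad_inner[OF \<beta>s] by (simp add: power2_eq_square)
 have "(LBINT x. (\<beta> x)^2 * u x * (\<Sum>i\<in>Basis. dd i (dd i u) x)) = (LBINT x. (\<Sum>i\<in>Basis. dd i (dd i u) x * w x))"
  by (simp add: w_def sum_distrib_left sum_distrib_right power2_eq_square mult_ac)
 also have "... = (\<Sum>i\<in>Basis. \<integral>x. dd i (dd i u) x * w x \<partial>lborel)" by (rule tf_integral_sum[OF t1])
 also have "... = (\<Sum>i\<in>Basis. - (LBINT x. dd i u x * dd i w x))"
  by (intro sum.cong refl integration_by_parts w sm)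
 also have "... = - (LBINT x. (\<Sum>i\<in>Basis. dd i u x * dd i w x))"
  by (subst tf_integral_sum[OF t2]) (simp_all add: sum_negf)
 finally have eq: "(LBINT x. (\<beta> x)^2 * u x * (\<Sum>i\<in>Basis. dd i (dd i u) x))
  = - (LBINT x. (\<Sum>i\<in>Basis. dd i u x * dd i w x))" .
 have "(LBINT x. (\<beta> x)^2 * (norm (grad u x))^2) - 2 * (LBINT x. (\<Sum>i\<in>Basis. dd i u x * dd i w x))
  = (LBINT x. \<beta> x * (\<beta> x * (\<Sum>i\<in>Basis. dd i u x * dd i u x)) - 2 * (\<Sum>i\<in>Basis. dd i u x * dd i w x))"
  unfolding gu unfolding power2_eq_square mult.assoc
  by (subst Bochner_Integration.integral_diff) (auto intro!: tf_integrable[OF t3] tf_integrable[OF tf_sum[OF t2]] integrable_mult_right)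
 also have "... <= (LBINT x. 4 * ((\<Sum>i\<in>Basis. dd i \<beta> x * dd i \<beta> x) * (u x * u x)))"
 proof (rule integral_mono)
  show "intble (\<lambda>x. \<beta> x * (\<beta> x * (\<Sum>i\<in>Basis. dd i u x * dd i u x)) - 2 * (\<Sum>i\<in>Basis. dd i u x * dd i w x))"
   by (intro Bochner_Integration.integrable_diff integrable_mult_right tf_integrable[OF t3] tf_integrable[OF tf_sum[OF t2]])
  show "intble (\<lambda>x. 4 * ((\<Sum>i\<in>Basis. dd i \<beta> x * dd i \<beta> x) * (u x * u x)))"
   by (intro integrable_mult_right tf_integrable[OF t4])
  fix x
  have "\<beta> x * (\<beta> x * (dd i u x * dd i u x)) - 2 * (dd i u x * dd i w x) <= 4 * (dd i \<beta> x * dd i \<beta> x * (u x * u x))" for i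
  proof -
   have "4 * (dd i \<beta> x * dd i \<beta> x * (u x * u x)) - (\<beta> x * (\<beta> x * (dd i u x * dd i u x)) - 2 * (dd i u x * dd i w x))
    = (\<beta> x * dd i u x + 2 * (dd i \<beta> x * u x))^2"
    unfolding dw by (simp add: power2_eq_square algebra_simps)
   then show ?thesis by (smt (verit) zero_le_power2)
  qed
  then have "(\<Sum>i\<in>Basis. \<beta> x * (\<beta> x * (dd i u x * dd i u x)) - 2 * (dd i u x * dd i w x)) <= (\<Sum>i\<in>Basis. 4 * (dd i \<beta> x * dd i \<beta> x * (u x * u x)))"
   by (intro sum_mono)
  then show "\<beta> x * (\<beta> x * (\<Sum>i\<in>Basis. dd i u x * dd i u x)) - 2 * (\<Sum>i\<in>Basis. dd i u x * dd i w x) <= 4 * ((\<Sum>i\<in>Basis. dd i \<beta> x * dd i \<beta> x) * (u x * u x))"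
   by (simp add: sum_subtractf sum_distrib_left sum_distrib_right)
 qed
 finally show ?thesis unfolding eq gb by (simp add: power2_eq_square)
qed

text \<open>A single time: \<open>f\<close> stands for the density, while \<open>v\<close> enters
  through the bounds of \<open>regular_field\<close>. \<open>S\<close> measures translations of
  \<open>f\<close> at the mollification scale, and \<open>2 * \<epsilon> <= 1\<close> keeps the
  shifts within the range of the difference quotient estimate.\<close>

locale slice = cutoff a for a :: "'a::euclidean_space => real" +
 fixes f :: "'a => real" and v :: "'a => 'a" and M L D \<epsilon> S :: real
 assumes f: "L1_Linf_le f M" and v: "regular_field L D v" and \<epsilon>: "0 < \<epsilon>" "2 * \<epsilon> <= 1"
  and S: "!!h. norm h <= 2 * \<epsilon> ==> (LBINT x. (f (x - h) - f x)^2) <= S"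
begin

abbreviation "\<eta> \<equiv> mol \<epsilon>"

definition u :: "'a => real" where "u = conv f \<eta>"

lemma f_int: "intble f" and f_L1: "(LBINT x. \<bar>f x\<bar>) <= M" and f_Linf: "AE x in lborel. \<bar>f x\<bar> <= M"
 using f by (auto simp: L1_Linf_le_def)

lemma f_borel[measurable]: "borelf f" using f_int by auto

lemma M0: "0 <= M" by (rule L1_Linf_nonneg[OF f])
lemma S0: "0 <= S" by (rule order_trans[OF _ S[of 0]]) (use \<epsilon> in auto)

lemma v_cont: "continuous_on UNIV v" and v_bound: "norm (v x) <= L"
 using v by (auto simp: regular_field_def)

lemma v_borel[measurable]: "borelf v" by (rule borel_measurable_continuous_onI[OF v_cont])

lemma L0: "0 <= L" using v_bound[of 0] norm_ge_zero order_trans by blast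

lemma \<eta>_tf: "test_fun UNIV \<eta>" by (rule mol_tf[OF \<epsilon>(1)])
lemma \<eta>_smooth: "smooth \<eta>" by (rule mol_smooth[OF \<epsilon>(1)])
lemma \<eta>_borel[measurable]: "borelf \<eta>" by (rule mol_borel[OF \<epsilon>(1)])
lemma grad_\<eta>_borel[measurable]: "grad \<eta> \<in> borel_measurable borel" by (rule grad_borel[OF \<eta>_smooth])

lemma locint_f: "locint f" by (rule locint_integrable[OF f_int])

lemma u_smooth: "smooth u" unfolding u_def by (rule smooth_conv[OF locint_f \<eta>_tf])
lemma u_borel[measurable]: "borelf u" by (rule smooth_borel[OF u_smooth])
lemma u_bound: "\<bar>u x\<bar> <= M" unfolding u_def by (rule conv_mol_bounded[OF locint_f f_Linf \<epsilon>(1)])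

lemma u_L2: "in_L2 u" and u_close: "(LBINT x. (u x - f x)^2) <= S"
 unfolding u_def using conv_mol_L2[OF L1_Linf_L2(1)[OF f] \<epsilon>(1) S] by auto

lemma grad_u: "grad u x = (LBINT y. f y *\<^sub>R grad \<eta> (x - y))"
proof -
 have "(LBINT y. f y *\<^sub>R grad \<eta> (x - y)) = (LBINT y. (\<Sum>i\<in>Basis. (f y * dd i \<eta> (x - y)) *\<^sub>R i))"
  by (simp add: grad_def scaleR_sum_right)
 also have "... = (\<Sum>i\<in>Basis. conv f (dd i \<eta>) x *\<^sub>R i)"
  using conv_integrable[OF locint_f tf_dd[OF \<eta>_tf]]
  by (subst Bochner_Integration.integral_sum) (auto simp: conv_def)
 also have "... = grad u x" by (simp add: grad_def u_def fun_cong[OF dd_conv[OF locint_f \<eta>_tf]])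
 finally show ?thesis by simp
qed

lemma grad_\<eta>_integrable: "intble (grad \<eta>)"
 unfolding grad_def by (intro Bochner_Integration.integrable_sum integrable_scaleR_left tf_integrable[OF tf_dd[OF \<eta>_tf]])

lemma grad_\<eta>_bounded: obtains B where "B > 0" "!!x. norm (grad \<eta> x) <= B"
 using tf_grad_bounded[OF \<eta>_tf] by blast

lemma transport_integrable:
 assumes F: "intble F" and [measurable]: "borelf V" and V: "!!x. norm (V x) <= C"
 shows "intble (\<lambda>y. F y * (V y \<bullet> grad \<eta> (x - y)))"
proof -
 obtain B where B: "B > 0" "!!x. norm (grad \<eta> x) <= B" using grad_\<eta>_bounded by blast
 have "intble (\<lambda>y. (V y \<bullet> grad \<eta> (x - y)) * F y)"
 proof (rule integrable_bounded_mult[OF F])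
  show "\<bar>V y \<bullet> grad \<eta> (x - y)\<bar> <= C * B" for y
   by (rule order_trans[OF Cauchy_Schwarz_ineq2])
    (use V B order_trans[OF norm_ge_zero V] in \<open>auto intro!: mult_mono\<close>)
 qed measurable
 then show ?thesis by (simp add: mult.commute)
qed

text \<open>The divergence of the mollified flux \<open>f y *\<^sub>R v y\<close>.\<close>

definition T :: "'a => real" where "T x = (LBINT y. f y * (v y \<bullet> grad \<eta> (x - y)))"

text \<open>The commutator of mollification and transport. The difference of \<open>v\<close>
  compensates the factor 1 / \<epsilon> of the gradient of the mollifier.\<close>

definition R :: "'a => real" where "R x = (LBINT y. f y * ((v y - v x) \<bullet> grad \<eta> (x - y)))"

lemma T_split: "T x = v x \<bullet> grad u x + R x"
proof -
 have vx: "borelf (\<lambda>y. v x)" by simp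
 have 1: "intble (\<lambda>y. f y * (v y \<bullet> grad \<eta> (x - y)))" "intble (\<lambda>y. f y * (v x \<bullet> grad \<eta> (x - y)))"
  using transport_integrable[OF f_int v_borel v_bound] transport_integrable[OF f_int vx v_bound] by auto
 have gi: "intble (\<lambda>y. f y *\<^sub>R grad \<eta> (x - y))"
 proof -
  have "f y *\<^sub>R grad \<eta> (x - y) = (\<Sum>i\<in>Basis. (f y * dd i \<eta> (x - y)) *\<^sub>R i)" for y
   by (simp add: grad_def scaleR_sum_right)
  then show ?thesis
   by (simp only:) (intro Bochner_Integration.integrable_sum integrable_scaleR_left conv_integrable[OF locint_f tf_dd[OF \<eta>_tf]])
 qed
 have "v x \<bullet> grad u x = (LBINT y. f y * (v x \<bullet> grad \<eta> (x - y)))"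
  unfolding grad_u using integral_inner_right[of "v x" lborel "\<lambda>y. f y *\<^sub>R grad \<eta> (x - y)"] gi by simp
 moreover have "R x = (LBINT y. f y * (v y \<bullet> grad \<eta> (x - y))) - (LBINT y. f y * (v x \<bullet> grad \<eta> (x - y)))"
  unfolding R_def using 1 by (simp add: inner_diff_left right_diff_distrib)
 ultimately show ?thesis by (simp add: T_def)
qed

lemma R_borel[measurable]: "borelf R"
proof -
 have "(\<lambda>x. \<integral>y. f y * ((v y - v x) \<bullet> grad \<eta> (x - y)) \<partial>lborel) \<in> borel_measurable lborel"
  by (rule lborel.borel_measurable_lebesgue_integral) measurable
 then show ?thesis by (simp add: R_def[abs_def])
qed

text \<open>The commutator: up to the divergence of \<open>v\<close>, it is governed by the continuity of
 translations of \<open>f\<close> and by the difference quotients of \<open>v\<close>, both in \<open>L^2\<close>.\<close>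

definition Q :: "'a => real" where "Q x = (LBINT y. (v x - v y) \<bullet> grad \<eta> (x - y))"

definition J :: "'a => real" where
 "J x = (LBINT y. \<bar>u x * f y - (f x)^2\<bar> * (norm (v x - v y) * norm (grad \<eta> (x - y))))"

lemma grad_\<eta>_shift: "intble (\<lambda>y. grad \<eta> (x - y))" "(LBINT y. grad \<eta> (x - y)) = 0"
proof -
 show "intble (\<lambda>y. grad \<eta> (x - y))"
  using integrable_reflect[of "grad \<eta>" x] grad_\<eta>_integrable by simp
 have "(LBINT y. grad \<eta> (x - y)) = (LBINT y. grad \<eta> y)"
  by (rule integral_reflect) simp
 also have "... = (\<Sum>i\<in>Basis. (LBINT y. dd i \<eta> y) *\<^sub>R i)"
  unfolding grad_def using tf_integrable[OF tf_dd[OF \<eta>_tf]] by (subst Bochner_Integration.integral_sum) auto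
 also have "... = 0" by (simp add: tf_integral_dd[OF \<eta>_tf])
 finally show "(LBINT y. grad \<eta> (x - y)) = 0" .
qed

lemma v_grad_\<eta>_integrable: "intble (\<lambda>y. (v x - v y) \<bullet> grad \<eta> (x - y))"
proof -
 have "intble (\<lambda>y. (v y - v x) \<bullet> grad \<eta> (x - y))"
 proof (rule Bochner_Integration.integrable_bound[of _ "\<lambda>y. (2 * L) * norm (grad \<eta> (x - y))"])
  show "intble (\<lambda>y. (2 * L) * norm (grad \<eta> (x - y)))" using grad_\<eta>_shift(1) by simp
  show "AE y in lborel. norm ((v y - v x) \<bullet> grad \<eta> (x - y)) <= norm ((2 * L) * norm (grad \<eta> (x - y)))"
  proof (intro AE_I2)
   fix y
   have "norm (v y - v x) <= 2 * L" using norm_triangle_ineq4[of "v y" "v x"] v_bound[of y] v_bound[of x] by linarith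
   then have "norm (v y - v x) * norm (grad \<eta> (x - y)) <= 2 * L * norm (grad \<eta> (x - y))" by (rule mult_right_mono) simp
   then show "norm ((v y - v x) \<bullet> grad \<eta> (x - y)) <= norm ((2 * L) * norm (grad \<eta> (x - y)))"
    using Cauchy_Schwarz_ineq2[of "v y - v x" "grad \<eta> (x - y)"] L0 by (simp add: abs_mult)
  qed
 qed measurable
 from integrable_minus[OF this] show ?thesis by (simp add: inner_diff_left)
qed

text \<open>The gradient of the mollifier has integral zero, which removes \<open>v x\<close>. What
  remains is the weak divergence of \<open>v\<close> tested against a function of mass one.\<close>

lemma Q_bound: "\<bar>Q x\<bar> <= D"
proof -
 have 1: "intble (\<lambda>y. v x \<bullet> grad \<eta> (x - y))" using grad_\<eta>_shift(1) by simp
 have 2: "intble (\<lambda>y. v y \<bullet> grad \<eta> (x - y))"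
  using Bochner_Integration.integrable_diff[OF 1 v_grad_\<eta>_integrable[of x]] by (simp add: inner_diff_left)
 have g: "test_fun UNIV (\<lambda>y. \<eta> (x - y))" by (rule tf_reflect[OF \<eta>_tf])
 have gr: "grad (\<lambda>y. \<eta> (x - y)) y = - grad \<eta> (x - y)" for y
  by (simp add: grad_def dd_reflect[OF \<eta>_smooth] sum_negf)
 have "Q x = v x \<bullet> (LBINT y. grad \<eta> (x - y)) - (LBINT y. v y \<bullet> grad \<eta> (x - y))"
  unfolding Q_def inner_diff_left using 1 2 grad_\<eta>_shift(1)[of x] by simp
 also have "... = (LBINT y. v y \<bullet> grad (\<lambda>y. \<eta> (x - y)) y)"
  by (simp add: grad_\<eta>_shift(2) gr)
 also have "\<bar>\<dots>\<bar> <= D * (LBINT y. \<bar>\<eta> (x - y)\<bar>)"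
  using v g by (simp add: regular_field_def)
 also have "... = D" using mol_nonneg[OF \<epsilon>(1)] by (simp add: mol_shift_integral[OF \<epsilon>(1)])
 finally show ?thesis .
qed

lemma J_integrand: "intble (\<lambda>y. \<bar>u x * f y - (f x)^2\<bar> * (norm (v x - v y) * norm (grad \<eta> (x - y))))"
proof -
 have lf: "locint (\<lambda>y. \<bar>u x * f y - (f x)^2\<bar>)"
 proof -
  have "intble (\<lambda>y. indicator (cball 0 r) y * (u x * f y - (f x)^2))" for r
  proof -
   have "intble (\<lambda>y::'a. indicator (cball 0 r) y :: real)"
    by (intro integrable_real_indicator) (auto simp: emeasure_lborel_cball_finite[simplified])
   moreover have "intble (\<lambda>y. indicator (cball 0 r) y * f y)" using locint_f by (simp add: locint_def)
   ultimately have "intble (\<lambda>y. u x * (indicator (cball 0 r) y * f y) - (f x)^2 * indicator (cball 0 r) y)" by simp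
   then show ?thesis by (simp add: right_diff_distrib mult_ac)
  qed
  from integrable_abs[OF this] show ?thesis by (simp add: locint_def abs_mult)
 qed
 obtain B where B: "B > 0" "!!x. norm (grad \<eta> x) <= B" using grad_\<eta>_bounded by blast
 show ?thesis
 proof (rule locint_mult[OF lf, where B = "2 * L * B" and r = "norm x + 2 * \<epsilon>"])
  show "\<bar>norm (v x - v y) * norm (grad \<eta> (x - y))\<bar> <= 2 * L * B" for y
  proof -
   have "norm (v x - v y) <= 2 * L" using norm_triangle_ineq4[of "v x" "v y"] v_bound[of y] v_bound[of x] by linarith
   then show ?thesis using B(2) L0 by (auto simp: abs_mult intro!: mult_mono)
  qed
  fix y :: 'a assume "norm x + 2 * \<epsilon> < norm y"
  then have "norm (x - y) > 2 * \<epsilon>" using norm_triangle_ineq2[of y x] by (simp add: norm_minus_commute)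
  then have "grad \<eta> (x - y) = 0" by (intro grad_zero_outside[of "2 * \<epsilon>"] mol_zero \<epsilon>) auto
  then show "norm (v x - v y) * norm (grad \<eta> (x - y)) = 0" by simp
 qed measurable
qed

lemma J_nonneg: "0 <= J x" unfolding J_def by (intro integral_nonneg_AE AE_I2) simp

lemma J_borel[measurable]: "borelf J"
proof -
 have "(\<lambda>x. \<integral>y. \<bar>u x * f y - (f x)^2\<bar> * (norm (v x - v y) * norm (grad \<eta> (x - y))) \<partial>lborel) \<in> borel_measurable lborel"
  by (rule lborel.borel_measurable_lebesgue_integral) measurable
 then show ?thesis by (simp add: J_def[abs_def])
qed

text \<open>Subtracting \<open>(f x)^2 * Q x\<close> from \<open>- (u x * R x)\<close> leaves the
  factor \<open>u x * f y - (f x)^2\<close> in the integrand, which is small in the mean when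
  \<open>y\<close> is close to \<open>x\<close>. The subtracted term does not tend to zero, but its
  integral is controlled by the energy itself.\<close>

lemma commutator_split: "- (u x * R x) <= D * (f x)^2 + J x"
proof -
 have i1: "intble (\<lambda>y. f y * ((v y - v x) \<bullet> grad \<eta> (x - y)))"
 proof -
  have "norm (v y - v x) <= 2 * L" for y
   using norm_triangle_ineq4[of "v y" "v x"] v_bound[of y] v_bound[of x] by linarith
  then show ?thesis by (intro transport_integrable[OF f_int]) auto
 qed
 have "- (u x * R x) - (f x)^2 * Q x = (LBINT y. - (u x * (f y * ((v y - v x) \<bullet> grad \<eta> (x - y)))) - (f x)^2 * ((v x - v y) \<bullet> grad \<eta> (x - y)))"
  unfolding R_def Q_def using i1 v_grad_\<eta>_integrable by simp
 also have "... <= J x"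
  unfolding J_def
 proof (rule integral_mono)
  show "intble (\<lambda>y. - (u x * (f y * ((v y - v x) \<bullet> grad \<eta> (x - y)))) - (f x)^2 * ((v x - v y) \<bullet> grad \<eta> (x - y)))"
   using i1 v_grad_\<eta>_integrable by simp
  fix y
  have "- (u x * (f y * ((v y - v x) \<bullet> grad \<eta> (x - y)))) - (f x)^2 * ((v x - v y) \<bullet> grad \<eta> (x - y))
    = (u x * f y - (f x)^2) * ((v x - v y) \<bullet> grad \<eta> (x - y))"
   by (simp add: inner_diff_left algebra_simps)
  also have "... <= \<bar>u x * f y - (f x)^2\<bar> * \<bar>(v x - v y) \<bullet> grad \<eta> (x - y)\<bar>"
   by (simp flip: abs_mult)
  also have "... <= \<bar>u x * f y - (f x)^2\<bar> * (norm (v x - v y) * norm (grad \<eta> (x - y)))"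
   by (intro mult_left_mono Cauchy_Schwarz_ineq2) simp
  finally show "- (u x * (f y * ((v y - v x) \<bullet> grad \<eta> (x - y)))) - (f x)^2 * ((v x - v y) \<bullet> grad \<eta> (x - y))
   <= \<bar>u x * f y - (f x)^2\<bar> * (norm (v x - v y) * norm (grad \<eta> (x - y)))" .
 qed (rule J_integrand)
 finally have "- (u x * R x) <= (f x)^2 * Q x + J x" by simp
 also have "(f x)^2 * Q x <= (f x)^2 * D" using Q_bound[of x] by (intro mult_left_mono) auto
 finally show ?thesis by (simp add: mult.commute)
qed

text \<open>In the variable h = x - y, the factor with \<open>f\<close> is bounded by
  \<open>M\<close> times translation differences whose squares integrate to at most
  \<open>S\<close>, and the square of the difference of \<open>v\<close> integrates to order
  \<epsilon>^2. Young's inequality separates them, and the factor \<epsilon> so gained cancels the 1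
  / \<epsilon> in the mass of the gradient of the mollifier.\<close>

lemma J_estimate:
 assumes b: "borelf b" "!!x. 0 <= b x" "!!x. b x <= 1" "!!x. norm x > r ==> b x = 0"
  and Cv: "Cv \<ge> 0" "!!h. norm h <= 1 ==> (LBINT x. indicator (cball 0 r) x * (norm (v (x + h) - v x))^2) <= Cv * (norm h)^2"
  and C\<eta>: "(LBINT x. norm (grad \<eta> x)) <= C\<eta> / \<epsilon>"
  and l: "0 < \<mu>"
 shows "intble (\<lambda>x. b x * J x)" "(LBINT x. b x * J x) <= 2 * C\<eta> * M * (1 + Cv) * (\<mu> + S / \<mu>)"
proof -
 note [measurable] = b(1)
 have C0: "0 <= C\<eta> / \<epsilon>" by (rule order_trans[OF _ C\<eta>]) simp
 then have C0': "0 <= C\<eta>" using \<epsilon> by (simp add: zero_le_divide_iff)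
 \<comment> \<open>The weights are balanced so that both parts integrate to a multiple of
   \<open>\<epsilon>\<close>: the first to \<epsilon> S / \<mu>, the second, in which the difference
   of \<open>v\<close> contributes \<epsilon>^2, to \<epsilon> \<mu>.\<close>
 define A where "A h x = \<epsilon> / \<mu> * ((u x - f x)^2 + (f (x - h) - f x)^2) + \<mu> / (2 * \<epsilon>) * (indicator (cball 0 r) x * (norm (v (x - h) - v x))^2)" for h x
 have A0: "0 <= A h x" for h x using \<epsilon> l by (auto simp: A_def)
 have [measurable]: "(\<lambda>(x, h). A h x) \<in> borel_measurable (borel \<Otimes>\<^sub>M borel)" unfolding A_def by measurable
 have Am[measurable]: "A h \<in> borel_measurable borel" for h unfolding A_def by measurable
 have pt: "AE x in lborel. AE h in lborel. b x * (\<bar>u x * f (x - h) - (f x)^2\<bar> * (norm (v x - v (x - h)) * norm (grad \<eta> h)))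
   <= M * (norm (grad \<eta> h) * A h x)"
  using f_Linf
 proof eventually_elim
  fix x assume fx: "\<bar>f x\<bar> <= M"
  show "AE h in lborel. b x * (\<bar>u x * f (x - h) - (f x)^2\<bar> * (norm (v x - v (x - h)) * norm (grad \<eta> h)))
   <= M * (norm (grad \<eta> h) * A h x)"
   using AE_reflect[OF f_Linf, of x]
  proof eventually_elim
   fix h assume fh: "\<bar>f (x - h)\<bar> <= M"
   define p q V where "p = \<bar>u x - f x\<bar>" "q = \<bar>f (x - h) - f x\<bar>" "V = b x * norm (v (x - h) - v x)"
   have nn: "0 <= p" "0 <= q" "0 <= V" using b(2) by (auto simp: p_q_V_def)
   have 1: "\<bar>u x * f (x - h) - (f x)^2\<bar> <= M * (p + q)"
   proof -
    have "u x * f (x - h) - (f x)^2 = (u x - f x) * f (x - h) + f x * (f (x - h) - f x)"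
     by (simp add: power2_eq_square algebra_simps)
    also have "\<bar>\<dots>\<bar> <= p * \<bar>f (x - h)\<bar> + \<bar>f x\<bar> * q"
     unfolding p_q_V_def by (rule order_trans[OF abs_triangle_ineq]) (simp add: abs_mult)
    also have "... <= p * M + M * q" using fx fh nn by (intro add_mono mult_mono) auto
    finally show ?thesis by (simp add: algebra_simps)
   qed
   have am: "c * V <= \<epsilon> / \<mu> * c^2 + \<mu> / (4 * \<epsilon>) * V^2" for c
   proof -
    have "0 <= (sqrt (\<epsilon> / \<mu>) * c - sqrt (\<mu> / \<epsilon>) / 2 * V)^2" by simp
    also have "... = \<epsilon> / \<mu> * c^2 - (sqrt (\<epsilon> / \<mu>) * sqrt (\<mu> / \<epsilon>)) * (c * V) + (\<mu> / \<epsilon>) / 4 * V^2"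
     using \<epsilon> l by (simp add: power2_diff power_mult_distrib power_divide mult_ac)
    also have "sqrt (\<epsilon> / \<mu>) * sqrt (\<mu> / \<epsilon>) = 1"
     using \<epsilon> l by (simp flip: real_sqrt_mult)
    finally show ?thesis by simp
   qed
   have e1: "(p + q) * V <= \<epsilon> / \<mu> * (p^2 + q^2) + \<mu> / (2 * \<epsilon>) * V^2"
    using am[of p] am[of q] by (simp add: algebra_simps)
   have e2: "V^2 <= indicator (cball 0 r) x * (norm (v (x - h) - v x))^2"
   proof (cases "norm x > r")
    case False
    have "V <= norm (v (x - h) - v x)" unfolding p_q_V_def using b(2,3) by (simp add: mult_left_le_one_le)
    then show ?thesis using False nn by (simp add: power_mono)
   qed (simp add: p_q_V_def b(4))
   have 2: "(p + q) * V <= A h x"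
    unfolding A_def
   proof (rule order_trans[OF e1], intro add_mono mult_left_mono e2)
    show "p^2 <= (u x - f x)^2" "q^2 <= (f (x - h) - f x)^2" by (simp_all add: p_q_V_def)
   qed (use \<epsilon> l in auto)
   have "b x * (\<bar>u x * f (x - h) - (f x)^2\<bar> * (norm (v x - v (x - h)) * norm (grad \<eta> h)))
     = \<bar>u x * f (x - h) - (f x)^2\<bar> * V * norm (grad \<eta> h)"
    by (simp add: p_q_V_def norm_minus_commute)
   also have "... <= M * (p + q) * V * norm (grad \<eta> h)"
    using 1 nn by (intro mult_right_mono) auto
   also have "... <= M * A h x * norm (grad \<eta> h)"
    using mult_left_mono[OF 2 M0] by (intro mult_right_mono) (auto simp: mult.assoc)
   finally show "b x * (\<bar>u x * f (x - h) - (f x)^2\<bar> * (norm (v x - v (x - h)) * norm (grad \<eta> h)))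
     <= M * (norm (grad \<eta> h) * A h x)" by (simp add: mult_ac)
  qed
 qed
 have "(\<integral>\<^sup>+x. ennreal (b x * J x) \<partial>lborel) = (\<integral>\<^sup>+x. (\<integral>\<^sup>+y. ennreal (b x * (\<bar>u x * f y - (f x)^2\<bar> * (norm (v x - v y) * norm (grad \<eta> (x - y))))) \<partial>lborel) \<partial>lborel)"
 proof (intro nn_integral_cong)
  fix x
  show "ennreal (b x * J x) = (\<integral>\<^sup>+y. ennreal (b x * (\<bar>u x * f y - (f x)^2\<bar> * (norm (v x - v y) * norm (grad \<eta> (x - y))))) \<partial>lborel)"
   unfolding J_def using J_integrand[of x] b(2) by (subst nn_integral_eq_integral) auto
 qed
 also have "... = (\<integral>\<^sup>+x. (\<integral>\<^sup>+h. ennreal (b x * (\<bar>u x * f (x - h) - (f x)^2\<bar> * (norm (v x - v (x - h)) * norm (grad \<eta> h)))) \<partial>lborel) \<partial>lborel)"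
 proof (rule nn_integral_cong)
  fix x
  have "(\<integral>\<^sup>+h. (\<lambda>y. ennreal (b x * (\<bar>u x * f y - (f x)^2\<bar> * (norm (v x - v y) * norm (grad \<eta> (x - y)))))) (x - h) \<partial>lborel)
   = (\<integral>\<^sup>+y. ennreal (b x * (\<bar>u x * f y - (f x)^2\<bar> * (norm (v x - v y) * norm (grad \<eta> (x - y))))) \<partial>lborel)"
   by (rule nn_integral_reflect) measurable
  then show "(\<integral>\<^sup>+y. ennreal (b x * (\<bar>u x * f y - (f x)^2\<bar> * (norm (v x - v y) * norm (grad \<eta> (x - y))))) \<partial>lborel)
   = (\<integral>\<^sup>+h. ennreal (b x * (\<bar>u x * f (x - h) - (f x)^2\<bar> * (norm (v x - v (x - h)) * norm (grad \<eta> h)))) \<partial>lborel)"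
   by simp
 qed
 also have "... <= (\<integral>\<^sup>+x. (\<integral>\<^sup>+h. ennreal (M * (norm (grad \<eta> h) * A h x)) \<partial>lborel) \<partial>lborel)"
 proof (rule nn_integral_mono_AE)
  show "AE x in lborel. (\<integral>\<^sup>+h. ennreal (b x * (\<bar>u x * f (x - h) - (f x)^2\<bar> * (norm (v x - v (x - h)) * norm (grad \<eta> h)))) \<partial>lborel)
   <= (\<integral>\<^sup>+h. ennreal (M * (norm (grad \<eta> h) * A h x)) \<partial>lborel)"
   using pt
  proof eventually_elim
   case (elim x)
   from this have "AE h in lborel. ennreal (b x * (\<bar>u x * f (x - h) - (f x)^2\<bar> * (norm (v x - v (x - h)) * norm (grad \<eta> h))))
    <= ennreal (M * (norm (grad \<eta> h) * A h x))"
    by eventually_elim (rule ennreal_leI)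
   then show ?case by (rule nn_integral_mono_AE)
  qed
 qed
 also have "... = (\<integral>\<^sup>+h. (\<integral>\<^sup>+x. ennreal (M * (norm (grad \<eta> h) * A h x)) \<partial>lborel) \<partial>lborel)"
  by (rule lborel_pair.Fubini') measurable
 also have "... <= (\<integral>\<^sup>+h. ennreal (M * (norm (grad \<eta> h) * (2 * \<epsilon> * (S / \<mu> + Cv * \<mu>)))) \<partial>lborel)"
 proof (rule nn_integral_mono)
  fix h
  show "(\<integral>\<^sup>+x. ennreal (M * (norm (grad \<eta> h) * A h x)) \<partial>lborel) <= ennreal (M * (norm (grad \<eta> h) * (2 * \<epsilon> * (S / \<mu> + Cv * \<mu>))))"
  proof (cases "norm h > 2 * \<epsilon>")
   case True
   then have "grad \<eta> h = 0" by (intro grad_zero_outside[of "2 * \<epsilon>"] mol_zero \<epsilon>) auto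
   then show ?thesis by simp
  next
   case False
   then have h: "norm h <= 2 * \<epsilon>" "norm (- h) <= 1" using \<epsilon> by auto
   have i1: "intble (\<lambda>x. (u x - f x)^2)" "intble (\<lambda>x. (f (x - h) - f x)^2)"
    using in_L2_diff[OF u_L2 L1_Linf_L2(1)[OF f]] in_L2_diff[OF in_L2_shift[OF L1_Linf_L2(1)[OF f]] L1_Linf_L2(1)[OF f], of h]
    by (auto simp: in_L2_real)
   have i2: "intble (\<lambda>x. indicator (cball 0 r) x * (norm (v (x - h) - v x))^2)"
   proof (rule integrable_bounded_support[where B = "(2 * L)^2" and r = r])
    show "\<bar>indicator (cball 0 r) x * (norm (v (x - h) - v x))^2\<bar> <= (2 * L)^2" for x
    proof -
     have "norm (v (x - h) - v x) <= 2 * L"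
      using norm_triangle_ineq4[of "v (x - h)" "v x"] v_bound[of "x - h"] v_bound[of x] by linarith
     then have "(norm (v (x - h) - v x))^2 <= (2 * L)^2" by (rule power_mono) simp
     then show ?thesis by (auto simp: indicator_def)
    qed
   qed auto
   have "(LBINT x. A h x) = \<epsilon> / \<mu> * ((LBINT x. (u x - f x)^2) + (LBINT x. (f (x - h) - f x)^2))
     + \<mu> / (2 * \<epsilon>) * (LBINT x. indicator (cball 0 r) x * (norm (v (x - h) - v x))^2)"
    unfolding A_def using i1 i2 by simp
   also have "... <= \<epsilon> / \<mu> * (S + S) + \<mu> / (2 * \<epsilon>) * (Cv * (2 * \<epsilon>)^2)"
   proof (intro add_mono mult_left_mono u_close S h(1))
    have "(LBINT x. indicator (cball 0 r) x * (norm (v (x - h) - v x))^2) <= Cv * (norm h)^2"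
     using Cv(2)[OF h(2)] by simp
    also have "... <= Cv * (2 * \<epsilon>)^2" using h Cv(1) by (intro mult_left_mono power_mono) auto
    finally show "(LBINT x. indicator (cball 0 r) x * (norm (v (x - h) - v x))^2) <= Cv * (2 * \<epsilon>)^2" .
   qed (use \<epsilon> l in auto)
   also have "... = 2 * \<epsilon> * (S / \<mu> + Cv * \<mu>)"
    using \<epsilon> l by (simp add: power2_eq_square field_simps)
   finally have le: "(LBINT x. A h x) <= 2 * \<epsilon> * (S / \<mu> + Cv * \<mu>)" .
   have iA: "intble (A h)" unfolding A_def using i1 i2 by simp
   have "(\<integral>\<^sup>+x. ennreal (M * (norm (grad \<eta> h) * A h x)) \<partial>lborel) = ennreal (M * (norm (grad \<eta> h) * (LBINT x. A h x)))"
    using iA A0 M0 by (subst nn_integral_eq_integral) auto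
   also have "... <= ennreal (M * (norm (grad \<eta> h) * (2 * \<epsilon> * (S / \<mu> + Cv * \<mu>))))"
    using le M0 by (intro ennreal_leI mult_left_mono) auto
   finally show ?thesis .
  qed
 qed
 also have "... = ennreal (M * ((LBINT h. norm (grad \<eta> h)) * (2 * \<epsilon> * (S / \<mu> + Cv * \<mu>))))"
  using grad_\<eta>_integrable M0 \<epsilon> l S0 Cv(1) by (subst nn_integral_eq_integral) auto
 also have "... <= ennreal (2 * C\<eta> * M * (1 + Cv) * (\<mu> + S / \<mu>))"
 proof (rule ennreal_leI)
  have nn: "0 <= S / \<mu> + Cv * \<mu>" using S0 l Cv(1) by simp
  have "M * ((LBINT h. norm (grad \<eta> h)) * (2 * \<epsilon> * (S / \<mu> + Cv * \<mu>))) <= M * (C\<eta> / \<epsilon> * (2 * \<epsilon> * (S / \<mu> + Cv * \<mu>)))"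
   using C\<eta> M0 \<epsilon> nn by (intro mult_left_mono mult_right_mono) auto
  also have "... = 2 * C\<eta> * M * (S / \<mu> + Cv * \<mu>)" using \<epsilon> by simp
  also have "... <= 2 * C\<eta> * M * ((1 + Cv) * (\<mu> + S / \<mu>))"
  proof (intro mult_left_mono)
   have "0 <= Cv * (S / \<mu>)" using S0 l Cv(1) by simp
   then show "S / \<mu> + Cv * \<mu> <= (1 + Cv) * (\<mu> + S / \<mu>)" using l unfolding distrib_right distrib_left mult_1_left by linarith
  qed (use C0' M0 in auto)
  finally show "M * ((LBINT h. norm (grad \<eta> h)) * (2 * \<epsilon> * (S / \<mu> + Cv * \<mu>))) <= 2 * C\<eta> * M * (1 + Cv) * (\<mu> + S / \<mu>)"
   by (simp add: mult.assoc)
 qed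
 finally have le: "(\<integral>\<^sup>+x. ennreal (b x * J x) \<partial>lborel) <= ennreal (2 * C\<eta> * M * (1 + Cv) * (\<mu> + S / \<mu>))" .
 have nn: "0 <= 2 * C\<eta> * M * (1 + Cv) * (\<mu> + S / \<mu>)" using C0' M0 Cv(1) l S0 by simp
 have m: "(\<lambda>x. b x * J x) \<in> borel_measurable lborel" by measurable
 have bJ: "0 <= b x * J x" for x using b(2) J_nonneg by simp
 show "intble (\<lambda>x. b x * J x)" "(LBINT x. b x * J x) <= 2 * C\<eta> * M * (1 + Cv) * (\<mu> + S / \<mu>)"
  by (rule integral_le_nn_integral[OF m bJ nn le])+
qed

end

text \<open>The modulus \<open>S\<close> of \<open>f\<close> thus also serves for its absolute
  value, which appears when the mollified square is estimated.\<close>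

lemma mollified_abs_difference:
 fixes f :: "'a::euclidean_space => real"
 assumes f: "in_L2 f"
 shows "(LBINT x. (\<bar>f (x - h)\<bar> - \<bar>f x\<bar>)^2) <= (LBINT x. (f (x - h) - f x)^2)"
proof -
 have [measurable]: "borelf f" using f by (simp add: in_L2_real)
 have fd: "in_L2 (\<lambda>x. f (x - h) - f x)" by (intro in_L2_diff in_L2_shift f)
 have le: "(\<bar>f (x - h)\<bar> - \<bar>f x\<bar>)^2 <= (f (x - h) - f x)^2" for x
  using abs_triangle_ineq3[of "f (x - h)" "f x"] by (simp add: abs_le_square_iff[symmetric])
 have i: "intble (\<lambda>x. (f (x - h) - f x)^2)" using fd by (simp add: in_L2_real)
 have "intble (\<lambda>x. (\<bar>f (x - h)\<bar> - \<bar>f x\<bar>)^2)"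
  by (rule Bochner_Integration.integrable_bound[OF i]) (use le in auto)
 then show ?thesis using i le by (intro integral_mono) auto
qed

text \<open>The Laplacian is moved to \<open>\<psi>\<close>, so that \<open>f\<close> need not be differentiable.\<close>

definition rhs :: "('a::euclidean_space => 'a) => real => real => ('a => real) => ('a => real) => real" where
 "rhs v \<kappa> \<nu> f \<psi> = (LBINT y. f y * (v y \<bullet> grad \<psi> y) + \<kappa> * (f y)^2 * \<psi> y
  + \<nu> * (f y * (\<Sum>i\<in>Basis. dd i (dd i \<psi>) y)))"

context slice
begin

definition Z :: "'a => real" where "Z = conv (\<lambda>y. (f y)^2) \<eta>"

text \<open>The mollified square of \<open>f\<close> is dominated by \<open>M\<close> times this
  function. It is not dominated by \<open>M * \<bar>u x\<bar>\<close>, as \<open>f\<close> may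
  change sign.\<close>

definition ua :: "'a => real" where "ua = conv (\<lambda>y. \<bar>f y\<bar>) \<eta>"

definition Lu :: "'a => real" where "Lu x = (\<Sum>i\<in>Basis. dd i (dd i u) x)"

lemma locint_f2: "locint (\<lambda>y. (f y)^2)"
 using L1_Linf_L2(1)[OF f] by (intro locint_integrable) (simp add: in_L2_real)

lemma locint_fa: "locint (\<lambda>y. \<bar>f y\<bar>)"
 by (intro locint_integrable integrable_abs f_int)

lemma Z_smooth: "smooth Z" unfolding Z_def by (rule smooth_conv[OF locint_f2 \<eta>_tf])
lemma Lu_smooth: "smooth Lu" unfolding Lu_def[abs_def] by (intro smooth_sum smooth_dd u_smooth)

lemma ua_close: "in_L2 ua" "(LBINT x. (ua x - \<bar>f x\<bar>)^2) <= S"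
proof -
 have fa: "in_L2 (\<lambda>x. \<bar>f x\<bar>)" using L1_Linf_L2(1)[OF f] by (simp add: in_L2_real)
 have "norm h <= 2 * \<epsilon> ==> (LBINT x. (\<bar>f (x - h)\<bar> - \<bar>f x\<bar>)^2) <= S" for h
  by (rule order_trans[OF mollified_abs_difference[OF L1_Linf_L2(1)[OF f]] S])
 then show "in_L2 ua" "(LBINT x. (ua x - \<bar>f x\<bar>)^2) <= S"
  unfolding ua_def using conv_mol_L2[OF fa \<epsilon>(1)] by auto
qed

lemma Z_bound: "\<bar>Z x\<bar> <= M * ua x"
proof -
 have "\<bar>Z x\<bar> <= (LBINT y. \<bar>(f y)^2 * \<eta> (x - y)\<bar>)"
  unfolding Z_def conv_def by (rule integral_abs_bound)
 also have "... <= (LBINT y. M * (\<bar>f y\<bar> * \<eta> (x - y)))"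
 proof (rule integral_mono_AE)
  show "AE y in lborel. \<bar>(f y)^2 * \<eta> (x - y)\<bar> <= M * (\<bar>f y\<bar> * \<eta> (x - y))"
   using f_Linf
  proof eventually_elim
   case (elim y)
   have "(f y)^2 <= M * \<bar>f y\<bar>" using mult_right_mono[OF elim abs_ge_zero[of "f y"]] by (simp add: power2_eq_square)
   then have "(f y)^2 * \<eta> (x - y) <= M * \<bar>f y\<bar> * \<eta> (x - y)" by (rule mult_right_mono[OF _ mol_nonneg[OF \<epsilon>(1)]])
   then show ?case using mol_nonneg[OF \<epsilon>(1)] by (simp add: abs_mult mult.assoc)
  qed
 qed (use conv_integrable[OF locint_f2 \<eta>_tf, of x] conv_integrable[OF locint_fa \<eta>_tf, of x] in auto)
 also have "... = M * ua x" by (simp add: ua_def conv_def)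
 finally show ?thesis .
qed

text \<open>The reflection of the mollifier reverses the sign of its gradient and preserves its
  Laplacian, whence the minus sign at \<open>T\<close> only.\<close>

lemma rhs_mollifier: "rhs v \<kappa> \<nu> f (\<lambda>y. \<eta> (x - y)) = - T x + \<kappa> * Z x + \<nu> * Lu x"
proof -
 have gr: "grad (\<lambda>y. \<eta> (x - y)) y = - grad \<eta> (x - y)" for y
  by (simp add: grad_def dd_reflect[OF \<eta>_smooth] sum_negf)
 have dd2: "dd i (dd i (\<lambda>y. \<eta> (x - y))) y = dd i (dd i \<eta>) (x - y)" for i y
 proof -
  have "dd i (\<lambda>y. \<eta> (x - y)) = (\<lambda>y. (- 1) * dd i \<eta> (x - y))" by (rule ext) (simp add: dd_reflect[OF \<eta>_smooth])
  then have "dd i (dd i (\<lambda>y. \<eta> (x - y))) y = (- 1) * dd i (\<lambda>y. dd i \<eta> (x - y)) y"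
   using dd_mult[of "\<lambda>_. - 1" y "\<lambda>y. dd i \<eta> (x - y)" i] smooth_differentiable[OF tf_smooth[OF tf_reflect[OF tf_dd[OF \<eta>_tf]]]]
   by simp
  then show ?thesis by (simp add: dd_reflect[OF smooth_dd[OF \<eta>_smooth]])
 qed
 have i1: "intble (\<lambda>y. f y * (v y \<bullet> grad \<eta> (x - y)))"
  by (rule transport_integrable[OF f_int v_borel v_bound])
 have i2: "intble (\<lambda>y. (f y)^2 * \<eta> (x - y))" by (rule conv_integrable[OF locint_f2 \<eta>_tf])
 have i3: "intble (\<lambda>y. f y * dd i (dd i \<eta>) (x - y))" for i by (rule conv_integrable[OF locint_f tf_dd[OF tf_dd[OF \<eta>_tf]]])
 have i4: "intble (\<lambda>y. f y * (\<Sum>i\<in>Basis. dd i (dd i \<eta>) (x - y)))"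
  unfolding sum_distrib_left by (intro Bochner_Integration.integrable_sum i3)
 have L: "(LBINT y. f y * (\<Sum>i\<in>Basis. dd i (dd i \<eta>) (x - y))) = Lu x"
 proof -
  have "dd i (dd i u) x = conv f (dd i (dd i \<eta>)) x" for i
  proof -
   have "dd i u = conv f (dd i \<eta>)" unfolding u_def by (rule dd_conv[OF locint_f \<eta>_tf])
   then show ?thesis by (simp add: fun_cong[OF dd_conv[OF locint_f tf_dd[OF \<eta>_tf]]])
  qed
  then show ?thesis unfolding Lu_def sum_distrib_left
   by (subst Bochner_Integration.integral_sum) (auto simp: i3 conv_def)
 qed
 have "rhs v \<kappa> \<nu> f (\<lambda>y. \<eta> (x - y)) = (LBINT y. - (f y * (v y \<bullet> grad \<eta> (x - y))) + \<kappa> * ((f y)^2 * \<eta> (x - y))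
  + \<nu> * (f y * (\<Sum>i\<in>Basis. dd i (dd i \<eta>) (x - y))))"
  unfolding rhs_def gr dd2 by (simp add: mult.assoc)
 also have "... = - T x + \<kappa> * Z x + \<nu> * Lu x"
  using i1 i2 i4 by (simp add: T_def Z_def conv_def L)
 finally show ?thesis .
qed

lemma T_borel[measurable]: "borelf T"
proof -
 have "(\<lambda>x. \<integral>y. f y * (v y \<bullet> grad \<eta> (x - y)) \<partial>lborel) \<in> borel_measurable lborel"
  by (rule lborel.borel_measurable_lebesgue_integral) measurable
 then show ?thesis by (simp add: T_def[abs_def])
qed

text \<open>In the growth factor, \<open>2 * \<bar>\<kappa>\<bar> * M\<close> comes from the
  reaction term, \<open>D + L^2\<close> from transport of the mollified density, and
  \<open>2 * D\<close> from the commutator. All error terms carry the common factor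
  \<open>\<mu> + S / \<mu>\<close>; the energy on the right is that of \<open>f\<close>, so that the
  inequality can be closed after the mollification is removed.\<close>

lemma energy_estimate:
 assumes \<beta>: "test_fun UNIV \<beta>" "!!x. 0 <= \<beta> x" "!!x. \<beta> x <= 1" "!!x. norm x > r ==> \<beta> x = 0"
  and B: "!!x. (norm (grad \<beta> x))^2 <= B"
  and Cv: "Cv \<ge> 0" "!!h. norm h <= 1 ==> (LBINT x. indicator (cball 0 r) x * (norm (v (x + h) - v x))^2) <= Cv * (norm h)^2"
  and C\<eta>: "(LBINT x. norm (grad \<eta> x)) <= C\<eta> / \<epsilon>"
  and l: "0 < \<mu>" "\<mu> <= 1" and \<nu>: "0 <= \<nu>"
 shows "2 * (LBINT x. (\<beta> x)^2 * (u x * rhs v \<kappa> \<nu> f (\<lambda>y. \<eta> (x - y)))) + \<nu> * (LBINT x. (\<beta> x)^2 * (norm (grad u x))^2)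
  <= (2 * \<bar>\<kappa>\<bar> * M + 3 * D + L^2) * (LBINT x. (\<beta> x)^2 * (f x)^2)
   + (4 * \<nu> + 1) * (LBINT x. (norm (grad \<beta> x))^2 * (f x)^2)
   + ((2 * \<bar>\<kappa>\<bar> * M + D + L^2) * (M^2 + 2) + (4 * \<nu> + 1) * B * (M^2 + 2) + 4 * C\<eta> * M * (1 + Cv)) * (\<mu> + S / \<mu>)"
proof -
 have \<beta>s: "smooth \<beta>" by (rule tf_smooth[OF \<beta>(1)])
 have [measurable]: "borelf \<beta>" by (rule smooth_borel[OF \<beta>s])
 have gb[measurable]: "grad \<beta> \<in> borel_measurable borel" by (rule grad_borel[OF \<beta>s])
 have b01: "0 <= (\<beta> x)^2" "(\<beta> x)^2 <= 1" for x using \<beta>(2,3)[of x] by (auto simp: power_le_one)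
 have bab: "\<bar>(\<beta> x)^2\<bar> <= 1" for x using b01 by simp
 have bm: "(\<lambda>x. (\<beta> x)^2) \<in> borel_measurable borel" by measurable
 have gbm: "(\<lambda>x. (norm (grad \<beta> x))^2) \<in> borel_measurable borel" by measurable
 have gbb: "\<bar>(norm (grad \<beta> x))^2\<bar> <= B" for x using B by simp
 note f2 = L1_Linf_L2[OF f]
 have iu2: "intble (\<lambda>x. (u x)^2)" and if2: "intble (\<lambda>x. (f x)^2)"
  and iua2: "intble (\<lambda>x. (ua x)^2)"
  using u_L2 f2(1) ua_close(1) by (auto simp: in_L2_real)
 note ib = integrable_bounded_mult[OF _ bm bab]
 note ig = integrable_bounded_mult[OF _ gbm gbb]
 define Wf where "Wf = (LBINT x. (\<beta> x)^2 * (f x)^2)"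
 define Gf where "Gf = (LBINT x. (norm (grad \<beta> x))^2 * (f x)^2)"
 define Wu where "Wu = (LBINT x. (\<beta> x)^2 * (u x)^2)"
 define Wa where "Wa = (LBINT x. (\<beta> x)^2 * (ua x)^2)"
 define Gu where "Gu = (LBINT x. (norm (grad \<beta> x))^2 * (u x)^2)"
 define \<theta> where "\<theta> = \<mu> + S / \<mu>"
 have \<theta>0: "0 <= \<theta>" using l S0 by (simp add: \<theta>_def)
 have Wu: "Wu <= Wf + (M^2 + 2) * \<theta>"
  using weighted_square_le[OF f2 u_L2 u_close bm b01 l] by (simp add: Wu_def Wf_def \<theta>_def)
 have Gu: "Gu <= Gf + B * (M^2 + 2) * \<theta>"
  using weighted_square_le[OF f2 u_L2 u_close gbm zero_le_power2 B l] by (simp add: Gu_def Gf_def \<theta>_def)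
 have Wa: "Wa <= Wf + (M^2 + 2) * \<theta>"
 proof -
  have fa: "in_L2 (\<lambda>x. \<bar>f x\<bar>)" "(LBINT x. \<bar>f x\<bar>^2) <= M^2" using f2 by (simp_all add: in_L2_real)
  show ?thesis using weighted_square_le[OF fa ua_close bm b01 l] by (simp add: Wa_def Wf_def \<theta>_def)
 qed
 have D0: "0 <= D" using Q_bound[of 0] by linarith
 have int_bu: "intble (\<lambda>x. (\<beta> x)^2 * (u x * g x))" if "smooth g" for g
  unfolding power2_eq_square mult.assoc
  by (intro tf_integrable[of UNIV] tf_mult'[OF \<beta>(1)] smooth_mult \<beta>s u_smooth that)
 have visc: "2 * (LBINT x. (\<beta> x)^2 * (u x * Lu x)) + (LBINT x. (\<beta> x)^2 * (norm (grad u x))^2) <= 4 * Gu"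
  using viscous_energy[OF u_smooth \<beta>(1)] by (simp add: Lu_def Gu_def mult.assoc)
 \<comment> \<open>Twice the product of \<open>\<bar>u x\<bar>\<close> and \<open>ua x\<close> is at
   most the sum of their squares, and both weighted square integrals are close to that of
   \<open>f\<close>.\<close>
 have reac: "2 * (LBINT x. (\<beta> x)^2 * (u x * Z x)) * \<kappa> <= \<bar>\<kappa>\<bar> * M * (Wu + Wa)"
 proof -
  have "\<bar>LBINT x. (\<beta> x)^2 * (u x * Z x)\<bar> <= (LBINT x. M / 2 * ((\<beta> x)^2 * (u x)^2 + (\<beta> x)^2 * (ua x)^2))"
  proof (rule integral_abs_bound_integral)
   fix x
   have "\<bar>(\<beta> x)^2 * (u x * Z x)\<bar> = (\<beta> x)^2 * (\<bar>u x\<bar> * \<bar>Z x\<bar>)" by (simp add: abs_mult)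
   also have "... <= (\<beta> x)^2 * (\<bar>u x\<bar> * (M * ua x))" using Z_bound by (intro mult_left_mono) auto
   also have "... = (\<beta> x)^2 * (M / 2 * (2 * \<bar>u x\<bar> * ua x))" by simp
   also have "... <= (\<beta> x)^2 * (M / 2 * ((u x)^2 + (ua x)^2))"
    using sum_squares_bound[of "\<bar>u x\<bar>" "ua x"] M0 by (intro mult_left_mono) auto
   finally show "\<bar>(\<beta> x)^2 * (u x * Z x)\<bar> <= M / 2 * ((\<beta> x)^2 * (u x)^2 + (\<beta> x)^2 * (ua x)^2)"
    by (simp add: distrib_left mult.left_commute)
  qed (use int_bu[OF Z_smooth] ib[OF iu2] ib[OF iua2] in auto)
  also have "... = M / 2 * (Wu + Wa)" using ib[OF iu2] ib[OF iua2] by (simp add: Wu_def Wa_def)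
  finally have le: "\<bar>LBINT x. (\<beta> x)^2 * (u x * Z x)\<bar> <= M / 2 * (Wu + Wa)" .
  have "2 * (LBINT x. (\<beta> x)^2 * (u x * Z x)) * \<kappa> <= 2 * (\<bar>LBINT x. (\<beta> x)^2 * (u x * Z x)\<bar> * \<bar>\<kappa>\<bar>)"
  proof -
   have "(LBINT x. (\<beta> x)^2 * (u x * Z x)) * \<kappa> <= \<bar>LBINT x. (\<beta> x)^2 * (u x * Z x)\<bar> * \<bar>\<kappa>\<bar>"
    by (rule order_trans[OF abs_ge_self]) (simp only: abs_mult order_refl)
   then show ?thesis by linarith
  qed
  also have "... <= 2 * (M / 2 * (Wu + Wa) * \<bar>\<kappa>\<bar>)" using le by (intro mult_left_mono mult_right_mono) auto
  also have "... = \<bar>\<kappa>\<bar> * M * (Wu + Wa)" by simp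
  finally show ?thesis .
 qed
 \<comment> \<open>Twice the integrand is v \<bullet> grad (\<beta>^2 u^2) minus a term
   \<open>h\<close> containing grad \<beta>. The first is handled by the weak bound on the
   divergence, and Young's inequality for the second gives \<open>L^2 * Wu + Gu\<close>.\<close>
 have tr1: "- 2 * (LBINT x. (\<beta> x)^2 * (u x * (v x \<bullet> grad u x))) <= (D + L^2) * Wu + Gu"
  and itr1: "intble (\<lambda>x. (\<beta> x)^2 * (u x * (v x \<bullet> grad u x)))"
 proof -
  define w where "w x = \<beta> x * (\<beta> x * (u x * u x))" for x
  have w: "test_fun UNIV w" unfolding w_def[abs_def] by (intro tf_mult'[OF \<beta>(1)] smooth_mult \<beta>s u_smooth)
  have ws: "smooth w" by (rule tf_smooth[OF w])
  have dw: "dd i w x = 2 * ((\<beta> x)^2 * (u x * dd i u x)) + 2 * (\<beta> x * (u x)^2 * dd i \<beta> x)" for i x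
  proof -
   note sd = smooth_differentiable and sm = smooth_mult \<beta>s u_smooth
   have "dd i (\<lambda>x. u x * u x) x = u x * dd i u x + dd i u x * u x" by (intro dd_mult sd sm)
   moreover have "dd i (\<lambda>x. \<beta> x * (u x * u x)) x = \<beta> x * dd i (\<lambda>x. u x * u x) x + dd i \<beta> x * (u x * u x)" by (intro dd_mult sd sm)
   moreover have "dd i w x = \<beta> x * dd i (\<lambda>x. \<beta> x * (u x * u x)) x + dd i \<beta> x * (\<beta> x * (u x * u x))"
    unfolding w_def[abs_def] by (intro dd_mult sd sm)
   ultimately show ?thesis by (simp add: power2_eq_square algebra_simps)
  qed
  have gw: "v x \<bullet> grad w x = 2 * ((\<beta> x)^2 * (u x * (v x \<bullet> grad u x))) + 2 * (\<beta> x * (u x)^2 * (v x \<bullet> grad \<beta> x))" for x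
   using grad_inner[OF ws, of x "v x"] grad_inner[OF u_smooth, of x "v x"] grad_inner[OF \<beta>s, of x "v x"] dw[of x "v x"]
   by (simp add: inner_commute)
  define h where "h x = 2 * (\<beta> x * (u x)^2 * (v x \<bullet> grad \<beta> x))" for x
  have hb: "\<bar>h x\<bar> <= L^2 * ((\<beta> x)^2 * (u x)^2) + (norm (grad \<beta> x))^2 * (u x)^2" for x
  proof -
   have "\<bar>h x\<bar> = 2 * \<beta> x * \<bar>v x \<bullet> grad \<beta> x\<bar> * (u x)^2"
    using \<beta>(2) by (simp add: h_def abs_mult mult_ac)
   also have "... <= 2 * \<beta> x * (L * norm (grad \<beta> x)) * (u x)^2"
   proof (intro mult_right_mono mult_left_mono)
    show "\<bar>v x \<bullet> grad \<beta> x\<bar> <= L * norm (grad \<beta> x)"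
     by (rule order_trans[OF Cauchy_Schwarz_ineq2]) (intro mult_right_mono v_bound norm_ge_zero)
   qed (use \<beta>(2) in auto)
   also have "... = (2 * (L * \<beta> x) * norm (grad \<beta> x)) * (u x)^2" by simp
   also have "... <= ((L * \<beta> x)^2 + (norm (grad \<beta> x))^2) * (u x)^2"
    by (intro mult_right_mono sum_squares_bound) simp
   finally show ?thesis by (simp add: power_mult_distrib algebra_simps)
  qed
  have ihb: "intble (\<lambda>x. L^2 * ((\<beta> x)^2 * (u x)^2) + (norm (grad \<beta> x))^2 * (u x)^2)"
   using ib[OF iu2] ig[OF iu2] by simp
  have ih: "intble h"
  proof (rule Bochner_Integration.integrable_bound[OF ihb])
   show "h \<in> borel_measurable lborel" unfolding h_def[abs_def] by measurable
   show "AE x in lborel. norm (h x) <= norm (L^2 * ((\<beta> x)^2 * (u x)^2) + (norm (grad \<beta> x))^2 * (u x)^2)"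
    by (intro AE_I2) (simp only: real_norm_def order_trans[OF hb abs_ge_self])
  qed
  have igw: "intble (\<lambda>x. v x \<bullet> grad w x)"
  proof -
   have gwi: "intble (\<lambda>x. norm (grad w x))"
    unfolding grad_def by (intro integrable_norm Bochner_Integration.integrable_sum integrable_scaleR_left tf_integrable[OF tf_dd[OF w]])
   have gwm: "grad w \<in> borel_measurable borel" by (rule grad_borel[OF ws])
   show ?thesis
   proof (rule Bochner_Integration.integrable_bound[of _ "\<lambda>x. L * norm (grad w x)"])
    show "(\<lambda>x. v x \<bullet> grad w x) \<in> borel_measurable lborel" using gwm by measurable
    show "AE x in lborel. norm (v x \<bullet> grad w x) <= norm (L * norm (grad w x))"
    proof (intro AE_I2)
     fix x
     have "norm (v x) * norm (grad w x) <= L * norm (grad w x)" by (intro mult_right_mono v_bound) simp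
     then show "norm (v x \<bullet> grad w x) <= norm (L * norm (grad w x))"
      using Cauchy_Schwarz_ineq2[of "v x" "grad w x"] L0 by (simp add: abs_mult)
    qed
   qed (use gwi in simp)
  qed
  have eq: "(\<beta> x)^2 * (u x * (v x \<bullet> grad u x)) = (v x \<bullet> grad w x - h x) / 2" for x
   unfolding gw h_def by simp
  show "intble (\<lambda>x. (\<beta> x)^2 * (u x * (v x \<bullet> grad u x)))"
   unfolding eq using igw ih by simp
  have "- 2 * (LBINT x. (\<beta> x)^2 * (u x * (v x \<bullet> grad u x))) = - (LBINT x. v x \<bullet> grad w x) + (LBINT x. h x)"
   unfolding eq using igw ih by simp
  also have "... <= D * Wu + (L^2 * Wu + Gu)"
  proof (rule add_mono)
   have "- (LBINT x. v x \<bullet> grad w x) <= D * (LBINT x. \<bar>w x\<bar>)"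
    using v w unfolding regular_field_def by (meson abs_le_D2)
   also have "(\<lambda>x. \<bar>w x\<bar>) = (\<lambda>x. (\<beta> x)^2 * (u x)^2)"
    by (auto simp: w_def power2_eq_square abs_mult mult.assoc)
   finally show "- (LBINT x. v x \<bullet> grad w x) <= D * Wu" by (simp add: Wu_def)
   have "(LBINT x. h x) <= (LBINT x. L^2 * ((\<beta> x)^2 * (u x)^2) + (norm (grad \<beta> x))^2 * (u x)^2)"
    by (rule integral_mono[OF ih ihb]) (use hb abs_ge_self order_trans in blast)
   then show "(LBINT x. h x) <= L^2 * Wu + Gu"
    using ib[OF iu2] ig[OF iu2] by (simp add: Wu_def Gu_def)
  qed
  finally show "- 2 * (LBINT x. (\<beta> x)^2 * (u x * (v x \<bullet> grad u x))) <= (D + L^2) * Wu + Gu"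
   by (simp add: algebra_simps)
 qed
 have bz: "norm x > r ==> (\<beta> x)^2 = 0" for x by (simp add: \<beta>(4))
 note JJ = J_estimate[OF bm b01 bz Cv C\<eta> l(1)]
 obtain B\<eta> where B\<eta>: "B\<eta> > 0" "!!x. norm (grad \<eta> x) <= B\<eta>" using grad_\<eta>_bounded by blast
 have Tb: "\<bar>T x\<bar> <= L * B\<eta> * M" for x
 proof -
  have "\<bar>T x\<bar> <= (LBINT y. L * B\<eta> * \<bar>f y\<bar>)"
   unfolding T_def
  proof (rule integral_abs_bound_integral[OF transport_integrable[OF f_int v_borel v_bound]])
   fix y
   have "\<bar>v y \<bullet> grad \<eta> (x - y)\<bar> <= L * B\<eta>"
    by (rule order_trans[OF Cauchy_Schwarz_ineq2]) (intro mult_mono v_bound B\<eta>(2) norm_ge_zero L0)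
   then have "\<bar>f y\<bar> * \<bar>v y \<bullet> grad \<eta> (x - y)\<bar> <= \<bar>f y\<bar> * (L * B\<eta>)" by (rule mult_left_mono) simp
   then show "\<bar>f y * (v y \<bullet> grad \<eta> (x - y))\<bar> <= L * B\<eta> * \<bar>f y\<bar>" by (simp add: abs_mult mult_ac)
  qed (use f_int in simp)
  also have "... <= L * B\<eta> * M" using f_L1 L0 B\<eta>(1) by (simp add: mult_left_mono)
  finally show ?thesis .
 qed
 have iT: "intble (\<lambda>x. (\<beta> x)^2 * (u x * T x))"
 proof (rule integrable_bounded_support[where B = "1 * (M * (L * B\<eta> * M))" and r = r])
  show "\<bar>(\<beta> x)^2 * (u x * T x)\<bar> <= 1 * (M * (L * B\<eta> * M))" for x
   unfolding abs_mult using bab[of x] u_bound[of x] Tb[of x] M0 by (intro mult_mono) auto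
 qed (auto simp: bz)
 have iR: "intble (\<lambda>x. (\<beta> x)^2 * (u x * R x))"
  using Bochner_Integration.integrable_diff[OF iT itr1] by (simp add: T_split algebra_simps)
 have tr2: "- 2 * (LBINT x. (\<beta> x)^2 * (u x * R x)) <= 2 * D * Wf + 4 * C\<eta> * M * (1 + Cv) * \<theta>"
 proof -
  have "- (LBINT x. (\<beta> x)^2 * (u x * R x)) = (LBINT x. (\<beta> x)^2 * (- (u x * R x)))"
   by simp
  also have "... <= (LBINT x. D * ((\<beta> x)^2 * (f x)^2) + (\<beta> x)^2 * J x)"
  proof (rule integral_mono)
   show "(\<beta> x)^2 * (- (u x * R x)) <= D * ((\<beta> x)^2 * (f x)^2) + (\<beta> x)^2 * J x" for x
    using mult_left_mono[OF commutator_split b01(1), of x x] by (simp add: distrib_left mult_ac)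
  qed (use iR ib[OF if2] JJ(1) in auto)
  also have "... = D * Wf + (LBINT x. (\<beta> x)^2 * J x)"
   using ib[OF if2] JJ(1) by (simp add: Wf_def)
  also have "... <= D * Wf + 2 * C\<eta> * M * (1 + Cv) * \<theta>" using JJ(2) by (simp add: \<theta>_def)
  finally show ?thesis by simp
 qed
 have tr: "- 2 * (LBINT x. (\<beta> x)^2 * (u x * T x)) <= (D + L^2) * Wu + Gu + 2 * D * Wf + 4 * C\<eta> * M * (1 + Cv) * \<theta>"
 proof -
  have "(LBINT x. (\<beta> x)^2 * (u x * T x)) = (LBINT x. (\<beta> x)^2 * (u x * (v x \<bullet> grad u x))) + (LBINT x. (\<beta> x)^2 * (u x * R x))"
   using itr1 iR by (simp add: T_split distrib_left)
  then show ?thesis using tr1 tr2 by linarith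
 qed
 have split: "(LBINT x. (\<beta> x)^2 * (u x * rhs v \<kappa> \<nu> f (\<lambda>y. \<eta> (x - y))))
  = - (LBINT x. (\<beta> x)^2 * (u x * T x)) + (LBINT x. (\<beta> x)^2 * (u x * Z x)) * \<kappa> + \<nu> * (LBINT x. (\<beta> x)^2 * (u x * Lu x))"
 proof -
  have "(LBINT x. (\<beta> x)^2 * (u x * rhs v \<kappa> \<nu> f (\<lambda>y. \<eta> (x - y))))
   = (LBINT x. - ((\<beta> x)^2 * (u x * T x)) + (\<beta> x)^2 * (u x * Z x) * \<kappa> + \<nu> * ((\<beta> x)^2 * (u x * Lu x)))"
   unfolding rhs_mollifier by (intro Bochner_Integration.integral_cong refl) (simp add: algebra_simps)
  then show ?thesis using iT int_bu[OF Z_smooth] int_bu[OF Lu_smooth] by simp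
 qed
 have "2 * (LBINT x. (\<beta> x)^2 * (u x * rhs v \<kappa> \<nu> f (\<lambda>y. \<eta> (x - y)))) + \<nu> * (LBINT x. (\<beta> x)^2 * (norm (grad u x))^2)
   <= ((D + L^2) * Wu + Gu + 2 * D * Wf + 4 * C\<eta> * M * (1 + Cv) * \<theta>) + \<bar>\<kappa>\<bar> * M * (Wu + Wa) + \<nu> * (4 * Gu)"
  using tr reac mult_left_mono[OF visc \<nu>] unfolding split by (simp add: algebra_simps)
 also have "... = (D + L^2 + \<bar>\<kappa>\<bar> * M) * Wu + \<bar>\<kappa>\<bar> * M * Wa + (4 * \<nu> + 1) * Gu + 2 * D * Wf + 4 * C\<eta> * M * (1 + Cv) * \<theta>"
  by (simp add: algebra_simps)
 also have "... <= (D + L^2 + \<bar>\<kappa>\<bar> * M) * (Wf + (M^2 + 2) * \<theta>) + \<bar>\<kappa>\<bar> * M * (Wf + (M^2 + 2) * \<theta>)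
   + (4 * \<nu> + 1) * (Gf + B * (M^2 + 2) * \<theta>) + 2 * D * Wf + 4 * C\<eta> * M * (1 + Cv) * \<theta>"
  using D0 M0 \<nu> by (intro add_mono mult_left_mono Wu Wa Gu order_refl) auto
 also have "... = (2 * \<bar>\<kappa>\<bar> * M + 3 * D + L^2) * Wf + (4 * \<nu> + 1) * Gf
   + ((2 * \<bar>\<kappa>\<bar> * M + D + L^2) * (M^2 + 2) + (4 * \<nu> + 1) * B * (M^2 + 2) + 4 * C\<eta> * M * (1 + Cv)) * \<theta>"
  by (simp add: algebra_simps)
 finally show ?thesis unfolding Wf_def Gf_def \<theta>_def .
qed

end

subsection \<open>Riesz representation and weak gradients\<close>

text \<open>With the weights 2^n the squares still have a finite total integral. Hence 2^n (d n x)^2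
  is bounded in n for almost every \<open>x\<close>, and \<open>\<bar>d n x\<bar>\<close> decays
  geometrically.\<close>

lemma AE_summable_squares:
 fixes d :: "nat => 'a::euclidean_space => real"
 assumes d: "!!n. in_L2 (d n)" "!!n. (LBINT x. (d n x)^2) <= C * (1 / 4) ^ n" and C: "0 <= C"
 shows "AE x in lborel. summable (\<lambda>n. \<bar>d n x\<bar>)"
proof -
 have [measurable]: "d n \<in> borel_measurable borel" for n using d(1) by (simp add: in_L2_real)
 have i: "intble (\<lambda>x. (d n x)^2)" for n using d(1) by (simp add: in_L2_real)
 have "(\<integral>\<^sup>+x. (\<Sum>n. ennreal (2 ^ n * (d n x)^2)) \<partial>lborel) = (\<Sum>n. \<integral>\<^sup>+x. ennreal (2 ^ n * (d n x)^2) \<partial>lborel)"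
  by (rule nn_integral_suminf) measurable
 also have "... <= (\<Sum>n. ennreal (C * (1 / 2) ^ n))"
 proof (intro suminf_le summableI)
  fix n
  have "(\<integral>\<^sup>+x. ennreal (2 ^ n * (d n x)^2) \<partial>lborel) = ennreal (2 ^ n * (LBINT x. (d n x)^2))"
   using i[of n] by (subst nn_integral_eq_integral) auto
  also have "... <= ennreal (2 ^ n * (C * (1 / 4) ^ n))"
   using d(2)[of n] by (intro ennreal_leI mult_left_mono) auto
  also have "2 ^ n * (C * (1 / 4) ^ n) = C * (1 / 2) ^ n"
  proof -
   have "(2::real) ^ n * (1 / 4) ^ n = (1 / 2) ^ n" by (simp flip: power_mult_distrib)
   then show ?thesis by (simp add: mult.left_commute)
  qed
  finally show "(\<integral>\<^sup>+x. ennreal (2 ^ n * (d n x)^2) \<partial>lborel) <= ennreal (C * (1 / 2) ^ n)" .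
 qed
 also have "... = ennreal (C * 2)"
  using C sums_mult[OF geometric_sums[of "1/2 :: real"], of C] by (intro suminf_ennreal_eq) auto
 finally have "(\<integral>\<^sup>+x. (\<Sum>n. ennreal (2 ^ n * (d n x)^2)) \<partial>lborel) \<noteq> \<infinity>" by (auto simp: top_unique)
 then have "AE x in lborel. (\<Sum>n. ennreal (2 ^ n * (d n x)^2)) \<noteq> \<infinity>"
  by (intro nn_integral_PInf_AE) measurable
 then show ?thesis
 proof eventually_elim
  fix x assume fin: "(\<Sum>n. ennreal (2 ^ n * (d n x)^2)) \<noteq> \<infinity>"
  define c where "c = enn2real (\<Sum>n. ennreal (2 ^ n * (d n x)^2))"
  have c: "(\<Sum>n. ennreal (2 ^ n * (d n x)^2)) = ennreal c" "0 <= c"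
   using fin unfolding c_def infinity_ennreal_def by (simp_all only: ennreal_enn2real less_top enn2real_nonneg)
  have "2 ^ n * (d n x)^2 <= c" for n
  proof -
   have "(\<Sum>m\<in>{n}. ennreal (2 ^ m * (d m x)^2)) <= (\<Sum>n. ennreal (2 ^ n * (d n x)^2))"
    by (rule sum_le_suminf) auto
   then show ?thesis unfolding c(1) using c(2) by (simp add: ennreal_le_iff)
  qed
  then have b: "\<bar>d n x\<bar> <= sqrt c * sqrt (1 / 2) ^ n" for n
  proof -
   have "(d n x)^2 <= c * (1 / 2) ^ n" using \<open>2 ^ n * (d n x)^2 <= c\<close> by (simp add: power_one_over field_simps)
   then have "sqrt ((d n x)^2) <= sqrt (c * (1 / 2) ^ n)" by (rule real_sqrt_le_mono)
   from this[unfolded real_sqrt_abs] show ?thesis by (simp only: real_sqrt_mult real_sqrt_power)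
  qed
  have "summable (\<lambda>n. sqrt c * sqrt (1 / 2) ^ n)"
   by (intro summable_mult summable_geometric) (simp add: real_sqrt_divide)
  then show "summable (\<lambda>n. \<bar>d n x\<bar>)"
   by (rule summable_comparison_test') (use b in auto)
 qed
qed

text \<open>A fast Cauchy sequence converges almost everywhere; Fatou's lemma carries the Cauchy
  bound to the limit. On the exceptional null set \<open>lim\<close> has an unspecified value, and
  \<open>g\<close> is measurable nonetheless.\<close>

lemma L2_complete:
 fixes \<phi> :: "nat => 'a::euclidean_space => real"
 assumes \<phi>: "!!n. in_L2 (\<phi> n)" and C: "0 <= C"
  and cauchy: "!!n m. n <= m ==> (LBINT x. (\<phi> m x - \<phi> n x)^2) <= C * (1 / 4) ^ n"
 obtains g where "in_L2 g" "(\<lambda>n. L2_norm (\<lambda>x. \<phi> n x - g x)) \<longlonglongrightarrow> 0"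
proof -
 have [measurable]: "\<phi> n \<in> borel_measurable borel" for n using \<phi> by (simp add: in_L2_real)
 define g where "g x = lim (\<lambda>n. \<phi> n x)" for x
 have gm[measurable]: "borelf g" unfolding g_def[abs_def] by measurable
 have "AE x in lborel. summable (\<lambda>n. \<bar>\<phi> (Suc n) x - \<phi> n x\<bar>)"
  by (rule AE_summable_squares[where C = C]) (auto intro!: in_L2_diff \<phi> cauchy C)
 then have lim: "AE x in lborel. (\<lambda>n. \<phi> n x) \<longlonglongrightarrow> g x"
 proof eventually_elim
  fix x assume "summable (\<lambda>n. \<bar>\<phi> (Suc n) x - \<phi> n x\<bar>)"
  then have "summable (\<lambda>n. \<phi> (Suc n) x - \<phi> n x)" by (rule summable_rabs_cancel)
  then have "convergent (\<lambda>n. \<Sum>i<n. \<phi> (Suc i) x - \<phi> i x)" by (simp add: summable_iff_convergent)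
  then have "convergent (\<lambda>n. \<phi> n x - \<phi> 0 x)" 
   using sum_lessThan_telescope[of "\<lambda>n. \<phi> n x"] by simp
  then obtain l where "(\<lambda>n. \<phi> n x - \<phi> 0 x) \<longlonglongrightarrow> l" by (auto simp: convergent_def)
  from tendsto_add[OF this tendsto_const[of "\<phi> 0 x"]] have "convergent (\<lambda>n. \<phi> n x)" by (auto simp: convergent_def)
  then show "(\<lambda>n. \<phi> n x) \<longlonglongrightarrow> g x" unfolding g_def by (simp add: convergent_LIMSEQ_iff)
 qed
 have bound: "(\<integral>\<^sup>+x. ennreal ((\<phi> n x - g x)^2) \<partial>lborel) <= ennreal (C * (1 / 4) ^ n)" for n
 proof -
  have "(\<integral>\<^sup>+x. ennreal ((\<phi> n x - g x)^2) \<partial>lborel) = (\<integral>\<^sup>+x. liminf (\<lambda>m. ennreal ((\<phi> m x - \<phi> n x)^2)) \<partial>lborel)"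
  proof (rule nn_integral_cong_AE)
   show "AE x in lborel. ennreal ((\<phi> n x - g x)^2) = liminf (\<lambda>m. ennreal ((\<phi> m x - \<phi> n x)^2))"
    using lim
   proof eventually_elim
    fix x assume "(\<lambda>n. \<phi> n x) \<longlonglongrightarrow> g x"
    then have "(\<lambda>m. ennreal ((\<phi> m x - \<phi> n x)^2)) \<longlonglongrightarrow> ennreal ((g x - \<phi> n x)^2)"
     by (intro tendsto_ennrealI tendsto_intros)
    from lim_imp_Liminf[OF _ this] show "ennreal ((\<phi> n x - g x)^2) = liminf (\<lambda>m. ennreal ((\<phi> m x - \<phi> n x)^2))"
     by (simp add: power2_commute)
   qed
  qed
  also have "... <= liminf (\<lambda>m. \<integral>\<^sup>+x. ennreal ((\<phi> m x - \<phi> n x)^2) \<partial>lborel)"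
   by (rule nn_integral_liminf) measurable
  also have "... <= ennreal (C * (1 / 4) ^ n)"
  proof (rule Liminf_le)
   show "\<forall>\<^sub>F m in sequentially. (\<integral>\<^sup>+x. ennreal ((\<phi> m x - \<phi> n x)^2) \<partial>lborel) <= ennreal (C * (1 / 4) ^ n)"
    using eventually_ge_at_top[of n]
   proof eventually_elim
    fix m assume "n <= m"
    have "intble (\<lambda>x. (\<phi> m x - \<phi> n x)^2)" using in_L2_diff[OF \<phi> \<phi>, of m n] by (simp add: in_L2_real)
    then show "(\<integral>\<^sup>+x. ennreal ((\<phi> m x - \<phi> n x)^2) \<partial>lborel) <= ennreal (C * (1 / 4) ^ n)"
     using cauchy[OF \<open>n <= m\<close>] by (subst nn_integral_eq_integral) (auto intro: ennreal_leI)
   qed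
  qed simp
  finally show ?thesis .
 qed
 have c0: "0 <= C * (1 / 4) ^ n" for n using C by simp
 have m: "(\<lambda>x. (\<phi> n x - g x)^2) \<in> borel_measurable lborel" for n by measurable
 note bb = integral_le_nn_integral[OF m zero_le_power2 c0 bound]
 have "in_L2 (\<lambda>x. \<phi> 0 x - g x)" using bb(1)[of 0] by (simp add: in_L2_real)
 from in_L2_diff[OF \<phi>[of 0] this] have g2: "in_L2 g" by simp
 have "(\<lambda>n. C * (1 / 4) ^ n) \<longlonglongrightarrow> C * 0"
  by (intro tendsto_mult tendsto_const LIMSEQ_realpow_zero) auto
 then have c1: "(\<lambda>n. C * (1 / 4) ^ n) \<longlonglongrightarrow> 0" by simp
 have "(\<lambda>n. \<integral>x. (\<phi> n x - g x)^2 \<partial>lborel) \<longlonglongrightarrow> 0"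
 proof (rule Lim_null_comparison[OF _ c1])
  show "\<forall>\<^sub>F n in sequentially. norm (LBINT x. (\<phi> n x - g x)^2) <= C * (1 / 4) ^ n"
   using bb(2) by (intro always_eventually allI) simp
 qed
 from tendsto_real_sqrt[OF this] have "(\<lambda>n. L2_norm (\<lambda>x. \<phi> n x - g x)) \<longlonglongrightarrow> 0" by (simp add: L2_norm_def)
 with g2 that show ?thesis by blast
qed

lemma L2_norm_nonneg: "0 <= L2_norm f" by (simp add: L2_norm_def)

lemma tf_in_L2: "test_fun S (\<psi> :: 'a::euclidean_space => real) ==> in_L2 \<psi>"
proof -
 assume \<psi>: "test_fun S \<psi>"
 obtain B where "!!x. \<bar>\<psi> x\<bar> <= B" using tf_bounded[OF \<psi>] by metis
 moreover obtain r where "!!x. norm x > r ==> \<psi> x = 0" using tf_support[OF \<psi>] by metis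
 ultimately show ?thesis using smooth_borel[OF tf_smooth[OF \<psi>]] by (intro in_L2_support) auto
qed

lemma tf_diff: "test_fun UNIV (f::'a::euclidean_space => real) ==> test_fun UNIV g ==> test_fun UNIV (\<lambda>x. f x - g x)"
 using tf_add[of f "\<lambda>x. (-1) * g x"] tf_cmult[of g "-1"] by simp

lemma L2_norm_combination:
 fixes f g :: "'a::euclidean_space => real"
 assumes "in_L2 f" "in_L2 g"
 shows "(LBINT x. (f x + t * g x)^2) = (LBINT x. (f x)^2) + 2 * t * (LBINT x. f x * g x) + t^2 * (LBINT x. (g x)^2)"
proof -
 have "(LBINT x. (f x + t * g x)^2) = (LBINT x. (f x)^2 + 2 * t * (f x * g x) + t^2 * (g x)^2)"
  by (intro Bochner_Integration.integral_cong) (auto simp: power2_eq_square algebra_simps)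
 also have "... = (LBINT x. (f x)^2) + 2 * t * (LBINT x. f x * g x) + t^2 * (LBINT x. (g x)^2)"
  using assms in_L2_mult_integrable[OF assms] by (simp add: in_L2_real)
 finally show ?thesis .
qed

lemma quadratic_zero:
 fixes e N :: real
 assumes "0 <= N" "!!t. 2 * t * e - t^2 * N <= 0"
 shows "e = 0"
proof -
 have "2 * (e / (N + 1)) * e - (e / (N + 1))^2 * N = e^2 * (N + 2) / (N + 1)^2"
  using assms(1) by (simp add: divide_simps power2_eq_square) (simp add: algebra_simps)
 then have "e^2 * (N + 2) / (N + 1)^2 <= 0" using assms(2)[of "e / (N + 1)"] by simp
 moreover have "0 < (N + 1)^2" using assms(1) by simp
 ultimately have "e^2 * (N + 2) <= 0" by (simp add: divide_le_0_iff)
 then show ?thesis using assms(1) by (simp add: mult_le_0_iff)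
qed

text \<open>The representing function is the maximizer of 2 ell(f) - ||f||^2. The supremum is taken
  over test functions, where alone \<open>ell\<close> is given. A maximizing sequence converges in
  L^2 and the condition of stationarity at the limit is the representation.\<close>

lemma Riesz_L2:
 fixes ell :: "('a::euclidean_space => real) => real"
 assumes lin: "!!f g t. test_fun UNIV f ==> test_fun UNIV g ==> ell (\<lambda>x. f x + t * g x) = ell f + t * ell g"
  and bd: "!!f. test_fun UNIV f ==> \<bar>ell f\<bar> <= m * L2_norm f"
 obtains g where "in_L2 g" "!!\<psi>. test_fun UNIV \<psi> ==> ell \<psi> = (LBINT x. \<psi> x * g x)"
proof -
 define J where "J f = 2 * ell f - (LBINT x. (f x)^2)" for f
 have Jb: "J f <= m^2" if f: "test_fun UNIV f" for f
 proof -
  have "J f <= 2 * (m * L2_norm f) - (L2_norm f)^2"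
   using bd[OF f] by (simp add: J_def L2_norm_sq)
  also have "... <= m^2" using zero_le_power2[of "m - L2_norm f"] by (simp add: power2_diff)
  finally show ?thesis .
 qed
 have bdd: "bdd_above (J ` {f. test_fun UNIV f})" using Jb by (auto intro!: bdd_aboveI)
 have ne: "J ` {f. test_fun UNIV f} \<noteq> {}" using tf_zero by blast
 define s where "s = Sup (J ` {f. test_fun UNIV f})"
 have Js: "J f <= s" if "test_fun UNIV f" for f
  unfolding s_def using that bdd by (intro cSup_upper) auto
 have "\<exists>f. test_fun UNIV f \<and> s - (1 / 4) ^ n < J f" for n :: nat
 proof -
  have "s - (1 / 4) ^ n < Sup (J ` {f. test_fun UNIV f})" by (simp add: s_def)
  then show ?thesis using less_cSup_iff[OF ne bdd] by auto
 qed
 then obtain \<phi> where \<phi>: "!!n. test_fun UNIV (\<phi> n)" "!!n. s - (1 / 4) ^ n < J (\<phi> n)" by metis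
 note \<phi>2 = tf_in_L2[OF \<phi>(1)]
 have Jc: "J (\<lambda>x. f x + t * g x) = J f + 2 * t * (ell g - (LBINT x. f x * g x)) - t^2 * (LBINT x. (g x)^2)"
  if "test_fun UNIV f" "test_fun UNIV g" for f g t
  unfolding J_def lin[OF that] L2_norm_combination[OF tf_in_L2[OF that(1)] tf_in_L2[OF that(2)]]
  by (simp add: algebra_simps)
 \<comment> \<open>Comparison with the midpoint: the value of \<open>J\<close> there exceeds the
   mean of the two end values by a quarter of the squared distance, yet is at most
   \<open>s\<close>.\<close>
 have cauchy: "(LBINT x. (\<phi> k x - \<phi> n x)^2) <= 4 * (1 / 4) ^ n" if "n <= k" for n k
 proof -
  let ?d = "\<lambda>x. \<phi> k x - \<phi> n x"
  have d: "test_fun UNIV ?d" by (intro tf_diff \<phi>)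
  define N where "N = (LBINT x. (?d x)^2)"
  define c where "c = ell ?d - (LBINT x. \<phi> n x * ?d x)"
  have "J (\<lambda>x. \<phi> n x + 1 * ?d x) = J (\<phi> n) + 2 * 1 * c - 1^2 * N"
   unfolding Jc[OF \<phi>(1) d] c_def N_def ..
  then have 1: "J (\<phi> k) = J (\<phi> n) + 2 * c - N" by simp
  have "J (\<lambda>x. \<phi> n x + (1 / 2) * ?d x) = J (\<phi> n) + 2 * (1 / 2) * c - (1 / 2)^2 * N"
   unfolding Jc[OF \<phi>(1) d] c_def N_def ..
  moreover have "J (\<lambda>x. \<phi> n x + (1 / 2) * ?d x) <= s" by (intro Js tf_add tf_cmult d \<phi>)
  ultimately have 2: "J (\<phi> n) + c - N / 4 <= s" by (simp add: power2_eq_square)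
  have "(1 / 4) ^ k <= (1 / 4 :: real) ^ n" using that by (intro power_decreasing) auto
  then show ?thesis using 1 2 \<phi>(2)[of n] \<phi>(2)[of k] unfolding N_def[symmetric] by linarith
 qed
 obtain g where g: "in_L2 g" "(\<lambda>n. L2_norm (\<lambda>x. \<phi> n x - g x)) \<longlonglongrightarrow> 0"
  using L2_complete[OF \<phi>2 _ cauchy] by auto
 have "ell \<psi> = (LBINT x. \<psi> x * g x)" if \<psi>: "test_fun UNIV \<psi>" for \<psi>
 proof -
  note \<psi>2 = tf_in_L2[OF \<psi>]
  let ?N = "LBINT x. (\<psi> x)^2"
  define c where "c n = (LBINT x. \<phi> n x * \<psi> x)" for n
  have cl: "c \<longlonglongrightarrow> (LBINT x. g x * \<psi> x)"
  proof (rule LIM_zero_cancel, rule Lim_null_comparison)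
   show "\<forall>\<^sub>F n in sequentially. norm (c n - (LBINT x. g x * \<psi> x)) <= L2_norm (\<lambda>x. \<phi> n x - g x) * L2_norm \<psi>"
   proof (intro always_eventually allI)
    fix n
    have "c n - (LBINT x. g x * \<psi> x) = (LBINT x. (\<phi> n x - g x) * \<psi> x)"
     unfolding c_def using in_L2_mult_integrable[OF \<phi>2[of n] \<psi>2] in_L2_mult_integrable[OF g(1) \<psi>2]
     by (simp add: left_diff_distrib)
    then show "norm (c n - (LBINT x. g x * \<psi> x)) <= L2_norm (\<lambda>x. \<phi> n x - g x) * L2_norm \<psi>"
     using Cauchy_Schwarz_integral[OF in_L2_diff[OF \<phi>2[of n] g(1)] \<psi>2] by simp
   qed
   show "(\<lambda>n. L2_norm (\<lambda>x. \<phi> n x - g x) * L2_norm \<psi>) \<longlonglongrightarrow> 0"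
    using tendsto_mult_right[OF g(2), of "L2_norm \<psi>"] by simp
  qed
  have ineq: "2 * t * (ell \<psi> - (LBINT x. g x * \<psi> x)) - t^2 * ?N <= 0" for t
  proof (rule LIMSEQ_le)
   show "(\<lambda>n. 2 * t * (ell \<psi> - c n) - t^2 * ?N) \<longlonglongrightarrow> 2 * t * (ell \<psi> - (LBINT x. g x * \<psi> x)) - t^2 * ?N"
    by (intro tendsto_intros cl)
   show "(\<lambda>n. (1 / 4 :: real) ^ n) \<longlonglongrightarrow> 0" by (rule LIMSEQ_realpow_zero) auto
   show "\<exists>N. \<forall>n\<ge>N. 2 * t * (ell \<psi> - c n) - t^2 * ?N <= (1 / 4) ^ n"
   proof (intro exI[of _ 0] allI impI)
    fix n
    have "J (\<lambda>x. \<phi> n x + t * \<psi> x) <= s" by (intro Js tf_add tf_cmult \<psi> \<phi>)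
    then show "2 * t * (ell \<psi> - c n) - t^2 * ?N <= (1 / 4) ^ n"
     unfolding Jc[OF \<phi>(1) \<psi>] c_def using \<phi>(2)[of n] by linarith
   qed
  qed
  define e where "e = ell \<psi> - (LBINT x. g x * \<psi> x)"
  have N0: "0 <= ?N" by simp
  have "e = 0" by (rule quadratic_zero[OF N0]) (use ineq in \<open>simp add: e_def\<close>)
  then show ?thesis by (simp add: e_def mult.commute)
 qed
 with g(1) that show ?thesis by blast
qed

section \<open>Weak gradients by components and by duality\<close>

lemma in_L2_component: "in_L2 (g :: 'a::euclidean_space => 'a) ==> i \<in> Basis ==> in_L2 (\<lambda>x. g x \<bullet> i)"
proof -
 assume g: "in_L2 g" and i: "i \<in> Basis"
 have [measurable]: "borelf g" using g by (simp add: in_L2_def)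
 have "intble (\<lambda>x. (g x \<bullet> i)^2)"
 proof (rule Bochner_Integration.integrable_bound[of _ "\<lambda>x. (norm (g x))^2"])
  show "AE x in lborel. norm ((g x \<bullet> i)^2) <= norm ((norm (g x))^2)"
   using Basis_le_norm[OF i] by (intro AE_I2) (simp add: abs_le_square_iff[symmetric])
 qed (use g in \<open>auto simp: in_L2_def\<close>)
 then show ?thesis by (simp add: in_L2_real)
qed

lemma weak_gradient_iff:
 fixes f :: "'a::euclidean_space => real"
 assumes f: "in_L2 f" and g: "in_L2 g"
 shows "weak_gradient f g \<longleftrightarrow> (\<forall>i\<in>Basis. \<forall>\<psi>. test_fun UNIV \<psi> -->
  (LBINT x. f x * dd i \<psi> x) = - (LBINT x. \<psi> x * (g x \<bullet> i)))"
proof -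
 have 1: "(LBINT x. f x *\<^sub>R grad \<psi> x) \<bullet> i = (LBINT x. f x * dd i \<psi> x)"
  and 2: "(LBINT x. \<psi> x *\<^sub>R g x) \<bullet> i = (LBINT x. \<psi> x * (g x \<bullet> i))"
  if \<psi>: "test_fun UNIV \<psi>" and i: "i \<in> Basis" for \<psi> i
 proof -
  have "intble (\<lambda>x. \<Sum>i\<in>Basis. (f x * dd i \<psi> x) *\<^sub>R i)"
   by (intro Bochner_Integration.integrable_sum integrable_scaleR_left locint_tf[OF locint_L2[OF f] tf_dd[OF \<psi>]])
  then have i1: "intble (\<lambda>x. f x *\<^sub>R grad \<psi> x)" by (simp add: grad_def scaleR_sum_right)
  show "(LBINT x. f x *\<^sub>R grad \<psi> x) \<bullet> i = (LBINT x. f x * dd i \<psi> x)"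
   using i1 by (simp add: grad_inner[OF tf_smooth[OF \<psi>]] flip: integral_inner_left)
  have gi: "intble (\<lambda>x. \<psi> x * (g x \<bullet> j))" if "j \<in> Basis" for j
   by (rule in_L2_mult_integrable[OF tf_in_L2[OF \<psi>] in_L2_component[OF g that]])
  have "intble (\<lambda>x. \<Sum>j\<in>Basis. (\<psi> x * (g x \<bullet> j)) *\<^sub>R j)"
   by (intro Bochner_Integration.integrable_sum integrable_scaleR_left gi)
  moreover have "(\<lambda>x. \<Sum>j\<in>Basis. (\<psi> x * (g x \<bullet> j)) *\<^sub>R j) = (\<lambda>x. \<psi> x *\<^sub>R g x)"
   by (rule ext) (simp add: euclidean_representation flip: scaleR_scaleR scaleR_sum_right)
  ultimately have i2: "intble (\<lambda>x. \<psi> x *\<^sub>R g x)" by simp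
  show "(LBINT x. \<psi> x *\<^sub>R g x) \<bullet> i = (LBINT x. \<psi> x * (g x \<bullet> i))"
   using i2 by (simp flip: integral_inner_left)
 qed
 show ?thesis
  unfolding weak_gradient_def euclidean_eq_iff[where 'a = 'a] inner_minus_left using 1 2 by auto
qed

text \<open>One direction is the Cauchy-Schwarz inequality, the other Riesz representation for each
  partial derivative. The bound is a natural number so that membership becomes a countable union of
  conditions closed under convergence in L^2; this makes the set of times with \<rho> in H^1
  measurable.\<close>

lemma in_H1_iff:
 fixes f :: "'a::euclidean_space => real"
 assumes f: "in_L2 f"
 shows "in_H1 f \<longleftrightarrow> (\<exists>m::nat. \<forall>i\<in>Basis. \<forall>\<psi>. test_fun UNIV \<psi> --> \<bar>LBINT x. f x * dd i \<psi> x\<bar> <= real m * L2_norm \<psi>)"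
proof
 assume "in_H1 f"
 then obtain g where g: "in_L2 g" "weak_gradient f g" by (auto simp: in_H1_def)
 obtain m :: nat where m: "(\<Sum>i\<in>Basis. L2_norm (\<lambda>x. g x \<bullet> i)) <= real m" using real_arch_simple by blast
 have "\<bar>LBINT x. f x * dd i \<psi> x\<bar> <= real m * L2_norm \<psi>" if i: "i \<in> Basis" and \<psi>: "test_fun UNIV \<psi>" for i \<psi>
 proof -
  have "\<bar>LBINT x. f x * dd i \<psi> x\<bar> = \<bar>LBINT x. \<psi> x * (g x \<bullet> i)\<bar>"
   using g(2) i \<psi> unfolding weak_gradient_iff[OF f g(1)] by simp
  also have "... <= L2_norm \<psi> * L2_norm (\<lambda>x. g x \<bullet> i)"
   by (rule Cauchy_Schwarz_integral[OF tf_in_L2[OF \<psi>] in_L2_component[OF g(1) i]])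
  also have "... <= L2_norm \<psi> * real m"
   using member_le_sum[OF i, of "\<lambda>i. L2_norm (\<lambda>x. g x \<bullet> i)"] m
   by (intro mult_left_mono L2_norm_nonneg) (auto simp: L2_norm_nonneg)
  finally show ?thesis by (simp add: mult.commute)
 qed
 then show "\<exists>m::nat. \<forall>i\<in>Basis. \<forall>\<psi>. test_fun UNIV \<psi> --> \<bar>LBINT x. f x * dd i \<psi> x\<bar> <= real m * L2_norm \<psi>" by blast
next
 assume "\<exists>m::nat. \<forall>i\<in>Basis. \<forall>\<psi>. test_fun UNIV \<psi> --> \<bar>LBINT x. f x * dd i \<psi> x\<bar> <= real m * L2_norm \<psi>"
 then obtain m :: nat where m: "!!i \<psi>. i \<in> Basis ==> test_fun UNIV \<psi> ==> \<bar>LBINT x. f x * dd i \<psi> x\<bar> <= real m * L2_norm \<psi>" by blast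
 have "\<exists>g. in_L2 g \<and> (\<forall>\<psi>. test_fun UNIV \<psi> --> (LBINT x. f x * dd i \<psi> x) = (LBINT x. \<psi> x * g x))" if i: "i \<in> Basis" for i
 proof (rule Riesz_L2[of "\<lambda>\<psi>. \<integral>x. f x * dd i \<psi> x \<partial>lborel" "real m"])
  show "(LBINT x. f x * dd i (\<lambda>x. p x + t * q x) x) = (LBINT x. f x * dd i p x) + t * (LBINT x. f x * dd i q x)"
   if p: "test_fun UNIV p" and q: "test_fun UNIV q" for p q t
  proof -
   have "dd i (\<lambda>x. p x + t * q x) x = dd i p x + t * dd i q x" for x
   proof -
    note sd = smooth_differentiable[OF tf_smooth]
    have "dd i (\<lambda>x. p x + t * q x) x = dd i p x + dd i (\<lambda>x. t * q x) x"
     by (intro dd_add sd[OF p] sd[OF tf_cmult[OF q]])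
    moreover have "dd i (\<lambda>x. t * q x) x = t * dd i q x" using dd_mult[of "\<lambda>_. t" x q i] sd[OF q] by simp
    ultimately show ?thesis by simp
   qed
   then show ?thesis
    using locint_tf[OF locint_L2[OF f] tf_dd[OF p]] locint_tf[OF locint_L2[OF f] tf_dd[OF q]]
    by (simp add: distrib_left mult.left_commute[of _ t])
  qed
 qed (use m[OF i] in auto)
 then obtain G where G: "!!i. i \<in> Basis ==> in_L2 (G i)"
  "!!i \<psi>. i \<in> Basis ==> test_fun UNIV \<psi> ==> (LBINT x. f x * dd i \<psi> x) = (LBINT x. \<psi> x * G i x)"
  by metis
 define g where "g x = (\<Sum>i\<in>Basis. (- G i x) *\<^sub>R i)" for x
 have gi: "g x \<bullet> i = - G i x" if "i \<in> Basis" for i x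
  unfolding g_def by (rule inner_sum_left_Basis[OF that])
 have "in_L2 g"
 proof -
  have "borelf g" unfolding g_def[abs_def] using G(1)
   by (intro borel_measurable_sum borel_measurable_scaleR borel_measurable_uminus) (auto simp: in_L2_real)
  moreover have "intble (\<lambda>x. (norm (g x))^2)"
   unfolding norm_sq_sum using G(1) by (intro Bochner_Integration.integrable_sum) (simp add: gi in_L2_real)
  ultimately show ?thesis by (simp add: in_L2_def)
 qed
 moreover from this have "weak_gradient f g" unfolding weak_gradient_iff[OF f \<open>in_L2 g\<close>] by (simp add: gi G(2))
 ultimately show "in_H1 f" using f by (auto simp: in_H1_def)
qed

lemma wgrad_H1: "in_H1 f ==> in_L2 (wgrad f) \<and> weak_gradient f (wgrad f)"
 using someI_ex[of "\<lambda>g. in_L2 g \<and> weak_gradient f g"] by (simp add: in_H1_def wgrad_def)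

text \<open>The default value is the same for every such \<open>f\<close>. That lets the weak
  formulation be evaluated explicitly at the exceptional times.\<close>

lemma wgrad_not_H1: "in_L2 f ==> \<not> in_H1 f ==> wgrad f = (SOME g. False)"
proof -
 assume "in_L2 f" "\<not> in_H1 f"
 then have "(\<lambda>g. in_L2 g \<and> weak_gradient f g) = (\<lambda>g. False)" by (auto simp: in_H1_def)
 then show ?thesis by (simp add: wgrad_def)
qed

context cutoff
begin

text \<open>The definition of the weak gradient, tested with the translated mollifier. It identifies
  the limit of the gradients of the mollified density.\<close>

lemma conv_wgrad:
 assumes f: "in_H1 f" and \<epsilon>: "0 < \<epsilon>" and i: "i \<in> Basis"
 shows "dd i (conv f (mol \<epsilon>)) x = conv (\<lambda>y. wgrad f y \<bullet> i) (mol \<epsilon>) x"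
proof -
 have f2: "in_L2 f" using f by (simp add: in_H1_def)
 have g: "in_L2 (wgrad f)" "weak_gradient f (wgrad f)" using wgrad_H1[OF f] by auto
 have t: "test_fun UNIV (\<lambda>y. mol \<epsilon> (x - y))" by (rule tf_reflect[OF mol_tf[OF \<epsilon>]])
 have "dd i (conv f (mol \<epsilon>)) x = conv f (dd i (mol \<epsilon>)) x"
  by (rule fun_cong[OF dd_conv[OF locint_L2[OF f2] mol_tf[OF \<epsilon>]]])
 also have "... = - (LBINT y. f y * dd i (\<lambda>y. mol \<epsilon> (x - y)) y)"
  by (simp add: conv_def dd_reflect[OF mol_smooth[OF \<epsilon>]])
 also have "... = (LBINT y. mol \<epsilon> (x - y) * (wgrad f y \<bullet> i))"
  using g(2) i t unfolding weak_gradient_iff[OF f2 g(1)] by simp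
 finally show ?thesis by (simp add: conv_def mult.commute)
qed

end

subsection \<open>Stability in the mean square\<close>

lemma L1_Linf_mono: "L1_Linf_le f M ==> M <= M' ==> L1_Linf_le f M'"
 unfolding L1_Linf_le_def by (auto elim!: eventually_mono)

text \<open>The rate forces convergence almost everywhere, which preserves the supremum bound, while
  Fatou's lemma preserves the bound on the mass.\<close>

lemma L1_Linf_limit:
 fixes \<phi> :: "nat => 'a::euclidean_space => real"
 assumes \<phi>: "!!n. L1_Linf_le (\<phi> n) M" and f: "in_L2 f"
  and lim: "!!n. (LBINT x. (\<phi> n x - f x)^2) <= (1 / 4) ^ n"
 shows "L1_Linf_le f M"
proof -
 have M0: "0 <= M" by (rule L1_Linf_nonneg[OF \<phi>[of 0]])
 have i: "intble (\<phi> n)" and b: "AE x in lborel. \<bar>\<phi> n x\<bar> <= M" and l: "(LBINT x. \<bar>\<phi> n x\<bar>) <= M" for n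
  using \<phi>[of n] by (auto simp: L1_Linf_le_def)
 have [measurable]: "\<phi> n \<in> borel_measurable borel" for n using i[of n] by auto
 have [measurable]: "borelf f" using f by (simp add: in_L2_real)
 have "AE x in lborel. summable (\<lambda>n. \<bar>\<phi> n x - f x\<bar>)"
  by (rule AE_summable_squares[where C = 1]) (use lim in \<open>auto intro!: in_L2_diff L1_Linf_L2(1)[OF \<phi>] f\<close>)
 then have cv: "AE x in lborel. (\<lambda>n. \<phi> n x) \<longlonglongrightarrow> f x"
 proof eventually_elim
  fix x assume "summable (\<lambda>n. \<bar>\<phi> n x - f x\<bar>)"
  then have "(\<lambda>n. \<bar>\<phi> n x - f x\<bar>) \<longlonglongrightarrow> 0" by (rule summable_LIMSEQ_zero)
  then show "(\<lambda>n. \<phi> n x) \<longlonglongrightarrow> f x" by (simp add: tendsto_rabs_zero_iff LIM_zero_iff)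
 qed
 have "AE x in lborel. \<forall>n. \<bar>\<phi> n x\<bar> <= M" using b by (simp add: AE_all_countable)
 with cv have ab: "AE x in lborel. \<bar>f x\<bar> <= M"
 proof eventually_elim
  fix x assume "(\<lambda>n. \<phi> n x) \<longlonglongrightarrow> f x" "\<forall>n. \<bar>\<phi> n x\<bar> <= M"
  then show "\<bar>f x\<bar> <= M" by (intro LIMSEQ_le_const2[OF tendsto_rabs]) auto
 qed
 have "(\<integral>\<^sup>+x. ennreal \<bar>f x\<bar> \<partial>lborel) = (\<integral>\<^sup>+x. liminf (\<lambda>n. ennreal \<bar>\<phi> n x\<bar>) \<partial>lborel)"
 proof (rule nn_integral_cong_AE)
  show "AE x in lborel. ennreal \<bar>f x\<bar> = liminf (\<lambda>n. ennreal \<bar>\<phi> n x\<bar>)"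
   using cv
  proof eventually_elim
   fix x assume "(\<lambda>n. \<phi> n x) \<longlonglongrightarrow> f x"
   then have "(\<lambda>n. ennreal \<bar>\<phi> n x\<bar>) \<longlonglongrightarrow> ennreal \<bar>f x\<bar>" by (intro tendsto_ennrealI tendsto_rabs)
   from lim_imp_Liminf[OF _ this] show "ennreal \<bar>f x\<bar> = liminf (\<lambda>n. ennreal \<bar>\<phi> n x\<bar>)" by simp
  qed
 qed
 also have "... <= liminf (\<lambda>n. \<integral>\<^sup>+x. ennreal \<bar>\<phi> n x\<bar> \<partial>lborel)" by (rule nn_integral_liminf) measurable
 also have "... <= ennreal M"
 proof (rule Liminf_le)
  show "\<forall>\<^sub>F n in sequentially. (\<integral>\<^sup>+x. ennreal \<bar>\<phi> n x\<bar> \<partial>lborel) <= ennreal M"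
   using i l by (intro always_eventually allI) (subst nn_integral_eq_integral, auto intro!: ennreal_leI)
 qed simp
 finally have le: "(\<integral>\<^sup>+x. ennreal \<bar>f x\<bar> \<partial>lborel) <= ennreal M" .
 have m: "(\<lambda>x. \<bar>f x\<bar>) \<in> borel_measurable lborel" by measurable
 note r = integral_le_nn_integral[OF m abs_ge_zero M0 le]
 have "intble f" using r(1) by (simp add: integrable_abs_iff)
 then show ?thesis using r(2) ab by (simp add: L1_Linf_le_def)
qed

text \<open>A null set contains no interval of positive length. Positivity of \<open>T\<close>
  guarantees that the part of the neighbourhood inside the time interval has positive
  length.\<close>

lemma AE_dense:
 assumes P: "AE t in lborel. t \<in> {0..T} --> P t" and t: "t \<in> {0..T}" and T: "0 < T" and \<delta>: "\<delta> > (0::real)"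
 shows "\<exists>s\<in>{0..T}. \<bar>s - t\<bar> < \<delta> \<and> P s"
proof (rule ccontr)
 assume no: "\<not> (\<exists>s\<in>{0..T}. \<bar>s - t\<bar> < \<delta> \<and> P s)"
 define l where "l = max 0 (t - \<delta> / 2)"
 define u where "u = min T (t + \<delta> / 2)"
 have lu: "l < u" "0 <= l" "u <= T" "t - \<delta> / 2 <= l" "u <= t + \<delta> / 2" using t T \<delta> by (auto simp: l_def u_def)
 obtain N where N: "{t \<in> space lborel. \<not> (t \<in> {0..T} --> P t)} \<subseteq> N" "emeasure lborel N = 0" "N \<in> sets lborel"
  using AE_E[OF P] by blast
 have "{l..u} \<subseteq> N"
 proof
  fix s assume s: "s \<in> {l..u}"
  then have "s \<in> {0..T}" "\<bar>s - t\<bar> < \<delta>" using lu \<delta> by auto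
  then show "s \<in> N" using no N(1) by auto
 qed
 then have "emeasure lborel {l..u} <= emeasure lborel N" using N(3) by (intro emeasure_mono) auto
 then show False using N(2) lu(1) by simp
qed

text \<open>Times with the bound are dense and the bound is closed under convergence in L^2, so
  continuity in time extends it to the exceptional times.\<close>

lemma bound_all_times:
 assumes \<rho>: "in_C_L2 T \<rho>" and T: "0 < T" and bd: "AE t in lborel. t \<in> {0..T} --> L1_Linf_le (\<rho> t) M" and t: "t \<in> {0..T}"
 shows "L1_Linf_le (\<rho> t) M"
proof -
 have tl: "((\<lambda>s. L2_norm (\<lambda>x. \<rho> s x - \<rho> t x)) \<longlongrightarrow> 0) (at t within {0..T})" and t2: "in_L2 (\<rho> t)"
  using \<rho> t by (auto simp: in_C_L2_def)
 have "\<exists>s. L1_Linf_le (\<rho> s) M \<and> (LBINT x. (\<rho> s x - \<rho> t x)^2) <= (1 / 4) ^ n" for n :: nat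
 proof -
  have "(1 / 2) ^ n > (0::real)" by simp
  with tl have "\<forall>\<^sub>F s in at t within {0..T}. L2_norm (\<lambda>x. \<rho> s x - \<rho> t x) < (1 / 2) ^ n" by (rule order_tendstoD(2))
  then obtain \<delta> where \<delta>: "\<delta> > 0" "!!s. s \<in> {0..T} ==> s \<noteq> t ==> dist s t < \<delta> ==> L2_norm (\<lambda>x. \<rho> s x - \<rho> t x) < (1 / 2) ^ n"
   unfolding eventually_at by blast
  obtain s where s: "s \<in> {0..T}" "\<bar>s - t\<bar> < \<delta>" "L1_Linf_le (\<rho> s) M" using AE_dense[OF bd t T \<delta>(1)] by blast
  have "L2_norm (\<lambda>x. \<rho> s x - \<rho> t x) <= (1 / 2) ^ n"
   using \<delta>(2)[OF s(1)] s(2) by (cases "s = t") (auto simp: L2_norm_def dist_real_def)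
  then have "(L2_norm (\<lambda>x. \<rho> s x - \<rho> t x))^2 <= ((1 / 2) ^ n)^2" by (intro power_mono L2_norm_nonneg)
  also have "((1 / 2) ^ n)^2 = (1 / 4 :: real) ^ n"
   unfolding power2_eq_square by (simp flip: power_mult_distrib)
  finally show ?thesis using s(3) by (auto simp: L2_norm_sq)
 qed
 then obtain s where "!!n. L1_Linf_le (\<rho> (s n)) M" "!!n. (LBINT x. (\<rho> (s n) x - \<rho> t x)^2) <= (1 / 4) ^ n" by metis
 then show ?thesis by (rule L1_Linf_limit[OF _ t2])
qed

section \<open>Stability of the velocity and of the tested equation\<close>

lemma vel_difference:
 fixes f g :: "'a::euclidean_space => real"
 assumes f: "L1_Linf_le f M" and g: "L1_Linf_le g M" and dr: "0 < \<delta>" "\<delta> <= r"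
 shows "norm (vel f x - vel g x) <= 2 * M * ker_const TYPE('a) * \<delta>
  + (1 / \<delta>) ^ (DIM('a) - 1) * (sqrt (unit_ball_vol (DIM('a)) * r ^ DIM('a)) * L2_norm (\<lambda>y. f y - g y)) + (1 / r) ^ (DIM('a) - 1) * (2 * M)"
proof -
 define h where "h y = f y - g y" for y
 have fi: "intble f" "AE x in lborel. \<bar>f x\<bar> <= M" "(LBINT x. \<bar>f x\<bar>) <= M"
  and gi: "intble g" "AE x in lborel. \<bar>g x\<bar> <= M" "(LBINT x. \<bar>g x\<bar>) <= M"
  using f g by (auto simp: L1_Linf_le_def)
 have hi: "intble h" unfolding h_def[abs_def] using fi gi by simp
 have hb: "AE x in lborel. \<bar>h x\<bar> <= 2 * M"
  using fi(2) gi(2) by eventually_elim (simp add: h_def abs_le_iff)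
 have h1: "(LBINT x. \<bar>h x\<bar>) <= 2 * M"
 proof -
  have "(LBINT x. \<bar>h x\<bar>) <= (LBINT x. \<bar>f x\<bar> + \<bar>g x\<bar>)"
   using hi fi gi by (intro integral_mono) (auto simp: h_def)
  also have "... <= 2 * M" using fi gi by simp
  finally show ?thesis .
 qed
 have h2: "in_L2 h" unfolding h_def[abs_def] by (intro in_L2_diff L1_Linf_L2(1)[OF f] L1_Linf_L2(1)[OF g])
 have "vel f x - vel g x = (LBINT y. f y *\<^sub>R ker (x - y) - g y *\<^sub>R ker (x - y))"
  unfolding vel_def using vel_bounds(1)[OF fi(1,2) dr] vel_bounds(1)[OF gi(1,2) dr] by simp
 also have "... = vel h x" by (simp add: vel_def h_def scaleR_diff_left)
 finally have "norm (vel f x - vel g x) = norm (vel h x)" by simp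
 also have "... <= 2 * M * ker_const TYPE('a) * \<delta>
   + (1 / \<delta>) ^ (DIM('a) - 1) * (LBINT y. indicator (cball x r) y * \<bar>h y\<bar>)
   + (1 / r) ^ (DIM('a) - 1) * (LBINT y. \<bar>h y\<bar>)"
  by (rule vel_bounds(2)[OF hi hb dr])
 also have "... <= 2 * M * ker_const TYPE('a) * \<delta>
  + (1 / \<delta>) ^ (DIM('a) - 1) * (sqrt (unit_ball_vol (DIM('a)) * r ^ DIM('a)) * L2_norm h) + (1 / r) ^ (DIM('a) - 1) * (2 * M)"
 proof (intro add_mono mult_left_mono order_refl h1)
  have ind: "(\<lambda>y::'a. (indicator (cball x r) y :: real)^2) = indicator (cball x r)" by (auto simp: indicator_def)
  have ii: "intble (\<lambda>y::'a. indicator (cball x r) y :: real)"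
   by (intro integrable_real_indicator) (auto simp: emeasure_lborel_cball_finite[simplified])
  have i2: "in_L2 (\<lambda>y::'a. indicator (cball x r) y :: real)" using ii by (simp add: in_L2_real ind)
  have [measurable]: "borelf h" using h2 by (simp add: in_L2_real)
  have a2: "in_L2 (\<lambda>y. \<bar>h y\<bar>)" using h2 by (simp add: in_L2_real)
  have "L2_norm (\<lambda>y::'a. indicator (cball x r) y :: real) = sqrt (unit_ball_vol (DIM('a)) * r ^ DIM('a))"
   unfolding L2_norm_def using content_cball[of r x] dr by (simp add: ind)
  moreover have "L2_norm (\<lambda>y. \<bar>h y\<bar>) = L2_norm h" by (simp add: L2_norm_def)
  ultimately show "(LBINT y. indicator (cball x r) y * \<bar>h y\<bar>) <= sqrt (unit_ball_vol (DIM('a)) * r ^ DIM('a)) * L2_norm h"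
   using Cauchy_Schwarz_integral[OF i2 a2] by simp
 qed (use dr L1_Linf_nonneg[OF f] ker_const_pos[where 'a = 'a] in auto)
 finally show ?thesis by (simp add: h_def[abs_def])
qed

text \<open>The radius \<open>r\<close> is chosen first and makes the far zone small; the decay
  needed there is \<open>DIM('a) - 1 \<ge> 1\<close>. Then \<open>\<delta>\<close> settles the
  singular zone, and \<open>\<eta>\<close> the middle zone, whose constant depends on both.\<close>

lemma vel_stable:
 assumes dim: "DIM('a::euclidean_space) \<ge> 2" and e: "e > 0" and M: "0 <= M"
 obtains \<eta> where "\<eta> > 0" "!!(f :: 'a => real) g x. L1_Linf_le f M ==> L1_Linf_le g M ==> L2_norm (\<lambda>y. f y - g y) <= \<eta> ==>
  norm (vel f x - vel g x) <= e"
proof -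
 let ?C = "ker_const TYPE('a)" and ?d = "DIM('a)"
 define r where "r = max 1 (6 * M / e)"
 have r: "r \<ge> 1" "6 * M / e <= r" by (auto simp: r_def)
 define \<delta> where "\<delta> = min r (e / (3 * (2 * M * ?C + 1)))"
 have C0: "0 <= 2 * M * ?C" using M ker_const_pos[where 'a = 'a] by simp
 have \<delta>: "\<delta> > 0" "\<delta> <= r" "\<delta> <= e / (3 * (2 * M * ?C + 1))" using r e C0 by (auto simp: \<delta>_def)
 define K where "K = (1 / \<delta>) ^ (?d - 1) * sqrt (unit_ball_vol ?d * r ^ ?d)"
 have K0: "0 <= K" using \<delta> r by (simp add: K_def)
 define \<eta> where "\<eta> = e / (3 * (K + 1))"
 have \<eta>: "\<eta> > 0" using e K0 by (simp add: \<eta>_def)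
 have "norm (vel f x - vel g x) <= e"
  if f: "L1_Linf_le f M" and g: "L1_Linf_le g M" and fg: "L2_norm (\<lambda>y. f y - g y) <= \<eta>" for f g and x :: 'a
 proof -
  have 1: "2 * M * ?C * \<delta> <= e / 3"
  proof -
   have "2 * M * ?C * \<delta> <= (2 * M * ?C + 1) * (e / (3 * (2 * M * ?C + 1)))"
    using C0 \<delta> by (intro mult_mono) auto
   also have "... = e / 3"
   proof -
    have "2 * M * ?C + 1 \<noteq> 0" using C0 by linarith
    then show ?thesis by (simp add: field_simps)
   qed
   finally show ?thesis .
  qed
  have 2: "K * L2_norm (\<lambda>y. f y - g y) <= e / 3"
  proof -
   have "K * L2_norm (\<lambda>y. f y - g y) <= (K + 1) * \<eta>" using K0 fg by (intro mult_mono) (auto simp: L2_norm_nonneg)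
   also have "... = e / 3" using K0 by (simp add: \<eta>_def field_simps)
   finally show ?thesis .
  qed
  have 3: "(1 / r) ^ (?d - 1) * (2 * M) <= e / 3"
  proof -
   have "(1 / r) ^ (?d - 1) <= (1 / r) ^ 1" using r dim by (intro power_decreasing) auto
   then have "(1 / r) ^ (?d - 1) * (2 * M) <= 1 / r * (2 * M)" using M by (intro mult_right_mono) auto
   also have "... <= e / 3" using r e by (simp add: field_simps)
   finally show ?thesis .
  qed
  from vel_difference[OF f g \<delta>(1,2), of x] 1 2 3 show ?thesis by (simp add: K_def mult.assoc)
 qed
 with \<eta> that show ?thesis by blast
qed

lemma vel_regular:
 fixes f :: "'a::euclidean_space => real"
 assumes f: "L1_Linf_le f M"
 shows "regular_field (\<bar>k\<bar> * M * (ker_const TYPE('a) + 2)) (\<bar>k\<bar> * (DIM('a) * unit_ball_vol (DIM('a))) * M) (\<lambda>x. k *\<^sub>R vel f x)"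
proof -
 have fi: "intble f" "AE x in lborel. \<bar>f x\<bar> <= M" "(LBINT x. \<bar>f x\<bar>) <= M"
  using f by (auto simp: L1_Linf_le_def)
 show ?thesis
  unfolding regular_field_def
 proof (intro conjI allI impI ballI)
  show "continuous_on UNIV (\<lambda>x. k *\<^sub>R vel f x)" by (intro continuous_intros vel_continuous[OF fi(1,2)])
  show "norm (k *\<^sub>R vel f x) <= \<bar>k\<bar> * M * (ker_const TYPE('a) + 2)" for x
   using mult_left_mono[OF vel_bounded[OF fi, of x], of "\<bar>k\<bar>"] by (simp add: mult.assoc)
  show "\<bar>LBINT x. (k *\<^sub>R vel f x) \<bullet> grad g x\<bar> <= \<bar>k\<bar> * (DIM('a) * unit_ball_vol (DIM('a))) * M * (LBINT x. \<bar>g x\<bar>)"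
   if g: "test_fun UNIV g" for g
   using mult_left_mono[OF vel_div_bound[OF fi(1,2) g], of "\<bar>k\<bar>"] by (simp add: abs_mult mult_ac)
  show "(LBINT x. (k *\<^sub>R vel f x \<bullet> i) * dd j g x) = (LBINT x. (k *\<^sub>R vel f x \<bullet> j) * dd i g x)"
   if "i \<in> Basis" "j \<in> Basis" "test_fun UNIV g" for g i j
   using vel_curl[OF fi(1,2) that(3,1,2)] by (simp add: mult.assoc)
 qed
qed

definition lap :: "('a::euclidean_space => real) => 'a => real" where
 "lap \<psi> x = (\<Sum>i\<in>Basis. dd i (dd i \<psi>) x)"

lemma lap_tf: "test_fun UNIV \<psi> ==> test_fun UNIV (lap \<psi>)"
 unfolding lap_def[abs_def] by (intro tf_sum tf_dd)

lemma rhs_parts: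
 fixes f :: "'a::euclidean_space => real"
 assumes f: "L1_Linf_le f M" and v: "borelf v" "!!x. norm (v x) <= L" and \<psi>: "test_fun UNIV \<psi>"
 shows "intble (\<lambda>y. f y * (v y \<bullet> grad \<psi> y))" "intble (\<lambda>y. (f y)^2 * \<psi> y)"
  "intble (\<lambda>y. f y * lap \<psi> y)"
  "rhs v \<kappa> \<nu> f \<psi> = (LBINT y. f y * (v y \<bullet> grad \<psi> y)) + \<kappa> * (LBINT y. (f y)^2 * \<psi> y) + \<nu> * (LBINT y. f y * lap \<psi> y)"
proof -
 have fi: "intble f" using f by (auto simp: L1_Linf_le_def)
 note [measurable] = v(1) grad_borel[OF tf_smooth[OF \<psi>]]
 obtain B where B: "B > 0" "!!x. norm (grad \<psi> x) <= B" using tf_grad_bounded[OF \<psi>] by blast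
 have L0: "0 <= L" using v(2)[of 0] norm_ge_zero order_trans by blast
 have "intble (\<lambda>y. (v y \<bullet> grad \<psi> y) * f y)"
 proof (rule integrable_bounded_mult[OF fi])
  show "\<bar>v y \<bullet> grad \<psi> y\<bar> <= L * B" for y
   by (rule order_trans[OF Cauchy_Schwarz_ineq2]) (intro mult_mono v(2) B(2) L0 norm_ge_zero)
 qed measurable
 then show 1: "intble (\<lambda>y. f y * (v y \<bullet> grad \<psi> y))" by (simp add: mult.commute)
 show 2: "intble (\<lambda>y. (f y)^2 * \<psi> y)"
  using L1_Linf_L2(1)[OF f] by (intro locint_tf[OF locint_integrable \<psi>]) (simp add: in_L2_real)
 show 3: "intble (\<lambda>y. f y * lap \<psi> y)" by (rule locint_tf[OF locint_integrable[OF fi] lap_tf[OF \<psi>]])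
 show "rhs v \<kappa> \<nu> f \<psi> = (LBINT y. f y * (v y \<bullet> grad \<psi> y)) + \<kappa> * (LBINT y. (f y)^2 * \<psi> y) + \<nu> * (LBINT y. f y * lap \<psi> y)"
  unfolding rhs_def lap_def[symmetric] using 1 2 3 by (simp add: mult.assoc)
qed

lemma rhs_bound:
 fixes f :: "'a::euclidean_space => real"
 assumes f: "L1_Linf_le f M" and v: "borelf v" "!!x. norm (v x) <= L" and \<psi>: "test_fun UNIV \<psi>"
  and P: "!!x. \<bar>\<psi> x\<bar> <= P0" "!!x. norm (grad \<psi> x) <= P1" "!!x. \<bar>lap \<psi> x\<bar> <= P2"
 shows "\<bar>rhs v \<kappa> \<nu> f \<psi>\<bar> <= L * P1 * M + \<bar>\<kappa>\<bar> * (P0 * M^2) + \<bar>\<nu>\<bar> * (P2 * M)"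
proof -
 have fi: "intble f" "(LBINT x. \<bar>f x\<bar>) <= M" using f by (auto simp: L1_Linf_le_def)
 note r = rhs_parts[OF f v \<psi>]
 have L0: "0 <= L" using v(2)[of 0] norm_ge_zero order_trans by blast
 have P00: "0 <= P0" "0 <= P1" "0 <= P2" using P(1)[of 0] P(2)[of 0] P(3)[of 0] norm_ge_zero[of "grad \<psi> 0"] by linarith+
 have 1: "\<bar>LBINT y. f y * (v y \<bullet> grad \<psi> y)\<bar> <= L * P1 * M"
 proof -
  have "\<bar>LBINT y. f y * (v y \<bullet> grad \<psi> y)\<bar> <= (LBINT y. L * P1 * \<bar>f y\<bar>)"
  proof (rule integral_abs_bound_integral[OF r(1)])
   fix y
   have "\<bar>v y \<bullet> grad \<psi> y\<bar> <= L * P1"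
    by (rule order_trans[OF Cauchy_Schwarz_ineq2]) (intro mult_mono v(2) P(2) L0 norm_ge_zero)
   then have "\<bar>f y\<bar> * \<bar>v y \<bullet> grad \<psi> y\<bar> <= \<bar>f y\<bar> * (L * P1)" by (rule mult_left_mono) simp
   then show "\<bar>f y * (v y \<bullet> grad \<psi> y)\<bar> <= L * P1 * \<bar>f y\<bar>" by (simp add: abs_mult mult_ac)
  qed (use fi in simp)
  also have "... <= L * P1 * M" using fi(2) L0 P00 by (simp add: mult_left_mono)
  finally show ?thesis .
 qed
 have 2: "\<bar>LBINT y. (f y)^2 * \<psi> y\<bar> <= P0 * M^2"
 proof -
  have "\<bar>LBINT y. (f y)^2 * \<psi> y\<bar> <= (LBINT y. P0 * (f y)^2)"
  proof (rule integral_abs_bound_integral[OF r(2)])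
   show "\<bar>(f y)^2 * \<psi> y\<bar> <= P0 * (f y)^2" for y
    using mult_left_mono[OF P(1)[of y], of "(f y)^2"] by (simp add: abs_mult mult.commute)
  qed (use L1_Linf_L2(1)[OF f] in \<open>simp add: in_L2_real\<close>)
  also have "... <= P0 * M^2" using L1_Linf_L2(2)[OF f] P00 by (simp add: mult_left_mono)
  finally show ?thesis .
 qed
 have 3: "\<bar>LBINT y. f y * lap \<psi> y\<bar> <= P2 * M"
 proof -
  have "\<bar>LBINT y. f y * lap \<psi> y\<bar> <= (LBINT y. P2 * \<bar>f y\<bar>)"
  proof (rule integral_abs_bound_integral[OF r(3)])
   show "\<bar>f y * lap \<psi> y\<bar> <= P2 * \<bar>f y\<bar>" for y
    using mult_left_mono[OF P(3)[of y], of "\<bar>f y\<bar>"] by (simp add: abs_mult mult.commute)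
  qed (use fi in simp)
  also have "... <= P2 * M" using fi(2) P00 by (simp add: mult_left_mono)
  finally show ?thesis .
 qed
 have "\<bar>rhs v \<kappa> \<nu> f \<psi>\<bar> <= \<bar>LBINT y. f y * (v y \<bullet> grad \<psi> y)\<bar> + \<bar>\<kappa>\<bar> * \<bar>LBINT y. (f y)^2 * \<psi> y\<bar> + \<bar>\<nu>\<bar> * \<bar>LBINT y. f y * lap \<psi> y\<bar>"
  unfolding r(4) abs_mult[symmetric] by linarith
 also have "... <= L * P1 * M + \<bar>\<kappa>\<bar> * (P0 * M^2) + \<bar>\<nu>\<bar> * (P2 * M)"
  by (intro add_mono mult_left_mono 1 2 3) auto
 finally show ?thesis .
qed

lemma L2_norm_abs: "L2_norm (\<lambda>x. \<bar>f x :: real\<bar>) = L2_norm f"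
 by (simp add: L2_norm_def)

lemma abs_pairing_le:
 fixes f g :: "'a::euclidean_space => real"
 assumes "in_L2 f" "in_L2 g"
 shows "intble (\<lambda>x. \<bar>f x\<bar> * \<bar>g x\<bar>)" "(LBINT x. \<bar>f x\<bar> * \<bar>g x\<bar>) <= L2_norm f * L2_norm g"
proof -
 have [measurable]: "borelf f" "borelf g" using assms by (simp_all add: in_L2_real)
 have a: "in_L2 (\<lambda>x. \<bar>f x\<bar>)" "in_L2 (\<lambda>x. \<bar>g x\<bar>)" using assms by (simp_all add: in_L2_real)
 show "intble (\<lambda>x. \<bar>f x\<bar> * \<bar>g x\<bar>)" by (rule in_L2_mult_integrable[OF a])
 show "(LBINT x. \<bar>f x\<bar> * \<bar>g x\<bar>) <= L2_norm f * L2_norm g"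
  using Cauchy_Schwarz_integral[OF a] by (simp add: L2_norm_abs)
qed

text \<open>The tested right-hand side is nonlinear and nonlocal. Each product is split by changing
  one factor at a time; the change of the velocity is small uniformly in space and meets the mass of
  \<open>g\<close>, all others are paired with \<open>h\<close> in L^2. It yields continuity in
  time.\<close>

lemma rhs_stable:
 fixes \<psi> :: "'a::euclidean_space => real"
 assumes dim: "DIM('a) \<ge> 2" and \<psi>: "test_fun UNIV \<psi>" and M: "0 <= M" and e: "e > 0"
 obtains \<eta> where "\<eta> > 0" "!!f g. L1_Linf_le f M ==> L1_Linf_le g M ==> L2_norm (\<lambda>y. f y - g y) <= \<eta> ==>
  \<bar>rhs (\<lambda>x. k *\<^sub>R vel f x) \<kappa> \<nu> f \<psi> - rhs (\<lambda>x. k *\<^sub>R vel g x) \<kappa> \<nu> g \<psi>\<bar> <= e"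
proof -
 obtain B where B: "B > 0" "!!x. norm (grad \<psi> x) <= B" using tf_grad_bounded[OF \<psi>] by blast
 define L where "L = \<bar>k\<bar> * M * (ker_const TYPE('a) + 2)"
 have L0: "0 <= L" using M ker_const_pos[where 'a = 'a] by (simp add: L_def)
 define ng where "ng x = norm (grad \<psi> x)" for x
 have gm[measurable]: "grad \<psi> \<in> borel_measurable borel" by (rule grad_borel[OF tf_smooth[OF \<psi>]])
 have ng2: "in_L2 ng"
 proof -
  obtain r where r: "!!x. norm x > r ==> \<psi> x = 0" using tf_support[OF \<psi>] by metis
  show ?thesis
   unfolding ng_def using B(2) grad_zero_outside[of r \<psi>, OF r]
   by (intro in_L2_support[where B = B and r = r]) auto
 qed
 define K where "K = L * L2_norm ng + \<bar>\<kappa>\<bar> * (2 * M) * L2_norm \<psi> + \<bar>\<nu>\<bar> * L2_norm (lap \<psi>)"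
 have K0: "0 <= K" using L0 M by (auto simp: K_def L2_norm_nonneg intro!: add_nonneg_nonneg mult_nonneg_nonneg)
 define e' where "e' = e / (2 * (\<bar>k\<bar> * B * M + 1))"
 have q0: "0 <= \<bar>k\<bar> * B * M" using B M by simp
 have e': "e' > 0" using e q0 by (simp add: e'_def)
 obtain \<eta>1 where \<eta>1: "\<eta>1 > 0" "!!(f :: 'a => real) g x. L1_Linf_le f M ==> L1_Linf_le g M ==> L2_norm (\<lambda>y. f y - g y) <= \<eta>1 ==>
  norm (vel f x - vel g x) <= e'" using vel_stable[OF dim e' M] by metis
 define \<eta> where "\<eta> = min \<eta>1 (e / (2 * (K + 1)))"
 have \<eta>: "\<eta> > 0" "\<eta> <= \<eta>1" "\<eta> <= e / (2 * (K + 1))" using \<eta>1 e K0 by (auto simp: \<eta>_def)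
 have "\<bar>rhs (\<lambda>x. k *\<^sub>R vel f x) \<kappa> \<nu> f \<psi> - rhs (\<lambda>x. k *\<^sub>R vel g x) \<kappa> \<nu> g \<psi>\<bar> <= e"
  if f: "L1_Linf_le f M" and g: "L1_Linf_le g M" and fg: "L2_norm (\<lambda>y. f y - g y) <= \<eta>" for f g
 proof -
  define h where "h y = f y - g y" for y
  have h2: "in_L2 h" unfolding h_def[abs_def] by (intro in_L2_diff L1_Linf_L2(1)[OF f] L1_Linf_L2(1)[OF g])
  have hn: "L2_norm h <= \<eta>" using fg by (simp add: h_def[abs_def])
  have fb: "AE x in lborel. \<bar>f x\<bar> <= M" and gb: "AE x in lborel. \<bar>g x\<bar> <= M" using f g by (auto simp: L1_Linf_le_def)
  have gi: "intble g" "(LBINT x. \<bar>g x\<bar>) <= M" using g by (auto simp: L1_Linf_le_def)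
  have vf: "borelf (\<lambda>x. k *\<^sub>R vel f x)" "!!x. norm (k *\<^sub>R vel f x) <= L"
   using vel_regular[OF f, of k] unfolding regular_field_def L_def by (auto intro: borel_measurable_continuous_onI)
  have vg: "borelf (\<lambda>x. k *\<^sub>R vel g x)" "!!x. norm (k *\<^sub>R vel g x) <= L"
   using vel_regular[OF g, of k] unfolding regular_field_def L_def by (auto intro: borel_measurable_continuous_onI)
  note rf = rhs_parts[OF f vf \<psi>] and rg = rhs_parts[OF g vg \<psi>]
  have vd: "norm (k *\<^sub>R vel f x - k *\<^sub>R vel g x) <= \<bar>k\<bar> * e'" for x
  proof -
   have "norm (k *\<^sub>R vel f x - k *\<^sub>R vel g x) = \<bar>k\<bar> * norm (vel f x - vel g x)"
    by (simp flip: scaleR_diff_right)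
   also have "... <= \<bar>k\<bar> * e'" using \<eta>1(2)[OF f g, of x] fg \<eta>(2) by (intro mult_left_mono) auto
   finally show ?thesis .
  qed
  have i1: "intble (\<lambda>x. \<bar>h x\<bar> * \<bar>ng x\<bar>)" and b1: "(LBINT x. \<bar>h x\<bar> * \<bar>ng x\<bar>) <= L2_norm h * L2_norm ng"
   using abs_pairing_le[OF h2 ng2] by auto
  have i2: "intble (\<lambda>x. \<bar>h x\<bar> * \<bar>\<psi> x\<bar>)" and b2: "(LBINT x. \<bar>h x\<bar> * \<bar>\<psi> x\<bar>) <= L2_norm h * L2_norm \<psi>"
   using abs_pairing_le[OF h2 tf_in_L2[OF \<psi>]] by auto
  have i3: "intble (\<lambda>x. \<bar>h x\<bar> * \<bar>lap \<psi> x\<bar>)" and b3: "(LBINT x. \<bar>h x\<bar> * \<bar>lap \<psi> x\<bar>) <= L2_norm h * L2_norm (lap \<psi>)"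
   using abs_pairing_le[OF h2 tf_in_L2[OF lap_tf[OF \<psi>]]] by auto
  let ?D = "\<lambda>y. (f y * (k *\<^sub>R vel f y \<bullet> grad \<psi> y) - g y * (k *\<^sub>R vel g y \<bullet> grad \<psi> y)) + \<kappa> * ((f y)^2 * \<psi> y - (g y)^2 * \<psi> y)
   + \<nu> * (f y * lap \<psi> y - g y * lap \<psi> y)"
  let ?U = "\<lambda>y. L * (\<bar>h y\<bar> * \<bar>ng y\<bar>) + \<bar>k\<bar> * e' * B * \<bar>g y\<bar> + \<bar>\<kappa>\<bar> * (2 * M) * (\<bar>h y\<bar> * \<bar>\<psi> y\<bar>) + \<bar>\<nu>\<bar> * (\<bar>h y\<bar> * \<bar>lap \<psi> y\<bar>)"
  have iD: "intble ?D"
   by (intro Bochner_Integration.integrable_add Bochner_Integration.integrable_diff integrable_mult_right rf(1-3) rg(1-3))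
  have iU: "intble ?U"
   by (intro Bochner_Integration.integrable_add integrable_mult_right integrable_abs i1 i2 i3 gi(1))
  have bd: "AE y in lborel. norm (?D y) <= ?U y"
   using fb gb
  proof eventually_elim
   fix y assume fy: "\<bar>f y\<bar> <= M" and gy: "\<bar>g y\<bar> <= M"
   have 1: "\<bar>f y * (k *\<^sub>R vel f y \<bullet> grad \<psi> y) - g y * (k *\<^sub>R vel g y \<bullet> grad \<psi> y)\<bar> <= L * (\<bar>h y\<bar> * \<bar>ng y\<bar>) + \<bar>k\<bar> * e' * B * \<bar>g y\<bar>"
   proof -
    have "f y * (k *\<^sub>R vel f y \<bullet> grad \<psi> y) - g y * (k *\<^sub>R vel g y \<bullet> grad \<psi> y)
     = h y * (k *\<^sub>R vel f y \<bullet> grad \<psi> y) + g y * ((k *\<^sub>R vel f y - k *\<^sub>R vel g y) \<bullet> grad \<psi> y)"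
     by (simp add: h_def inner_diff_left algebra_simps)
    also have "\<bar>\<dots>\<bar> <= \<bar>h y\<bar> * \<bar>k *\<^sub>R vel f y \<bullet> grad \<psi> y\<bar> + \<bar>g y\<bar> * \<bar>(k *\<^sub>R vel f y - k *\<^sub>R vel g y) \<bullet> grad \<psi> y\<bar>"
     unfolding abs_mult[symmetric] by (rule abs_triangle_ineq)
    also have "... <= \<bar>h y\<bar> * (L * ng y) + \<bar>g y\<bar> * (\<bar>k\<bar> * e' * B)"
    proof (intro add_mono mult_left_mono)
     show "\<bar>k *\<^sub>R vel f y \<bullet> grad \<psi> y\<bar> <= L * ng y" unfolding ng_def
      by (rule order_trans[OF Cauchy_Schwarz_ineq2]) (intro mult_right_mono vf(2) norm_ge_zero)
     show "\<bar>(k *\<^sub>R vel f y - k *\<^sub>R vel g y) \<bullet> grad \<psi> y\<bar> <= \<bar>k\<bar> * e' * B"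
      by (rule order_trans[OF Cauchy_Schwarz_ineq2]) (use e' in \<open>intro mult_mono vd B(2) norm_ge_zero, simp\<close>)
    qed auto
    finally show ?thesis by (simp add: mult_ac ng_def)
   qed
   have 2: "\<bar>(f y)^2 * \<psi> y - (g y)^2 * \<psi> y\<bar> <= 2 * M * (\<bar>h y\<bar> * \<bar>\<psi> y\<bar>)"
   proof -
    have "(f y)^2 * \<psi> y - (g y)^2 * \<psi> y = (f y + g y) * (h y * \<psi> y)" by (simp add: h_def power2_eq_square algebra_simps)
    also have "\<bar>\<dots>\<bar> = \<bar>f y + g y\<bar> * (\<bar>h y\<bar> * \<bar>\<psi> y\<bar>)" by (simp add: abs_mult)
    also have "... <= 2 * M * (\<bar>h y\<bar> * \<bar>\<psi> y\<bar>)" using fy gy by (intro mult_right_mono) auto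
    finally show ?thesis .
   qed
   have 3: "\<bar>f y * lap \<psi> y - g y * lap \<psi> y\<bar> = \<bar>h y\<bar> * \<bar>lap \<psi> y\<bar>" by (simp add: h_def abs_mult flip: left_diff_distrib)
   have "norm (?D y) <= \<bar>f y * (k *\<^sub>R vel f y \<bullet> grad \<psi> y) - g y * (k *\<^sub>R vel g y \<bullet> grad \<psi> y)\<bar>
    + \<bar>\<kappa>\<bar> * \<bar>(f y)^2 * \<psi> y - (g y)^2 * \<psi> y\<bar> + \<bar>\<nu>\<bar> * \<bar>f y * lap \<psi> y - g y * lap \<psi> y\<bar>"
    unfolding abs_mult[of \<kappa>, symmetric] abs_mult[of \<nu>, symmetric] real_norm_def by linarith
   also have "... <= (L * (\<bar>h y\<bar> * \<bar>ng y\<bar>) + \<bar>k\<bar> * e' * B * \<bar>g y\<bar>) + \<bar>\<kappa>\<bar> * (2 * M * (\<bar>h y\<bar> * \<bar>\<psi> y\<bar>)) + \<bar>\<nu>\<bar> * (\<bar>h y\<bar> * \<bar>lap \<psi> y\<bar>)"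
    using 1 2 3 by (intro add_mono mult_left_mono) auto
   finally show "norm (?D y) <= ?U y" by (simp add: mult.assoc)
  qed
  have eq: "rhs (\<lambda>x. k *\<^sub>R vel f x) \<kappa> \<nu> f \<psi> - rhs (\<lambda>x. k *\<^sub>R vel g x) \<kappa> \<nu> g \<psi> = (LBINT y. ?D y)"
   unfolding rf(4) rg(4) using rf(1-3) rg(1-3) by (simp add: right_diff_distrib)
  have le: "\<bar>LBINT y. ?D y\<bar> <= (LBINT y. norm (?D y))"
   using integral_norm_bound[of lborel ?D] by (simp only: real_norm_def)
  have le2: "(LBINT y. norm (?D y)) <= (LBINT y. ?U y)"
   using integrable_norm[OF iD] iU bd by (rule integral_mono_AE)
  have "\<bar>rhs (\<lambda>x. k *\<^sub>R vel f x) \<kappa> \<nu> f \<psi> - rhs (\<lambda>x. k *\<^sub>R vel g x) \<kappa> \<nu> g \<psi>\<bar> <= (LBINT y. ?U y)"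
   unfolding eq by (rule order_trans[OF le le2])
  also have "... = L * (LBINT y. \<bar>h y\<bar> * \<bar>ng y\<bar>) + \<bar>k\<bar> * e' * B * (LBINT y. \<bar>g y\<bar>)
   + \<bar>\<kappa>\<bar> * (2 * M) * (LBINT y. \<bar>h y\<bar> * \<bar>\<psi> y\<bar>) + \<bar>\<nu>\<bar> * (LBINT y. \<bar>h y\<bar> * \<bar>lap \<psi> y\<bar>)"
   using i1 i2 i3 gi(1) by simp
  also have "... <= L * (L2_norm h * L2_norm ng) + \<bar>k\<bar> * e' * B * M + \<bar>\<kappa>\<bar> * (2 * M) * (L2_norm h * L2_norm \<psi>) + \<bar>\<nu>\<bar> * (L2_norm h * L2_norm (lap \<psi>))"
   using L0 e' B M by (intro add_mono mult_left_mono b1 b2 b3 gi(2)) auto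
  also have "... = K * L2_norm h + \<bar>k\<bar> * B * M * e'" by (simp add: K_def algebra_simps)
  also have "K * L2_norm h <= e / 2"
  proof -
   have "K * L2_norm h <= (K + 1) * (e / (2 * (K + 1)))"
    using K0 hn \<eta>(3) by (intro mult_mono) (auto simp: L2_norm_nonneg)
   also have "... = e / 2" using K0 by (simp add: field_simps)
   finally show ?thesis .
  qed
  also have "\<bar>k\<bar> * B * M * e' <= e / 2"
  proof -
   have "\<bar>k\<bar> * B * M * e' <= (\<bar>k\<bar> * B * M + 1) * e'" using e' by (intro mult_right_mono) auto
   also have "... = e / 2"
   proof -
    have "\<bar>k\<bar> * B * M + 1 \<noteq> 0" using q0 by linarith
    then show ?thesis by (simp add: e'_def field_simps)
   qed
   finally show ?thesis .
  qed
  finally show ?thesis by simp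
 qed
 with \<eta>(1) that show ?thesis by blast
qed

subsection \<open>The evolution tested against smooth functions\<close>

lemma continuous_in_L2:
 assumes \<rho>: "in_C_L2 T \<rho>"
  and F: "!!e. e > 0 ==> \<exists>\<eta>>0. \<forall>s\<in>{0..T}. \<forall>t\<in>{0..T}. L2_norm (\<lambda>x. \<rho> s x - \<rho> t x) <= \<eta> --> dist (F s) (F t) <= e"
 shows "continuous_on {0..T} (F :: real => real)"
 unfolding continuous_on_def
proof
 fix t assume t: "t \<in> {0..T}"
 have tl: "((\<lambda>s. L2_norm (\<lambda>x. \<rho> s x - \<rho> t x)) \<longlongrightarrow> 0) (at t within {0..T})" using \<rho> t by (auto simp: in_C_L2_def)
 show "(F \<longlongrightarrow> F t) (at t within {0..T})"
  unfolding tendsto_iff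
 proof safe
  fix e :: real assume "e > 0"
  then have "e / 2 > 0" by simp
  from F[OF this] obtain \<eta> where \<eta>: "\<eta> > 0"
   "\<forall>s\<in>{0..T}. \<forall>t\<in>{0..T}. L2_norm (\<lambda>x. \<rho> s x - \<rho> t x) <= \<eta> --> dist (F s) (F t) <= e / 2" by blast
  have "\<forall>\<^sub>F s in at t within {0..T}. s \<in> {0..T}" by (auto simp: eventually_at_filter)
  with order_tendstoD(2)[OF tl \<eta>(1)] show "\<forall>\<^sub>F s in at t within {0..T}. dist (F s) (F t) < e"
  proof eventually_elim
   fix s assume "L2_norm (\<lambda>x. \<rho> s x - \<rho> t x) < \<eta>" "s \<in> {0..T}"
   then have "dist (F s) (F t) <= e / 2" using \<eta>(2) t by auto
   then show "dist (F s) (F t) < e" using \<open>e > 0\<close> by simp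
  qed
 qed
qed

lemma lipschitz_in_L2:
 assumes \<rho>: "in_C_L2 T \<rho>"
  and F: "!!s t. s \<in> {0..T} ==> t \<in> {0..T} ==> \<bar>F s - F t\<bar> <= C * L2_norm (\<lambda>x. \<rho> s x - \<rho> t x)"
 shows "continuous_on {0..T} F"
proof (rule continuous_in_L2[OF \<rho>])
 fix e :: real assume e: "e > 0"
 show "\<exists>\<eta>>0. \<forall>s\<in>{0..T}. \<forall>t\<in>{0..T}. L2_norm (\<lambda>x. \<rho> s x - \<rho> t x) <= \<eta> --> dist (F s) (F t) <= e"
 proof (intro exI[of _ "e / (\<bar>C\<bar> + 1)"] conjI ballI impI)
  fix s t assume st: "s \<in> {0..T}" "t \<in> {0..T}" and l: "L2_norm (\<lambda>x. \<rho> s x - \<rho> t x) <= e / (\<bar>C\<bar> + 1)"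
  have "\<bar>F s - F t\<bar> <= (\<bar>C\<bar> + 1) * L2_norm (\<lambda>x. \<rho> s x - \<rho> t x)"
   by (rule order_trans[OF F[OF st]]) (intro mult_right_mono L2_norm_nonneg, simp)
  also have "... <= (\<bar>C\<bar> + 1) * (e / (\<bar>C\<bar> + 1))" using l by (intro mult_left_mono) auto
  also have "... = e"
  proof -
   have "\<bar>C\<bar> + 1 \<noteq> 0" by linarith
   then show ?thesis by simp
  qed
  finally show "dist (F s) (F t) <= e" by (simp add: dist_real_def)
 qed (use e in \<open>auto intro!: divide_pos_pos\<close>)
qed

lemma pairing_continuous:
 assumes \<rho>: "in_C_L2 T \<rho>" and h: "in_L2 h"
 shows "continuous_on {0..T} (\<lambda>t. \<integral>x. \<rho> t x * h x \<partial>lborel)"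
proof (rule lipschitz_in_L2[OF \<rho>])
 fix s t assume st: "s \<in> {0..T}" "t \<in> {0..T}"
 have 1: "in_L2 (\<rho> s)" "in_L2 (\<rho> t)" using \<rho> st by (auto simp: in_C_L2_def)
 have "(LBINT x. \<rho> s x * h x) - (LBINT x. \<rho> t x * h x) = (LBINT x. (\<rho> s x - \<rho> t x) * h x)"
  using in_L2_mult_integrable[OF 1(1) h] in_L2_mult_integrable[OF 1(2) h] by (simp add: left_diff_distrib)
 then show "\<bar>(LBINT x. \<rho> s x * h x) - (LBINT x. \<rho> t x * h x)\<bar> <= L2_norm h * L2_norm (\<lambda>x. \<rho> s x - \<rho> t x)"
  using Cauchy_Schwarz_integral[OF in_L2_diff[OF 1] h] by (simp add: mult.commute)
qed

text \<open>For a fixed bound \<open>m\<close> and a fixed test function the condition is closed in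
  time. An intersection over uncountably many test functions is still closed, and the union over
  \<open>m\<close> is countable.\<close>

lemma in_H1_times:
 assumes \<rho>: "in_C_L2 T \<rho>"
 shows "{t \<in> {0..T}. in_H1 (\<rho> t)} \<in> sets borel"
proof -
 let ?A = "\<lambda>i \<psi> m. {t \<in> {0..T}. \<bar>LBINT x. \<rho> t x * dd i \<psi> x\<bar> <= real m * L2_norm \<psi>}"
 have iff: "in_H1 (\<rho> t) \<longleftrightarrow> (\<exists>m::nat. \<forall>i\<in>Basis. \<forall>\<psi>. test_fun UNIV \<psi> --> \<bar>LBINT x. \<rho> t x * dd i \<psi> x\<bar> <= real m * L2_norm \<psi>)"
  if "t \<in> {0..T}" for t using \<rho> that by (intro in_H1_iff) (auto simp: in_C_L2_def)
 have "{t \<in> {0..T}. in_H1 (\<rho> t)} = (\<Union>m::nat. {0..T} \<inter> (\<Inter>i\<in>Basis. \<Inter>\<psi>\<in>{\<psi>. test_fun UNIV \<psi>}. ?A i \<psi> m))"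
  using iff by (intro set_eqI) (simp cong: conj_cong)
 also have "... \<in> sets borel"
 proof (intro sets.countable_UN image_subsetI)
  fix m :: nat
  have "closed (?A i \<psi> m)" if \<psi>: "test_fun UNIV \<psi>" for i \<psi>
   by (intro continuous_on_closed_Collect_le continuous_intros pairing_continuous[OF \<rho> tf_in_L2[OF tf_dd[OF \<psi>]]])
  then have "closed ({0..T} \<inter> (\<Inter>i\<in>Basis. \<Inter>\<psi>\<in>{\<psi>. test_fun UNIV \<psi>}. ?A i \<psi> m))"
   by (intro closed_Int closed_INT) auto
  then show "{0..T} \<inter> (\<Inter>i\<in>Basis. \<Inter>\<psi>\<in>{\<psi>. test_fun UNIV \<psi>}. ?A i \<psi> m) \<in> sets borel" by simp
 qed
 finally show ?thesis .
qed

lemma tf_product: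
 assumes \<theta>: "test_fun S (\<theta> :: real => real)" and \<psi>: "test_fun UNIV (\<psi> :: 'a::euclidean_space => real)"
 shows "test_fun (S \<times> UNIV) (\<lambda>z. \<theta> (fst z) * \<psi> (snd z))"
proof -
 have e: "{z. \<theta> (fst z) * \<psi> (snd z) \<noteq> 0} = {s. \<theta> s \<noteq> 0} \<times> {x. \<psi> x \<noteq> 0}" by auto
 have "Ck k (\<lambda>z. \<theta> (fst z) * \<psi> (snd z))" for k
  using Ck_mult[OF Ck_affine[OF bounded_linear_fst, of k \<theta> 0] Ck_affine[OF bounded_linear_snd, of k \<psi> 0]] tf_smooth[OF \<theta>] tf_smooth[OF \<psi>]
  by simp
 moreover have "compact (closure {z. \<theta> (fst z) * \<psi> (snd z) \<noteq> 0})"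
  unfolding e closure_Times using \<theta> \<psi> by (auto simp: test_fun_def intro: compact_Times)
 moreover have "closure {z. \<theta> (fst z) * \<psi> (snd z) \<noteq> 0} \<subseteq> S \<times> UNIV"
  unfolding e closure_Times using \<theta> by (auto simp: test_fun_def)
 ultimately show ?thesis by (simp add: test_fun_def)
qed

lemma smooth_real_derivative:
 assumes "smooth (\<theta> :: real => real)"
 shows "(\<theta> has_real_derivative dd 1 \<theta> t) (at t)"
proof -
 have "(\<lambda>h. dd h \<theta> t) = (*) (dd 1 \<theta> t)"
  using linear_cmul[OF dd_linear[OF assms, of t], of _ 1] by (intro ext) (metis mult.commute mult.right_neutral real_scaleR_def)
 from has_derivative_eq_rhs[OF has_derivative_dd[OF smooth_differentiable[OF assms, of t]] this] show ?thesis
  unfolding has_field_derivative_def .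
qed

lemma grad_cmult:
 assumes "smooth (\<psi> :: 'a::euclidean_space => real)"
 shows "grad (\<lambda>y. c * \<psi> y) x = c *\<^sub>R grad \<psi> x"
proof -
 have "dd i (\<lambda>y. c * \<psi> y) x = c * dd i \<psi> x" for i
  by (intro dd_eq has_derivative_mult_right has_derivative_dd smooth_differentiable assms)
 then show ?thesis by (simp add: grad_def scaleR_sum_right)
qed

lemma H1_pairing:
 fixes f :: "'a::euclidean_space => real"
 assumes f: "in_H1 f" and \<psi>: "test_fun UNIV \<psi>"
 shows "intble (\<lambda>x. wgrad f x \<bullet> grad \<psi> x)" "(LBINT x. wgrad f x \<bullet> grad \<psi> x) = - (LBINT x. f x * lap \<psi> x)"
proof -
 have f2: "in_L2 f" using f by (simp add: in_H1_def)
 have g: "in_L2 (wgrad f)" "weak_gradient f (wgrad f)" using wgrad_H1[OF f] by auto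
 have e: "wgrad f x \<bullet> grad \<psi> x = (\<Sum>i\<in>Basis. (wgrad f x \<bullet> i) * dd i \<psi> x)" for x
  unfolding grad_def by (simp add: inner_sum_right inner_scaleR_right mult.commute)
 have i: "intble (\<lambda>x. (wgrad f x \<bullet> i) * dd i \<psi> x)" if "i \<in> Basis" for i
  by (intro in_L2_mult_integrable in_L2_component[OF g(1) that] tf_in_L2[OF tf_dd[OF \<psi>]])
 have i2: "intble (\<lambda>x. f x * dd i (dd i \<psi>) x)" for i
  by (intro in_L2_mult_integrable f2 tf_in_L2[OF tf_dd[OF tf_dd[OF \<psi>]]])
 show "intble (\<lambda>x. wgrad f x \<bullet> grad \<psi> x)" unfolding e using i by (intro Bochner_Integration.integrable_sum)
 have "(LBINT x. wgrad f x \<bullet> grad \<psi> x) = (\<Sum>i\<in>Basis. \<integral>x. dd i \<psi> x * (wgrad f x \<bullet> i) \<partial>lborel)"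
  unfolding e using i by (subst Bochner_Integration.integral_sum) (auto simp: mult.commute)
 also have "... = (\<Sum>i\<in>Basis. - (LBINT x. f x * dd i (dd i \<psi>) x))"
  using weak_gradient_iff[OF f2 g(1)] g(2) tf_dd[OF \<psi>] by (intro sum.cong) auto
 also have "... = - (LBINT x. f x * lap \<psi> x)"
  unfolding lap_def sum_distrib_left using i2 by (subst Bochner_Integration.integral_sum) (auto simp: sum_negf)
 finally show "(LBINT x. wgrad f x \<bullet> grad \<psi> x) = - (LBINT x. f x * lap \<psi> x)" .
qed

text \<open>\<open>k\<close> is the factor in front of \<open>vel\<close> in the velocity, and
  \<open>\<kappa>\<close> the coefficient of the square of the density in divergence form. The bound
  \<open>M\<close> holds at every time.\<close>

locale evolution = cutoff a for a :: "'a::euclidean_space => real" +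
 fixes \<rho> :: "real => 'a => real" and T M k \<kappa> \<nu> :: real
 assumes dim: "DIM('a) \<ge> 2" and T: "0 < T" and \<nu>: "0 <= \<nu>" and cont: "in_C_L2 T \<rho>"
  and bd: "!!t. t \<in> {0..T} ==> L1_Linf_le (\<rho> t) M"
begin

definition G :: "('a => real) => real => real" where
 "G \<psi> t = rhs (\<lambda>x. k *\<^sub>R vel (\<rho> t) x) \<kappa> \<nu> (\<rho> t) \<psi>"

lemma M0: "0 <= M" using L1_Linf_nonneg[OF bd[of 0]] T by simp

lemma velocity_field:
 assumes "t \<in> {0..T}"
 shows "(\<lambda>x. k *\<^sub>R vel (\<rho> t) x) \<in> borel_measurable borel" "norm (k *\<^sub>R vel (\<rho> t) x) <= \<bar>k\<bar> * M * (ker_const TYPE('a) + 2)"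
proof -
 have "continuous_on UNIV (\<lambda>x. k *\<^sub>R vel (\<rho> t) x)" "\<forall>x. norm (k *\<^sub>R vel (\<rho> t) x) <= \<bar>k\<bar> * M * (ker_const TYPE('a) + 2)"
  using vel_regular[OF bd[OF assms], of k] unfolding regular_field_def by blast+
 then show "(\<lambda>x. k *\<^sub>R vel (\<rho> t) x) \<in> borel_measurable borel" "norm (k *\<^sub>R vel (\<rho> t) x) <= \<bar>k\<bar> * M * (ker_const TYPE('a) + 2)"
  by - (rule borel_measurable_continuous_onI, blast+)
qed

lemma G_continuous:
 assumes \<psi>: "test_fun UNIV \<psi>"
 shows "continuous_on {0..T} (G \<psi>)"
proof (rule continuous_in_L2[OF cont])
 fix e :: real assume "e > 0"
 from rhs_stable[OF dim \<psi> M0 this, of k \<kappa> \<nu>] obtain \<eta> where "\<eta> > 0" and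
  "!!f g. L1_Linf_le f M ==> L1_Linf_le g M ==> L2_norm (\<lambda>y. f y - g y) <= \<eta> ==>
   \<bar>rhs (\<lambda>x. k *\<^sub>R vel f x) \<kappa> \<nu> f \<psi> - rhs (\<lambda>x. k *\<^sub>R vel g x) \<kappa> \<nu> g \<psi>\<bar> <= e" by blast
 then show "\<exists>\<eta>>0. \<forall>s\<in>{0..T}. \<forall>t\<in>{0..T}. L2_norm (\<lambda>x. \<rho> s x - \<rho> t x) <= \<eta> --> dist (G \<psi> s) (G \<psi> t) <= e"
  using bd by (intro exI[of _ \<eta>]) (auto simp: G_def dist_real_def)
qed

text \<open>At the times where \<open>\<rho> t\<close> is not in \<open>H^1\<close>, \<open>wgrad (\<rho> t)\<close> is the junk value \<open>SOME g. False\<close>. These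
 times form a null set, but the inner integral must still be shown to be Borel measurable there, since
 otherwise the integral over time would be \<open>0\<close> by convention.\<close>

lemma weak_form_time:
 assumes \<psi>: "test_fun UNIV \<psi>" and \<theta>: "test_fun {..<T} \<theta>"
  and vel: "!!t x. t \<in> {0..T} ==> w t x = k *\<^sub>R vel (\<rho> t) x"
  and H1: "\<nu> > 0 ==> AE t in lborel. t \<in> {0..T} --> in_H1 (\<rho> t)"
  and W: "!!\<phi>. test_fun ({..<T} \<times> UNIV) \<phi> ==>
    (LBINT t:{0..T}. (\<integral>x.
      \<rho> t x * deriv (\<lambda>s. \<phi> (s, x)) t
     + \<rho> t x * (w t x \<bullet> grad (\<lambda>y. \<phi> (t, y)) x)
     + \<kappa> * (\<rho> t x)^2 * \<phi> (t, x)
     - \<nu> * (wgrad (\<rho> t) x \<bullet> grad (\<lambda>y. \<phi> (t, y)) x) \<partial>lborel)) = - (LBINT x. \<rho>\<^sub>0 x * \<phi> (0, x))"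
 shows "integral {0..T} (\<lambda>t. dd 1 \<theta> t * (LBINT x. \<rho> t x * \<psi> x) + \<theta> t * G \<psi> t) = - (\<theta> 0 * (LBINT x. \<rho>\<^sub>0 x * \<psi> x))"
proof -
 define F where "F t = (LBINT x. \<rho> t x * \<psi> x)" for t
 define A where "A t = (LBINT x. \<rho> t x * (k *\<^sub>R vel (\<rho> t) x \<bullet> grad \<psi> x))" for t
 define B where "B t = (LBINT x. (\<rho> t x)^2 * \<psi> x)" for t
 define N where "N t = (LBINT x. \<rho> t x * lap \<psi> x)" for t
 define I where "I t = (LBINT x. \<rho> t x * (dd 1 \<theta> t * \<psi> x) + \<rho> t x * (k *\<^sub>R vel (\<rho> t) x \<bullet> (\<theta> t *\<^sub>R grad \<psi> x))
     + \<kappa> * (\<rho> t x)^2 * (\<theta> t * \<psi> x) - \<nu> * (wgrad (\<rho> t) x \<bullet> (\<theta> t *\<^sub>R grad \<psi> x)))" for t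
 have Fc: "continuous_on {0..T} F" unfolding F_def[abs_def] by (rule pairing_continuous[OF cont tf_in_L2[OF \<psi>]])
 have Nc: "continuous_on {0..T} N" unfolding N_def[abs_def] by (rule pairing_continuous[OF cont tf_in_L2[OF lap_tf[OF \<psi>]]])
 have \<theta>c: "continuous_on {0..T} \<theta>" "continuous_on {0..T} (dd 1 \<theta>)"
  using tf_smooth[OF \<theta>] by (auto intro!: smooth_continuous_on smooth_dd)
 note p = rhs_parts[OF bd velocity_field(1) velocity_field(2) \<psi>]
 have G: "G \<psi> t = A t + \<kappa> * B t + \<nu> * N t" if "t \<in> {0..T}" for t
  unfolding G_def A_def B_def N_def by (rule p(4)[OF that that that])
 have deriv: "deriv (\<lambda>s. \<theta> s * c) t = dd 1 \<theta> t * c" for c t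
  using smooth_real_derivative[OF tf_smooth[OF \<theta>], of t] by (intro DERIV_imp_deriv DERIV_cmult_right)
 have "- (\<theta> 0 * (LBINT x. \<rho>\<^sub>0 x * \<psi> x)) = - (LBINT x. \<rho>\<^sub>0 x * (\<theta> 0 * \<psi> x))"
  by (simp add: mult.left_commute[of _ "\<theta> 0"])
 also have "... = (LBINT t:{0..T}. I t)"
  unfolding W[OF tf_product[OF \<theta> \<psi>], unfolded fst_conv snd_conv deriv grad_cmult[OF tf_smooth[OF \<psi>]], symmetric] I_def
  by (intro set_lebesgue_integral_cong) (auto simp: vel)
 also have "... = (LBINT t:{0..T}. dd 1 \<theta> t * F t + \<theta> t * G \<psi> t)"
 proof -
  \<comment> \<open>For zero viscosity every time is good, because the weak gradient is then
    multiplied by 0.\<close>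
  define good where "good t \<longleftrightarrow> \<nu> = 0 \<or> in_H1 (\<rho> t)" for t
  define E where "E = {t \<in> {0..T}. good t}"
  define g0 where "g0 = (SOME g :: 'a => 'a. False)"
  define Q where "Q \<longleftrightarrow> intble (\<lambda>x. g0 x \<bullet> grad \<psi> x)"
  define q0 where "q0 = (LBINT x. g0 x \<bullet> grad \<psi> x)"
  define J where "J t = dd 1 \<theta> t * F t + \<theta> t * (G \<psi> t - \<nu> * N t) - \<nu> * \<theta> t * q0" for t
  have Eb: "E \<in> sets borel"
  proof (cases "\<nu> = 0")
   case False
   then show ?thesis using in_H1_times[OF cont] by (simp add: E_def good_def)
  qed (simp add: E_def good_def)
  define P where "P t x = dd 1 \<theta> t * (\<rho> t x * \<psi> x) + \<theta> t * (\<rho> t x * (k *\<^sub>R vel (\<rho> t) x \<bullet> grad \<psi> x)) + \<kappa> * \<theta> t * ((\<rho> t x)^2 * \<psi> x)" for t x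
  have st: "I t = (LBINT x. P t x - \<nu> * \<theta> t * (wgrad (\<rho> t) x \<bullet> grad \<psi> x))"
   and iP: "intble (P t)" and P: "integral\<^sup>L lborel (P t) = dd 1 \<theta> t * F t + \<theta> t * (G \<psi> t - \<nu> * N t)"
   if t: "t \<in> {0..T}" for t
  proof -
   have i1: "intble (\<lambda>x. \<rho> t x * \<psi> x)" using cont t by (intro in_L2_mult_integrable tf_in_L2[OF \<psi>]) (auto simp: in_C_L2_def)
   note i23 = p(1)[OF t t t] p(2)[OF t t t]
   show "I t = (LBINT x. P t x - \<nu> * \<theta> t * (wgrad (\<rho> t) x \<bullet> grad \<psi> x))"
    unfolding I_def P_def by (intro Bochner_Integration.integral_cong refl) (simp add: algebra_simps)
   show "intble (P t)" unfolding P_def by (intro Bochner_Integration.integrable_add integrable_mult_right i1 i23)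
   show "integral\<^sup>L lborel (P t) = dd 1 \<theta> t * F t + \<theta> t * (G \<psi> t - \<nu> * N t)"
    unfolding G[OF t] P_def using i1 i23
    by (simp del: inner_scaleR_left add: F_def[symmetric] A_def[symmetric] B_def[symmetric]) (simp add: algebra_simps)
  qed
  have gd: "I t = dd 1 \<theta> t * F t + \<theta> t * G \<psi> t" if t: "t \<in> {0..T}" and g: "good t" for t
  proof (cases "\<nu> = 0")
   case True
   then show ?thesis using st[OF t] P[OF t] by simp
  next
   case False
   then have "in_H1 (\<rho> t)" using g by (simp add: good_def)
   note h = H1_pairing[OF this \<psi>]
   show ?thesis unfolding st[OF t] using iP[OF t] P[OF t] h
    by (subst Bochner_Integration.integral_diff) (auto simp: N_def algebra_simps)
  qed
  \<comment> \<open>With the default gradient \<open>g0\<close> the inner integral is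
    \<open>J t\<close> if \<open>g0\<close> can be integrated against \<open>grad \<psi>\<close>, or
    if \<open>\<theta> t = 0\<close> removes it. Otherwise the integrand is not integrable and the
    integral is 0 by convention. Each alternative is an explicit function of time.\<close>
  have bad: "I t = (if \<theta> t = 0 \<or> Q then J t else 0)" if t: "t \<in> {0..T}" and g: "\<not> good t" for t
  proof -
   have \<nu>0: "\<nu> \<noteq> 0" and "\<not> in_H1 (\<rho> t)" using g by (auto simp: good_def)
   then have w: "wgrad (\<rho> t) = g0" using cont t wgrad_not_H1[of "\<rho> t"] by (simp add: in_C_L2_def g0_def)
   consider "\<theta> t = 0" | "\<theta> t \<noteq> 0" "Q" | "\<theta> t \<noteq> 0" "\<not> Q" by blast
   then show ?thesis
   proof cases
    case 1
    then show ?thesis unfolding st[OF t] using P[OF t] by (simp add: J_def)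
   next
    case 2
    then show ?thesis unfolding st[OF t] w J_def q0_def using iP[OF t] P[OF t]
     by (subst Bochner_Integration.integral_diff) (auto simp: Q_def)
   next
    case 3
    have "\<not> intble (\<lambda>x. P t x - \<nu> * \<theta> t * (g0 x \<bullet> grad \<psi> x))"
    proof
     assume "intble (\<lambda>x. P t x - \<nu> * \<theta> t * (g0 x \<bullet> grad \<psi> x))"
     from Bochner_Integration.integrable_diff[OF iP[OF t] this] have "intble (\<lambda>x. \<nu> * \<theta> t * (g0 x \<bullet> grad \<psi> x))" by simp
     from integrable_mult_right[OF this, of "1 / (\<nu> * \<theta> t)"] show False using 3 \<nu>0 by (simp add: Q_def)
    qed
    then show ?thesis unfolding st[OF t] w using 3 by (simp add: not_integrable_integral_eq)
   qed
  qed
  have m: "borelf (\<lambda>t. indicator {0..T} t *\<^sub>R f t)" if "continuous_on {0..T} f" for f :: "real => real"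
   by (rule borel_measurable_continuous_on_indicator[OF _ that]) simp
  have m1: "(\<lambda>t. indicator {0..T} t *\<^sub>R (dd 1 \<theta> t * F t + \<theta> t * G \<psi> t)) \<in> borel_measurable borel"
   by (intro m continuous_intros \<theta>c Fc G_continuous \<psi>)
  have m2: "borelf (\<lambda>t. indicator {0..T} t *\<^sub>R J t)"
   unfolding J_def by (intro m continuous_intros \<theta>c Fc G_continuous \<psi> Nc)
  have \<theta>m[measurable]: "borelf \<theta>" by (rule smooth_borel[OF tf_smooth[OF \<theta>]])
  have "(\<lambda>t. indicator {0..T} t *\<^sub>R I t) = (\<lambda>t. if t \<in> E then indicator {0..T} t *\<^sub>R (dd 1 \<theta> t * F t + \<theta> t * G \<psi> t)
    else if \<theta> t = 0 \<or> Q then indicator {0..T} t *\<^sub>R J t else 0)"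
   using gd bad by (auto simp: E_def indicator_def fun_eq_iff)
  also have "... \<in> borel_measurable borel"
   using Eb m1 m2 by measurable
  finally have mI: "borelf (\<lambda>t. indicator {0..T} t *\<^sub>R I t)" .
  have ae: "AE t in lborel. t \<in> {0..T} --> good t"
   using H1 \<nu> by (cases "\<nu> = 0") (auto simp: good_def)
  have "AE t in lborel. indicator {0..T} t *\<^sub>R I t = indicator {0..T} t *\<^sub>R (dd 1 \<theta> t * F t + \<theta> t * G \<psi> t)"
   using ae by eventually_elim (auto simp: indicator_def gd)
  then show ?thesis unfolding set_lebesgue_integral_def using m1 mI by (intro integral_cong_AE) auto
 qed
 also have "... = integral {0..T} (\<lambda>t. dd 1 \<theta> t * F t + \<theta> t * G \<psi> t)"
  by (intro set_borel_integral_eq_integral borel_integrable_atLeastAtMost' continuous_intros \<theta>c Fc G_continuous \<psi>)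
 finally show ?thesis by (simp add: F_def)
qed

end

section \<open>Removal of the time test function\<close>

context cutoff
begin

lemma real_bump:
 obtains \<alpha> :: "real => real" where "smooth \<alpha>" "!!x. \<bar>x\<bar> \<ge> 2 ==> \<alpha> x = 0" "!!x. \<bar>x\<bar> < 1 ==> \<alpha> x = 1" "!!x. 0 <= \<alpha> x"
proof
 define e :: 'a where "e = (SOME i. i \<in> Basis)"
 have e: "norm e = 1" unfolding e_def by (metis nonempty_Basis norm_Basis some_in_eq)
 have l: "bounded_linear (\<lambda>x. x *\<^sub>R e)" by (rule bounded_linear_scaleR_left)
 show "smooth (\<lambda>x. a (x *\<^sub>R e))" using Ck_affine[OF l, of _ a 0] a_smooth by simp
 show "a (x *\<^sub>R e) = 0" if "\<bar>x\<bar> \<ge> 2" for x using that e by (intro a_zero) simp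
 show "a (x *\<^sub>R e) = 1" if "\<bar>x\<bar> < 1" for x using that e by (intro a_one) simp
 show "0 <= a (x *\<^sub>R e)" for x by (rule a_nonneg)
qed

text \<open>A smooth step down near \<open>t\<close>, whose derivative is a negative bump of width
  \<open>\<tau>\<close>. It is nonzero at time 0, as the weak formulation permits, and vanishes
  before \<open>T\<close>.\<close>

lemma time_step_function:
 assumes T: "0 < T" and t: "0 <= t" and \<tau>: "0 < \<tau>" "t + 2 * \<tau> < T"
  and \<alpha>: "smooth \<alpha>" "!!x. \<bar>x\<bar> \<ge> 2 ==> \<alpha> x = 0" "!!x. \<bar>x\<bar> < 1 ==> \<alpha> x = (1::real)"
 obtains \<theta> where "test_fun {..<T} \<theta>" "!!s. s \<in> {0..T} ==> dd 1 \<theta> s = - \<alpha> ((s - t) / \<tau>) / \<tau>"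
proof -
 have "\<exists>F. \<forall>x::real. - \<infinity> < ereal x --> ereal x < \<infinity> --> (F has_vector_derivative \<alpha> x) (at x)"
  by (rule einterval_antiderivative) (use smooth_continuous_on[OF \<alpha>(1), of UNIV] in \<open>auto simp: continuous_on_eq_continuous_at\<close>)
 then obtain A where A: "!!x. (A has_real_derivative \<alpha> x) (at x)" by (auto simp: has_real_derivative_iff_has_vector_derivative)
 have ddA: "dd v A x = v * \<alpha> x" for v x
  using dd_eq[OF A[of x, unfolded has_field_derivative_def], of v] by simp
 have sA: "smooth A"
 proof
  fix k show "Ck k A"
  proof (cases k)
   case 0
   then show ?thesis using A by (auto intro!: DERIV_continuous_on[of _ _ \<alpha>] simp: has_field_derivative_at_within)
  next
   case (Suc k)
   have "A differentiable (at x)" for x using A[of x] by (meson has_field_derivative_imp_has_derivative differentiable_def)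
   moreover have "Ck k (\<lambda>x. v * \<alpha> x)" for v using \<alpha>(1) by (intro Ck_mult Ck_const) simp
   ultimately show ?thesis using Suc ddA by simp
  qed
 qed
 have "\<exists>c. \<forall>x\<in>{2..}. A x = c"
 proof (rule has_field_derivative_zero_constant)
  show "(A has_real_derivative 0) (at x within {2..})" if "x \<in> {2..}" for x
   using has_field_derivative_at_within[OF A[of x]] \<alpha>(2)[of x] that by simp
 qed simp
 then have Ac: "A x = A 2" if "x \<ge> 2" for x using that by (metis atLeast_iff order_refl)
 \<comment> \<open>To the far left the step is a nonzero constant. The wide cutoff
   \<open>\<alpha> (s / L)\<close> makes the support compact and is 1 on the whole time
   interval.\<close>
 define L where "L = T + 1"
 have L: "L > 0" using T by (simp add: L_def)
 define \<theta> where "\<theta> s = (A 2 - A ((s - t) / \<tau>)) * \<alpha> (s / L)" for s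
 have s1: "smooth (\<lambda>s. A ((s - t) / \<tau>))"
  using Ck_affine[OF bounded_linear_mult_right[of "1 / \<tau>"], of _ A "- t / \<tau>"] sA by (simp add: diff_divide_distrib add.commute)
 have s2: "smooth (\<lambda>s. \<alpha> (s / L))"
  using Ck_affine[OF bounded_linear_mult_right[of "1 / L"], of _ \<alpha> 0] \<alpha>(1) by simp
 have s\<theta>: "smooth \<theta>"
  unfolding \<theta>_def[abs_def]
  using smooth_mult[OF smooth_add[OF smooth_const[of "A 2"] smooth_mult[OF smooth_const[of "-1"] s1]] s2] by simp
 have sup: "closure {s. \<theta> s \<noteq> 0} \<subseteq> {- 2 * L..t + 2 * \<tau>}"
 proof (rule closure_minimal)
  show "{s. \<theta> s \<noteq> 0} \<subseteq> {- 2 * L..t + 2 * \<tau>}"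
  proof
   fix s assume s: "s \<in> {s. \<theta> s \<noteq> 0}"
   have "\<not> (s - t) / \<tau> \<ge> 2"
   proof
    assume "(s - t) / \<tau> \<ge> 2"
    then have "A ((s - t) / \<tau>) = A 2" by (rule Ac)
    then show False using s by (simp add: \<theta>_def)
   qed
   then have 1: "s - t < 2 * \<tau>" using \<tau>(1) by (simp add: not_le pos_divide_less_eq)
   have "\<not> \<bar>s / L\<bar> \<ge> 2"
   proof
    assume "\<bar>s / L\<bar> \<ge> 2"
    then have "\<alpha> (s / L) = 0" by (rule \<alpha>(2))
    then show False using s by (simp add: \<theta>_def)
   qed
   then have "\<bar>s\<bar> < 2 * L" using L by (simp add: not_le abs_divide pos_divide_less_eq)
   with 1 show "s \<in> {- 2 * L..t + 2 * \<tau>}" by auto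
  qed
 qed simp
 have cp: "compact (closure {s. \<theta> s \<noteq> 0})"
  using bounded_subset[OF bounded_closed_interval sup] by (simp add: compact_eq_bounded_closed)
 have tf: "test_fun {..<T} \<theta>" unfolding test_fun_def using s\<theta> cp sup \<tau>(2) by auto
 have "dd 1 \<theta> s = - \<alpha> ((s - t) / \<tau>) / \<tau>" if s: "s \<in> {0..T}" for s
 proof -
  have d: "((\<lambda>s. A 2 - A ((s - t) / \<tau>)) has_real_derivative - \<alpha> ((s - t) / \<tau>) / \<tau>) (at s)"
   using \<tau>(1) by (auto intro!: derivative_eq_intros DERIV_chain2[OF A] simp: field_simps)
  have "(\<theta> has_real_derivative - \<alpha> ((s - t) / \<tau>) / \<tau>) (at s)"
  proof (rule has_field_derivative_transform_within_open[OF d])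
   show "open {- L<..<L}" by simp
   show "s \<in> {- L<..<L}" using s by (auto simp: L_def)
   show "A 2 - A ((s - t) / \<tau>) = \<theta> s" if "s \<in> {- L<..<L}" for s
   proof -
    have "\<bar>s / L\<bar> < 1" using that L by (auto simp: abs_if field_simps)
    then show ?thesis using \<alpha>(3) by (simp add: \<theta>_def)
   qed
  qed
  from DERIV_unique[OF this smooth_real_derivative[OF s\<theta>]] show ?thesis by simp
 qed
 with tf that show ?thesis by blast
qed

text \<open>The lemma of du Bois-Reymond: the continuous function \<open>H\<close> is orthogonal to
  the derivatives of all admissible \<open>\<theta>\<close>. These may be nonzero at time 0, so
  \<open>H\<close> is not merely constant but zero, and \<open>P\<close> is identified as the
  initial value.\<close>

lemma integrated_equation:
 fixes F g :: "real => real"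
 assumes T: "0 < T" and F: "continuous_on {0..T} F" and g: "continuous_on {0..T} g"
  and W: "!!\<theta>. test_fun {..<T} \<theta> ==> integral {0..T} (\<lambda>t. dd 1 \<theta> t * F t + \<theta> t * g t) = - (\<theta> 0 * P)"
  and t: "t \<in> {0..T}"
 shows "F t = P + integral {0..t} g"
proof -
 define \<Gamma> where "\<Gamma> t = integral {0..t} g" for t
 have \<Gamma>d: "(\<Gamma> has_real_derivative g t) (at t within {0..T})" if "t \<in> {0..T}" for t
  unfolding \<Gamma>_def[abs_def] using integral_has_vector_derivative[OF g that] by (simp add: has_real_derivative_iff_has_vector_derivative)
 have \<Gamma>c: "continuous_on {0..T} \<Gamma>" by (rule DERIV_continuous_on[OF \<Gamma>d])
 define H where "H t = F t - \<Gamma> t - P" for t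
 have Hc: "continuous_on {0..T} H" unfolding H_def[abs_def] by (intro continuous_intros F \<Gamma>c)
 have z: "integral {0..T} (\<lambda>t. dd 1 \<theta> t * H t) = 0" if \<theta>: "test_fun {..<T} \<theta>" for \<theta>
 proof -
  note d = smooth_real_derivative[OF tf_smooth[OF \<theta>], THEN has_field_derivative_at_within]
  have \<theta>c: "continuous_on {0..T} \<theta>" "continuous_on {0..T} (dd 1 \<theta>)"
   using tf_smooth[OF \<theta>] by (auto intro!: smooth_continuous_on smooth_dd)
  have "T \<notin> closure {z. \<theta> z \<noteq> 0}" using \<theta> by (auto simp: test_fun_def)
  then have \<theta>T: "\<theta> T = 0" using closure_subset[of "{z. \<theta> z \<noteq> 0}"] by auto
  have "((\<lambda>t. \<theta> t * (\<Gamma> t + P)) has_real_derivative dd 1 \<theta> t * (\<Gamma> t + P) + \<theta> t * g t) (at t within {0..T})" if "t \<in> {0..T}" for t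
   by (auto intro!: derivative_eq_intros d \<Gamma>d that)
  then have "((\<lambda>t. dd 1 \<theta> t * (\<Gamma> t + P) + \<theta> t * g t) has_integral \<theta> T * (\<Gamma> T + P) - \<theta> 0 * (\<Gamma> 0 + P)) {0..T}"
   using T by (intro fundamental_theorem_of_calculus) (auto simp: has_real_derivative_iff_has_vector_derivative)
  moreover have "\<theta> T * (\<Gamma> T + P) - \<theta> 0 * (\<Gamma> 0 + P) = - (\<theta> 0 * P)" by (simp add: \<theta>T \<Gamma>_def)
  moreover have "((\<lambda>t. dd 1 \<theta> t * F t + \<theta> t * g t) has_integral - (\<theta> 0 * P)) {0..T}"
   unfolding W[OF \<theta>, symmetric] by (intro integrable_integral integrable_continuous_real continuous_intros \<theta>c F g)
  ultimately have "((\<lambda>t. (dd 1 \<theta> t * F t + \<theta> t * g t) - (dd 1 \<theta> t * (\<Gamma> t + P) + \<theta> t * g t)) has_integral - (\<theta> 0 * P) - - (\<theta> 0 * P)) {0..T}"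
   by (intro has_integral_diff) auto
  then have "((\<lambda>t. dd 1 \<theta> t * H t) has_integral 0) {0..T}"
   by (simp add: H_def algebra_simps)
  then show ?thesis by (rule integral_unique)
 qed
 obtain \<alpha> :: "real => real" where \<alpha>: "smooth \<alpha>" "!!x. \<bar>x\<bar> \<ge> 2 ==> \<alpha> x = 0" "!!x. \<bar>x\<bar> < 1 ==> \<alpha> x = (1::real)" "!!x. 0 <= \<alpha> x"
  using real_bump by blast
 have H0: "H t = 0" if t: "t \<in> {0..<T}" for t
 proof (rule ccontr)
  assume n: "H t \<noteq> 0"
  have t': "t \<in> {0..T}" using t by auto
  then have "\<exists>\<delta>>0. \<forall>s\<in>{0..T}. dist s t < \<delta> --> dist (H s) (H t) < \<bar>H t\<bar>"
   using Hc n by (auto simp: continuous_on_iff)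
  then obtain \<delta> where \<delta>: "\<delta> > 0" "!!s. s \<in> {0..T} ==> dist s t < \<delta> ==> dist (H s) (H t) < \<bar>H t\<bar>" by blast
  obtain q where q: "q > 0" "q <= \<delta>" "q <= T - t" using \<delta>(1) t by (intro that[of "min \<delta> (T - t)"]) auto
  define \<tau> where "\<tau> = q / 3"
  have \<tau>: "\<tau> > 0" "2 * \<tau> < \<delta>" "t + 2 * \<tau> < T" using q by (auto simp: \<tau>_def)
  obtain \<theta> where \<theta>: "test_fun {..<T} \<theta>" "!!s. s \<in> {0..T} ==> dd 1 \<theta> s = - \<alpha> ((s - t) / \<tau>) / \<tau>"
   using time_step_function[OF T _ \<tau>(1,3) \<alpha>(1-3)] t by auto
  \<comment> \<open>Near \<open>t\<close> the values \<open>H s\<close> and \<open>H t\<close> have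
    the same sign, so \<open>w\<close> is nonnegative; a nonnegative continuous function with
    integral zero vanishes, in particular at \<open>t\<close>.\<close>
  define w where "w s = \<alpha> ((s - t) / \<tau>) * (H s * H t)" for s
  have \<alpha>c: "continuous_on {0..T} (\<lambda>s. \<alpha> ((s - t) / \<tau>))"
   by (rule continuous_on_compose2[OF smooth_continuous_on[OF \<alpha>(1), of UNIV]]) (use \<tau>(1) in \<open>auto intro!: continuous_intros\<close>)
  have wc: "continuous_on {0..T} w" unfolding w_def[abs_def] by (intro continuous_intros \<alpha>c Hc)
  have wp: "w s \<ge> 0" if s: "s \<in> {0..T}" for s
  proof (cases "dist s t < \<delta>")
   case True
   then have "\<bar>H s - H t\<bar> < \<bar>H t\<bar>" using \<delta>(2)[OF s] by (simp add: dist_real_def)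
   then have "0 <= H s * H t" by (auto simp: zero_le_mult_iff abs_if split: if_splits)
   then show ?thesis using \<alpha>(4) by (simp add: w_def)
  next
   case False
   then have "\<bar>(s - t) / \<tau>\<bar> \<ge> 2" using \<tau> by (auto simp: dist_real_def field_simps)
   then show ?thesis using \<alpha>(2) by (simp add: w_def)
  qed
  have "integral {0..T} w = integral {0..T} (\<lambda>s. (- \<tau> * H t) * (dd 1 \<theta> s * H s))"
   using \<tau>(1) by (intro integral_cong) (simp add: \<theta>(2) w_def)
  also have "... = 0" using z[OF \<theta>(1)] by (simp only: integral_mult_right mult_zero_right)
  finally have "\<forall>x\<in>{0..T}. w x = 0" using integral_eq_0_iff[OF wc T wp] by simp
  then have "w t = 0" using t' by blast
  then show False using n \<alpha>(3)[of 0] by (simp add: w_def)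
 qed
 \<comment> \<open>Admissible test functions vanish near \<open>T\<close>, so the final time is
   reached by continuity.\<close>
 have "H t = 0"
  by (rule continuous_constant_on_closure[of "{0..<T}"]) (use T t Hc H0 in auto)
 then show ?thesis by (simp add: H_def \<Gamma>_def)
qed

end

subsection \<open>The energy inequality\<close>

lemma grad_reflect:
 assumes f: "smooth (f :: 'a::euclidean_space => real)"
 shows "grad (\<lambda>y. f (x - y)) y = - grad f (x - y)"
proof -
 have "dd i (\<lambda>y. f (x - y)) y = - dd i f (x - y)" for i by (rule dd_reflect[OF f])
 then show ?thesis by (simp add: grad_def sum_negf)
qed

lemma lap_reflect:
 assumes f: "smooth (f :: 'a::euclidean_space => real)"
 shows "lap (\<lambda>y. f (x - y)) y = lap f (x - y)"
proof -
 have "dd i (\<lambda>y. - dd i f (x - y)) y = dd i (dd i f) (x - y)" for i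
 proof -
  have s: "smooth (dd i f)" by (rule smooth_dd[OF f])
  have "(\<lambda>y. dd i f (x - y)) differentiable (at y)"
   by (rule differentiable_compose[where g = "\<lambda>y. x - y", OF smooth_differentiable[OF s]]) simp
  then have "dd i (\<lambda>y. - dd i f (x - y)) y = - dd i (\<lambda>y. dd i f (x - y)) y"
   by (intro dd_eq has_derivative_minus has_derivative_dd)
  also have "dd i (\<lambda>y. dd i f (x - y)) y = - dd i (dd i f) (x - y)" by (rule dd_reflect[OF s])
  finally show ?thesis by simp
 qed
 moreover have "dd i (\<lambda>y. f (x - y)) = (\<lambda>y. - dd i f (x - y))" for i by (rule ext) (rule dd_reflect[OF f])
 ultimately show ?thesis by (simp add: lap_def)
qed

context evolution
begin

lemma L2_at: "t \<in> {0..T} ==> in_L2 (\<rho> t)"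
 using cont by (auto simp: in_C_L2_def)

text \<open>The difference of two squares factors, and the Cauchy-Schwarz inequality makes the
  functional Lipschitz in L^2 on states bounded by \<open>M\<close>.\<close>

lemma weighted_square_continuous:
 assumes w: "borelf w" "!!x. \<bar>w x\<bar> <= W"
 shows "continuous_on {0..T} (\<lambda>t. \<integral>x. w x * (\<rho> t x)^2 \<partial>lborel)"
proof (rule lipschitz_in_L2[OF cont])
 fix s t assume st: "s \<in> {0..T}" "t \<in> {0..T}"
 note L = L2_at[OF st(1)] L2_at[OF st(2)]
 have W0: "0 <= W" using w(2)[of 0] by linarith
 have [measurable]: "\<rho> s \<in> borel_measurable borel" "\<rho> t \<in> borel_measurable borel" "borelf w"
  using L w by (auto simp: in_L2_real)
 have i: "intble (\<lambda>x. w x * (\<rho> r x)^2)" if "in_L2 (\<rho> r)" for r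
  using that w(2) by (intro integrable_bounded_mult[of _ w W]) (auto simp: in_L2_real w(1))
 define g where "g x = w x * (\<rho> s x + \<rho> t x)" for x
 have le: "(g x)^2 <= 2 * W^2 * ((\<rho> s x)^2 + (\<rho> t x)^2)" for x
 proof -
  have "(g x)^2 = (w x)^2 * (\<rho> s x + \<rho> t x)^2" by (simp add: g_def power_mult_distrib)
  also have "... <= W^2 * (2 * (\<rho> s x)^2 + 2 * (\<rho> t x)^2)"
   using w(2)[of x] W0 by (intro mult_mono sq_add_le) (auto simp: abs_le_square_iff[symmetric])
  finally show ?thesis by (simp add: algebra_simps)
 qed
 have i2: "intble (\<lambda>x. 2 * W^2 * ((\<rho> s x)^2 + (\<rho> t x)^2))" using L by (simp add: in_L2_real)
 have ig: "intble (\<lambda>x. (g x)^2)"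
  by (rule Bochner_Integration.integrable_bound[OF i2]) (use le in \<open>auto simp: g_def intro!: AE_I2 order_trans[OF le] abs_ge_self\<close>)
 have g2: "in_L2 g" using ig by (simp add: in_L2_real) (simp add: g_def[abs_def])
 have "(LBINT x. (g x)^2) <= (LBINT x. 2 * W^2 * ((\<rho> s x)^2 + (\<rho> t x)^2))"
  by (rule integral_mono[OF ig i2 le])
 also have "... = 2 * W^2 * ((LBINT x. (\<rho> s x)^2) + (LBINT x. (\<rho> t x)^2))" using L by (simp add: in_L2_real)
 also have "... <= 2 * W^2 * (M^2 + M^2)" using L1_Linf_L2(2)[OF bd] st by (intro mult_left_mono add_mono) auto
 finally have "(L2_norm g)^2 <= (2 * W * M)^2" by (simp add: L2_norm_sq power_mult_distrib)
 from power2_le_imp_le[OF this] have gn: "L2_norm g <= 2 * W * M" using W0 M0 by simp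
 have "(LBINT x. w x * (\<rho> s x)^2) - (LBINT x. w x * (\<rho> t x)^2) = (LBINT x. (\<rho> s x - \<rho> t x) * g x)"
  using i[OF L(1)] i[OF L(2)] by (subst Bochner_Integration.integral_diff[symmetric]) (auto simp: g_def power2_eq_square algebra_simps)
 then have "\<bar>(LBINT x. w x * (\<rho> s x)^2) - (LBINT x. w x * (\<rho> t x)^2)\<bar> <= L2_norm (\<lambda>x. \<rho> s x - \<rho> t x) * L2_norm g"
  using Cauchy_Schwarz_integral[OF in_L2_diff[OF L] g2] by simp
 also have "... <= L2_norm (\<lambda>x. \<rho> s x - \<rho> t x) * (2 * W * M)" by (intro mult_left_mono gn L2_norm_nonneg)
 finally show "\<bar>(LBINT x. w x * (\<rho> s x)^2) - (LBINT x. w x * (\<rho> t x)^2)\<bar> <= 2 * W * M * L2_norm (\<lambda>x. \<rho> s x - \<rho> t x)"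
  by (simp add: mult.commute)
qed

lemma conv_square_continuous:
 assumes \<beta>: "test_fun UNIV \<beta>" and \<eta>: "test_fun UNIV \<eta>"
 shows "continuous_on {0..T} (\<lambda>t. \<integral>x. (\<beta> x)^2 * (conv (\<rho> t) \<eta> x)^2 \<partial>lborel)"
proof -
 obtain B where B: "B > 0" "!!x. \<bar>\<eta> x\<bar> <= B" using tf_bounded[OF \<eta>] by blast
 have b2: "intble (\<lambda>x. (\<beta> x)^2)" using tf_in_L2[OF \<beta>] by (simp add: in_L2_real)
 have [measurable]: "borelf \<beta>" by (rule smooth_borel[OF tf_smooth[OF \<beta>]])
 have cb: "\<bar>conv (\<rho> t) \<eta> x\<bar> <= B * M" if t: "t \<in> {0..T}" for t x
 proof -
  have i: "intble (\<rho> t)" "(LBINT y. \<bar>\<rho> t y\<bar>) <= M" using bd[OF t] by (auto simp: L1_Linf_le_def)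
  have "\<bar>conv (\<rho> t) \<eta> x\<bar> <= (LBINT y. B * \<bar>\<rho> t y\<bar>)" unfolding conv_def
  proof (rule integral_abs_bound_integral)
   show "intble (\<lambda>y. \<rho> t y * \<eta> (x - y))" by (rule conv_integrable[OF locint_L2[OF L2_at[OF t]] \<eta>])
   show "\<bar>\<rho> t y * \<eta> (x - y)\<bar> <= B * \<bar>\<rho> t y\<bar>" for y
    using mult_left_mono[OF B(2)[of "x - y"], of "\<bar>\<rho> t y\<bar>"] by (simp add: abs_mult mult.commute)
  qed (use i in simp)
  also have "... <= B * M" using i B by simp
  finally show ?thesis .
 qed
 have cd: "\<bar>conv (\<rho> s) \<eta> x - conv (\<rho> t) \<eta> x\<bar> <= L2_norm \<eta> * L2_norm (\<lambda>x. \<rho> s x - \<rho> t x)" if st: "s \<in> {0..T}" "t \<in> {0..T}" for s t x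
 proof -
  have \<eta>2: "in_L2 (\<lambda>y. \<eta> (x - y))" by (rule tf_in_L2[OF tf_reflect[OF \<eta>]])
  have n: "L2_norm (\<lambda>y. \<eta> (x - y)) = L2_norm \<eta>" unfolding L2_norm_def using integral_reflect[of "\<lambda>y. (norm (\<eta> y))^2" x] smooth_borel[OF tf_smooth[OF \<eta>]] by simp
  have "conv (\<rho> s) \<eta> x - conv (\<rho> t) \<eta> x = (LBINT y. (\<rho> s y - \<rho> t y) * \<eta> (x - y))" unfolding conv_def
   using conv_integrable[OF locint_L2[OF L2_at[OF st(1)]] \<eta>] conv_integrable[OF locint_L2[OF L2_at[OF st(2)]] \<eta>]
   by (simp add: left_diff_distrib)
  then show ?thesis using Cauchy_Schwarz_integral[OF in_L2_diff[OF L2_at L2_at, OF st] \<eta>2] by (simp add: n mult.commute)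
 qed
 have ic: "intble (\<lambda>x. (\<beta> x)^2 * (conv (\<rho> t) \<eta> x)^2)" if t: "t \<in> {0..T}" for t
 proof -
  have [measurable]: "conv (\<rho> t) \<eta> \<in> borel_measurable borel"
   by (rule smooth_borel[OF smooth_conv[OF locint_L2[OF L2_at[OF t]] \<eta>]])
  have "intble (\<lambda>x. (conv (\<rho> t) \<eta> x)^2 * (\<beta> x)^2)"
  proof (rule integrable_bounded_mult[OF b2, of _ "(B * M)^2"])
   show "\<bar>(conv (\<rho> t) \<eta> x)^2\<bar> <= (B * M)^2" for x using cb[OF t, of x] by (simp add: abs_le_square_iff[symmetric])
  qed measurable
  then show ?thesis by (simp add: mult.commute)
 qed
 show ?thesis
 proof (rule lipschitz_in_L2[OF cont])
  fix s t assume st: "s \<in> {0..T}" "t \<in> {0..T}"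
  define c where "c = 2 * (B * M) * (L2_norm \<eta> * L2_norm (\<lambda>x. \<rho> s x - \<rho> t x))"
  have "(LBINT x. (\<beta> x)^2 * (conv (\<rho> s) \<eta> x)^2) - (LBINT x. (\<beta> x)^2 * (conv (\<rho> t) \<eta> x)^2)
   = (LBINT x. (\<beta> x)^2 * (conv (\<rho> s) \<eta> x)^2 - (\<beta> x)^2 * (conv (\<rho> t) \<eta> x)^2)"
   using ic[OF st(1)] ic[OF st(2)] by simp
  moreover have "\<bar>LBINT x. (\<beta> x)^2 * (conv (\<rho> s) \<eta> x)^2 - (\<beta> x)^2 * (conv (\<rho> t) \<eta> x)^2\<bar> <= (LBINT x. c * (\<beta> x)^2)"
  proof (rule integral_abs_bound_integral)
   fix x
   let ?p = "conv (\<rho> s) \<eta> x" and ?q = "conv (\<rho> t) \<eta> x"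
   have "\<bar>?p^2 - ?q^2\<bar> = \<bar>?p + ?q\<bar> * \<bar>?p - ?q\<bar>" by (simp add: power2_eq_square algebra_simps flip: abs_mult)
   also have "... <= c" unfolding c_def
    using cb[OF st(1), of x] cb[OF st(2), of x] by (intro mult_mono cd[OF st]) (auto simp: L2_norm_nonneg)
   finally have "(\<beta> x)^2 * \<bar>?p^2 - ?q^2\<bar> <= (\<beta> x)^2 * c" by (rule mult_left_mono) simp
   then show "\<bar>(\<beta> x)^2 * ?p^2 - (\<beta> x)^2 * ?q^2\<bar> <= c * (\<beta> x)^2"
    by (simp add: abs_mult mult.commute flip: right_diff_distrib)
  qed (use ic[OF st(1)] ic[OF st(2)] b2 in auto)
  ultimately show "\<bar>(LBINT x. (\<beta> x)^2 * (conv (\<rho> s) \<eta> x)^2) - (LBINT x. (\<beta> x)^2 * (conv (\<rho> t) \<eta> x)^2)\<bar>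
   <= 2 * (B * M) * L2_norm \<eta> * (LBINT x. (\<beta> x)^2) * L2_norm (\<lambda>x. \<rho> s x - \<rho> t x)"
   by (simp add: c_def mult_ac)
 qed
qed

text \<open>If uniformity failed, the bad times would accumulate at some \<open>t\<close>. Near
  \<open>t\<close> the density is close to that at \<open>t\<close>, whose translations are
  continuous. The squared error splits with weights 4, 4 and 2 into terms of at most
  \<open>e / 12\<close>, which stays below \<open>e\<close>.\<close>

lemma uniform_translation:
 assumes e: "e > 0"
 obtains \<delta> where "\<delta> > 0" "!!t h. t \<in> {0..T} ==> norm h <= \<delta> ==> (LBINT x. (\<rho> t (x - h) - \<rho> t x)^2) <= e"
proof (rule ccontr)
 assume no: "\<not> thesis"
 have "\<exists>t h. t \<in> {0..T} \<and> norm h <= 1 / real (Suc n) \<and> (LBINT x. (\<rho> t (x - h) - \<rho> t x)^2) > e" for n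
  using no that[of "1 / real (Suc n)"] by (force simp: not_le)
 then obtain \<tau> h where \<tau>: "!!n. \<tau> n \<in> {0..T}" and h: "!!n. norm (h n) <= 1 / real (Suc n)"
  and big: "!!n. (LBINT x. (\<rho> (\<tau> n) (x - h n) - \<rho> (\<tau> n) x)^2) > e" by metis
 have "seq_compact {0..T}" by (rule compact_eq_seq_compact_metric[THEN iffD1, OF compact_Icc])
 then obtain t r where t: "t \<in> {0..T}" and r: "strict_mono r" and lim: "(\<tau> \<circ> r) \<longlonglongrightarrow> t"
  using \<tau> by (metis seq_compactE)
 have tl: "((\<lambda>s. L2_norm (\<lambda>x. \<rho> s x - \<rho> t x)) \<longlongrightarrow> 0) (at t within {0..T})" using cont t by (auto simp: in_C_L2_def)
 have "\<forall>\<^sub>F s in at t within {0..T}. L2_norm (\<lambda>x. \<rho> s x - \<rho> t x) < sqrt (e / 12)" using tl e by (intro order_tendstoD(2)) auto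
 then obtain d where d: "d > 0" "!!s. s \<in> {0..T} ==> s \<noteq> t ==> dist s t < d ==> L2_norm (\<lambda>x. \<rho> s x - \<rho> t x) < sqrt (e / 12)"
  unfolding eventually_at by blast
 obtain \<delta> where \<delta>: "\<delta> > 0" "!!h. norm h <= \<delta> ==> (LBINT x. (\<rho> t (x - h) - \<rho> t x)^2) <= e / 12"
  using translation_L2[OF L2_at[OF t], of "e / 12"] e by auto
 have ev1: "\<forall>\<^sub>F n in sequentially. dist (\<tau> (r n)) t < d" using lim d(1) by (auto simp: tendsto_iff o_def)
 have "(\<lambda>n. 1 / real (Suc n)) \<longlonglongrightarrow> 0" using LIMSEQ_inverse_real_of_nat unfolding inverse_eq_divide .
 then have "(\<lambda>n. 1 / real (Suc (r n))) \<longlonglongrightarrow> 0" using LIMSEQ_subseq_LIMSEQ[OF _ r] by (simp add: o_def)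
 then have "\<forall>\<^sub>F n in sequentially. 1 / real (Suc (r n)) < \<delta>" using \<delta>(1) by (rule order_tendstoD(2))
 with ev1 have "\<forall>\<^sub>F n in sequentially. False"
 proof eventually_elim
  fix n assume n: "dist (\<tau> (r n)) t < d" "1 / real (Suc (r n)) < \<delta>"
  define s where "s = \<tau> (r n)"
  define k where "k = h (r n)"
  have k: "norm k <= \<delta>" using h[of "r n"] n(2) by (simp add: k_def)
  have s: "s \<in> {0..T}" using \<tau> by (simp add: s_def)
  have "L2_norm (\<lambda>x. \<rho> s x - \<rho> t x) <= sqrt (e / 12)"
  proof (cases "s = t")
   case True
   then show ?thesis using e by (simp add: L2_norm_def)
  next
   case False
   then show ?thesis using d(2)[OF s] n(1) by (simp add: s_def)
  qed
  then have "(L2_norm (\<lambda>x. \<rho> s x - \<rho> t x))^2 <= (sqrt (e / 12))^2" by (intro power_mono L2_norm_nonneg)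
  then have st: "(LBINT x. (\<rho> s x - \<rho> t x)^2) <= e / 12" using e by (simp add: L2_norm_sq)
  define p where "p x = \<rho> s x - \<rho> t x" for x
  define q where "q x = \<rho> t (x - k) - \<rho> t x" for x
  have p2: "in_L2 p" unfolding p_def[abs_def] by (intro in_L2_diff L2_at s t)
  have q2: "in_L2 q" unfolding q_def[abs_def] by (intro in_L2_diff in_L2_shift L2_at t)
  note ps = in_L2_shift[OF p2, of k]
  have i: "intble (\<lambda>x. (p (x - k))^2)" "intble (\<lambda>x. (q x)^2)" "intble (\<lambda>x. (p x)^2)"
   using ps p2 q2 by (auto simp: in_L2_real)
  have "(LBINT x. (\<rho> s (x - k) - \<rho> s x)^2) <= (LBINT x. 4 * (p (x - k))^2 + 4 * (q x)^2 + 2 * (p x)^2)"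
  proof (rule integral_mono)
   show "intble (\<lambda>x. (\<rho> s (x - k) - \<rho> s x)^2)"
    using in_L2_diff[OF in_L2_shift[OF L2_at[OF s]] L2_at[OF s], of k] by (simp add: in_L2_real)
   show "(\<rho> s (x - k) - \<rho> s x)^2 <= 4 * (p (x - k))^2 + 4 * (q x)^2 + 2 * (p x)^2" for x
   proof -
    have "\<rho> s (x - k) - \<rho> s x = (p (x - k) + q x) + (- p x)" by (simp add: p_def q_def)
    then have "(\<rho> s (x - k) - \<rho> s x)^2 <= 2 * (p (x - k) + q x)^2 + 2 * (- p x)^2" by (simp only: sq_add_le)
    with sq_add_le[of "p (x - k)" "q x"] show ?thesis by simp
   qed
  qed (use i in simp)
  also have "... = 4 * (LBINT x. (p x)^2) + 4 * (LBINT x. (q x)^2) + 2 * (LBINT x. (p x)^2)"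
   using i integral_sq_shift[OF p2, of k] by simp
  also have "... <= 4 * (e / 12) + 4 * (e / 12) + 2 * (e / 12)"
   using st \<delta>(2)[OF k] by (intro add_mono mult_left_mono) (auto simp: p_def q_def)
  also have "... <= e" using e by simp
  finally show False using big[of "r n"] by (simp add: s_def k_def)
 qed
 then show False by simp
qed

end

text \<open>The equation in integrated form: a test function of space alone, at every time, which is
  the form that a fixed mollifier can be inserted into.\<close>

locale flow = evolution a \<rho> T M k \<kappa> \<nu> for a :: "'a::euclidean_space => real" and \<rho> T M k \<kappa> \<nu> +
 assumes ev: "!!\<psi> t. test_fun UNIV \<psi> ==> t \<in> {0..T} ==>
   (LBINT x. \<rho> t x * \<psi> x) = (LBINT x. \<rho> 0 x * \<psi> x) + integral {0..t} (G \<psi>)"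
  and H1: "\<nu> > 0 ==> AE t in lborel. t \<in> {0..T} --> in_H1 (\<rho> t)"
begin

abbreviation g :: "real => 'a => real => real" where "g \<epsilon> x t \<equiv> G (\<lambda>y. mol \<epsilon> (x - y)) t"

definition U :: "real => real => 'a => real" where "U \<epsilon> t = conv (\<rho> t) (mol \<epsilon>)"

lemma g_bounded:
 assumes \<epsilon>: "\<epsilon> > 0"
 obtains C where "C \<ge> 0" "!!x t. t \<in> {0..T} ==> \<bar>g \<epsilon> x t\<bar> <= C"
proof -
 note tf = mol_tf[OF \<epsilon>]
 obtain P0 where "P0 > 0" and P0: "!!x. \<bar>mol \<epsilon> x\<bar> <= P0" using tf_bounded[OF tf] by blast
 obtain P1 where "P1 > 0" and P1: "!!x. norm (grad (mol \<epsilon>) x) <= P1" using tf_grad_bounded[OF tf] by blast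
 obtain P2 where "P2 > 0" and P2: "!!x. \<bar>lap (mol \<epsilon>) x\<bar> <= P2" using tf_bounded[OF lap_tf[OF tf]] by blast
 have *: "\<bar>g \<epsilon> x t\<bar> <= \<bar>k\<bar> * M * (ker_const TYPE('a) + 2) * P1 * M + \<bar>\<kappa>\<bar> * (P0 * M^2) + \<bar>\<nu>\<bar> * (P2 * M)" if t: "t \<in> {0..T}" for x t
  unfolding G_def
  by (rule rhs_bound[OF bd[OF t] velocity_field[OF t] tf_reflect[OF tf]])
   (simp_all add: P0 grad_reflect[OF mol_smooth[OF \<epsilon>]] lap_reflect[OF mol_smooth[OF \<epsilon>]] P1 P2)
 show ?thesis by (rule that[OF order_trans[OF abs_ge_zero *[of 0 0]] *]) (use T in simp)
qed

text \<open>Testing with the mollifier centred at \<open>x\<close> makes the mollified density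
  differentiable in time at each point, with a derivative continuous in time, although the density
  itself need not have a time derivative as a function.\<close>

lemma U_derivative:
 assumes \<epsilon>: "\<epsilon> > 0" and t: "t \<in> {0..T}"
 shows "((\<lambda>t. U \<epsilon> t x) has_real_derivative g \<epsilon> x t) (at t within {0..T})"
proof -
 note tf = tf_reflect[OF mol_tf[OF \<epsilon>], of x]
 have "((\<lambda>t. U \<epsilon> 0 x + integral {0..t} (g \<epsilon> x)) has_vector_derivative g \<epsilon> x t) (at t within {0..T})"
  using integral_has_vector_derivative[OF G_continuous[OF tf] t] by (auto intro!: derivative_eq_intros)
 note d = this
 have "((\<lambda>t. U \<epsilon> t x) has_vector_derivative g \<epsilon> x t) (at t within {0..T})"
 proof (rule has_vector_derivative_transform[OF t _ d])
  show "U \<epsilon> s x = U \<epsilon> 0 x + integral {0..s} (g \<epsilon> x)" if "s \<in> {0..T}" for s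
   unfolding U_def conv_def by (rule ev[OF tf that])
 qed
 then show ?thesis by (simp add: has_real_derivative_iff_has_vector_derivative)
qed

lemma U_smooth: "\<epsilon> > 0 ==> t \<in> {0..T} ==> smooth (U \<epsilon> t)"
 unfolding U_def by (rule smooth_conv[OF locint_L2[OF L2_at] mol_tf])

lemma U_borel: "\<epsilon> > 0 ==> t \<in> {0..T} ==> U \<epsilon> t \<in> borel_measurable borel"
 by (rule smooth_borel[OF U_smooth])

lemma U_bounded: "\<epsilon> > 0 ==> t \<in> {0..T} ==> \<bar>U \<epsilon> t x\<bar> <= M"
 unfolding U_def using bd[of t] by (intro conv_mol_bounded locint_integrable) (auto simp: L1_Linf_le_def)

text \<open>Dominated convergence of the difference quotients. The derivative in time is bounded
  uniformly in space, so the integrable function \<beta>^2 supplies the domination.\<close>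

lemma energy_derivative:
 assumes \<epsilon>: "\<epsilon> > 0" and \<beta>: "test_fun UNIV \<beta>" and t: "t \<in> {0..T}"
 shows "((\<lambda>t. \<integral>x. (\<beta> x)^2 * (U \<epsilon> t x)^2 \<partial>lborel) has_real_derivative 2 * (LBINT x. (\<beta> x)^2 * (U \<epsilon> t x * g \<epsilon> x t))) (at t within {0..T})"
 unfolding has_field_derivative_iff tendsto_at_iff_sequentially
proof (intro allI impI)
 fix X :: "nat => real" assume X: "\<forall>i. X i \<in> {0..T} - {t}" "X \<longlonglongrightarrow> t"
 then have Xi: "X i \<in> {0..T}" "X i \<noteq> t" for i by auto
 have [measurable]: "borelf \<beta>" by (rule smooth_borel[OF tf_smooth[OF \<beta>]])
 have b2: "intble (\<lambda>x. (\<beta> x)^2)" using tf_in_L2[OF \<beta>] by (simp add: in_L2_real)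
 obtain C where C: "C \<ge> 0" "!!x t. t \<in> {0..T} ==> \<bar>g \<epsilon> x t\<bar> <= C" using g_bounded[OF \<epsilon>] by blast
 have lip: "\<bar>U \<epsilon> s x - U \<epsilon> t x\<bar> <= C * \<bar>s - t\<bar>" if "s \<in> {0..T}" for s x
  using field_differentiable_bound[of "{0..T}" "\<lambda>t. U \<epsilon> t x" "g \<epsilon> x" C s t] U_derivative[OF \<epsilon>] C(2) that t by simp
 have [measurable]: "U \<epsilon> t \<in> borel_measurable borel" "!!i. U \<epsilon> (X i) \<in> borel_measurable borel"
  using U_borel[OF \<epsilon>] t Xi by auto
 have iU: "intble (\<lambda>x. (\<beta> x)^2 * (U \<epsilon> s x)^2)" if s: "s \<in> {0..T}" for s
 proof -
  have "intble (\<lambda>x. (U \<epsilon> s x)^2 * (\<beta> x)^2)"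
  proof (rule integrable_bounded_mult[OF b2, of _ "M^2"])
   show "\<bar>(U \<epsilon> s x)^2\<bar> <= M^2" for x using U_bounded[OF \<epsilon> s, of x] by (simp add: abs_le_square_iff[symmetric])
  qed (use U_borel[OF \<epsilon> s] in measurable)
  then show ?thesis by (simp add: mult.commute)
 qed
 define q where "q i x = (\<beta> x)^2 * (((U \<epsilon> (X i) x)^2 - (U \<epsilon> t x)^2) / (X i - t))" for i x
 define w where "w x = (\<beta> x)^2 * (2 * U \<epsilon> t x * g \<epsilon> x t)" for x
 have qm[measurable]: "q i \<in> borel_measurable borel" for i unfolding q_def[abs_def] by measurable
 have lim: "(\<lambda>i. q i x) \<longlonglongrightarrow> w x" for x
 proof -
  have "((\<lambda>t. (U \<epsilon> t x)^2) has_real_derivative 2 * U \<epsilon> t x * g \<epsilon> x t) (at t within {0..T})"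
   by (auto intro!: derivative_eq_intros U_derivative[OF \<epsilon> t])
  then have "(\<lambda>i. ((U \<epsilon> (X i) x)^2 - (U \<epsilon> t x)^2) / (X i - t)) \<longlonglongrightarrow> 2 * U \<epsilon> t x * g \<epsilon> x t"
   using X unfolding has_field_derivative_iff tendsto_at_iff_sequentially by (auto simp: o_def)
  then show ?thesis unfolding q_def w_def by (intro tendsto_mult tendsto_const)
 qed
 \<comment> \<open>Measurability in space of the time derivative is obtained from that of the
   difference quotients of which it is the limit.\<close>
 have wm: "w \<in> borel_measurable lborel"
  by (rule borel_measurable_LIMSEQ_real[of _ q]) (use lim qm in auto)
 have bound: "\<bar>q i x\<bar> <= 2 * M * C * (\<beta> x)^2" for i x
 proof -
  have "\<bar>(U \<epsilon> (X i) x)^2 - (U \<epsilon> t x)^2\<bar> = \<bar>U \<epsilon> (X i) x + U \<epsilon> t x\<bar> * \<bar>U \<epsilon> (X i) x - U \<epsilon> t x\<bar>"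
   by (simp add: power2_eq_square algebra_simps flip: abs_mult)
  also have "... <= (2 * M) * (C * \<bar>X i - t\<bar>)"
   using U_bounded[OF \<epsilon> Xi(1)[of i], of x] U_bounded[OF \<epsilon> t, of x] by (intro mult_mono lip Xi) auto
  finally have "\<bar>((U \<epsilon> (X i) x)^2 - (U \<epsilon> t x)^2) / (X i - t)\<bar> <= 2 * M * C"
   using Xi(2)[of i] by (simp add: abs_divide pos_divide_le_eq mult.assoc)
  then have "(\<beta> x)^2 * \<bar>((U \<epsilon> (X i) x)^2 - (U \<epsilon> t x)^2) / (X i - t)\<bar> <= (\<beta> x)^2 * (2 * M * C)" by (rule mult_left_mono) simp
  then show ?thesis by (simp add: q_def abs_mult mult_ac)
 qed
 have "(\<lambda>i. \<integral>x. q i x \<partial>lborel) \<longlonglongrightarrow> (LBINT x. w x)"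
  by (rule integral_dominated_convergence[of w lborel q "\<lambda>x. 2 * M * C * (\<beta> x)^2"]) (use wm b2 lim bound in auto)
 moreover have "(LBINT x. w x) = 2 * (LBINT x. (\<beta> x)^2 * (U \<epsilon> t x * g \<epsilon> x t))"
  unfolding w_def by (subst integral_mult_right_zero[symmetric]) (simp add: mult_ac)
 moreover have "(LBINT x. q i x) = ((LBINT x. (\<beta> x)^2 * (U \<epsilon> (X i) x)^2) - (LBINT x. (\<beta> x)^2 * (U \<epsilon> t x)^2)) / (X i - t)" for i
  unfolding q_def using iU[OF Xi(1)[of i]] iU[OF t]
  by (simp add: right_diff_distrib)
 ultimately show "((\<lambda>s. ((LBINT x. (\<beta> x)^2 * (U \<epsilon> s x)^2) - (LBINT x. (\<beta> x)^2 * (U \<epsilon> t x)^2)) / (s - t)) \<circ> X)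
   \<longlonglongrightarrow> 2 * (LBINT x. (\<beta> x)^2 * (U \<epsilon> t x * g \<epsilon> x t))"
  by (simp add: o_def)
qed

definition Lc :: real where "Lc = \<bar>k\<bar> * M * (ker_const TYPE('a) + 2)"
definition Dc :: real where "Dc = \<bar>k\<bar> * (DIM('a) * unit_ball_vol (DIM('a))) * M"
definition Ac :: real where "Ac = 2 * \<bar>\<kappa>\<bar> * M + 3 * Dc + Lc^2"

text \<open>Each component of the gradient is again a convolution of the density, with a derivative
  of the mollifier.\<close>

lemma grad_energy_continuous:
 assumes \<epsilon>: "\<epsilon> > 0" and \<beta>: "test_fun UNIV \<beta>"
 shows "continuous_on {0..T} (\<lambda>t. \<integral>x. (\<beta> x)^2 * (norm (grad (U \<epsilon> t) x))^2 \<partial>lborel)"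
proof -
 have e: "(LBINT x. (\<beta> x)^2 * (norm (grad (U \<epsilon> t) x))^2) = (\<Sum>i\<in>Basis. \<integral>x. (\<beta> x)^2 * (conv (\<rho> t) (dd i (mol \<epsilon>)) x)^2 \<partial>lborel)"
  if t: "t \<in> {0..T}" for t
 proof -
  have c: "grad (U \<epsilon> t) x \<bullet> i = conv (\<rho> t) (dd i (mol \<epsilon>)) x" for x i
   using grad_inner[OF U_smooth[OF \<epsilon> t], of x i] fun_cong[OF dd_conv[OF locint_L2[OF L2_at[OF t]] mol_tf[OF \<epsilon>], of i], of x]
   by (simp only: U_def)
  have i: "intble (\<lambda>x. (\<beta> x)^2 * (conv (\<rho> t) (dd i (mol \<epsilon>)) x)^2)" for i
  proof -
   have s: "smooth (conv (\<rho> t) (dd i (mol \<epsilon>)))" by (rule smooth_conv[OF locint_L2[OF L2_at[OF t]] tf_dd[OF mol_tf[OF \<epsilon>]]])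
   have "test_fun UNIV (\<lambda>x. \<beta> x * conv (\<rho> t) (dd i (mol \<epsilon>)) x)" by (rule tf_mult'[OF \<beta> s])
   then show ?thesis using tf_in_L2 by (fastforce simp: in_L2_real power_mult_distrib)
  qed
  show ?thesis unfolding norm_sq_sum c sum_distrib_left using i by (rule Bochner_Integration.integral_sum)
 qed
 show ?thesis
  by (subst continuous_on_cong[OF refl e]) (auto intro!: continuous_on_sum conv_square_continuous \<beta> tf_dd mol_tf \<epsilon>)
qed

text \<open>The constant \<open>Cv\<close> depends on the support of \<open>\<beta>\<close>, and
  \<open>\<mu>\<close> on \<open>Cv\<close> and \<open>e\<close>. The scale
  \<open>\<epsilon>0\<close> then follows from the uniform continuity of translations, so it depends
  on \<open>\<beta>\<close> and \<open>e\<close> but serves all times.\<close>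

lemma energy_inequality:
 assumes \<beta>: "test_fun UNIV \<beta>" "!!x. 0 <= \<beta> x" "!!x. \<beta> x <= 1" and e: "e > 0"
 obtains \<epsilon>0 where "\<epsilon>0 > 0" "!!\<epsilon> t. 0 < \<epsilon> ==> \<epsilon> < \<epsilon>0 ==> t \<in> {0..T} ==>
  (LBINT x. (\<beta> x)^2 * (U \<epsilon> t x)^2) + \<nu> * integral {0..t} (\<lambda>s. \<integral>x. (\<beta> x)^2 * (norm (grad (U \<epsilon> s) x))^2 \<partial>lborel)
  <= (LBINT x. (\<beta> x)^2 * (U \<epsilon> 0 x)^2)
   + integral {0..t} (\<lambda>s. Ac * (LBINT x. (\<beta> x)^2 * (\<rho> s x)^2) + (4 * \<nu> + 1) * (LBINT x. (norm (grad \<beta> x))^2 * (\<rho> s x)^2)) + e * t"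
proof -
 obtain r where r: "r > 0" "!!x. norm x > r ==> \<beta> x = 0" using tf_support[OF \<beta>(1)] by metis
 obtain B' where B': "B' > 0" "!!x. norm (grad \<beta> x) <= B'" using tf_grad_bounded[OF \<beta>(1)] by blast
 define B where "B = B'^2"
 have B: "(norm (grad \<beta> x))^2 <= B" for x unfolding B_def using B'(2) by (intro power_mono) auto
 obtain Cv where Cv: "Cv \<ge> 0" "!!(v :: 'a => 'a) h. regular_field Lc Dc v ==> norm h <= 1 ==>
  (LBINT x. indicator (cball 0 r) x * (norm (v (x + h) - v x))^2) <= Cv * (norm h)^2" using regular_field_difference[OF r(1)] by blast
 obtain C\<eta> where C\<eta>: "C\<eta> > 0" "!!\<epsilon>. \<epsilon> > 0 ==> (LBINT x. norm (grad (mol \<epsilon>) x)) <= C\<eta> / \<epsilon>" using mol_grad_integral by blast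
 define c where "c = (2 * \<bar>\<kappa>\<bar> * M + Dc + Lc^2) * (M^2 + 2) + (4 * \<nu> + 1) * B * (M^2 + 2) + 4 * C\<eta> * M * (1 + Cv)"
 have D0: "0 <= Dc" using M0 by (simp add: Dc_def)
 have c0: "0 <= c" unfolding c_def using M0 D0 \<nu> Cv(1) C\<eta>(1) by (simp add: B_def)
 \<comment> \<open>Translations will be required to satisfy \<open>S = \<mu>^2\<close>. The error
   factor \<open>\<mu> + S / \<mu>\<close> is then \<open>2 * \<mu>\<close>, and this choice brings
   its product with \<open>c\<close> below \<open>e\<close>.\<close>
 define \<mu> where "\<mu> = min 1 (e / (2 * (c + 1)))"
 have \<mu>: "0 < \<mu>" "\<mu> <= 1" "\<mu> <= e / (2 * (c + 1))" using e c0 by (auto simp: \<mu>_def)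
 have ce: "c * (\<mu> + \<mu>^2 / \<mu>) <= e"
 proof -
  have "c * (\<mu> + \<mu>^2 / \<mu>) = 2 * (c * \<mu>)" using \<mu>(1) by (simp add: power2_eq_square)
  also have "c * \<mu> <= (c + 1) * (e / (2 * (c + 1)))" using c0 \<mu> by (intro mult_mono) auto
  also have "2 * ((c + 1) * (e / (2 * (c + 1)))) = e" using c0 by (simp add: field_simps)
  finally show ?thesis by simp
 qed
 obtain \<delta> where \<delta>: "\<delta> > 0" "!!t h. t \<in> {0..T} ==> norm h <= \<delta> ==> (LBINT x. (\<rho> t (x - h) - \<rho> t x)^2) <= \<mu>^2"
  using uniform_translation[of "\<mu>^2"] \<mu>(1) by auto
 have [measurable]: "borelf \<beta>" "grad \<beta> \<in> borel_measurable borel"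
  using smooth_borel[OF tf_smooth[OF \<beta>(1)]] grad_borel[OF tf_smooth[OF \<beta>(1)]] by auto
 have b1: "\<bar>(\<beta> x)^2\<bar> <= 1" for x using \<beta>(2,3)[of x] by (simp add: power_le_one)
 have Yc: "continuous_on {0..T} (\<lambda>s. \<integral>x. (\<beta> x)^2 * (\<rho> s x)^2 \<partial>lborel)"
  by (rule weighted_square_continuous[OF _ b1]) measurable
 have Zc: "continuous_on {0..T} (\<lambda>s. \<integral>x. (norm (grad \<beta> x))^2 * (\<rho> s x)^2 \<partial>lborel)"
  by (rule weighted_square_continuous[where W = B]) (use B in auto)
 show ?thesis
 proof (rule that[of "min (\<delta> / 2) (1 / 2)"])
  show "min (\<delta> / 2) (1 / 2) > 0" using \<delta>(1) by simp
  fix \<epsilon> t assume \<epsilon>: "0 < \<epsilon>" "\<epsilon> < min (\<delta> / 2) (1 / 2)" and t: "t \<in> {0..T}"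
  define \<Psi> where "\<Psi> s = Ac * (LBINT x. (\<beta> x)^2 * (\<rho> s x)^2) + (4 * \<nu> + 1) * (LBINT x. (norm (grad \<beta> x))^2 * (\<rho> s x)^2)" for s
  define E where "E s = (LBINT x. (\<beta> x)^2 * (norm (grad (U \<epsilon> s) x))^2)" for s
  have st: "{0..t} \<subseteq> {0..T}" using t by auto
  have \<Psi>c: "continuous_on {0..t} \<Psi>" unfolding \<Psi>_def[abs_def] by (intro continuous_intros continuous_on_subset[OF Yc st] continuous_on_subset[OF Zc st])
  have Ec: "continuous_on {0..t} E" unfolding E_def[abs_def] by (rule continuous_on_subset[OF grad_energy_continuous[OF \<epsilon>(1) \<beta>(1)] st])
  have le: "2 * (LBINT x. (\<beta> x)^2 * (U \<epsilon> s x * g \<epsilon> x s)) <= \<Psi> s - \<nu> * E s + e" if s: "s \<in> {0..T}" for s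
  proof -
   interpret S: slice a "\<rho> s" "\<lambda>x. k *\<^sub>R vel (\<rho> s) x" M Lc Dc \<epsilon> "\<mu>^2"
   proof
    show "regular_field Lc Dc (\<lambda>x. k *\<^sub>R vel (\<rho> s) x)" unfolding Lc_def Dc_def by (rule vel_regular[OF bd[OF s]])
   qed (use bd[OF s] \<epsilon> \<delta>(2)[OF s] in auto)
   have u: "S.u = U \<epsilon> s" by (simp add: S.u_def U_def)
   have "2 * (LBINT x. (\<beta> x)^2 * (U \<epsilon> s x * g \<epsilon> x s)) + \<nu> * E s <= \<Psi> s + c * (\<mu> + \<mu>^2 / \<mu>)"
    using S.energy_estimate[OF \<beta> r(2) B Cv(1) Cv(2)[OF S.v] C\<eta>(2)[OF \<epsilon>(1)] \<mu>(1,2) \<nu>, of \<kappa>]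
    unfolding u E_def \<Psi>_def c_def Ac_def G_def .
   with ce show ?thesis by simp
  qed
  \<comment> \<open>The gauge integral integrates every derivative, so no continuity in time of the
    derivative of the energy has to be shown.\<close>
  have h1: "((\<lambda>s. 2 * (LBINT x. (\<beta> x)^2 * (U \<epsilon> s x * g \<epsilon> x s))) has_integral
   (LBINT x. (\<beta> x)^2 * (U \<epsilon> t x)^2) - (LBINT x. (\<beta> x)^2 * (U \<epsilon> 0 x)^2)) {0..t}"
  proof (rule fundamental_theorem_of_calculus)
   fix s assume "s \<in> {0..t}"
   with st have "s \<in> {0..T}" by blast
   from has_field_derivative_subset[OF energy_derivative[OF \<epsilon>(1) \<beta>(1) this] st]
   show "((\<lambda>s. \<integral>x. (\<beta> x)^2 * (U \<epsilon> s x)^2 \<partial>lborel) has_vector_derivative 2 * (LBINT x. (\<beta> x)^2 * (U \<epsilon> s x * g \<epsilon> x s))) (at s within {0..t})"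
    by (simp add: has_real_derivative_iff_has_vector_derivative)
  qed (use t in simp)
  have h2: "((\<lambda>s. \<Psi> s - \<nu> * E s + e) has_integral integral {0..t} \<Psi> - \<nu> * integral {0..t} E + e * t) {0..t}"
   using has_integral_const_real[of e 0 t] t
   by (intro has_integral_add has_integral_diff has_integral_mult_right integrable_integral integrable_continuous_real \<Psi>c Ec) (auto simp: mult.commute)
  have "(LBINT x. (\<beta> x)^2 * (U \<epsilon> t x)^2) - (LBINT x. (\<beta> x)^2 * (U \<epsilon> 0 x)^2) <= integral {0..t} \<Psi> - \<nu> * integral {0..t} E + e * t"
   by (rule has_integral_le[OF h1 h2]) (use le st in blast)
  then show "(LBINT x. (\<beta> x)^2 * (U \<epsilon> t x)^2) + \<nu> * integral {0..t} (\<lambda>s. \<integral>x. (\<beta> x)^2 * (norm (grad (U \<epsilon> s) x))^2 \<partial>lborel)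
  <= (LBINT x. (\<beta> x)^2 * (U \<epsilon> 0 x)^2)
   + integral {0..t} (\<lambda>s. Ac * (LBINT x. (\<beta> x)^2 * (\<rho> s x)^2) + (4 * \<nu> + 1) * (LBINT x. (norm (grad \<beta> x))^2 * (\<rho> s x)^2)) + e * t"
   unfolding E_def[abs_def, symmetric] \<Psi>_def[abs_def, symmetric] by (simp add: E_def \<Psi>_def)
 qed
qed

end

subsection \<open>Passage to the limit and Gronwall's inequality\<close>

text \<open>The weights converge only pointwise, so dominated convergence is used for the fixed
  function \<open>f\<close>. The error \<open>h n = u n - f\<close> is small in L^2, and there the
  bound 1 on the weights is enough.\<close>

lemma weighted_limit:
 fixes f :: "'a::euclidean_space => real"
 assumes f: "in_L2 f" and u: "!!n. in_L2 (u n)" and lim: "(\<lambda>n. \<integral>x. (u n x - f x)^2 \<partial>lborel) \<longlonglongrightarrow> 0"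
  and \<beta>: "!!n. \<beta> n \<in> borel_measurable borel" "!!n x. \<bar>\<beta> n x\<bar> <= 1" "!!x. (\<lambda>n. \<beta> n x) \<longlonglongrightarrow> b x"
 shows "(\<lambda>n. \<integral>x. (\<beta> n x)^2 * (u n x)^2 \<partial>lborel) \<longlonglongrightarrow> (LBINT x. (b x)^2 * (f x)^2)"
proof -
 have [measurable]: "borelf f" "!!n. u n \<in> borel_measurable borel" using f u by (auto simp: in_L2_real)
 note [measurable] = \<beta>(1)
 have bm[measurable]: "borelf b" by (rule borel_measurable_LIMSEQ_real[OF \<beta>(3)]) measurable
 have f2: "intble (\<lambda>x. (f x)^2)" using f by (simp add: in_L2_real)
 have b1: "\<bar>(\<beta> n x)^2\<bar> <= 1" for n x using \<beta>(2)[of n x] by (simp add: abs_square_le_1)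
 define h where "h n x = u n x - f x" for n x
 have h: "in_L2 (h n)" for n unfolding h_def[abs_def] by (rule in_L2_diff[OF u f])
 have h2: "intble (\<lambda>x. (h n x)^2)" for n using h by (simp add: in_L2_real)
 define \<delta> where "\<delta> n = L2_norm (h n)" for n
 have \<delta>: "\<delta> \<longlonglongrightarrow> 0"
  using tendsto_real_sqrt[OF lim] unfolding \<delta>_def[abs_def] L2_norm_def h_def by simp
 have L1: "(\<lambda>n. \<integral>x. (\<beta> n x)^2 * (f x)^2 \<partial>lborel) \<longlonglongrightarrow> (LBINT x. (b x)^2 * (f x)^2)"
 proof (rule integral_dominated_convergence[of _ _ _ "\<lambda>x. (f x)^2"])
  show "AE x in lborel. (\<lambda>n. (\<beta> n x)^2 * (f x)^2) \<longlonglongrightarrow> (b x)^2 * (f x)^2" by (intro AE_I2 tendsto_intros \<beta>(3))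
  show "AE x in lborel. norm ((\<beta> n x)^2 * (f x)^2) <= (f x)^2" for n
   using b1 by (intro AE_I2) (simp add: abs_mult mult_left_le_one_le)
 qed (use f2 in auto)
 have i1: "intble (\<lambda>x. (\<beta> n x)^2 * (f x)^2)" and i2: "intble (\<lambda>x. (\<beta> n x)^2 * (h n x)^2)" for n
  by (rule integrable_bounded_mult[OF f2 _ b1], measurable, rule integrable_bounded_mult[OF h2 _ b1], measurable)
 have g2: "in_L2 (\<lambda>x. (\<beta> n x)^2 * f x)" for n
 proof -
  have "intble (\<lambda>x. ((\<beta> n x)^2)^2 * (f x)^2)"
  proof (rule integrable_bounded_mult[OF f2, of _ 1])
   show "\<bar>((\<beta> n x)^2)^2\<bar> <= 1" for x using power_le_one[of "(\<beta> n x)^2" 2] b1[of n x] by simp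
  qed measurable
  then show ?thesis by (simp add: in_L2_real power_mult_distrib)
 qed
 have gn: "L2_norm (\<lambda>x. (\<beta> n x)^2 * f x) <= L2_norm f" for n
  unfolding L2_norm_def
 proof (intro real_sqrt_le_mono integral_mono)
  show "(norm ((\<beta> n x)^2 * f x))^2 <= (norm (f x))^2" for x
   using b1[of n x] by (intro power_mono) (auto simp: abs_mult mult_left_le_one_le)
 qed (use g2[of n] f in \<open>auto simp: in_L2_def\<close>)
 have i3: "intble (\<lambda>x. (\<beta> n x)^2 * f x * h n x)" for n by (rule in_L2_mult_integrable[OF g2 h])
 have L2: "(\<lambda>n. \<integral>x. (\<beta> n x)^2 * (h n x)^2 \<partial>lborel) \<longlonglongrightarrow> 0"
 proof (rule tendsto_sandwich[OF _ _ tendsto_const lim])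
  show "\<forall>\<^sub>F n in sequentially. 0 <= (LBINT x. (\<beta> n x)^2 * (h n x)^2)" by simp
  have "(LBINT x. (\<beta> n x)^2 * (h n x)^2) <= (LBINT x. (h n x)^2)" for n
   using b1 by (intro integral_mono i2 h2) (simp add: mult_left_le_one_le)
  then show "\<forall>\<^sub>F n in sequentially. (LBINT x. (\<beta> n x)^2 * (h n x)^2) <= (LBINT x. (u n x - f x)^2)"
   by (simp add: h_def)
 qed
 have L3: "(\<lambda>n. \<integral>x. (\<beta> n x)^2 * f x * h n x \<partial>lborel) \<longlonglongrightarrow> 0"
 proof (rule Lim_null_comparison)
  have "\<bar>LBINT x. (\<beta> n x)^2 * f x * h n x\<bar> <= L2_norm f * \<delta> n" for n
   unfolding \<delta>_def by (rule order_trans[OF Cauchy_Schwarz_integral[OF g2 h]]) (intro mult_right_mono gn L2_norm_nonneg)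
  then show "\<forall>\<^sub>F n in sequentially. norm (LBINT x. (\<beta> n x)^2 * f x * h n x) <= L2_norm f * \<delta> n" by simp
  show "(\<lambda>n. L2_norm f * \<delta> n) \<longlonglongrightarrow> 0" using tendsto_mult_right_zero[OF \<delta>] .
 qed
 have "(LBINT x. (\<beta> n x)^2 * (u n x)^2) = (LBINT x. (\<beta> n x)^2 * (f x)^2) + (LBINT x. (\<beta> n x)^2 * (h n x)^2)
   + 2 * (LBINT x. (\<beta> n x)^2 * f x * h n x)" for n
 proof -
  have "(\<beta> n x)^2 * (u n x)^2 = (\<beta> n x)^2 * (f x)^2 + (\<beta> n x)^2 * (h n x)^2 + 2 * ((\<beta> n x)^2 * f x * h n x)" for x
   unfolding h_def by (simp add: power2_eq_square algebra_simps)
  then show ?thesis using i1[of n] i2[of n] i3[of n] by simp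
 qed
 then show ?thesis using tendsto_add[OF tendsto_add[OF L1 L2] tendsto_mult_left[OF L3, of 2]] by simp
qed

text \<open>The bound is for the integral expression rather than for \<open>Y\<close>, since that
  expression also dominates the dissipation. Differentiating \<open>h\<close> shows it to be
  nonincreasing: the hypothesis bounds \<open>Y\<close> by \<open>X\<close>, and the exponential
  weight of the forcing is at most 1.\<close>

lemma gronwall:
 fixes Y w :: "real => real"
 assumes Y: "continuous_on {0..T} Y" and w: "continuous_on {0..T} w" "!!t. 0 <= w t" and AB: "0 <= A" "0 <= B"
  and le: "!!t. t \<in> {0..T} ==> Y t <= Y0 + integral {0..t} (\<lambda>s. A * Y s + B * w s)" and t: "t \<in> {0..T}"
 shows "Y0 + integral {0..t} (\<lambda>s. A * Y s + B * w s) <= (Y0 + B * integral {0..t} w) * exp (A * t)"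
proof -
 define X where "X t = Y0 + integral {0..t} (\<lambda>s. A * Y s + B * w s)" for t
 define h where "h t = X t * exp (- (A * t)) - B * integral {0..t} w" for t
 have c: "continuous_on {0..T} (\<lambda>s. A * Y s + B * w s)" by (intro continuous_intros Y w)
 have dX: "(X has_real_derivative A * Y s + B * w s) (at s within {0..T})" if "s \<in> {0..T}" for s
  unfolding X_def[abs_def] using integral_has_vector_derivative[OF c that]
  by (auto simp: has_real_derivative_iff_has_vector_derivative intro!: derivative_eq_intros)
 have dw: "((\<lambda>t. integral {0..t} w) has_real_derivative w s) (at s within {0..T})" if "s \<in> {0..T}" for s
  using integral_has_vector_derivative[OF w(1) that] by (simp add: has_real_derivative_iff_has_vector_derivative)
 have dh: "(h has_real_derivative (A * Y s + B * w s - A * X s) * exp (- (A * s)) - B * w s) (at s within {0..T})" if "s \<in> {0..T}" for s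
  unfolding h_def[abs_def] by (auto intro!: derivative_eq_intros dX dw that simp: algebra_simps)
 have st: "{0..t} \<subseteq> {0..T}" using t by auto
 have "((\<lambda>s. (A * Y s + B * w s - A * X s) * exp (- (A * s)) - B * w s) has_integral h t - h 0) {0..t}"
  by (rule fundamental_theorem_of_calculus)
   (use t st in \<open>auto intro!: has_field_derivative_subset[OF dh st] simp flip: has_real_derivative_iff_has_vector_derivative\<close>)
 from has_integral_le[OF this has_integral_0] have "h t - h 0 <= 0"
 proof -
  have "(A * Y s + B * w s - A * X s) * exp (- (A * s)) - B * w s <= 0" if "s \<in> {0..t}" for s
  proof -
   have "A * Y s <= A * X s" unfolding X_def using that st by (intro mult_left_mono le AB) auto
   then have "(A * Y s + B * w s - A * X s) * exp (- (A * s)) <= (B * w s) * exp (- (A * s))" by (intro mult_right_mono) auto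
   also have "... <= (B * w s) * 1" using that AB w(2)[of s] by (intro mult_left_mono) auto
   finally show ?thesis by simp
  qed
  with has_integral_le[OF \<open>(_ has_integral h t - h 0) {0..t}\<close> has_integral_0] show ?thesis by blast
 qed
 then have "X t * exp (- (A * t)) <= Y0 + B * integral {0..t} w" by (simp add: h_def X_def)
 then have "X t * exp (- (A * t)) * exp (A * t) <= (Y0 + B * integral {0..t} w) * exp (A * t)" by (rule mult_right_mono) simp
 then show ?thesis by (simp add: X_def mult.assoc flip: exp_add)
qed

section \<open>The outer cutoff and its compactly supported truncations\<close>

definition annulus :: "real => 'a::euclidean_space set" where
 "annulus R = {x. R <= norm x \<and> norm x <= 2 * R}"

lemma annulus_borel[measurable]: "annulus R \<in> sets borel"
proof -
 have "closed (annulus R)" unfolding annulus_def by (intro closed_Collect_conj closed_Collect_le continuous_intros)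
 then show ?thesis by (rule borel_closed)
qed

context cutoff
begin

lemma bcut_bounds: "0 <= bcut a R x" "bcut a R x <= 1"
 using a_nonneg a_le_1 by (auto simp: bcut_def)

lemma bcut_smooth:
 assumes "R > 0" shows "smooth (bcut a R)"
 unfolding bcut_def[abs_def] using smooth_add[OF smooth_const[of 1] smooth_mult[OF smooth_const[of "-1"] tf_smooth[OF a_scale_tf[OF assms]]]]
 by simp

lemma grad_bcut:
 assumes R: "R > 0" and Ca: "!!x. norm (grad a x) <= Ca"
 shows "(norm (grad (bcut a R) x))^2 <= Ca^2 / R^2 * indicator (annulus R) x"
proof -
 have "dd i (bcut a R) x = - dd i (\<lambda>x. a (x /\<^sub>R R)) x" for i
  unfolding bcut_def[abs_def] using smooth_differentiable[OF tf_smooth[OF a_scale_tf[OF R]], of x]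
  by (intro dd_eq) (auto intro!: derivative_eq_intros has_derivative_dd)
 then have g: "grad (bcut a R) x = - (grad a (x /\<^sub>R R) /\<^sub>R R)"
  unfolding grad_a_scale[symmetric] by (simp add: grad_def sum_negf)
 have n: "norm (x /\<^sub>R R) = norm x / R" using R by (simp add: divide_inverse_commute)
 show ?thesis
 proof (cases "x \<in> annulus R")
  case True
  have "(norm (grad (bcut a R) x))^2 = (norm (grad a (x /\<^sub>R R)))^2 / R^2"
   unfolding g using R by (simp add: power_mult_distrib divide_inverse power_inverse mult.commute)
  also have "... <= Ca^2 / R^2" by (intro divide_right_mono power_mono Ca) auto
  finally show ?thesis using True by simp
 next
  case False
  have "grad a (x /\<^sub>R R) = 0"
  proof (cases "norm x > 2 * R")
   case True
   then have "2 < norm (x /\<^sub>R R)" unfolding n using R by (simp add: pos_less_divide_eq)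
   then show ?thesis by (intro grad_zero_outside[of 2] a_zero) simp_all
  next
   case f: False
   with False have "norm x < R" by (auto simp: annulus_def)
   then have "norm (x /\<^sub>R R) < 1" unfolding n using R by (simp add: pos_divide_less_eq)
   then have b: "x /\<^sub>R R \<in> ball 0 1" by simp
   have "(a has_derivative (\<lambda>h. 0)) (at (x /\<^sub>R R))"
    by (rule has_derivative_transform_within_open[OF has_derivative_const[of 1] open_ball b]) (simp add: a_one)
   then have "dd i a (x /\<^sub>R R) = 0" for i by (rule dd_eq)
   then show ?thesis by (simp add: grad_def)
  qed
  then show ?thesis using False by (simp add: g)
 qed
qed

text \<open>An admissible spatial weight that increases neither the cutoff nor its range. The
  gradient of the additional factor is of order 1 / n on a large shell, and this suffices because
  the density is square integrable.\<close>

definition cutb :: "real => nat => 'a => real" where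
 "cutb R n x = bcut a R x * a (x /\<^sub>R real (Suc n))"

lemma cutb_bounds: "0 <= cutb R n x" "cutb R n x <= bcut a R x" "cutb R n x <= 1"
proof -
 show "0 <= cutb R n x" using bcut_bounds a_nonneg by (simp add: cutb_def)
 show "cutb R n x <= bcut a R x" unfolding cutb_def using bcut_bounds(1) a_nonneg a_le_1 by (intro mult_right_le_one_le)
 then show "cutb R n x <= 1" using bcut_bounds(2) order_trans by blast
qed

lemma cutb_tf: "R > 0 ==> test_fun UNIV (cutb R n)"
 unfolding cutb_def[abs_def] by (intro tf_mult a_scale_tf bcut_smooth) simp

lemma cutb_limit: "(\<lambda>n. cutb R n x) \<longlonglongrightarrow> bcut a R x"
proof (rule tendsto_eventually)
 obtain m where m: "norm x < real m" using reals_Archimedean2 by blast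
 have "cutb R n x = bcut a R x" if "n \<ge> m" for n
 proof -
  have "norm x < real (Suc n)" using m that by linarith
  then have "norm (x /\<^sub>R real (Suc n)) < 1" by (simp add: pos_divide_less_eq flip: divide_inverse_commute)
  then show ?thesis by (simp only: cutb_def a_one mult_1_right)
 qed
 then show "\<forall>\<^sub>F n in sequentially. cutb R n x = bcut a R x" by (auto simp: eventually_sequentially)
qed

lemma grad_cutb:
 assumes R: "R > 0" and Ca: "!!x. norm (grad a x) <= Ca"
 shows "(norm (grad (cutb R n) x))^2 <= 2 * (Ca^2 / R^2 * indicator (annulus R) x) + 2 * (Ca / real (Suc n))^2"
proof -
 define \<chi>' where "\<chi>' = (\<lambda>x. a (x /\<^sub>R real (Suc n)))"
 have s: "smooth \<chi>'" unfolding \<chi>'_def by (intro tf_smooth[OF a_scale_tf]) simp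
 have "dd i (cutb R n) x = bcut a R x * dd i \<chi>' x + dd i (bcut a R) x * \<chi>' x" for i
  unfolding cutb_def[abs_def] \<chi>'_def[symmetric]
  using dd_mult[OF smooth_differentiable[OF bcut_smooth[OF R]] smooth_differentiable[OF s], of x i] by (simp add: \<chi>'_def)
 then have "grad (cutb R n) x = bcut a R x *\<^sub>R grad \<chi>' x + \<chi>' x *\<^sub>R grad (bcut a R) x"
  by (simp add: grad_def scaleR_add_left sum.distrib scaleR_sum_right mult.commute)
 then have "norm (grad (cutb R n) x) <= bcut a R x * norm (grad \<chi>' x) + \<chi>' x * norm (grad (bcut a R) x)"
  using norm_triangle_ineq[of "bcut a R x *\<^sub>R grad \<chi>' x" "\<chi>' x *\<^sub>R grad (bcut a R) x"] bcut_bounds(1)[of R x] a_nonneg by (simp add: \<chi>'_def)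
 also have "... <= norm (grad \<chi>' x) + norm (grad (bcut a R) x)"
  using bcut_bounds[of R x] a_nonneg a_le_1 by (intro add_mono mult_left_le_one_le) (auto simp: \<chi>'_def)
 finally have "(norm (grad (cutb R n) x))^2 <= (norm (grad \<chi>' x) + norm (grad (bcut a R) x))^2" by (rule power_mono) simp
 also have "... <= 2 * (norm (grad \<chi>' x))^2 + 2 * (norm (grad (bcut a R) x))^2" by (rule sq_add_le)
 also have "... <= 2 * (Ca / real (Suc n))^2 + 2 * (Ca^2 / R^2 * indicator (annulus R) x)"
 proof (intro add_mono mult_left_mono grad_bcut[OF R Ca] power_mono)
  show "norm (grad \<chi>' x) <= Ca / real (Suc n)"
   unfolding \<chi>'_def grad_a_scale using Ca[of "x /\<^sub>R real (Suc n)"] by (simp add: divide_inverse_commute mult_left_mono)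
 qed auto
 finally show ?thesis by simp
qed

lemma conv_mol_L2_limit:
 assumes f: "in_L2 f" and \<epsilon>: "!!n. \<epsilon> n > 0" "\<epsilon> \<longlonglongrightarrow> 0"
 shows "(\<lambda>n. \<integral>x. (conv f (mol (\<epsilon> n)) x - f x)^2 \<partial>lborel) \<longlonglongrightarrow> 0"
 unfolding tendsto_iff
proof safe
 fix e :: real assume e: "e > 0"
 then obtain \<delta> where \<delta>: "\<delta> > 0" "!!h. norm h <= \<delta> ==> (LBINT x. (f (x - h) - f x)^2) <= e / 2" using translation_L2[OF f, of "e / 2"] by auto
 have "\<forall>\<^sub>F n in sequentially. \<epsilon> n < \<delta> / 2" using \<epsilon>(2) \<delta>(1) by (intro order_tendstoD(2)) auto
 then show "\<forall>\<^sub>F n in sequentially. dist (LBINT x. (conv f (mol (\<epsilon> n)) x - f x)^2) 0 < e"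
 proof eventually_elim
  fix n assume n: "\<epsilon> n < \<delta> / 2"
  have "(LBINT x. (conv f (mol (\<epsilon> n)) x - f x)^2) <= e / 2"
   by (rule conv_mol_L2(2)[OF f \<epsilon>(1)], rule \<delta>(2)) (use n in linarith)
  then show "dist (LBINT x. (conv f (mol (\<epsilon> n)) x - f x)^2) 0 < e" using e by simp
 qed
qed

lemma conv_mol_in_L2:
 assumes f: "in_L2 f" and \<epsilon>: "\<epsilon> > 0"
 shows "in_L2 (conv f (mol \<epsilon>))"
proof (rule conv_mol_L2(1)[OF f \<epsilon>])
 fix h :: 'a
 have i: "intble (\<lambda>x. (f (x - h))^2)" "intble (\<lambda>x. (f x)^2)" using in_L2_shift[OF f] f by (auto simp: in_L2_real)
 have "(LBINT x. (f (x - h) - f x)^2) <= (LBINT x. 2 * (f (x - h))^2 + 2 * (f x)^2)"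
 proof (rule integral_mono)
  show "intble (\<lambda>x. (f (x - h) - f x)^2)" using in_L2_diff[OF in_L2_shift[OF f] f] by (simp add: in_L2_real)
  show "(f (x - h) - f x)^2 <= 2 * (f (x - h))^2 + 2 * (f x)^2" for x using sq_add_le[of "f (x - h)" "- f x"] by simp
 qed (use i in simp)
 also have "... = 4 * (LBINT x. (f x)^2)" using i integral_sq_shift[OF f, of h] by simp
 finally show "(LBINT x. (f (x - h) - f x)^2) <= 4 * (LBINT x. (f x)^2)" .
qed

end

text \<open>The factor of the energy in the energy estimate, with the bounds on the velocity and its
  divergence inserted. As a nondecreasing continuous function of \<open>M\<close> it turns the
  control \<open>K\<close> into a time constant.\<close>

definition growth_rate :: "'a::euclidean_space itself => real => real => real => real" where
 "growth_rate _ k \<kappa> M = 2 * \<bar>\<kappa>\<bar> * M + 3 * (\<bar>k\<bar> * (DIM('a) * unit_ball_vol (DIM('a))) * M) + (\<bar>k\<bar> * M * (ker_const TYPE('a) + 2))^2"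

lemma growth_rate_mono:
 assumes "0 <= M" "M <= M'"
 shows "0 <= growth_rate TYPE('a::euclidean_space) k \<kappa> M" "growth_rate TYPE('a) k \<kappa> M <= growth_rate TYPE('a) k \<kappa> M'"
proof -
 have p: "0 <= ker_const TYPE('a) + 2" using ker_const_pos[where 'a = 'a] by linarith
 show "0 <= growth_rate TYPE('a) k \<kappa> M" using assms by (simp add: growth_rate_def)
 show "growth_rate TYPE('a) k \<kappa> M <= growth_rate TYPE('a) k \<kappa> M'"
  unfolding growth_rate_def using assms p
  by (intro add_mono mult_left_mono mult_right_mono power_mono) auto
qed

context flow
begin

lemma Ac_eq: "Ac = growth_rate TYPE('a) k \<kappa> M"
 by (simp add: Ac_def Dc_def Lc_def growth_rate_def)

lemma outer_energy_eq:
 "outer_energy a \<nu> R \<rho> t = (LBINT x. (bcut a R x)^2 * (\<rho> t x)^2)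
  + \<nu> * (LBINT s:{0..t}. \<integral>x. (bcut a R x)^2 * (norm (wgrad (\<rho> s) x))^2 \<partial>lborel)"
 using bcut_bounds by (simp add: outer_energy_def L2_norm_sq power_mult_distrib)

lemma bcut_borel: "R > 0 ==> bcut a R \<in> borel_measurable borel"
 by (rule smooth_borel[OF bcut_smooth])

lemma bcut_sq_le: "\<bar>(bcut a R x)^2\<bar> <= 1"
 using bcut_bounds[of R x] by (simp add: power_le_one)

text \<open>The weighted energies and the right-hand side converge. For the dissipation, almost
  every time slice converges and Fatou's lemma in time gives the one-sided bound.\<close>

lemma outer_inequality:
 assumes R: "R > 0" and Ca: "!!x. norm (grad a x) <= Ca" and t: "t \<in> {0..T}"
 shows "outer_energy a \<nu> R \<rho> t <= (LBINT x. (bcut a R x)^2 * (\<rho> 0 x)^2)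
  + integral {0..t} (\<lambda>s. Ac * (LBINT x. (bcut a R x)^2 * (\<rho> s x)^2)
    + 8 * Ca^2 * (\<nu> + 1) / R^2 * (LBINT x. indicator (annulus R) x * (\<rho> s x)^2))"
proof -
 define Y where "Y s = (LBINT x. (bcut a R x)^2 * (\<rho> s x)^2)" for s
 define W where "W s = (LBINT x. indicator (annulus R) x * (\<rho> s x)^2)" for s
 define q where "q s = Ac * Y s + 8 * Ca^2 * (\<nu> + 1) / R^2 * W s" for s
 define P where "P n e s = (LBINT x. (cutb R n x)^2 * (U e s x)^2)" for n e s
 define E where "E n e s = (LBINT x. (cutb R n x)^2 * (norm (grad (U e s) x))^2)" for n e s
 define Q where "Q n s = Ac * (LBINT x. (cutb R n x)^2 * (\<rho> s x)^2) + (4 * \<nu> + 1) * (LBINT x. (norm (grad (cutb R n) x))^2 * (\<rho> s x)^2)" for n s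
 \<comment> \<open>The mollification parameter \<open>\<epsilon> n\<close> is chosen after the compactly supported cutoff
  \<open>cutb R n\<close>, as the commutator error depends on the support of the latter.\<close>
 define c1 where "c1 = (4 * \<nu> + 1) * (2 * Ca^2 * M^2)"
 have st: "{0..t} \<subseteq> {0..T}" using t by auto
 have A0: "0 <= Ac" unfolding Ac_eq by (rule growth_rate_mono(1)[OF M0 order_refl])
 note cm[measurable] = smooth_borel[OF tf_smooth[OF cutb_tf[OF R]]] grad_borel[OF tf_smooth[OF cutb_tf[OF R]]] bcut_borel[OF R]
 have cb: "\<bar>cutb R n x\<bar> <= 1" for n x using cutb_bounds[of R n x] by simp
 have cb2: "\<bar>(cutb R n x)^2\<bar> <= 1" for n x using cb[of n x] by (simp add: abs_square_le_1)
 have gb: "\<bar>(norm (grad (cutb R n) x))^2\<bar> <= 2 * (Ca^2 / R^2) + 2 * Ca^2" for n x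
 proof -
  have "Ca^2 / (real (Suc n))^2 <= Ca^2 / 1" by (intro divide_left_mono one_le_power) auto
  then have "(Ca / real (Suc n))^2 <= Ca^2" unfolding power_divide by simp
  moreover have "Ca^2 / R^2 * indicator (annulus R) x <= Ca^2 / R^2" by (simp add: indicator_def)
  ultimately show ?thesis using grad_cutb[OF R Ca, of n x] by simp
 qed
 have ib: "\<bar>indicator (annulus R) x :: real\<bar> <= 1" for x :: 'a by (simp add: indicator_def)
 have r2: "intble (\<lambda>x. (\<rho> s x)^2)" if "s \<in> {0..T}" for s using L2_at[OF that] by (simp add: in_L2_real)
 have wi: "intble (\<lambda>x. w x * (\<rho> s x)^2)" if "borelf w" "!!x. \<bar>w x\<bar> <= c" "s \<in> {0..T}" for w c s
  by (rule integrable_bounded_mult[OF r2[OF that(3)] that(1,2)])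
 have Qc: "continuous_on {0..T} (Q n)" for n
  unfolding Q_def[abs_def]
  by (intro continuous_intros weighted_square_continuous[OF _ cb2] weighted_square_continuous[OF _ gb]) measurable
 have Yc: "continuous_on {0..T} Y" unfolding Y_def[abs_def] by (rule weighted_square_continuous[OF _ bcut_sq_le]) measurable
 have Wc: "continuous_on {0..T} W" unfolding W_def[abs_def] by (rule weighted_square_continuous[OF _ ib]) measurable
 have qc: "continuous_on {0..T} q" unfolding q_def[abs_def] by (intro continuous_intros Yc Wc)
 have Qq: "Q n s <= q s + c1 / real (Suc n)" if s: "s \<in> {0..T}" for n s
 proof -
  have 1: "(LBINT x. (cutb R n x)^2 * (\<rho> s x)^2) <= Y s" unfolding Y_def
  proof (rule integral_mono)
   show "(cutb R n x)^2 * (\<rho> s x)^2 <= (bcut a R x)^2 * (\<rho> s x)^2" for x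
    by (intro mult_right_mono power_mono cutb_bounds) simp
  qed (rule wi[OF _ cb2 s], measurable, rule wi[OF _ bcut_sq_le s], measurable)
  have n1: "(Ca / real (Suc n))^2 <= Ca^2 / real (Suc n)"
   unfolding power_divide by (intro divide_left_mono self_le_power) auto
  have "(LBINT x. (norm (grad (cutb R n) x))^2 * (\<rho> s x)^2)
   <= (LBINT x. 2 * (Ca^2 / R^2) * (indicator (annulus R) x * (\<rho> s x)^2) + 2 * (Ca^2 / real (Suc n)) * (\<rho> s x)^2)"
  proof (rule integral_mono)
   show "intble (\<lambda>x. (norm (grad (cutb R n) x))^2 * (\<rho> s x)^2)" by (rule wi[OF _ gb s]) measurable
   show "intble (\<lambda>x. 2 * (Ca^2 / R^2) * (indicator (annulus R) x * (\<rho> s x)^2) + 2 * (Ca^2 / real (Suc n)) * (\<rho> s x)^2)"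
    by (intro Bochner_Integration.integrable_add integrable_mult_right r2[OF s] wi[OF _ ib s]) measurable
   fix x
   have "(norm (grad (cutb R n) x))^2 <= 2 * (Ca^2 / R^2 * indicator (annulus R) x) + 2 * (Ca^2 / real (Suc n))"
    using grad_cutb[OF R Ca, of n x] n1 by linarith
   from mult_right_mono[OF this, of "(\<rho> s x)^2"]
   show "(norm (grad (cutb R n) x))^2 * (\<rho> s x)^2 <= 2 * (Ca^2 / R^2) * (indicator (annulus R) x * (\<rho> s x)^2) + 2 * (Ca^2 / real (Suc n)) * (\<rho> s x)^2"
    by (simp add: distrib_right mult.assoc)
  qed
  also have "... = 2 * (Ca^2 / R^2) * W s + 2 * (Ca^2 / real (Suc n)) * (LBINT x. (\<rho> s x)^2)"
   unfolding W_def using r2[OF s] wi[OF _ ib s] by simp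
  also have "... <= 2 * (Ca^2 / R^2) * W s + 2 * (Ca^2 / real (Suc n)) * M^2"
   using L1_Linf_L2(2)[OF bd[OF s]] by (intro add_mono mult_left_mono order_refl) auto
  finally have 2: "(LBINT x. (norm (grad (cutb R n) x))^2 * (\<rho> s x)^2) <= 2 * (Ca^2 / R^2) * W s + 2 * (Ca^2 / real (Suc n)) * M^2" .
  have W0: "0 <= Ca^2 / R^2 * W s" unfolding W_def by simp
  have "Q n s <= Ac * Y s + (4 * \<nu> + 1) * (2 * (Ca^2 / R^2) * W s + 2 * (Ca^2 / real (Suc n)) * M^2)"
   unfolding Q_def using A0 \<nu> by (intro add_mono mult_left_mono 1 2) auto
  also have "... = Ac * Y s + (8 * \<nu> + 2) * (Ca^2 / R^2 * W s) + c1 / real (Suc n)"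
   by (simp only: c1_def) (simp add: algebra_simps add_divide_distrib)
  \<comment> \<open>Twice \<open>4 * \<nu> + 1\<close>, where the 2 comes from squaring the sum of
    the two gradients of the truncated cutoff, is rounded up to
    \<open>8 * (\<nu> + 1)\<close>.\<close>
  also have "... <= Ac * Y s + (8 * (\<nu> + 1)) * (Ca^2 / R^2 * W s) + c1 / real (Suc n)"
   using W0 by (intro add_mono mult_right_mono order_refl) auto
  also have "(8 * (\<nu> + 1)) * (Ca^2 / R^2 * W s) = 8 * Ca^2 * (\<nu> + 1) / R^2 * W s" by simp
  finally show ?thesis by (simp only: q_def)
 qed
 have "\<exists>e. 0 < e \<and> e <= 1 / real (Suc n) \<and> P n e t + \<nu> * integral {0..t} (E n e) <= P n e 0 + integral {0..t} (Q n) + 1 / real (Suc n) * t" for n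
 proof -
  have "1 / real (Suc n) > 0" by simp
  from energy_inequality[OF cutb_tf[OF R] cutb_bounds(1) cutb_bounds(3) this, of n]
  obtain \<epsilon>0 where e0: "\<epsilon>0 > 0" and ei: "!!\<epsilon> t. 0 < \<epsilon> ==> \<epsilon> < \<epsilon>0 ==> t \<in> {0..T} ==>
   P n \<epsilon> t + \<nu> * integral {0..t} (E n \<epsilon>) <= P n \<epsilon> 0 + integral {0..t} (Q n) + 1 / real (Suc n) * t"
   unfolding P_def E_def[abs_def] Q_def[abs_def] by blast
  show ?thesis
   by (rule exI[of _ "min (\<epsilon>0 / 2) (1 / real (Suc n))"], intro conjI ei t) (use e0 in \<open>auto simp: min_less_iff_disj\<close>)
 qed
 then obtain \<epsilon> where \<epsilon>: "!!n. \<epsilon> n > 0" "!!n. \<epsilon> n <= 1 / real (Suc n)"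
  and ei: "!!n. P n (\<epsilon> n) t + \<nu> * integral {0..t} (E n (\<epsilon> n)) <= P n (\<epsilon> n) 0 + integral {0..t} (Q n) + 1 / real (Suc n) * t" by metis
 have inv0: "(\<lambda>n. 1 / real (Suc n)) \<longlonglongrightarrow> 0" using LIMSEQ_inverse_real_of_nat unfolding inverse_eq_divide .
 have \<epsilon>0: "\<epsilon> \<longlonglongrightarrow> 0"
  by (rule tendsto_sandwich[OF _ _ tendsto_const inv0]) (use \<epsilon> in \<open>auto intro!: always_eventually less_imp_le simp del: of_nat_Suc\<close>)
 have Plim: "(\<lambda>n. P n (\<epsilon> n) s) \<longlonglongrightarrow> Y s" if s: "s \<in> {0..T}" for s
  unfolding P_def Y_def U_def
  by (rule weighted_limit[OF L2_at[OF s] conv_mol_in_L2[OF L2_at[OF s] \<epsilon>(1)] conv_mol_L2_limit[OF L2_at[OF s] \<epsilon>(1) \<epsilon>0] cm(1) cb cutb_limit])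
 define r where "r n = P n (\<epsilon> n) 0 + (integral {0..t} q + c1 * (1 / real (Suc n)) * t) + 1 / real (Suc n) * t" for n
 have QI: "integral {0..t} (Q n) <= integral {0..t} q + c1 * (1 / real (Suc n)) * t" for n
 proof -
  have i: "Q n integrable_on {0..t}" "q integrable_on {0..t}"
   by (intro integrable_continuous_real continuous_on_subset[OF Qc st] continuous_on_subset[OF qc st])+
  have "integral {0..t} (Q n) <= integral {0..t} (\<lambda>s. q s + c1 / real (Suc n))"
   using i Qq st by (intro integral_le integrable_add) auto
  also have "... = integral {0..t} q + c1 / real (Suc n) * t" 
   by (subst Henstock_Kurzweil_Integration.integral_add) (use i t in \<open>auto simp: mult.commute intro!: integrable_continuous_real\<close>)
  finally show ?thesis by simp
 qed
 have Er: "\<nu> * integral {0..t} (E n (\<epsilon> n)) <= r n - P n (\<epsilon> n) t" for n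
  using ei[of n] QI[of n] unfolding r_def by linarith
 have "r \<longlonglongrightarrow> Y 0 + (integral {0..t} q + c1 * 0 * t) + 0 * t"
  unfolding r_def[abs_def] using t by (intro tendsto_intros Plim inv0) auto
 then have rlim: "(\<lambda>n. r n - P n (\<epsilon> n) t) \<longlonglongrightarrow> Y 0 + integral {0..t} q - Y t"
  using Plim[OF t] by (intro tendsto_diff) auto
 have Ec: "continuous_on {0..t} (E n (\<epsilon> n))" for n
  unfolding E_def[abs_def] by (rule continuous_on_subset[OF grad_energy_continuous[OF \<epsilon>(1) cutb_tf[OF R]] st])
 have Epos: "0 <= E n e s" for n e s unfolding E_def by simp
 have EI0: "0 <= integral {0..t} (E n (\<epsilon> n))" for n
  by (intro Henstock_Kurzweil_Integration.integral_nonneg integrable_continuous_real Ec Epos)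
 define D where "D s = (LBINT x. (bcut a R x)^2 * (norm (wgrad (\<rho> s) x))^2)" for s
 \<comment> \<open>For zero viscosity nothing is known of the weak gradients. The left-hand side is
   then 0, and only the limit inequality without dissipation remains.\<close>
 have "\<nu> * (LBINT s:{0..t}. D s) <= Y 0 + integral {0..t} q - Y t"
 proof (cases "\<nu> = 0")
  case True
  have "0 <= r n - P n (\<epsilon> n) t" for n using Er[of n] True by simp
  then show ?thesis using LIMSEQ_le_const[OF rlim, of 0] True by simp
 next
  case False
  then have \<nu>0: "\<nu> > 0" using \<nu> by simp
  define l where "l n = (r n - P n (\<epsilon> n) t) / \<nu>" for n
  define l' where "l' = (Y 0 + integral {0..t} q - Y t) / \<nu>"
  have llim: "l \<longlonglongrightarrow> l'" unfolding l_def[abs_def] l'_def by (intro tendsto_divide rlim tendsto_const) (use False in simp)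
  have El: "integral {0..t} (E n (\<epsilon> n)) <= l n" for n using Er[of n] \<nu>0 by (simp add: l_def pos_le_divide_eq mult.commute)
  have l0: "0 <= l'" by (rule LIMSEQ_le_const[OF llim]) (use order_trans[OF EI0 El] in auto)
  let ?E = "\<lambda>n s. indicator {0..t} s *\<^sub>R E n (\<epsilon> n) s"
  let ?D = "\<lambda>s. indicator {0..t} s *\<^sub>R D s"
  have Em: "?E n \<in> borel_measurable borel" for n by (rule borel_measurable_continuous_on_indicator[OF _ Ec]) simp
  have nE: "(\<integral>\<^sup>+s. ennreal (?E n s) \<partial>lborel) = ennreal (integral {0..t} (E n (\<epsilon> n)))" for n
  proof -
   have si: "set_integrable lborel {0..t} (E n (\<epsilon> n))" by (rule borel_integrable_atLeastAtMost'[OF Ec])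
   have "(\<integral>\<^sup>+s. ennreal (?E n s) \<partial>lborel) = ennreal (LBINT s. ?E n s)"
    using si Epos unfolding set_integrable_def by (intro nn_integral_eq_integral) auto
   then show ?thesis using set_borel_integral_eq_integral(2)[OF si] by (simp add: set_lebesgue_integral_def)
  qed
  have pt: "(\<lambda>n. E n (\<epsilon> n) s) \<longlonglongrightarrow> D s" if s: "s \<in> {0..T}" and h: "in_H1 (\<rho> s)" for s
  proof -
   have w: "in_L2 (wgrad (\<rho> s))" using wgrad_H1[OF h] by simp
   note wc = in_L2_component[OF w]
   have c: "grad (U (\<epsilon> n) s) x \<bullet> i = conv (\<lambda>y. wgrad (\<rho> s) y \<bullet> i) (mol (\<epsilon> n)) x" if "i \<in> Basis" for n x i
    using grad_inner[OF U_smooth[OF \<epsilon>(1) s], of n x i] conv_wgrad[OF h \<epsilon>(1) that] by (simp add: U_def)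
   have i: "intble (\<lambda>x. (cutb R n x)^2 * (conv (\<lambda>y. wgrad (\<rho> s) y \<bullet> i) (mol (\<epsilon> n)) x)^2)" if "i \<in> Basis" for n i
    by (rule integrable_bounded_mult[OF _ _ cb2]) (use conv_mol_in_L2[OF wc[OF that] \<epsilon>(1)[of n]] cm in \<open>auto simp: in_L2_real\<close>)
   have i': "intble (\<lambda>x. (bcut a R x)^2 * (wgrad (\<rho> s) x \<bullet> i)^2)" if "i \<in> Basis" for i
    by (rule integrable_bounded_mult[OF _ _ bcut_sq_le]) (use wc[OF that] cm in \<open>auto simp: in_L2_real\<close>)
   have "E n (\<epsilon> n) s = (\<Sum>i\<in>Basis. \<integral>x. (cutb R n x)^2 * (conv (\<lambda>y. wgrad (\<rho> s) y \<bullet> i) (mol (\<epsilon> n)) x)^2 \<partial>lborel)" for n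
   proof -
    have "(cutb R n x)^2 * (norm (grad (U (\<epsilon> n) s) x))^2 = (\<Sum>i\<in>Basis. (cutb R n x)^2 * (conv (\<lambda>y. wgrad (\<rho> s) y \<bullet> i) (mol (\<epsilon> n)) x)^2)" for x
     unfolding norm_sq_sum sum_distrib_left by (intro sum.cong refl) (simp add: c)
    then show ?thesis unfolding E_def using i by (simp add: Bochner_Integration.integral_sum)
   qed
   moreover have "D s = (\<Sum>i\<in>Basis. \<integral>x. (bcut a R x)^2 * (wgrad (\<rho> s) x \<bullet> i)^2 \<partial>lborel)"
    unfolding D_def norm_sq_sum sum_distrib_left using i' by (rule Bochner_Integration.integral_sum)
   moreover have "(\<lambda>n. \<Sum>i\<in>Basis. \<integral>x. (cutb R n x)^2 * (conv (\<lambda>y. wgrad (\<rho> s) y \<bullet> i) (mol (\<epsilon> n)) x)^2 \<partial>lborel)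
    \<longlonglongrightarrow> (\<Sum>i\<in>Basis. \<integral>x. (bcut a R x)^2 * (wgrad (\<rho> s) x \<bullet> i)^2 \<partial>lborel)"
    by (intro tendsto_sum weighted_limit[OF wc conv_mol_in_L2[OF wc \<epsilon>(1)] conv_mol_L2_limit[OF wc \<epsilon>(1) \<epsilon>0] cm(1) cb cutb_limit])
   ultimately show ?thesis by simp
  qed
  have "(\<integral>\<^sup>+s. ennreal (?D s) \<partial>lborel) = (\<integral>\<^sup>+s. liminf (\<lambda>n. ennreal (?E n s)) \<partial>lborel)"
  proof (rule nn_integral_cong_AE)
   show "AE s in lborel. ennreal (?D s) = liminf (\<lambda>n. ennreal (?E n s))"
    using H1[OF \<nu>0]
   proof eventually_elim
    fix s assume h: "s \<in> {0..T} --> in_H1 (\<rho> s)"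
    have "(\<lambda>n. ?E n s) \<longlonglongrightarrow> ?D s" using pt[of s] h st by (cases "s \<in> {0..t}") auto
    then have "(\<lambda>n. ennreal (?E n s)) \<longlonglongrightarrow> ennreal (?D s)" by (rule tendsto_ennrealI)
    from lim_imp_Liminf[OF _ this] show "ennreal (?D s) = liminf (\<lambda>n. ennreal (?E n s))" by simp
   qed
  qed
  also have "... <= liminf (\<lambda>n. \<integral>\<^sup>+s. ennreal (?E n s) \<partial>lborel)"
   by (rule nn_integral_liminf) (use Em in measurable)
  also have "... <= liminf (\<lambda>n. ennreal (l n))"
   unfolding nE using El by (intro Liminf_mono always_eventually allI ennreal_leI)
  also have "... = ennreal l'" using lim_imp_Liminf[OF _ tendsto_ennrealI[OF llim]] by simp
  finally have fin: "(\<integral>\<^sup>+s. ennreal (?D s) \<partial>lborel) <= ennreal l'" .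
  \<comment> \<open>\<open>D\<close> is only known to agree almost everywhere with a Borel function, hence the case distinction.\<close>
  have "(LBINT s. ?D s) <= l'"
  proof (cases "?D \<in> borel_measurable lborel")
   case True
   show ?thesis by (rule integral_le_nn_integral(2)[OF True _ l0 fin]) (simp add: D_def)
  next
   case False
   then have "\<not> intble ?D" using borel_measurable_integrable by blast
   then show ?thesis using l0 by (simp add: not_integrable_integral_eq)
  qed
  then show ?thesis using \<nu>0 by (simp add: l'_def set_lebesgue_integral_def pos_le_divide_eq mult.commute)
 qed
 then show ?thesis unfolding outer_energy_eq D_def q_def[symmetric] Y_def[symmetric] W_def[symmetric] by simp
qed

lemma outer_growth:
 assumes R: "R > 0" and Ca: "!!x. norm (grad a x) <= Ca" and t: "t \<in> {0..T}"
  and w: "!!s. s \<in> {0..t} ==> (LBINT x. indicator (annulus R) x * (\<rho> s x)^2) <= w"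
 shows "outer_energy a \<nu> R \<rho> t <= ((LBINT x. (bcut a R x)^2 * (\<rho> 0 x)^2) + 8 * Ca^2 * (\<nu> + 1) / R^2 * (w * t))
  * exp (growth_rate TYPE('a) k \<kappa> M * t)"
proof -
 define Y where "Y s = (LBINT x. (bcut a R x)^2 * (\<rho> s x)^2)" for s
 define W where "W s = (LBINT x. indicator (annulus R) x * (\<rho> s x)^2)" for s
 define B where "B = 8 * Ca^2 * (\<nu> + 1) / R^2"
 have st: "{0..t} \<subseteq> {0..T}" using t by auto
 have A0: "0 <= Ac" unfolding Ac_eq by (rule growth_rate_mono(1)[OF M0 order_refl])
 have B0: "0 <= B" using \<nu> by (simp add: B_def)
 have Yc: "continuous_on {0..T} Y" unfolding Y_def[abs_def] by (rule weighted_square_continuous[OF _ bcut_sq_le]) (use bcut_borel[OF R] in measurable)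
 have Wc: "continuous_on {0..T} W" unfolding W_def[abs_def] by (rule weighted_square_continuous[of _ 1]) (auto simp: indicator_def)
 have oi: "outer_energy a \<nu> R \<rho> s <= Y 0 + integral {0..s} (\<lambda>s. Ac * Y s + B * W s)" if "s \<in> {0..T}" for s
  using outer_inequality[OF R Ca that] unfolding Y_def W_def B_def .
 have "Y s <= outer_energy a \<nu> R \<rho> s" for s
 proof -
  have "0 <= (LBINT s:{0..s}. \<integral>x. (bcut a R x)^2 * (norm (wgrad (\<rho> s) x))^2 \<partial>lborel)"
   unfolding set_lebesgue_integral_def by (intro Bochner_Integration.integral_nonneg) simp
  then show ?thesis using \<nu> unfolding outer_energy_eq Y_def by simp
 qed
 from order_trans[OF this oi] have Yle: "Y s <= Y 0 + integral {0..s} (\<lambda>s. Ac * Y s + B * W s)" if "s \<in> {0..T}" for s using that .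
 have le: "outer_energy a \<nu> R \<rho> t <= (Y 0 + B * integral {0..t} W) * exp (Ac * t)"
  by (rule order_trans[OF oi[OF t] gronwall[OF Yc Wc _ A0 B0 Yle t]]) (simp add: W_def)
 have "integral {0..t} W <= integral {0..t} (\<lambda>s. w)"
  using w by (intro integral_le integrable_continuous_real continuous_on_subset[OF Wc st] continuous_on_const) (simp add: W_def)
 then have "integral {0..t} W <= w * t" using t by (simp add: mult.commute)
 then have "(Y 0 + B * integral {0..t} W) * exp (Ac * t) <= (Y 0 + B * (w * t)) * exp (Ac * t)"
  by (intro mult_right_mono add_left_mono mult_left_mono B0) auto
 from order_trans[OF le this] show ?thesis unfolding Y_def B_def Ac_eq .
qed

end

subsection \<open>Decay of weak solutions\<close>

lemma in_C_L2_subset: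
 assumes "in_C_L2 T \<rho>" "t <= T"
 shows "in_C_L2 t \<rho>"
proof -
 have "{0..t} \<subseteq> {0..T}" using assms by auto
 then show ?thesis using assms(1) unfolding in_C_L2_def by (blast intro: tendsto_within_subset)
qed

context cutoff
begin

context
 fixes \<sigma>\<^sub>1 \<sigma>\<^sub>2 \<nu> T c :: real and \<rho>\<^sub>0 :: "'a => real" and \<rho> and K :: "real => real"
 assumes dim: "DIM('a) \<ge> 2" and sol: "weak_solution \<sigma>\<^sub>1 \<sigma>\<^sub>2 \<nu> T \<rho>\<^sub>0 \<rho>" and ctrl: "controlled K T \<rho>" and K: "time_const K"
  and \<nu>: "0 <= \<nu>" and T: "0 < T"
  and c: "!!\<sigma> (f :: 'a => real) x. f \<in> borel_measurable borel ==> velocity \<sigma> f x = (\<sigma> * c) *\<^sub>R vel f x"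
begin

text \<open>This is where \<open>K T\<close> is replaced by \<open>K t\<close>. A positive
  \<open>t\<close> is required, as the bound holds only almost everywhere and reaches single times
  through the density of good ones.\<close>

lemma solution_bound:
 assumes t: "0 < t" "t <= T" and s: "s \<in> {0..t}"
 shows "L1_Linf_le (\<rho> s) (K t)"
proof (rule bound_all_times[OF in_C_L2_subset[OF _ t(2)] t(1) _ s])
 show "in_C_L2 T \<rho>" using sol by (simp add: weak_solution_def)
 have "AE s in lborel. s \<in> {0..T} --> L1_Linf_le (\<rho> s) (K s)" using ctrl by (simp add: controlled_def)
 then show "AE s in lborel. s \<in> {0..t} --> L1_Linf_le (\<rho> s) (K t)"
 proof eventually_elim
  fix s assume h: "s \<in> {0..T} --> L1_Linf_le (\<rho> s) (K s)"
  show "s \<in> {0..t} --> L1_Linf_le (\<rho> s) (K t)"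
  proof
   assume s: "s \<in> {0..t}"
   then have le: "K s <= K t" using K by (intro mono_onD[of "{0..}" K]) (auto simp: time_const_def)
   have "s \<in> {0..T}" using s t by auto
   from L1_Linf_mono[OF h[rule_format, OF this] le] show "L1_Linf_le (\<rho> s) (K t)" .
  qed
 qed
qed

lemma weak_solution_flow:
 assumes t: "0 < t" "t <= T"
 shows "flow a \<rho> t (K t) (\<sigma>\<^sub>1 * c) (\<sigma>\<^sub>1 + \<sigma>\<^sub>2) \<nu>"
proof -
 have cont: "in_C_L2 T \<rho>" and H1: "\<nu> > 0 ==> AE t in lborel. t \<in> {0..T} --> in_H1 (\<rho> t)"
  using sol by (auto simp: weak_solution_def in_L2_H1_def)
 \<comment> \<open>Two intervals are needed: the weak formulation is posed up to \<open>T\<close>,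
   so the time test function is removed there, while the estimates are to be run up to
   \<open>t\<close> with the smaller bound \<open>K t\<close>.\<close>
 interpret E: evolution a \<rho> T "K T" "\<sigma>\<^sub>1 * c" "\<sigma>\<^sub>1 + \<sigma>\<^sub>2" \<nu>
  by unfold_locales (rule dim T \<nu> cont solution_bound[OF T order_refl] | assumption)+
 interpret F: evolution a \<rho> t "K t" "\<sigma>\<^sub>1 * c" "\<sigma>\<^sub>1 + \<sigma>\<^sub>2" \<nu>
  by unfold_locales (rule dim t \<nu> in_C_L2_subset[OF cont t(2)] solution_bound[OF t] | assumption)+
 have vel: "velocity \<sigma>\<^sub>1 (\<rho> s) x = (\<sigma>\<^sub>1 * c) *\<^sub>R vel (\<rho> s) x" if "s \<in> {0..T}" for s x
  using E.L2_at[OF that] by (intro c) (simp add: in_L2_real)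
 have W: "(LBINT t:{0..T}. (LBINT x. \<rho> t x * deriv (\<lambda>s. \<phi> (s, x)) t + \<rho> t x * (velocity \<sigma>\<^sub>1 (\<rho> t) x \<bullet> grad (\<lambda>y. \<phi> (t, y)) x)
   + (\<sigma>\<^sub>1 + \<sigma>\<^sub>2) * (\<rho> t x)^2 * \<phi> (t, x) - \<nu> * (wgrad (\<rho> t) x \<bullet> grad (\<lambda>y. \<phi> (t, y)) x)))
   = - (LBINT x. \<rho>\<^sub>0 x * \<phi> (0, x))" if "test_fun ({..<T} \<times> UNIV) \<phi>" for \<phi>
  using sol that unfolding weak_solution_def by blast
 have eq: "(LBINT x. \<rho> s x * \<psi> x) = (LBINT x. \<rho>\<^sub>0 x * \<psi> x) + integral {0..s} (E.G \<psi>)"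
  if \<psi>: "test_fun UNIV \<psi>" and s: "s \<in> {0..T}" for \<psi> s
  by (rule integrated_equation[OF T pairing_continuous[OF cont tf_in_L2[OF \<psi>]] E.G_continuous[OF \<psi>] _ s])
   (rule E.weak_form_time[OF \<psi> _ vel H1 W])
 show ?thesis
 proof
  show "(LBINT x. \<rho> s x * \<psi> x) = (LBINT x. \<rho> 0 x * \<psi> x) + integral {0..s} (F.G \<psi>)"
   if \<psi>: "test_fun UNIV \<psi>" and s: "s \<in> {0..t}" for \<psi> s
   \<comment> \<open>At time 0 the integrated equation identifies the pairings of
     \<open>\<rho> 0\<close> and \<open>\<rho>\<^sub>0\<close>, which replaces one by the
     other.\<close>
   using eq[OF \<psi>, of s] eq[OF \<psi>, of 0] s t T by simp
  show "AE s in lborel. s \<in> {0..t} --> in_H1 (\<rho> s)" if "\<nu> > 0"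
   using H1[OF that] by eventually_elim (use t in auto)
 qed
qed

text \<open>The same path in L^2 tends to \<open>\<rho>\<^sub>0\<close> by the initial condition and
  to \<open>\<rho> 0\<close> by continuity at 0, so the two limits agree almost everywhere.\<close>

lemma initial_density: "AE x in lborel. \<rho> 0 x = \<rho>\<^sub>0 x"
proof -
 have cont: "in_C_L2 T \<rho>" and l0: "((\<lambda>t. L2_norm (\<lambda>x. \<rho> t x - \<rho>\<^sub>0 x)) \<longlongrightarrow> 0) (at_right 0)"
  using sol by (auto simp: weak_solution_def)
 have r0: "in_L2 \<rho>\<^sub>0" using sol L1_Linf_L2(1) by (auto simp: weak_solution_def)
 have r: "in_L2 (\<rho> t)" if "t \<in> {0..T}" for t using cont that by (simp add: in_C_L2_def)
 have "((\<lambda>t. L2_norm (\<lambda>x. \<rho> t x - \<rho> 0 x)) \<longlongrightarrow> 0) (at 0 within {0..T})" using cont T by (auto simp: in_C_L2_def)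
 then have l1: "((\<lambda>t. L2_norm (\<lambda>x. \<rho> t x - \<rho> 0 x)) \<longlongrightarrow> 0) (at_right 0)" using T by (simp add: at_within_Icc_at_right)
 define d where "d x = \<rho> 0 x - \<rho>\<^sub>0 x" for x
 have d2: "in_L2 d" unfolding d_def[abs_def] using r0 r T by (intro in_L2_diff) auto
 have "((\<lambda>t. 2 * (L2_norm (\<lambda>x. \<rho> t x - \<rho>\<^sub>0 x))^2 + 2 * (L2_norm (\<lambda>x. \<rho> t x - \<rho> 0 x))^2) \<longlongrightarrow> 2 * 0^2 + 2 * 0^2) (at_right 0)"
  by (intro tendsto_intros l0 l1)
 moreover have "\<forall>\<^sub>F t in at_right 0. (LBINT x. (d x)^2) <= 2 * (L2_norm (\<lambda>x. \<rho> t x - \<rho>\<^sub>0 x))^2 + 2 * (L2_norm (\<lambda>x. \<rho> t x - \<rho> 0 x))^2"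
  using eventually_at_right_real[OF T]
 proof eventually_elim
  fix t assume t: "t \<in> {0<..<T}"
  have i: "intble (\<lambda>x. (\<rho> t x - \<rho>\<^sub>0 x)^2)" "intble (\<lambda>x. (\<rho> t x - \<rho> 0 x)^2)" "intble (\<lambda>x. (d x)^2)"
   using in_L2_diff[OF r r0, of t] in_L2_diff[OF r r, of t 0] d2 t T by (auto simp: in_L2_real)
  have "(LBINT x. (d x)^2) <= (LBINT x. 2 * (\<rho> t x - \<rho>\<^sub>0 x)^2 + 2 * (\<rho> t x - \<rho> 0 x)^2)"
  proof (rule integral_mono)
   show "(d x)^2 <= 2 * (\<rho> t x - \<rho>\<^sub>0 x)^2 + 2 * (\<rho> t x - \<rho> 0 x)^2" for x
    using sq_add_le[of "\<rho> t x - \<rho>\<^sub>0 x" "- (\<rho> t x - \<rho> 0 x)"] by (simp add: d_def power2_commute)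
  qed (use i in auto)
  then show "(LBINT x. (d x)^2) <= 2 * (L2_norm (\<lambda>x. \<rho> t x - \<rho>\<^sub>0 x))^2 + 2 * (L2_norm (\<lambda>x. \<rho> t x - \<rho> 0 x))^2"
   using i by (simp add: L2_norm_sq)
 qed
 ultimately have "(LBINT x. (d x)^2) <= 2 * 0^2 + 2 * 0^2" by (rule tendsto_lowerbound) simp
 then have "(LBINT x. (d x)^2) = 0" by (intro antisym Bochner_Integration.integral_nonneg) auto
 then have "AE x in lborel. (d x)^2 = 0" using d2 by (subst (asm) integral_nonneg_eq_0_iff_AE) (auto simp: in_L2_real)
 then show ?thesis by eventually_elim (simp add: d_def)
qed

lemma solution_growth:
 assumes R: "R > 0" and Ca: "!!x. norm (grad a x) <= Ca" and t: "t \<in> {0..T}"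
  and w: "!!s. s \<in> {0..t} ==> (LBINT x. indicator (annulus R) x * (\<rho> s x)^2) <= w"
 shows "outer_energy a \<nu> R \<rho> t <= ((L2_norm (\<lambda>x. bcut a R x * \<rho>\<^sub>0 x))^2 + 8 * Ca^2 * (\<nu> + 1) / R^2 * (w * t))
  * exp (growth_rate TYPE('a) (\<sigma>\<^sub>1 * c) (\<sigma>\<^sub>1 + \<sigma>\<^sub>2) (K t) * t)"
proof -
 have [measurable]: "\<rho> 0 \<in> borel_measurable borel" "\<rho>\<^sub>0 \<in> borel_measurable borel"
  using L1_Linf_L2(1)[OF solution_bound[OF T order_refl, of 0]] sol T L1_Linf_L2(1)[of \<rho>\<^sub>0] by (auto simp: weak_solution_def in_L2_real)
 have [measurable]: "bcut a R \<in> borel_measurable borel" by (rule smooth_borel[OF bcut_smooth[OF R]])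
 have "(LBINT x. (bcut a R x)^2 * (\<rho> 0 x)^2) = (LBINT x. (bcut a R x)^2 * (\<rho>\<^sub>0 x)^2)"
  using initial_density by (intro integral_cong_AE) auto
 then have e: "(L2_norm (\<lambda>x. bcut a R x * \<rho>\<^sub>0 x))^2 = (LBINT x. (bcut a R x)^2 * (\<rho> 0 x)^2)"
  by (simp add: L2_norm_sq power_mult_distrib)
 show ?thesis
 \<comment> \<open>The locale \<open>flow\<close> demands an interval of positive length. At time 0
   the dissipation integral runs over a single point.\<close>
 proof (cases "t = 0")
  case True
  have "AE s in lborel. indicator {0..0::real} s *\<^sub>R (L2_norm (\<lambda>x. bcut a R x *\<^sub>R wgrad (\<rho> s) x))^2 = 0"
   using AE_lborel_singleton[of "0::real"] by eventually_elim (simp add: indicator_def)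
  then have "(LBINT s:{0..0}. (L2_norm (\<lambda>x. bcut a R x *\<^sub>R wgrad (\<rho> s) x))^2) = 0"
   unfolding set_lebesgue_integral_def by (rule integral_eq_zero_AE)
  then show ?thesis unfolding e using True by (simp add: outer_energy_def L2_norm_sq power_mult_distrib)
 next
  case False
  then have t': "0 < t" "t <= T" using t by auto
  interpret flow a \<rho> t "K t" "\<sigma>\<^sub>1 * c" "\<sigma>\<^sub>1 + \<sigma>\<^sub>2" \<nu> by (rule weak_solution_flow[OF t'])
  show ?thesis unfolding e by (rule outer_growth[OF R Ca _ w]) (use t' in auto)
 qed
qed

lemma growth_exp_le:
 assumes "0 <= s" "s <= t" "t <= T"
 shows "exp (growth_rate TYPE('a) (\<sigma>\<^sub>1 * c) (\<sigma>\<^sub>1 + \<sigma>\<^sub>2) (K s) * s) <= exp (growth_rate TYPE('a) (\<sigma>\<^sub>1 * c) (\<sigma>\<^sub>1 + \<sigma>\<^sub>2) (K t) * t)"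
proof -
 have "K s <= K t" using K assms by (intro mono_onD[of "{0..}" K]) (auto simp: time_const_def)
 moreover have "0 <= K s" using K assms by (auto simp: time_const_def less_imp_le)
 ultimately show ?thesis using assms growth_rate_mono[where 'a = 'a, of "K s" "K t"] growth_rate_mono(1)[where 'a = 'a, of "K t" "K t"]
  by (simp add: mult_mono)
qed

lemma annulus_bound:
 assumes R: "R > 0" and s: "s \<in> {0..T}"
 shows "(LBINT x. indicator (annulus R) x * (\<rho> s x)^2) <= (LBINT x. (bcut a (R / 2) x)^2 * (\<rho> s x)^2)"
  "(LBINT x. (bcut a R x)^2 * (\<rho> s x)^2) <= outer_energy a \<nu> R \<rho> s"
  "(LBINT x. (bcut a R x)^2 * (\<rho> s x)^2) <= (K T)^2"
proof -
 have L: "in_L2 (\<rho> s)" "(LBINT x. (\<rho> s x)^2) <= (K T)^2" using L1_Linf_L2[OF solution_bound[OF T order_refl s]] .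
 have r: "intble (\<lambda>x. (\<rho> s x)^2)" using L by (simp add: in_L2_real)
 have b: "\<bar>(bcut a R x)^2\<bar> <= 1" for R x using bcut_bounds[of R x] by (simp add: power_le_one)
 have i: "intble (\<lambda>x. (bcut a R x)^2 * (\<rho> s x)^2)" if "R > 0" for R
  by (rule integrable_bounded_mult[OF r _ b]) (use smooth_borel[OF bcut_smooth[OF that]] in measurable)
 show "(LBINT x. indicator (annulus R) x * (\<rho> s x)^2) <= (LBINT x. (bcut a (R / 2) x)^2 * (\<rho> s x)^2)"
 proof (rule integral_mono)
  show "intble (\<lambda>x. indicator (annulus R) x * (\<rho> s x)^2)"
   by (rule integrable_bounded_mult[OF r, of _ 1]) (auto simp: indicator_def)
  fix x :: 'a
  show "indicator (annulus R) x * (\<rho> s x)^2 <= (bcut a (R / 2) x)^2 * (\<rho> s x)^2"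
  proof (cases "x \<in> annulus R")
   case True
   then have "norm (x /\<^sub>R (R / 2)) \<ge> 2" using R by (simp add: annulus_def field_simps)
   then have "bcut a (R / 2) x = 1" unfolding bcut_def by (simp only: a_zero diff_zero)
   then show ?thesis using True by simp
  qed simp
 qed (use i R in simp)
 show "(LBINT x. (bcut a R x)^2 * (\<rho> s x)^2) <= outer_energy a \<nu> R \<rho> s"
 proof -
  have "0 <= (LBINT s:{0..s}. (L2_norm (\<lambda>x. bcut a R x *\<^sub>R wgrad (\<rho> s) x))^2)"
   unfolding set_lebesgue_integral_def by (intro Bochner_Integration.integral_nonneg) simp
  then show ?thesis using \<nu> by (simp add: outer_energy_def L2_norm_sq power_mult_distrib)
 qed
 have "(LBINT x. (bcut a R x)^2 * (\<rho> s x)^2) <= (LBINT x. (\<rho> s x)^2)"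
  using b by (intro integral_mono i r R) (simp add: mult_left_le_one_le)
 with L(2) show "(LBINT x. (bcut a R x)^2 * (\<rho> s x)^2) <= (K T)^2" by linarith
qed

text \<open>The constant \<open>Q\<close> may depend on the solution: in the theorem it is absorbed by a factor \<open>R^-2\<close>.\<close>

lemma algebraic_decay:
 assumes Ca: "!!x. norm (grad a x) <= Ca"
  and init: "\<forall>\<^sub>F R in at_top. (L2_norm (\<lambda>x. bcut a R x * \<rho>\<^sub>0 x))^2 <= C / R ^ N" and m: "m <= N"
 shows "\<exists>Q\<ge>0. \<forall>\<^sub>F R in at_top. \<forall>s\<in>{0..T}. (LBINT x. (bcut a R x)^2 * (\<rho> s x)^2) <= Q / R ^ m"
 using m
proof (induction m)
 case 0
 show ?case
 proof (intro exI[of _ "(K T)^2"] conjI)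
  show "\<forall>\<^sub>F R in at_top. \<forall>s\<in>{0..T}. (LBINT x. (bcut a R x)^2 * (\<rho> s x)^2) <= (K T)^2 / R ^ 0"
   using eventually_gt_at_top[of 0] by eventually_elim (use annulus_bound(3) in auto)
 qed simp
next
 case (Suc m)
 then obtain Q where Q: "Q \<ge> 0" and ev: "\<forall>\<^sub>F R in at_top. \<forall>s\<in>{0..T}. (LBINT x. (bcut a R x)^2 * (\<rho> s x)^2) <= Q / R ^ m" by auto
 define B where "B = 8 * Ca^2 * (\<nu> + 1)"
 define X where "X = exp (growth_rate TYPE('a) (\<sigma>\<^sub>1 * c) (\<sigma>\<^sub>1 + \<sigma>\<^sub>2) (K T) * T)"
 define P where "P = (\<bar>C\<bar> + B * (Q * 2 ^ m * T)) * X"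
 have B0: "0 <= B" using \<nu> by (simp add: B_def)
 have P0: "0 <= P" unfolding P_def X_def using B0 Q T by (intro mult_nonneg_nonneg add_nonneg_nonneg) auto
 have "\<forall>\<^sub>F R in at_top. \<forall>s\<in>{0..T}. (LBINT x. (bcut a (R / 2) x)^2 * (\<rho> s x)^2) <= Q / (R / 2) ^ m"
  using eventually_compose_filterlim[OF ev, of "\<lambda>R. R / 2" at_top]
   filterlim_tendsto_pos_mult_at_top[OF tendsto_const[of "1 / 2 :: real"] _ filterlim_ident] by simp
 with init eventually_ge_at_top[of 1]
 have "\<forall>\<^sub>F R in at_top. \<forall>s\<in>{0..T}. (LBINT x. (bcut a R x)^2 * (\<rho> s x)^2) <= P / R ^ Suc m"
 proof eventually_elim
  fix R :: real
  assume i: "(L2_norm (\<lambda>x. bcut a R x * \<rho>\<^sub>0 x))^2 <= C / R ^ N" and R1: "1 <= R"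
   and h: "\<forall>s\<in>{0..T}. (LBINT x. (bcut a (R / 2) x)^2 * (\<rho> s x)^2) <= Q / (R / 2) ^ m"
  have R: "R > 0" using R1 by simp
  define w where "w = Q * 2 ^ m / R ^ m"
  have w: "(LBINT x. indicator (annulus R) x * (\<rho> s x)^2) <= w" if "s \<in> {0..T}" for s
   using order_trans[OF annulus_bound(1)[OF R that]] h that by (auto simp: w_def power_divide)
  have w0: "0 <= w" using Q R by (simp add: w_def)
  show "\<forall>s\<in>{0..T}. (LBINT x. (bcut a R x)^2 * (\<rho> s x)^2) <= P / R ^ Suc m"
  proof
   fix s assume s: "s \<in> {0..T}"
   have "(LBINT x. (bcut a R x)^2 * (\<rho> s x)^2) <= ((L2_norm (\<lambda>x. bcut a R x * \<rho>\<^sub>0 x))^2 + 8 * Ca^2 * (\<nu> + 1) / R^2 * (w * s))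
     * exp (growth_rate TYPE('a) (\<sigma>\<^sub>1 * c) (\<sigma>\<^sub>1 + \<sigma>\<^sub>2) (K s) * s)"
    by (rule order_trans[OF annulus_bound(2)[OF R s] solution_growth[OF R Ca s w]]) (use s in auto)
   also have "... <= (\<bar>C\<bar> / R ^ Suc m + B * (Q * 2 ^ m * T) / R ^ Suc m) * X"
   proof (intro mult_mono add_mono)
    have "C / R ^ N <= \<bar>C\<bar> / R ^ Suc m"
     using R1 Suc.prems by (intro frac_le power_increasing) auto
    with i show "(L2_norm (\<lambda>x. bcut a R x * \<rho>\<^sub>0 x))^2 <= \<bar>C\<bar> / R ^ Suc m" by linarith
    \<comment> \<open>The estimate gains two powers of R. Only one is kept, so that the induction
      passes through every exponent up to \<open>N\<close>.\<close>
    have "8 * Ca^2 * (\<nu> + 1) / R^2 * (w * s) = B * (Q * 2 ^ m * s) / R ^ (m + 2)"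
     by (simp add: B_def w_def power2_eq_square)
    also have "... <= B * (Q * 2 ^ m * T) / R ^ Suc m"
     using B0 Q s R1 T by (intro frac_le power_increasing mult_left_mono) auto
    finally show "8 * Ca^2 * (\<nu> + 1) / R^2 * (w * s) <= B * (Q * 2 ^ m * T) / R ^ Suc m" .
    show "exp (growth_rate TYPE('a) (\<sigma>\<^sub>1 * c) (\<sigma>\<^sub>1 + \<sigma>\<^sub>2) (K s) * s) <= X"
     unfolding X_def by (rule growth_exp_le) (use s in auto)
    show "0 <= \<bar>C\<bar> / R ^ Suc m + B * (Q * 2 ^ m * T) / R ^ Suc m"
     using B0 Q R T by (intro add_nonneg_nonneg divide_nonneg_nonneg mult_nonneg_nonneg) auto
   qed simp
   also have "... = P / R ^ Suc m" by (simp add: P_def add_divide_distrib distrib_right)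
   finally show "(LBINT x. (bcut a R x)^2 * (\<rho> s x)^2) <= P / R ^ Suc m" .
  qed
 qed
 with P0 show ?case by blast
qed

end

end

text \<open>At time 0 the outer energy equals its initial value, so the second estimate retains that
  value beside the term with the factor \<open>t\<close>. The constants are chosen before the
  viscosity, the time span and the solution; the threshold for R is chosen after them.\<close>

theorem proposition3p1:
  fixes a \<rho>\<^sub>0 :: "'a::euclidean_space \<Rightarrow> real"
    and \<sigma>\<^sub>1 \<sigma>\<^sub>2 :: real
    and K :: "real \<Rightarrow> real"
  assumes "DIM('a) \<ge> 2"
    and "radial_cutoff a"
    and "\<sigma>\<^sub>1 \<noteq> 0"
    and "time_const K"
  shows "(\<exists>C\<^sub>0. time_const C\<^sub>0 \<and>
            (\<forall>\<nu>\<ge>0. \<forall>T>0. \<forall>\<rho>. weak_solution \<sigma>\<^sub>1 \<sigma>\<^sub>2 \<nu> T \<rho>\<^sub>0 \<rho> \<longrightarrow> controlled K T \<rho> \<longrightarrow>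
               (\<forall>R>0. \<forall>t\<in>{0..T}.
                  outer_energy a \<nu> R \<rho> t
                    \<le> ((L2_norm (\<lambda>x. bcut a R x * \<rho>\<^sub>0 x))\<^sup>2 + C\<^sub>0 t * t * (\<nu> + 1) / R ^ 2)
                        * exp (C\<^sub>0 t * t))))
       \<and> (\<forall>N::nat. \<forall>C::real. N \<ge> 2 \<longrightarrow>
            (\<forall>\<^sub>F R in at_top. (L2_norm (\<lambda>x. bcut a R x * \<rho>\<^sub>0 x))\<^sup>2 \<le> C / R ^ N) \<longrightarrow>
            (\<exists>C\<^sub>0. time_const C\<^sub>0 \<and>
              (\<forall>\<nu>\<ge>0. \<forall>T>0. \<forall>\<rho>. weak_solution \<sigma>\<^sub>1 \<sigma>\<^sub>2 \<nu> T \<rho>\<^sub>0 \<rho> \<longrightarrow> controlled K T \<rho> \<longrightarrow>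
                 (\<forall>\<^sub>F R in at_top. \<forall>t\<in>{0..T}.
                    outer_energy a \<nu> R \<rho> t
                      \<le> ((L2_norm (\<lambda>x. bcut a R x * \<rho>\<^sub>0 x))\<^sup>2
                           + C\<^sub>0 t * t * (\<nu> + 1)\<^sup>2 / R ^ N)
                          * exp (C\<^sub>0 t * t)))))"
proof -
 interpret cutoff a by unfold_locales fact
 note K = \<open>time_const K\<close> and dim = \<open>DIM('a) \<ge> 2\<close>
 obtain c where c: "!!\<sigma> (f :: 'a => real) x. f \<in> borel_measurable borel ==> velocity \<sigma> f x = (\<sigma> * c) *\<^sub>R vel f x"
  using velocity_eq_vel[OF dim] by blast
 obtain Ca where Ca: "!!x. norm (grad a x) <= Ca" using tf_grad_bounded[OF a_tf] by blast
 let ?g = "\<lambda>t. growth_rate TYPE('a) (\<sigma>\<^sub>1 * c) (\<sigma>\<^sub>1 + \<sigma>\<^sub>2) (K t)"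
 let ?Y = "\<lambda>R. (L2_norm (\<lambda>x. bcut a R x * \<rho>\<^sub>0 x))^2"
 \<comment> \<open>One function serves both claims: the growth rate for the exponent, and the
   coefficient of the forcing with \<open>(K t)^2\<close> as the bound of the mass on the annulus.
   The summand 1 gives positivity, and it suffices alone in the second claim, where large R brings
   the forcing coefficient below 1.\<close>
 define C0 where "C0 t = ?g t + 8 * Ca^2 * (K t)^2 + 1" for t
 have K0: "0 <= K t" if "0 <= t" for t using K that by (auto simp: time_const_def less_imp_le)
 have Kc: "continuous_on {0..} K" and Km: "K s <= K t" if "0 <= s" "s <= t" for s t
  using K that by (auto simp: time_const_def intro: mono_onD[of "{0..}" K])
 have g0: "0 <= ?g t" if "0 <= t" for t using growth_rate_mono(1)[OF K0[OF that] order_refl] .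
 have C0: "time_const C0"
  unfolding time_const_def
 proof (intro conjI allI impI)
  show "C0 t > 0" if "0 <= t" for t unfolding C0_def using g0[OF that] by (intro add_nonneg_pos add_nonneg_nonneg) auto
  show "continuous_on {0..} C0" unfolding C0_def[abs_def] growth_rate_def by (intro continuous_intros Kc) auto
  show "mono_on {0..} C0"
  proof (rule mono_onI)
   fix s t :: real assume s: "s \<in> {0..}" "t \<in> {0..}" "s <= t"
   then have "K s <= K t" "0 <= K s" using Km K0 by auto
   then show "C0 s <= C0 t" unfolding C0_def
    by (intro add_mono growth_rate_mono mult_left_mono power_mono) auto
  qed
 qed
 have C0_ge: "1 <= C0 t" "?g t <= C0 t" "8 * Ca^2 * (K t)^2 <= C0 t" if "0 <= t" for t
  using g0[OF that] by (auto simp: C0_def)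
 have est: "outer_energy a \<nu> R \<rho> t <= (?Y R + B) * exp (C0 t * t)"
  if sol: "weak_solution \<sigma>\<^sub>1 \<sigma>\<^sub>2 \<nu> T \<rho>\<^sub>0 \<rho>" "controlled K T \<rho>" "0 <= \<nu>" "0 < T" and R: "R > 0" and t: "t \<in> {0..T}"
   and w: "!!s. s \<in> {0..t} ==> (LBINT x. indicator (annulus R) x * (\<rho> s x)^2) <= w"
   and B: "8 * Ca^2 * (\<nu> + 1) / R^2 * (w * t) <= B" "0 <= B" for \<nu> T \<rho> R t w B
 proof -
  have "outer_energy a \<nu> R \<rho> t <= (?Y R + 8 * Ca^2 * (\<nu> + 1) / R^2 * (w * t)) * exp (?g t * t)"
   by (rule solution_growth[OF dim sol(1,2) K sol(3,4) c R Ca t w])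
  also have "... <= (?Y R + B) * exp (?g t * t)" using B by (intro mult_right_mono add_left_mono) auto
  also have "... <= (?Y R + B) * exp (C0 t * t)"
   using t B(2) C0_ge(2)[of t] by (intro mult_left_mono add_nonneg_nonneg) (auto simp: mult_right_mono)
  finally show ?thesis .
 qed
 show ?thesis
 proof (intro conjI exI[of _ C0] allI impI C0 ballI)
  fix \<nu> T :: real and \<rho> and R t :: real
  assume sol: "0 <= \<nu>" "0 < T" "weak_solution \<sigma>\<^sub>1 \<sigma>\<^sub>2 \<nu> T \<rho>\<^sub>0 \<rho>" "controlled K T \<rho>" and R: "0 < R" and t: "t \<in> {0..T}"
  show "outer_energy a \<nu> R \<rho> t <= (?Y R + C0 t * t * (\<nu> + 1) / R ^ 2) * exp (C0 t * t)"
  \<comment> \<open>At time 0 the forcing carries the factor \<open>t\<close>, so any bound of the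
    annulus integral will do, and the one from \<open>K\<close>, available for positive times only,
    is avoided.\<close>
  proof (cases "t = 0")
   case True
   show ?thesis
    by (rule est[OF sol(3,4,1,2) R t, of "(LBINT x. indicator (annulus R) x * (\<rho> 0 x)^2)"]) (use True in auto)
  next
   case False
   then have t0: "0 < t" "t <= T" using t by auto
   show ?thesis
   proof (rule est[OF sol(3,4,1,2) R t, of "(K t)^2"])
    fix s assume s: "s \<in> {0..t}"
    note L = L1_Linf_L2[OF solution_bound[OF dim sol(3,4) K sol(1,2) c t0 s]]
    have "(LBINT x. indicator (annulus R) x * (\<rho> s x)^2) <= (LBINT x. (\<rho> s x)^2)"
     using L(1) by (intro integral_mono integrable_bounded_mult[of _ _ 1]) (auto simp: in_L2_real indicator_def)
    with L(2) show "(LBINT x. indicator (annulus R) x * (\<rho> s x)^2) <= (K t)^2" by linarith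
   next
    have "8 * Ca^2 * (\<nu> + 1) / R^2 * ((K t)^2 * t) = (8 * Ca^2 * (K t)^2) * t * (\<nu> + 1) / R ^ 2" by simp
    also have "... <= C0 t * t * (\<nu> + 1) / R ^ 2"
     using C0_ge(3)[of t] t0 sol(1) by (intro divide_right_mono mult_right_mono) auto
    finally show "8 * Ca^2 * (\<nu> + 1) / R^2 * ((K t)^2 * t) <= C0 t * t * (\<nu> + 1) / R ^ 2" .
    show "0 <= C0 t * t * (\<nu> + 1) / R ^ 2"
     using C0_ge(1)[of t] t0 sol(1) by (intro divide_nonneg_nonneg mult_nonneg_nonneg) auto
   qed
  qed
 next
  fix N :: nat and C \<nu> T :: real and \<rho>
  assume init: "\<forall>\<^sub>F R in at_top. ?Y R <= C / R ^ N"
   and sol: "0 <= \<nu>" "0 < T" "weak_solution \<sigma>\<^sub>1 \<sigma>\<^sub>2 \<nu> T \<rho>\<^sub>0 \<rho>" "controlled K T \<rho>"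
  obtain Q where Q: "Q \<ge> 0" and ev: "\<forall>\<^sub>F R in at_top. \<forall>s\<in>{0..T}. (LBINT x. (bcut a R x)^2 * (\<rho> s x)^2) <= Q / R ^ N"
   using algebraic_decay[OF dim sol(3,4) K sol(1,2) c Ca init order_refl] by blast
  have "\<forall>\<^sub>F R in at_top. \<forall>s\<in>{0..T}. (LBINT x. (bcut a (R / 2) x)^2 * (\<rho> s x)^2) <= Q / (R / 2) ^ N"
   using eventually_compose_filterlim[OF ev, of "\<lambda>R. R / 2" at_top]
    filterlim_tendsto_pos_mult_at_top[OF tendsto_const[of "1 / 2 :: real"] _ filterlim_ident] by simp
  \<comment> \<open>Rate \<open>N\<close> is already available, with the constant \<open>Q\<close>
    depending on the solution. One more application of the growth estimate gains the factor R^-2;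
    requiring R to exceed this multiple of \<open>Q\<close> absorbs it, so that \<open>Q\<close>
    affects the threshold and not the constant.\<close>
  with eventually_ge_at_top[of 1] eventually_ge_at_top[of "8 * Ca^2 * (Q * 2 ^ N)"]
  show "\<forall>\<^sub>F R in at_top. \<forall>t\<in>{0..T}. outer_energy a \<nu> R \<rho> t <= (?Y R + C0 t * t * (\<nu> + 1)^2 / R ^ N) * exp (C0 t * t)"
  proof eventually_elim
   fix R :: real
   assume R1: "1 <= R" and RQ: "8 * Ca^2 * (Q * 2 ^ N) <= R"
    and h: "\<forall>s\<in>{0..T}. (LBINT x. (bcut a (R / 2) x)^2 * (\<rho> s x)^2) <= Q / (R / 2) ^ N"
   have R: "R > 0" using R1 by simp
   show "\<forall>t\<in>{0..T}. outer_energy a \<nu> R \<rho> t <= (?Y R + C0 t * t * (\<nu> + 1)^2 / R ^ N) * exp (C0 t * t)"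
   proof
    fix t assume t: "t \<in> {0..T}"
    show "outer_energy a \<nu> R \<rho> t <= (?Y R + C0 t * t * (\<nu> + 1)^2 / R ^ N) * exp (C0 t * t)"
    proof (rule est[OF sol(3,4,1,2) R t, of "Q * 2 ^ N / R ^ N"])
     fix s assume "s \<in> {0..t}"
     then have s: "s \<in> {0..T}" using t by auto
     show "(LBINT x. indicator (annulus R) x * (\<rho> s x)^2) <= Q * 2 ^ N / R ^ N"
      using order_trans[OF annulus_bound(1)[OF dim sol(3,4) K sol(1,2) c R s]] h s by (auto simp: power_divide)
    next
     have "8 * Ca^2 * (\<nu> + 1) / R^2 * (Q * 2 ^ N / R ^ N * t) = (8 * Ca^2 * (Q * 2 ^ N)) / R^2 * (t * (\<nu> + 1) / R ^ N)" by simp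
     also have "... <= 1 * (t * (\<nu> + 1) / R ^ N)"
     proof (rule mult_right_mono)
      have "R <= R^2" using R1 by (intro self_le_power) auto
      with RQ show "8 * Ca^2 * (Q * 2 ^ N) / R^2 <= 1" using R by (simp add: divide_le_eq)
      show "0 <= t * (\<nu> + 1) / R ^ N" using t sol(1) R by simp
     qed
     also have "1 * (t * (\<nu> + 1) / R ^ N) <= C0 t * (t * (\<nu> + 1)^2 / R ^ N)"
      using t sol(1) R C0_ge(1)[of t] by (intro mult_mono divide_right_mono mult_left_mono self_le_power) auto
     finally show "8 * Ca^2 * (\<nu> + 1) / R^2 * (Q * 2 ^ N / R ^ N * t) <= C0 t * t * (\<nu> + 1)^2 / R ^ N" by simp
     show "0 <= C0 t * t * (\<nu> + 1)^2 / R ^ N"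
      using C0_ge(1)[of t] t R by (intro divide_nonneg_nonneg mult_nonneg_nonneg) auto
    qed
   qed
  qed
 qed
qed

end
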